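(* Let $1<p<\infty$, $1/p+1/q=1$, and let $c\in PC$ be a matching function (i.e. $c\widetilde c=1$) such that $T(c):H^p\to H^p$ is Fredholm, represented in the forms $$c=\varphi_{\gamma_+}c_1,\qquad c=\varphi_{\gamma_-}c_2,$$ where $c_1,c_2\in PC$ are continuous at the points $t=1$ and $t=-1$, respectively, $\varphi_{\gamma_+}:=\varphi_{\gamma_+,1}$, $\varphi_{\gamma_-}:=\varphi_{\gamma_-,-1}$, and $\gamma_\pm\in\mathbb{C}$ with $\operatorname{Re}\gamma_+,\operatorname{Re}\gamma_-\in(-1/q,1/p)$. Then $$\boldsymbol\sigma(c)=\boldsymbol\sigma(c_1)=\boldsymbol\sigma(c_2).$$
   Context: $\mathbb{T}$ is the unit circle with counterclockwise orientation. $PC$ is the algebra of functions in $L^\infty(\mathbb{T})$ having one-sided limits at every $t\in\mathbb{T}$. $L^p=L^p(\mathbb{T})$, $H^p=\{f\in L^p:\widehat f_n=0\text{ for }n<0\}$, $\overline{H^p}=\{f\in L^p:\widehat f_n=0\text{ for }n>0\}$; $f(0)=\widehat f_0$ for $f\in H^p$, $f(\infty)=\widehat f_0$ for $f\in\overline{H^p}$. $P$ is the Riesz projection of $L^p$ onto $H^p$, $\widetilde a(t)=a(1/t)$, $T(a)f=P(af)$ on $H^p$. For $\beta\in\mathbb{C}$, $\tau\in\mathbb{T}$: $\varphi_{\beta,\tau}(t):=\exp\{i\beta\arg(-t/\tau)\}$, $t\in\mathbb{T}$, with $\arg z\in(-\pi,\pi]$; it has at most one discontinuity, a jump at $\tau$,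 with $\varphi_{\beta,\tau}(\tau+0)=e^{-i\pi\beta}$, $\varphi_{\beta,\tau}(\tau-0)=e^{i\pi\beta}$. For a matching function $c\in PC$ with $T(c)$ Fredholm on $H^p$, both representations in the claim exist, $c_1,c_2$ are matching functions, and $T(c_1),T(c_2)$ are Fredholm on $H^p$. Wiener--Hopf factorization of $g\in L^\infty$ in $H^p$: $g=g_-t^{\nu}g_+$ with $\nu\in\mathbb{Z}$, $g_+\in H^q$, $g_+^{-1}\in H^p$, $g_-\in\overline{H^p}$, $g_-^{-1}\in\overline{H^q}$, $g_-(\infty)=1$, such that $g_+^{-1}Pg_-^{-1}I$, defined on $\operatorname{span}\{t^k:k\ge0\}$, extends boundedly to $H^p$. It is unique and exists iff $T(g)$ is Fredholm on $H^p$; then $\nu=-\operatorname{ind}T(g)$. If $g\widetilde g=1$ and $T(g)$ is Fredholm, then $\boldsymbol\sigma(g):=g_+(0)\in\{1,-1\}$ is the factorization signature. *)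

theory Defs
  imports "HOL-Analysis.Analysis" "HOL-Computational_Algebra.Polynomial"
begin

text \<open>
  Elements of \<open>L\<^sup>p\<close> of the unit circle are represented by functions, and identities between them are
  identities almost everywhere with respect to the following measure, the normalized arc length on
  the unit circle.
\<close>

definition circle_measure :: "complex measure" where
  "circle_measure =
     distr (uniform_measure lborel {- pi <.. pi}) (restrict_space borel (sphere 0 1)) cis"

definition ae_eq :: "(complex \<Rightarrow> complex) \<Rightarrow> (complex \<Rightarrow> complex) \<Rightarrow> bool" where
  "ae_eq f g \<longleftrightarrow> (AE t in circle_measure. f t = g t)"

definition Lp :: "real \<Rightarrow> (complex \<Rightarrow> complex) set" where
  "Lp p = {f \<in> borel_measurable circle_measure.
             integrable circle_measure (\<lambda>t. norm (f t) powr p)}"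

definition Lp_norm :: "real \<Rightarrow> (complex \<Rightarrow> complex) \<Rightarrow> real" where
  "Lp_norm p f = (LINT t|circle_measure. norm (f t) powr p) powr (1 / p)"

definition Linfty :: "(complex \<Rightarrow> complex) set" where
  "Linfty = {f \<in> borel_measurable circle_measure.
               \<exists>K. AE t in circle_measure. norm (f t) \<le> K}"

definition fourier_coeff :: "(complex \<Rightarrow> complex) \<Rightarrow> int \<Rightarrow> complex" where
  "fourier_coeff f n = (LINT t|circle_measure. f t * t powi (- n))"

definition Hardy :: "real \<Rightarrow> (complex \<Rightarrow> complex) set" where
  "Hardy p = {f \<in> Lp p. \<forall>n<0. fourier_coeff f n = 0}"

definition co_Hardy :: "real \<Rightarrow> (complex \<Rightarrow> complex) set" where
  "co_Hardy p = {f \<in> Lp p. \<forall>n>0. fourier_coeff f n = 0}"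

text \<open>
  The Riesz projection sends \<open>f \<in> L\<^sup>p\<close> to the element of \<open>H\<^sup>p\<close> that has the same Fourier
  coefficients of nonnegative index. This determines it almost everywhere, hence the choice operator.
\<close>

definition Riesz_projection :: "real \<Rightarrow> (complex \<Rightarrow> complex) \<Rightarrow> complex \<Rightarrow> complex" where
  "Riesz_projection p f =
     (SOME h. h \<in> Hardy p \<and> (\<forall>n\<ge>0. fourier_coeff h n = fourier_coeff f n))"

definition Toeplitz ::
    "real \<Rightarrow> (complex \<Rightarrow> complex) \<Rightarrow> (complex \<Rightarrow> complex) \<Rightarrow> complex \<Rightarrow> complex" where
  "Toeplitz p a f = Riesz_projection p (\<lambda>t. a t * f t)"

text \<open>
  The estimate in the last conjunct, together with linearity, makes \<open>A\<close> respect equality almost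
  everywhere.
\<close>

definition bounded_operator_Hardy ::
    "real \<Rightarrow> ((complex \<Rightarrow> complex) \<Rightarrow> complex \<Rightarrow> complex) \<Rightarrow> bool" where
  "bounded_operator_Hardy p A \<longleftrightarrow>
     (\<forall>f\<in>Hardy p. A f \<in> Hardy p) \<and>
     (\<forall>f\<in>Hardy p. \<forall>g\<in>Hardy p. ae_eq (A (\<lambda>t. f t + g t)) (\<lambda>t. A f t + A g t)) \<and>
     (\<forall>z. \<forall>f\<in>Hardy p. ae_eq (A (\<lambda>t. z * f t)) (\<lambda>t. z * A f t)) \<and>
     (\<exists>K. \<forall>f\<in>Hardy p. Lp_norm p (A f) \<le> K * Lp_norm p f)"

text \<open>
  A bounded operator with finite-dimensional kernel, closed range, and finite-dimensional cokernel
  (all modulo equality almost everywhere).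
\<close>

definition Fredholm_Hardy ::
    "real \<Rightarrow> ((complex \<Rightarrow> complex) \<Rightarrow> complex \<Rightarrow> complex) \<Rightarrow> bool" where
  "Fredholm_Hardy p A \<longleftrightarrow>
     bounded_operator_Hardy p A \<and>
     (\<exists>B. finite B \<and> B \<subseteq> Hardy p \<and>
        (\<forall>f\<in>Hardy p. ae_eq (A f) (\<lambda>t. 0) \<longrightarrow> (\<exists>u. ae_eq f (\<lambda>t. \<Sum>b\<in>B. u b * b t)))) \<and>
     (\<forall>F h. (\<forall>n::nat. F n \<in> Hardy p) \<and> h \<in> Hardy p \<and>
        (\<lambda>n. Lp_norm p (\<lambda>t. A (F n) t - h t)) \<longlonglongrightarrow> 0 \<longrightarrow>
        (\<exists>f\<in>Hardy p. ae_eq h (A f))) \<and>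
     (\<exists>B. finite B \<and> B \<subseteq> Hardy p \<and>
        (\<forall>h\<in>Hardy p. \<exists>f\<in>Hardy p. \<exists>u. ae_eq h (\<lambda>t. A f t + (\<Sum>b\<in>B. u b * b t))))"

text \<open>
  The left and right limits at \<open>x\<close> are \<open>a(t - 0)\<close> and \<open>a(t + 0)\<close> for \<open>t = cis x\<close> and the
  counterclockwise orientation.
\<close>

definition PC :: "(complex \<Rightarrow> complex) set" where
  "PC = {a \<in> Linfty. \<forall>x::real.
           (\<exists>l. ((\<lambda>y. a (cis y)) \<longlongrightarrow> l) (at_left x)) \<and>
           (\<exists>l. ((\<lambda>y. a (cis y)) \<longlongrightarrow> l) (at_right x))}"

definition matching :: "(complex \<Rightarrow> complex) \<Rightarrow> bool" where
  "matching c \<longleftrightarrow> ae_eq (\<lambda>t. c t * c (1 / t)) (\<lambda>t. 1)"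

definition jump_fun :: "complex \<Rightarrow> complex \<Rightarrow> complex \<Rightarrow> complex" where
  "jump_fun \<beta> \<tau> t = exp (\<i> * \<beta> * of_real (Arg (- t / \<tau>)))"

text \<open>
  Nonvanishing of the factors is explicit because \<open>inverse 0 = 0\<close>. For a polynomial \<open>r\<close> the function
  \<open>g\<^sub>-\<inverse> r\<close> lies in \<open>L\<^sup>q\<close>, which is why the Riesz projection is that of \<open>L\<^sup>q\<close> there.
\<close>

definition Wiener_Hopf_factorization ::
    "real \<Rightarrow> real \<Rightarrow> (complex \<Rightarrow> complex) \<Rightarrow>
     (complex \<Rightarrow> complex) \<Rightarrow> int \<Rightarrow> (complex \<Rightarrow> complex) \<Rightarrow> bool" where
  "Wiener_Hopf_factorization p q g gm \<nu> gp \<longleftrightarrow>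
     ae_eq g (\<lambda>t. gm t * t powi \<nu> * gp t) \<and>
     (AE t in circle_measure. gp t \<noteq> 0) \<and> (AE t in circle_measure. gm t \<noteq> 0) \<and>
     gp \<in> Hardy q \<and> (\<lambda>t. inverse (gp t)) \<in> Hardy p \<and>
     gm \<in> co_Hardy p \<and> (\<lambda>t. inverse (gm t)) \<in> co_Hardy q \<and>
     fourier_coeff gm 0 = 1 \<and>
     (\<exists>A. bounded_operator_Hardy p A \<and>
        (\<forall>r :: complex poly.
           ae_eq (A (poly r))
             (\<lambda>t. inverse (gp t) * Riesz_projection q (\<lambda>s. inverse (gm s) * poly r s) t)))"

text \<open>The value \<open>g\<^sub>+(0)\<close> is the Fourier coefficient of index \<open>0\<close>.\<close>

definition factorization_signature ::
    "real \<Rightarrow> real \<Rightarrow> (complex \<Rightarrow> complex) \<Rightarrow> complex" where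
  "factorization_signature p q g =
     (THE s. \<exists>gm \<nu> gp. Wiener_Hopf_factorization p q g gm \<nu> gp \<and> s = fourier_coeff gp 0)"

end

theory Submission
  imports Defs "HOL-Probability.Probability" "HOL-Complex_Analysis.Complex_Analysis"
begin

text \<open>
  A factorization \<open>g\<^sub>- t\<^sup>\<nu> g\<^sub>+\<close> of \<open>c\<close> turns into one of \<open>c\<^sub>1\<close> on multiplying \<open>g\<^sub>+\<close> by
  \<open>(1 - t/\<tau>)\<^bsup>-\<gamma>\<^esup>\<close> and \<open>g\<^sub>-\<close> by \<open>(1 - \<tau>/t)\<^bsup>\<gamma>\<^esup>\<close>, because \<open>\<phi>\<^sub>\<gamma>\<close> is the quotient of these two powers. Both
  powers equal \<open>1\<close> at \<open>0\<close> and \<open>\<infinity>\<close> respectively, so \<open>g\<^sub>+(0)\<close> does not change, and the construction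
  can be reversed. The point is that the new factors are again in the required Hardy classes and that
  the boundedness condition survives. Away from \<open>\<tau>\<close> the powers are bounded with bounded inverses.
  Near \<open>\<tau>\<close> the remaining symbol is a small perturbation of a constant, hence it has
  a factorization with factors in \<open>L\<^sup>R\<close> for a large \<open>R\<close> (Neumann series). Comparison with this local
  model shows by a reflection argument that \<open>g\<^sub>+\<close> is there a power times a function of the model
  times a bounded function with bounded inverse. The boundedness of the model operator is that of the
  Riesz projection with power weights (Schur test), and the two regions are glued by the smoothness
  of the Cauchy kernel off the diagonal.
\<close>

section \<open>The normalized arc length\<close>

text \<open>The delicate point is integrability at \<tau>. A factor \<open>gp\<close> in H^q times
  an unbounded power of \<open>1 - t / \<tau>\<close> need not lie in L^q by Hoelder's inequality,
  so the size of \<open>gp\<close> near \<tau> must be known precisely. It is read off from two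
  quotients: \<open>gp\<close> divided by the plus factor of the local model, and the reciprocal. On
  an arc around \<tau> each of them comes from a function analytic inside the disc and also, up to a
  power of t, from one analytic outside; therefore both are bounded on a smaller arc. The minus
  factors then follow from the plus factors, because the symbol is bounded above and below; the
  lower bound comes from \<open>c(t) c(1/t) = 1\<close>. A single transfer result with two exponents
  \<alpha>, \<beta> serves both directions, with (\<gamma>, 0) and (0, \<gamma>). Hence c and c_1
  admit the same values of g_+(0), and the definite descriptions agree. As the projection is given
  by a choice based on Fourier coefficients, estimates are made for Cauchy integrals at radius r <
  1, uniformly in r, and identities are checked on coefficients of nonnegative index.\<close>

abbreviation \<mu> :: "complex measure" where "\<mu> \<equiv> circle_measure"

lemma space_circle [simp]: "space \<mu> = sphere 0 1"
  by (simp add: circle_measure_def space_restrict_space)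

lemma sets_circle [measurable_cong]: "sets \<mu> = sets (restrict_space borel (sphere 0 1))"
  by (simp add: circle_measure_def)

lemma measurable_cis_circle [measurable]:
  "cis \<in> measurable borel (restrict_space borel (sphere 0 1))"
  by (intro measurable_restrict_space2) (auto intro!: borel_measurable_continuous_onI continuous_intros)

lemma measurable_cis_uniform:
  "cis \<in> measurable (uniform_measure lborel A) (restrict_space borel (sphere 0 1))"
  using measurable_cis_circle by (simp cong: measurable_cong_sets)

interpretation circle: prob_space \<mu>
  unfolding circle_measure_def
  by (intro prob_space.prob_space_distr prob_space_uniform_measure measurable_cis_uniform) auto

lemma borel_measurable_circleI: "f \<in> borel_measurable borel \<Longrightarrow> f \<in> borel_measurable \<mu>"
  by (simp add: measurable_restrict_space1 cong: measurable_cong_sets add: sets_circle)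

lemma borel_measurable_circle_continuous:
  fixes f :: "complex \<Rightarrow> 'b::topological_space"
  shows "continuous_on (sphere 0 1) f \<Longrightarrow> f \<in> borel_measurable \<mu>"
  using borel_measurable_continuous_on_restrict[of "sphere 0 1" f]
  by (simp add: sets_circle cong: measurable_cong_sets)

lemma nn_integral_circle:
  assumes [measurable]: "f \<in> borel_measurable \<mu>"
  shows "(\<integral>\<^sup>+t. f t \<partial>\<mu>) = (\<integral>\<^sup>+x. f (cis x) * indicator {-pi<..pi} x \<partial>lborel) / ennreal (2*pi)"
proof -
  have [measurable]: "f \<in> borel_measurable (restrict_space borel (sphere 0 1))"
    using assms by (simp cong: measurable_cong_sets add: sets_circle)
  have [measurable]: "(\<lambda>x. f (cis x)) \<in> borel_measurable borel" by measurable
  have "(\<integral>\<^sup>+t. f t \<partial>\<mu>) = (\<integral>\<^sup>+x. f (cis x) \<partial>uniform_measure lborel {-pi<..pi})"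
    unfolding circle_measure_def by (intro nn_integral_distr measurable_cis_uniform) simp
  also have "\<dots> = (\<integral>\<^sup>+x. f (cis x) * indicator {-pi<..pi} x \<partial>lborel) / emeasure lborel {-pi<..pi}"
    by (intro nn_integral_uniform_measure) auto
  finally show ?thesis by simp
qed

lemma AE_circle_iff:
  assumes [measurable]: "Measurable.pred \<mu> P"
  shows "(AE t in \<mu>. P t) \<longleftrightarrow> (AE x in lborel. x \<in> {-pi<..pi} \<longrightarrow> P (cis x))"
proof -
  have [measurable]: "Measurable.pred (restrict_space borel (sphere 0 1)) P"
    using assms by (simp cong: measurable_cong_sets add: sets_circle)
  have "(AE t in \<mu>. P t) \<longleftrightarrow> (AE x in uniform_measure lborel {-pi<..pi}. P (cis x))"
    unfolding circle_measure_def
    using assms sets_circle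
    by (subst AE_distr_iff[OF measurable_cis_uniform]) (auto simp: space_restrict_space pred_def)
  also have "\<dots> \<longleftrightarrow> (AE x in lborel. x \<in> {-pi<..pi} \<longrightarrow> P (cis x))"
    by (subst AE_uniform_measure) auto
  finally show ?thesis .
qed

lemma integral_circle:
  fixes f :: "complex \<Rightarrow> complex"
  assumes [measurable]: "f \<in> borel_measurable \<mu>"
  shows "(\<integral>t. f t \<partial>\<mu>) = (LINT x:{-pi..pi}|lborel. f (cis x)) / (2*pi)"
proof -
  have [measurable]: "f \<in> borel_measurable (restrict_space borel (sphere 0 1))"
    using assms by (simp cong: measurable_cong_sets add: sets_circle)
  have "(\<integral>t. f t \<partial>\<mu>) = (\<integral>x. f (cis x) \<partial>uniform_measure lborel {-pi<..pi})"
    unfolding circle_measure_def by (intro integral_distr measurable_cis_uniform) simp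
  also have "uniform_measure lborel {-pi<..pi} = density lborel (\<lambda>x. ennreal (indicator {-pi<..pi} x / (2*pi)))"
    unfolding uniform_measure_def
    by (intro arg_cong[where f="density lborel"]) (auto simp: fun_eq_iff indicator_def ennreal_divide_numeral divide_ennreal simp flip: ennreal_1)
  also have "(\<integral>x. f (cis x) \<partial>density lborel (\<lambda>x. ennreal (indicator {-pi<..pi} x / (2*pi))))
     = (\<integral>x. (indicator {-pi<..pi} x / (2*pi)) *\<^sub>R f (cis x) \<partial>lborel)"
    by (intro integral_density) auto
  \<comment> \<open>The null point -pi is added to the half-open interval because the fundamental
    theorem of calculus is applied below on a closed one.\<close>
  also have "\<dots> = (\<integral>x. (indicator {-pi..pi} x *\<^sub>R f (cis x)) / (2*pi) \<partial>lborel)"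
  proof (intro integral_cong_AE)
    show "AE x in lborel. (indicator {-pi<..pi} x / (2*pi)) *\<^sub>R f (cis x) = (indicator {-pi..pi} x *\<^sub>R f (cis x)) / (2*pi)"
      using AE_lborel_singleton[of "-pi"]
      by eventually_elim (auto simp: indicator_def scaleR_conv_of_real)
  qed auto
  finally show ?thesis by (simp add: set_lebesgue_integral_def)
qed

lemma integral_circle_powi: "(\<integral>t. t powi n \<partial>\<mu>) = (if n = 0 then 1 else 0)"
proof (cases "n = 0")
  case False
  have "(\<integral>t. t powi n \<partial>\<mu>) = (LINT x:{-pi..pi}|lborel. cis x powi n) / (2*pi)"
    by (intro integral_circle borel_measurable_circle_continuous continuous_intros) auto
  also have "(LINT x:{-pi..pi}|lborel. cis x powi n) = (LINT x:{-pi..pi}|lborel. exp (\<i> * of_int n * of_real x))"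
  proof -
    have "cis x powi n = exp (\<i> * of_int n * of_real x)" for x
      unfolding cis_power_int[of x n] cis_conv_exp[of "of_int n * x"] of_real_mult of_real_of_int_eq mult.assoc ..
    then show ?thesis by simp
  qed
  also have "\<dots> = exp (\<i> * of_int n * of_real pi) / (\<i> * of_int n) - exp (\<i> * of_int n * of_real (-pi)) / (\<i> * of_int n)"
    unfolding set_lebesgue_integral_def
  proof (rule integral_FTC_atLeastAtMost)
    show "((\<lambda>x. exp (\<i> * of_int n * of_real x) / (\<i> * of_int n)) has_vector_derivative exp (\<i> * of_int n * of_real x)) (at x within {-pi..pi})" for x
    proof -
      have "((\<lambda>z. exp (\<i> * of_int n * z) / (\<i> * of_int n)) has_field_derivative exp (\<i> * of_int n * of_real x)) (at (of_real x))"
        using False by (auto intro!: derivative_eq_intros)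
      from has_vector_derivative_real_field[OF this] show ?thesis
        by (simp add: has_vector_derivative_at_within)
    qed
  qed (auto intro!: continuous_intros)
  also have "\<dots> = 0"
  proof -
    have "exp (\<i> * of_int n * of_real pi) = exp (\<i> * of_int n * of_real (-pi))"
      by (subst exp_eq) (auto intro!: exI[of _ n] simp: algebra_simps)
    then show ?thesis by simp
  qed
  finally show ?thesis using False by simp
qed (use circle.prob_space in auto)

section \<open>The spaces \<open>L\<^sup>p\<close>\<close>

lemma Lp_measurable [measurable_dest]: "f \<in> Lp p \<Longrightarrow> f \<in> borel_measurable \<mu>"
  by (simp add: Lp_def)

lemma Lp_integrable: "f \<in> Lp p \<Longrightarrow> integrable \<mu> (\<lambda>t. norm (f t) powr p)"
  by (simp add: Lp_def)

lemma Lp_norm_nonneg [simp]: "0 \<le> Lp_norm p f"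
  by (simp add: Lp_norm_def)

lemma Lp_norm_powr: "p > 0 \<Longrightarrow> Lp_norm p f powr p = (\<integral>t. norm (f t) powr p \<partial>\<mu>)"
  by (simp add: Lp_norm_def powr_powr)

lemma Lp_one_iff: "f \<in> Lp 1 \<longleftrightarrow> integrable \<mu> f"
proof -
  have *: "(\<lambda>t. norm (f t) powr 1) = (\<lambda>t. norm (f t))" by auto
  show ?thesis
    unfolding Lp_def * by (auto simp: integrable_norm_iff)
qed

lemma Lp_norm_one: "Lp_norm 1 f = (\<integral>t. norm (f t) \<partial>\<mu>)"
proof -
  have *: "(\<lambda>t. norm (f t) powr 1) = (\<lambda>t. norm (f t))" by auto
  show ?thesis unfolding Lp_norm_def * by simp
qed

lemma Lp_bound:
  assumes "p > 0" "g \<in> Lp p" "C \<ge> 0" and [measurable]: "f \<in> borel_measurable \<mu>"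
    and ae: "AE t in \<mu>. norm (f t) \<le> C * norm (g t)"
  shows "f \<in> Lp p" "Lp_norm p f \<le> C * Lp_norm p g"
proof -
  have [measurable]: "g \<in> borel_measurable \<mu>" using assms by auto
  have ae': "AE t in \<mu>. norm (f t) powr p \<le> C powr p * norm (g t) powr p"
    using ae
  proof eventually_elim
    case (elim t)
    have "norm (f t) powr p \<le> (C * norm (g t)) powr p"
      using elim assms by (intro powr_mono2) auto
    then show ?case using assms by (simp add: powr_mult)
  qed
  have int: "integrable \<mu> (\<lambda>t. C powr p * norm (g t) powr p)"
    using Lp_integrable[OF assms(2)] by auto
  have "integrable \<mu> (\<lambda>t. norm (f t) powr p)"
    by (rule Bochner_Integration.integrable_bound[OF int]) (use ae' in auto)
  then show f: "f \<in> Lp p" by (simp add: Lp_def)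
  have "(\<integral>t. norm (f t) powr p \<partial>\<mu>) \<le> (\<integral>t. C powr p * norm (g t) powr p \<partial>\<mu>)"
    using ae' Lp_integrable[OF f] int by (intro integral_mono_AE) auto
  then have "Lp_norm p f powr p \<le> (C * Lp_norm p g) powr p"
    using assms by (simp add: Lp_norm_powr powr_mult)
  then show "Lp_norm p f \<le> C * Lp_norm p g"
    using \<open>p > 0\<close> \<open>C \<ge> 0\<close> by (meson Lp_norm_nonneg mult_nonneg_nonneg powr_less_mono2 not_le)
qed

lemma Lp_cong_AE:
  assumes "AE t in \<mu>. f t = g t" "f \<in> borel_measurable \<mu>" "g \<in> Lp p"
  shows "f \<in> Lp p"
proof -
  have [measurable]: "f \<in> borel_measurable \<mu>" "g \<in> borel_measurable \<mu>" using assms by auto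
  have "integrable \<mu> (\<lambda>t. norm (f t) powr p) \<longleftrightarrow> integrable \<mu> (\<lambda>t. norm (g t) powr p)"
    by (intro integrable_cong_AE) (use assms(1) in auto)
  then show ?thesis using assms by (simp add: Lp_def)
qed

lemma Lp_norm_cong_AE:
  assumes "AE t in \<mu>. f t = g t" "f \<in> borel_measurable \<mu>" "g \<in> borel_measurable \<mu>"
  shows "Lp_norm p f = Lp_norm p g"
proof -
  have [measurable]: "f \<in> borel_measurable \<mu>" "g \<in> borel_measurable \<mu>" using assms by auto
  have "(\<integral>t. norm (f t) powr p \<partial>\<mu>) = (\<integral>t. norm (g t) powr p \<partial>\<mu>)"
    by (intro integral_cong_AE) (use assms(1) in auto)
  then show ?thesis by (simp add: Lp_norm_def)
qed

lemma Lp_bounded: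
  assumes "p > 0" "f \<in> borel_measurable \<mu>" "AE t in \<mu>. norm (f t) \<le> C" "C \<ge> 0"
  shows "f \<in> Lp p" "Lp_norm p f \<le> C"
proof -
  have one: "(\<lambda>t. 1) \<in> Lp p" by (auto simp: Lp_def)
  have "Lp_norm p (\<lambda>t. 1) = 1" using circle.prob_space by (simp add: Lp_norm_def)
  then show "f \<in> Lp p" "Lp_norm p f \<le> C"
    using Lp_bound[OF assms(1) one assms(4,2)] assms(3) by auto
qed

lemma Lp_scale:
  assumes "p > 0" "f \<in> Lp p"
  shows "(\<lambda>t. c * f t) \<in> Lp p" "Lp_norm p (\<lambda>t. c * f t) = norm c * Lp_norm p f"
proof -
  have [measurable]: "f \<in> borel_measurable \<mu>" using assms by auto
  show "(\<lambda>t. c * f t) \<in> Lp p"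
    by (rule Lp_bound(1)[OF assms, of "norm c"]) (auto simp: norm_mult)
  have "(Lp_norm p (\<lambda>t. c * f t)) powr p = (norm c * Lp_norm p f) powr p"
    using assms by (simp add: Lp_norm_powr norm_mult powr_mult)
  then show "Lp_norm p (\<lambda>t. c * f t) = norm c * Lp_norm p f"
    using assms by (metis Lp_norm_nonneg linorder_neqE mult_nonneg_nonneg norm_ge_zero order_less_irrefl powr_less_mono2)
qed

lemma Lp_uminus:
  assumes "p > 0" "f \<in> Lp p"
  shows "(\<lambda>t. - f t) \<in> Lp p" "Lp_norm p (\<lambda>t. - f t) = Lp_norm p f"
  using Lp_scale[OF assms, of "-1"] by auto

text \<open>If one of the points is 0 the inequality reduces to \<open>w powr p \<le> w\<close> for
  \<open>w\<close> in [0, 1]; convexity on the positive axis covers the rest.\<close>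

lemma powr_convex_nonneg:
  fixes x y :: real
  assumes "p \<ge> 1" "x \<ge> 0" "y \<ge> 0" "0 \<le> u" "0 \<le> v" "u + v = 1"
  shows "(u * x + v * y) powr p \<le> u * x powr p + v * y powr p"
proof -
  have le: "(w * z) powr p \<le> w * z powr p" if "0 \<le> w" "w \<le> 1" "0 \<le> z" for w z :: real
  proof -
    have "w powr p \<le> w" using powr_mono'[of 1 p w] that assms by simp
    then show ?thesis using that by (simp add: powr_mult mult_right_mono)
  qed
  show ?thesis
  proof (cases "x = 0 \<or> y = 0")
    case True
    then show ?thesis using le[of u x] le[of v y] assms by auto
  next
    case False
    then show ?thesis
      using convex_onD[OF powr_convex[OF assms(1)], of v x y] assms
      by (auto simp: eq_diff_eq[symmetric])
  qed
qed

section \<open>The inequalities of Minkowski and Hoelder\<close>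

lemma Lp_norm_leI:
  assumes "p > 0" "a > 0" "f \<in> Lp p" "(\<integral>t. (norm (f t) / a) powr p \<partial>\<mu>) \<le> 1"
  shows "Lp_norm p f \<le> a"
proof -
  have "(\<integral>t. (norm (f t) / a) powr p \<partial>\<mu>) = (Lp_norm p f) powr p / a powr p"
    using assms by (simp add: powr_divide Lp_norm_powr)
  then have "Lp_norm p f powr p \<le> a powr p" using assms by (simp add: divide_le_eq)
  then show ?thesis using assms by (meson less_imp_le not_le powr_less_mono2)
qed

text \<open>Taking \<open>a\<close> strictly above the norm means that a function of norm zero needs
  no separate treatment. The inequalities of Minkowski and Hoelder are first obtained for such
  bounds, and then the excess tends to zero.\<close>

lemma Lp_normalized:
  assumes "p > 0" "a > Lp_norm p f"
  shows "(\<integral>t. (norm (f t) / a) powr p \<partial>\<mu>) \<le> 1"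
proof -
  have a: "a > 0" using assms Lp_norm_nonneg[of p f] by linarith
  have "(\<integral>t. (norm (f t) / a) powr p \<partial>\<mu>) = (Lp_norm p f / a) powr p"
    using assms a by (simp add: powr_divide Lp_norm_powr)
  also have "\<dots> \<le> 1 powr p" using assms a by (intro powr_mono2) auto
  finally show ?thesis by simp
qed

lemma Lp_add:
  assumes "p \<ge> 1" "f \<in> Lp p" "g \<in> Lp p"
  shows "(\<lambda>t. f t + g t) \<in> Lp p" "Lp_norm p (\<lambda>t. f t + g t) \<le> Lp_norm p f + Lp_norm p g"
proof -
  have [measurable]: "f \<in> borel_measurable \<mu>" "g \<in> borel_measurable \<mu>" using assms by auto
  \<comment> \<open>Convexity is applied to the normalized functions with weights
    \<open>a / (a + b)\<close> and \<open>b / (a + b)\<close>: after integration the right-hand side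
    is a convex combination of numbers at most 1.\<close>
  have *: "(norm (f t + g t) / (a + b)) powr p \<le> a / (a + b) * (norm (f t) / a) powr p + b / (a + b) * (norm (g t) / b) powr p"
    if "a > 0" "b > 0" for a b t
  proof -
    have "norm (f t + g t) / (a + b) \<le> (norm (f t) + norm (g t)) / (a + b)"
      using that by (intro divide_right_mono norm_triangle_ineq) auto
    also have "\<dots> = a / (a + b) * (norm (f t) / a) + b / (a + b) * (norm (g t) / b)"
      using that by (simp add: divide_simps)
    finally have "(norm (f t + g t) / (a + b)) powr p \<le> (a / (a + b) * (norm (f t) / a) + b / (a + b) * (norm (g t) / b)) powr p"
      using that assms by (intro powr_mono2) auto
    also have "\<dots> \<le> a / (a + b) * (norm (f t) / a) powr p + b / (a + b) * (norm (g t) / b) powr p"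
      using that assms by (intro powr_convex_nonneg) (auto simp flip: add_divide_distrib)
    finally show ?thesis .
  qed
  have int: "integrable \<mu> (\<lambda>t. a / (a + b) * (norm (f t) / a) powr p + b / (a + b) * (norm (g t) / b) powr p)"
    if "a > 0" "b > 0" for a b
    using Lp_integrable[OF assms(2)] Lp_integrable[OF assms(3)] that
    by (auto simp: powr_divide intro!: Bochner_Integration.integrable_add)
  have int2: "integrable \<mu> (\<lambda>t. (norm (f t + g t) / (a + b)) powr p)" if "a > 0" "b > 0" for a b
    by (rule Bochner_Integration.integrable_bound[OF int[OF that]]) (use *[OF that] in \<open>auto intro!: AE_I2 order_trans[OF _ abs_ge_self]\<close>)
  have "integrable \<mu> (\<lambda>t. 2 powr p * (norm (f t + g t) / (1 + 1)) powr p)"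
    using int2[of 1 1] by auto
  then show fg: "(\<lambda>t. f t + g t) \<in> Lp p"
    by (auto simp: Lp_def powr_divide)
  have "Lp_norm p (\<lambda>t. f t + g t) \<le> a + b" if ab: "a > Lp_norm p f" "b > Lp_norm p g" for a b
  proof -
    have pos: "a > 0" "b > 0" using ab by (metis Lp_norm_nonneg order_le_less_trans)+
    have "(\<integral>t. (norm (f t + g t) / (a + b)) powr p \<partial>\<mu>) \<le> (\<integral>t. a / (a + b) * (norm (f t) / a) powr p + b / (a + b) * (norm (g t) / b) powr p \<partial>\<mu>)"
      using int int2 * pos by (intro integral_mono) auto
    also have "\<dots> = a / (a + b) * (\<integral>t. (norm (f t) / a) powr p \<partial>\<mu>) + b / (a + b) * (\<integral>t. (norm (g t) / b) powr p \<partial>\<mu>)"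
      using Lp_integrable[OF assms(2)] Lp_integrable[OF assms(3)] pos
      by (subst Bochner_Integration.integral_add) (auto simp: powr_divide)
    also have "\<dots> \<le> a / (a + b) * 1 + b / (a + b) * 1"
      using pos ab assms by (intro add_mono mult_left_mono Lp_normalized) auto
    also have "\<dots> = 1" using pos by (simp flip: add_divide_distrib)
    finally show ?thesis using assms fg pos by (intro Lp_norm_leI) auto
  qed
  from this[of "Lp_norm p f + e / 2" "Lp_norm p g + e / 2" for e]
  have "Lp_norm p (\<lambda>t. f t + g t) \<le> (Lp_norm p f + Lp_norm p g) + e" if "e > 0" for e
    using that by (smt (verit, best) field_sum_of_halves half_gt_zero)
  then show "Lp_norm p (\<lambda>t. f t + g t) \<le> Lp_norm p f + Lp_norm p g"
    by (rule field_le_epsilon)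
qed

lemma Lp_diff:
  assumes "p \<ge> 1" "f \<in> Lp p" "g \<in> Lp p"
  shows "(\<lambda>t. f t - g t) \<in> Lp p" "Lp_norm p (\<lambda>t. f t - g t) \<le> Lp_norm p f + Lp_norm p g"
  using Lp_add[OF assms(1,2) Lp_uminus(1)[OF _ assms(3)]] Lp_uminus(2)[OF _ assms(3)] assms(1) by auto

lemma Lp_zero [simp]: "(\<lambda>t. 0) \<in> Lp p"
  by (auto simp: Lp_def)

lemma Lp_sum:
  assumes "p \<ge> 1" "\<And>i. i \<in> I \<Longrightarrow> f i \<in> Lp p"
  shows "(\<lambda>t. \<Sum>i\<in>I. f i t) \<in> Lp p"
  using assms(2) by (induction I rule: infinite_finite_induct) (auto intro!: Lp_add[OF assms(1)])

lemma Hoelder_conj: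
  fixes f g :: "complex \<Rightarrow> complex"
  assumes "a > 1" "b > 1" "1 / a + 1 / b = 1" "f \<in> Lp a" "g \<in> Lp b"
  shows "(\<lambda>t. f t * g t) \<in> Lp 1" "Lp_norm 1 (\<lambda>t. f t * g t) \<le> Lp_norm a f * Lp_norm b g"
proof -
  have [measurable]: "f \<in> borel_measurable \<mu>" "g \<in> borel_measurable \<mu>" using assms by auto
  have *: "norm (f t * g t) \<le> u * v * ((norm (f t) / u) powr a / a + (norm (g t) / v) powr b / b)"
    if "u > 0" "v > 0" for u v t
    using Youngs_inequality[OF assms(1-3), of "norm (f t) / u" "norm (g t) / v"] that
    by (simp add: norm_mult pos_divide_le_eq mult.commute)
  have int: "integrable \<mu> (\<lambda>t. u * v * ((norm (f t) / u) powr a / a + (norm (g t) / v) powr b / b))"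
    if "u > 0" "v > 0" for u v
    using Lp_integrable[OF assms(4)] Lp_integrable[OF assms(5)] that
    by (auto simp: powr_divide intro!: Bochner_Integration.integrable_add)
  have int2: "integrable \<mu> (\<lambda>t. f t * g t)"
    by (rule Bochner_Integration.integrable_bound[OF int[of 1 1]]) (use *[of 1 1] in \<open>auto intro!: AE_I2 order_trans[OF _ abs_ge_self]\<close>)
  then show "(\<lambda>t. f t * g t) \<in> Lp 1" by (simp add: Lp_one_iff)
  have le: "Lp_norm 1 (\<lambda>t. f t * g t) \<le> u * v" if ab: "u > Lp_norm a f" "v > Lp_norm b g" for u v
  proof -
    have pos: "u > 0" "v > 0" using ab by (metis Lp_norm_nonneg order_le_less_trans)+
    have "Lp_norm 1 (\<lambda>t. f t * g t) \<le> (\<integral>t. u * v * ((norm (f t) / u) powr a / a + (norm (g t) / v) powr b / b) \<partial>\<mu>)"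
      unfolding Lp_norm_one using int int2 * pos by (intro integral_mono) auto
    also have "\<dots> = u * v * ((\<integral>t. (norm (f t) / u) powr a \<partial>\<mu>) / a + (\<integral>t. (norm (g t) / v) powr b \<partial>\<mu>) / b)"
      using Lp_integrable[OF assms(4)] Lp_integrable[OF assms(5)] pos
      by (simp add: powr_divide)
    also have "\<dots> \<le> u * v * (1 / a + 1 / b)"
      using pos ab assms by (intro add_mono mult_left_mono divide_right_mono Lp_normalized) auto
    finally show ?thesis using assms by simp
  qed
  have "\<forall>\<^sub>F e in at_right 0. Lp_norm 1 (\<lambda>t. f t * g t) \<le> (Lp_norm a f + e) * (Lp_norm b g + e)"
    using eventually_at_right_less[of 0] by eventually_elim (intro le, auto)
  moreover have "((\<lambda>e. (Lp_norm a f + e) * (Lp_norm b g + e)) \<longlongrightarrow> (Lp_norm a f + 0) * (Lp_norm b g + 0)) (at_right 0)"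
    by (intro tendsto_intros)
  ultimately show "Lp_norm 1 (\<lambda>t. f t * g t) \<le> Lp_norm a f * Lp_norm b g"
    using tendsto_lowerbound[where F="at_right (0::real)"] by (metis add_0_right trivial_limit_at_right_real)
qed

text \<open>Reduces to conjugate exponents \<open>a / c\<close> and \<open>b / c\<close> by passing
  to the moduli raised to the power \<open>c\<close>.\<close>

lemma Hoelder:
  fixes f g :: "complex \<Rightarrow> complex"
  assumes "a > 0" "b > 0" "c > 0" "1 / a + 1 / b = 1 / c" "f \<in> Lp a" "g \<in> Lp b"
  shows "(\<lambda>t. f t * g t) \<in> Lp c" "Lp_norm c (\<lambda>t. f t * g t) \<le> Lp_norm a f * Lp_norm b g"
proof -
  have [measurable]: "f \<in> borel_measurable \<mu>" "g \<in> borel_measurable \<mu>" using assms by auto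
  define F where "F t = complex_of_real (norm (f t) powr c)" for t
  define G where "G t = complex_of_real (norm (g t) powr c)" for t
  have *: "1 / (a / c) + 1 / (b / c) = 1"
  proof -
    have "1 / (a / c) + 1 / (b / c) = c * (1 / a + 1 / b)" by (simp add: field_simps)
    then show ?thesis using assms by simp
  qed
  have ab: "a / c > 1" "b / c > 1"
  proof -
    have "1 / a < 1 / c" "1 / b < 1 / c" using assms by (auto simp flip: assms(4))
    then show "a / c > 1" "b / c > 1" using assms by (auto simp: field_simps)
  qed
  have [measurable]: "F \<in> borel_measurable \<mu>" "G \<in> borel_measurable \<mu>"
    unfolding F_def[abs_def] G_def[abs_def] by measurable
  have F: "F \<in> Lp (a / c)" and G: "G \<in> Lp (b / c)"
    using assms by (auto simp: Lp_def F_def G_def powr_powr)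
  have nF: "Lp_norm (a / c) F = Lp_norm a f powr c"  and nG: "Lp_norm (b / c) G = Lp_norm b g powr c"
    using assms by (auto simp: Lp_norm_def F_def G_def powr_powr)
  note H = Hoelder_conj[OF ab * F G]
  have eq: "norm (F t * G t) = norm (f t * g t) powr c" for t
    by (simp add: F_def G_def norm_mult powr_mult)
  show fg: "(\<lambda>t. f t * g t) \<in> Lp c"
    using integrable_norm[OF H(1)[unfolded Lp_one_iff]] unfolding eq by (simp add: Lp_def)
  have "Lp_norm c (\<lambda>t. f t * g t) powr c \<le> (Lp_norm a f * Lp_norm b g) powr c"
    using H(2) assms unfolding Lp_norm_one eq nF nG by (simp add: Lp_norm_powr powr_mult)
  then show "Lp_norm c (\<lambda>t. f t * g t) \<le> Lp_norm a f * Lp_norm b g"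
    using assms by (meson Lp_norm_nonneg mult_nonneg_nonneg powr_less_mono2 not_le)
qed

text \<open>Hoelder's inequality against the constant 1, whose norms are at most 1 because the
  measure is a probability.\<close>

lemma Lp_mono:
  assumes "0 < c" "c \<le> a" "f \<in> Lp a"
  shows "f \<in> Lp c" "Lp_norm c f \<le> Lp_norm a f"
proof -
  have "f \<in> Lp c \<and> Lp_norm c f \<le> Lp_norm a f"
  proof (cases "c = a")
    case False
    define b where "b = 1 / (1 / c - 1 / a)"
    have "1 / c > 1 / a" using False assms by (simp add: field_simps)
    then have b: "b > 0" "1 / a + 1 / b = 1 / c" by (auto simp: b_def)
    have one: "(\<lambda>t. 1) \<in> Lp b" "Lp_norm b (\<lambda>t. 1) \<le> 1"
      using Lp_bounded[of b "\<lambda>t. 1" 1] b by auto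
    have "Lp_norm a f * Lp_norm b (\<lambda>t. 1) \<le> Lp_norm a f" using one by (simp add: mult_left_le)
    then show ?thesis using Hoelder[OF _ b(1) assms(1) b(2) assms(3) one(1)] assms by auto
  qed (use assms in auto)
  then show "f \<in> Lp c" "Lp_norm c f \<le> Lp_norm a f" by auto
qed

lemma Lp_imp_integrable: "f \<in> Lp p \<Longrightarrow> p \<ge> 1 \<Longrightarrow> integrable \<mu> f"
  using Lp_mono(1)[of 1 p f] by (simp add: Lp_one_iff)

lemma integral_norm_le_Lp_norm: "f \<in> Lp p \<Longrightarrow> p \<ge> 1 \<Longrightarrow> (\<integral>t. norm (f t) \<partial>\<mu>) \<le> Lp_norm p f"
  using Lp_mono(2)[of 1 p f] by (simp add: Lp_norm_one)

lemma Lp_norm_ennreal: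
  assumes "f \<in> Lp p" "p > 0"
  shows "(\<integral>\<^sup>+t. ennreal (norm (f t) powr p) \<partial>\<mu>) = ennreal (Lp_norm p f powr p)"
  using Lp_integrable[OF assms(1)] assms by (simp add: Lp_norm_powr nn_integral_eq_integral)

lemma LpI_nn_integral:
  assumes [measurable]: "f \<in> borel_measurable \<mu>" and "p > 0" "B \<ge> 0"
    and le: "(\<integral>\<^sup>+t. ennreal (norm (f t) powr p) \<partial>\<mu>) \<le> ennreal (B powr p)"
  shows "f \<in> Lp p" "Lp_norm p f \<le> B"
proof -
  have "integrable \<mu> (\<lambda>t. norm (f t) powr p)"
    using le by (intro integrableI_nonneg) (auto simp: le_less_trans)
  then show f: "f \<in> Lp p" by (simp add: Lp_def)
  have "Lp_norm p f powr p \<le> B powr p"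
    using le assms unfolding Lp_norm_ennreal[OF f assms(2)] by (subst (asm) ennreal_le_iff) auto
  then show "Lp_norm p f \<le> B" using assms by (meson not_le powr_less_mono2)
qed

text \<open>Norm bounds survive limits almost everywhere, even when convergence in norm is unknown.
  In this way estimates uniform in the radius are carried to the circle.\<close>

lemma Lp_Fatou:
  assumes "p > 0" "\<And>n. f n \<in> Lp p" "\<And>n. Lp_norm p (f n) \<le> B"
    and g[measurable]: "g \<in> borel_measurable \<mu>" and ae: "AE t in \<mu>. (\<lambda>n. f n t) \<longlonglongrightarrow> g t"
  shows "g \<in> Lp p" "Lp_norm p g \<le> B"
proof -
  have [measurable]: "f n \<in> borel_measurable \<mu>" for n using assms by auto
  have B: "B \<ge> 0" using assms(3)[of 0] Lp_norm_nonneg[of p "f 0"] by linarith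
  have "(\<integral>\<^sup>+t. ennreal (norm (g t) powr p) \<partial>\<mu>) = (\<integral>\<^sup>+t. liminf (\<lambda>n. ennreal (norm (f n t) powr p)) \<partial>\<mu>)"
  proof (rule nn_integral_cong_AE)
    show "AE t in \<mu>. ennreal (norm (g t) powr p) = liminf (\<lambda>n. ennreal (norm (f n t) powr p))"
      using ae
    proof eventually_elim
      case (elim t)
      have "(\<lambda>n. ennreal (norm (f n t) powr p)) \<longlonglongrightarrow> ennreal (norm (g t) powr p)"
        using elim assms(1) by (intro tendsto_ennrealI tendsto_powr' tendsto_norm) auto
      then show ?case by (intro lim_imp_Liminf[symmetric]) auto
    qed
  qed
  also have "\<dots> \<le> liminf (\<lambda>n. \<integral>\<^sup>+t. ennreal (norm (f n t) powr p) \<partial>\<mu>)"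
    by (intro nn_integral_liminf) auto
  also have "\<dots> \<le> liminf (\<lambda>n. ennreal (B powr p))"
    using assms B by (intro Liminf_mono always_eventually allI) (auto simp: Lp_norm_ennreal intro!: ennreal_leI powr_mono2)
  also have "\<dots> = ennreal (B powr p)" by (simp add: Liminf_const)
  finally show "g \<in> Lp p" "Lp_norm p g \<le> B"
    using LpI_nn_integral[OF g assms(1) B] by auto
qed

lemma Lp_dominated_convergence:
  assumes "p \<ge> 1" and w: "w \<in> Lp p" and [measurable]: "\<And>n. f n \<in> borel_measurable \<mu>" "g \<in> borel_measurable \<mu>"
    and lim: "AE t in \<mu>. (\<lambda>n. f n t) \<longlonglongrightarrow> g t"
    and dom: "\<And>n. AE t in \<mu>. norm (f n t) \<le> norm (w t)"
  shows "g \<in> Lp p" "(\<lambda>n. Lp_norm p (\<lambda>t. f n t - g t)) \<longlonglongrightarrow> 0"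
proof -
  have [measurable]: "w \<in> borel_measurable \<mu>" using w by auto
  have fn: "f n \<in> Lp p" "Lp_norm p (f n) \<le> Lp_norm p w" for n
    using Lp_bound[OF _ w, of 1 "f n"] dom[of n] assms(1) by auto
  show g: "g \<in> Lp p" using Lp_Fatou(1)[OF _ fn _ lim] assms(1) by simp
  have domg: "AE t in \<mu>. norm (g t) \<le> norm (w t)"
  proof -
    have "AE t in \<mu>. \<forall>n. norm (f n t) \<le> norm (w t)" using dom by (simp add: AE_all_countable)
    with lim show ?thesis
    proof eventually_elim
      case (elim t)
      then show ?case using tendsto_norm[OF elim(1)] by (intro LIMSEQ_le_const2[of "\<lambda>n. norm (f n t)"]) auto
    qed
  qed
  have "(\<lambda>n. \<integral>t. norm (f n t - g t) powr p \<partial>\<mu>) \<longlonglongrightarrow> (\<integral>t. 0 \<partial>\<mu>)"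
  proof (rule integral_dominated_convergence)
    show "integrable \<mu> (\<lambda>t. 2 powr p * norm (w t) powr p)" using Lp_integrable[OF w] by auto
    show "AE t in \<mu>. (\<lambda>n. norm (f n t - g t) powr p) \<longlonglongrightarrow> 0"
      using lim
    proof eventually_elim
      case (elim t)
      have "(\<lambda>n. norm (f n t - g t) powr p) \<longlonglongrightarrow> 0 powr p"
        using elim assms(1) by (intro tendsto_powr' tendsto_norm_zero) (auto simp: LIM_zero)
      then show ?case using assms(1) by simp
    qed
    show "AE t in \<mu>. norm (norm (f n t - g t) powr p) \<le> 2 powr p * norm (w t) powr p" for n
      using dom[of n] domg
    proof eventually_elim
      case (elim t)
      have "norm (f n t - g t) \<le> 2 * norm (w t)" using elim norm_triangle_ineq4[of "f n t" "g t"] by linarith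
      then have "norm (f n t - g t) powr p \<le> (2 * norm (w t)) powr p"
        using assms(1) by (intro powr_mono2) auto
      then show ?case by (simp add: powr_mult)
    qed
  qed auto
  then have "(\<lambda>n. (\<integral>t. norm (f n t - g t) powr p \<partial>\<mu>) powr (1 / p)) \<longlonglongrightarrow> 0 powr (1 / p)"
    using assms(1) by (intro tendsto_powr') auto
  then show "(\<lambda>n. Lp_norm p (\<lambda>t. f n t - g t)) \<longlonglongrightarrow> 0" using assms(1) by (simp add: Lp_norm_def)
qed

lemma Lp_norm_sum_le:
  assumes "p \<ge> 1" "\<And>i. i \<in> I \<Longrightarrow> f i \<in> Lp p"
  shows "Lp_norm p (\<lambda>t. \<Sum>i\<in>I. f i t) \<le> (\<Sum>i\<in>I. Lp_norm p (f i))"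
  using assms(2)
proof (induction I rule: infinite_finite_induct)
  case (insert x I)
  have "Lp_norm p (\<lambda>t. f x t + (\<Sum>i\<in>I. f i t)) \<le> Lp_norm p (f x) + Lp_norm p (\<lambda>t. \<Sum>i\<in>I. f i t)"
    using insert assms(1) by (intro Lp_add Lp_sum) auto
  then show ?case using insert by auto
qed (use assms in \<open>auto simp: Lp_norm_def\<close>)

text \<open>The series converges absolutely almost everywhere, since the L^1 norms are dominated by
  the L^p norms and are therefore summable. Fatou's lemma turns the bounds on finite blocks into the
  bound on the tail. Geometric decay is the form in which approximating sequences and the Neumann
  series arrive later.\<close>

lemma Lp_complete:
  assumes p: "p \<ge> 1" and f: "\<And>n. f n \<in> Lp p" and b: "\<And>n. Lp_norm p (f n) \<le> C * (1/2)^n"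
  obtains F where "F \<in> Lp p" "\<And>n. Lp_norm p (\<lambda>t. F t - (\<Sum>k<n. f k t)) \<le> 2 * C * (1/2)^n"
proof -
  have [measurable]: "f n \<in> borel_measurable \<mu>" for n using f by auto
  have C: "C \<ge> 0" using b[of 0] order_trans[OF Lp_norm_nonneg] by fastforce
  define F where "F t = (\<Sum>k. f k t)" for t
  have [measurable]: "F \<in> borel_measurable \<mu>" unfolding F_def[abs_def] by measurable
  have "(\<integral>\<^sup>+t. (\<Sum>k. ennreal (norm (f k t))) \<partial>\<mu>) = (\<Sum>k. \<integral>\<^sup>+t. ennreal (norm (f k t)) \<partial>\<mu>)"
    by (intro nn_integral_suminf) auto
  also have "\<dots> \<le> (\<Sum>k. ennreal (C * (1/2)^k))"
  proof (intro suminf_le allI)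
    show "(\<integral>\<^sup>+t. ennreal (norm (f k t)) \<partial>\<mu>) \<le> ennreal (C * (1/2)^k)" for k
      using Lp_imp_integrable[OF f p, of k] integral_norm_le_Lp_norm[OF f p, of k] b[of k]
      by (subst nn_integral_eq_integral) (auto intro!: ennreal_leI)
  qed auto
  also have "\<dots> < \<infinity>"
    using C by (subst suminf_ennreal2) (auto intro!: summable_mult summable_geometric)
  finally have "AE t in \<mu>. (\<Sum>k. ennreal (norm (f k t))) \<noteq> \<infinity>"
    by (intro nn_integral_PInf_AE) auto
  then have sm: "AE t in \<mu>. summable (\<lambda>k. norm (f k t))"
    by eventually_elim (auto intro: summable_suminf_not_top)
  have tail: "(\<lambda>t. F t - (\<Sum>k<n. f k t)) \<in> Lp p \<and> Lp_norm p (\<lambda>t. F t - (\<Sum>k<n. f k t)) \<le> 2 * C * (1/2)^n" for n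
  proof -
    have 1: "(\<lambda>t. \<Sum>k\<in>{n..<n+m}. f k t) \<in> Lp p" for m using f p by (intro Lp_sum) auto
    have 2: "Lp_norm p (\<lambda>t. \<Sum>k\<in>{n..<n+m}. f k t) \<le> 2 * C * (1/2)^n" for m
    proof -
      have "Lp_norm p (\<lambda>t. \<Sum>k\<in>{n..<n+m}. f k t) \<le> (\<Sum>k\<in>{n..<n+m}. Lp_norm p (f k))"
        using f p by (intro Lp_norm_sum_le) auto
      also have "\<dots> \<le> (\<Sum>k\<in>{n..<n+m}. C * (1/2)^k)" by (intro sum_mono b)
      also have "\<dots> = C * (\<Sum>k\<in>{n..<n+m}. (1/2)^k)" by (simp add: sum_distrib_left)
      also have "(\<Sum>k\<in>{n..<n+m}. (1/2::real)^k) = (1/2)^n * (\<Sum>k<m. (1/2)^k)"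
        by (induction m) (auto simp: power_add algebra_simps)
      also have "(\<Sum>k<m. (1/2::real)^k) \<le> 2" by (simp add: sum_gp_strict)
      finally show ?thesis using C by (simp add: mult.commute mult_left_mono)
    qed
    have 3: "AE t in \<mu>. (\<lambda>m. \<Sum>k\<in>{n..<n+m}. f k t) \<longlonglongrightarrow> F t - (\<Sum>k<n. f k t)"
      using sm
    proof eventually_elim
      case (elim t)
      have "(\<lambda>k. f k t) sums F t" unfolding F_def by (rule summable_sums[OF summable_norm_cancel[OF elim]])
      then have "(\<lambda>m. \<Sum>k<m + n. f k t) \<longlonglongrightarrow> F t" unfolding sums_def by (rule LIMSEQ_ignore_initial_segment)
      then have "(\<lambda>m. (\<Sum>k<m + n. f k t) - (\<Sum>k<n. f k t)) \<longlonglongrightarrow> F t - (\<Sum>k<n. f k t)"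
        by (intro tendsto_intros)
      moreover have "(\<Sum>k<m + n. f k t) - (\<Sum>k<n. f k t) = (\<Sum>k\<in>{n..<n+m}. f k t)" for m
        by (induction m) (auto simp: algebra_simps)
      ultimately show ?case by simp
    qed
    show ?thesis using Lp_Fatou[OF _ 1 2 _ 3] p by auto
  qed
  from tail[of 0] have "F \<in> Lp p" by simp
  with tail that show thesis by blast
qed

section \<open>Density of trigonometric polynomials in L^p\<close>

inductive_set trig :: "(complex \<Rightarrow> complex) set" where
  monom: "(\<And>t. norm t = 1 \<Longrightarrow> f t = c * t powi n) \<Longrightarrow> f \<in> trig"
| add: "f \<in> trig \<Longrightarrow> g \<in> trig \<Longrightarrow> (\<And>t. norm t = 1 \<Longrightarrow> h t = f t + g t) \<Longrightarrow> h \<in> trig"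

text \<open>Only values on the circle matter in \<open>trig\<close>. This admits functions such as
  real parts and conjugates, which agree with Laurent polynomials on the circle but not on the whole
  plane.\<close>

lemma trig_cong: "f \<in> trig \<Longrightarrow> (\<And>t. norm t = 1 \<Longrightarrow> g t = f t) \<Longrightarrow> g \<in> trig"
  using trig.add[of f "\<lambda>t. 0" g] trig.monom[of "\<lambda>t. 0" 0 0] by auto

lemma trig_const: "(\<lambda>t. c) \<in> trig"
  by (rule trig.monom[of _ c 0]) auto

lemma trig_mult: "f \<in> trig \<Longrightarrow> g \<in> trig \<Longrightarrow> (\<lambda>t. f t * g t) \<in> trig"
proof (induction f rule: trig.induct)
  case (monom f c n)
  from monom(2) show ?case
  proof (induction g rule: trig.induct)
    case (monom g d m)
    show ?case
    proof (rule trig.monom)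
      fix t :: complex assume "norm t = 1"
      then show "f t * g t = (c * d) * t powi (n + m)"
        using monom[of t] \<open>\<And>t. norm t = 1 \<Longrightarrow> f t = c * t powi n\<close> power_int_add[of t n m] by force
    qed
  next
    case (add g1 g2 h)
    show ?case by (rule trig.add[OF add.IH]) (auto simp: add.hyps algebra_simps)
  qed
next
  case (add f1 f2 h)
  show ?case by (rule trig.add[OF add.IH(1) add.IH(2)]) (auto simp: add.hyps add.prems algebra_simps)
qed

lemma trig_plus: "f \<in> trig \<Longrightarrow> g \<in> trig \<Longrightarrow> (\<lambda>t. f t + g t) \<in> trig"
  by (rule trig.add) auto

lemma trig_continuous: "f \<in> trig \<Longrightarrow> continuous_on (sphere 0 1) f"
proof (induction f rule: trig.induct)
  case (monom f c n)
  have "continuous_on (sphere 0 1) (\<lambda>t::complex. c * t powi n)" by (intro continuous_intros) auto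
  then show ?case by (rule continuous_on_eq) (use monom in auto)
next
  case (add f g h)
  have "continuous_on (sphere 0 1) (\<lambda>t. f t + g t)" using add by (intro continuous_intros)
  then show ?case by (rule continuous_on_eq) (use add in auto)
qed

lemma trig_measurable: "f \<in> trig \<Longrightarrow> f \<in> borel_measurable \<mu>"
  using trig_continuous borel_measurable_circle_continuous by blast

lemma continuous_circle_bounded:
  fixes f :: "complex \<Rightarrow> complex"
  assumes "continuous_on (sphere 0 1) f"
  shows "\<exists>C\<ge>0. \<forall>t. norm t = 1 \<longrightarrow> norm (f t) \<le> C"
proof -
  have "bounded (f ` sphere 0 1)"
    using assms by (intro compact_imp_bounded compact_continuous_image) auto
  then obtain C where "\<forall>y\<in>f ` sphere 0 1. norm y \<le> C" unfolding bounded_iff by blast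
  then show ?thesis by (intro exI[of _ "max C 0"]) (auto intro!: max.coboundedI1)
qed

lemma continuous_circle_Lp:
  fixes f :: "complex \<Rightarrow> complex"
  assumes "continuous_on (sphere 0 1) f" "p > 0"
  shows "f \<in> Lp p"
proof -
  obtain C where "C \<ge> 0" "\<forall>t. norm t = 1 \<longrightarrow> norm (f t) \<le> C" using continuous_circle_bounded[OF assms(1)] by blast
  then show ?thesis
    using assms(2) borel_measurable_circle_continuous[OF assms(1)] by (intro Lp_bounded(1)[of p f C]) auto
qed

lemma trig_Lp: "f \<in> trig \<Longrightarrow> p > 0 \<Longrightarrow> f \<in> Lp p"
  using trig_continuous continuous_circle_Lp by blast

lemma trig_Re_Im: "(\<lambda>t. of_real (Re t)) \<in> trig" "(\<lambda>t. of_real (Im t)) \<in> trig"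
proof -
  have a: "(\<lambda>t. 1 / 2 * t powi 1) \<in> trig" "(\<lambda>t. 1 / 2 * t powi (-1)) \<in> trig" "(\<lambda>t. 1 / (2*\<i>) * t powi 1) \<in> trig"
    "(\<lambda>t. -1 / (2*\<i>) * t powi (-1)) \<in> trig"
    by (rule trig.monom, rule refl)+
  have inv: "inverse t = cnj t" if "norm t = 1" for t
    using that by (metis complex_norm_square inverse_unique of_real_1 one_power2)
  show "(\<lambda>t. of_real (Re t)) \<in> trig"
    by (rule trig.add[OF a(1,2)]) (auto simp: complex_eq_iff inv power_int_minus)
  show "(\<lambda>t. of_real (Im t)) \<in> trig"
    by (rule trig.add[OF a(3,4)]) (auto simp: complex_eq_iff inv power_int_minus)
qed

text \<open>The bridge from the Stone-Weierstrass theorem, which speaks of real polynomial functions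
  on the plane, to trigonometric polynomials.\<close>

lemma real_polynomial_function_trig:
  "real_polynomial_function g \<Longrightarrow> (\<lambda>t::complex. of_real (g t)) \<in> trig"
proof (induction g rule: real_polynomial_function.induct)
  case (linear f)
  interpret bounded_linear f by fact
  have "f t = Re t * f 1 + Im t * f \<i>" for t
  proof -
    have "t = Re t *\<^sub>R 1 + Im t *\<^sub>R \<i>" by (simp add: complex_eq_iff)
    then have "f t = f (Re t *\<^sub>R 1 + Im t *\<^sub>R \<i>)" by simp
    also have "\<dots> = Re t * f 1 + Im t * f \<i>" unfolding add scaleR by simp
    finally show ?thesis .
  qed
  then have *: "of_real (f t) = of_real (Re t) * complex_of_real (f 1) + of_real (Im t) * of_real (f \<i>)" for t
    by (metis of_real_add of_real_mult)
  have "(\<lambda>t. of_real (Re t) * complex_of_real (f 1) + of_real (Im t) * of_real (f \<i>)) \<in> trig"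
    by (intro trig_plus trig_mult trig_Re_Im trig_const)
  then show ?case by (rule trig_cong) (rule *)
next
  case (const c)
  show ?case by (rule trig_const)
next
  case (add f g)
  show ?case unfolding of_real_add by (rule trig_plus[OF add.IH])
next
  case (mult f g)
  show ?case unfolding of_real_mult by (rule trig_mult[OF mult.IH])
qed

definition trig_closure :: "real \<Rightarrow> (complex \<Rightarrow> complex) set" where
  "trig_closure p = {f \<in> Lp p. \<forall>e>0. \<exists>g\<in>trig. Lp_norm p (\<lambda>t. f t - g t) < e}"

lemma trig_closure_limit:
  assumes "p \<ge> 1" "\<And>n. f n \<in> trig_closure p" "g \<in> Lp p" "(\<lambda>n. Lp_norm p (\<lambda>t. f n t - g t)) \<longlonglongrightarrow> 0"
  shows "g \<in> trig_closure p"
proof -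
  have "\<exists>h\<in>trig. Lp_norm p (\<lambda>t. g t - h t) < e" if "e > 0" for e
  proof -
    have "\<forall>\<^sub>F n in sequentially. Lp_norm p (\<lambda>t. f n t - g t) < e / 2"
      using assms(4) that by (intro order_tendstoD) auto
    then obtain n where n: "Lp_norm p (\<lambda>t. f n t - g t) < e / 2" by (auto simp: eventually_sequentially)
    obtain h where h: "h \<in> trig" "Lp_norm p (\<lambda>t. f n t - h t) < e / 2"
      using assms(2)[of n] \<open>e > 0\<close> unfolding trig_closure_def by (auto elim: allE[of _ "e / 2"])
    have fn: "f n \<in> Lp p" using assms(2)[of n] by (simp add: trig_closure_def)
    have d: "(\<lambda>t. f n t - h t) \<in> Lp p" "(\<lambda>t. f n t - g t) \<in> Lp p"
      using Lp_diff assms fn trig_Lp[OF h(1), of p] by auto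
    have "Lp_norm p (\<lambda>t. (f n t - h t) - (f n t - g t)) \<le> Lp_norm p (\<lambda>t. f n t - h t) + Lp_norm p (\<lambda>t. f n t - g t)"
      by (rule Lp_diff(2)[OF assms(1) d])
    then show ?thesis using n h by (intro bexI[of _ h]) auto
  qed
  then show ?thesis using assms by (auto simp: trig_closure_def)
qed

lemma trig_closure_add:
  assumes "p \<ge> 1" "f \<in> trig_closure p" "g \<in> trig_closure p"
  shows "(\<lambda>t. f t + g t) \<in> trig_closure p"
proof -
  have fg: "f \<in> Lp p" "g \<in> Lp p" using assms by (auto simp: trig_closure_def)
  have "\<exists>h\<in>trig. Lp_norm p (\<lambda>t. (f t + g t) - h t) < e" if "e > 0" for e
  proof -
    have "\<exists>h\<in>trig. Lp_norm p (\<lambda>t. k t - h t) < e / 2" if "k \<in> trig_closure p" for k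
      using that half_gt_zero[OF \<open>e > 0\<close>] unfolding trig_closure_def by blast
    from this[OF assms(2)] this[OF assms(3)] obtain h1 h2
      where h: "h1 \<in> trig" "Lp_norm p (\<lambda>t. f t - h1 t) < e / 2" "h2 \<in> trig" "Lp_norm p (\<lambda>t. g t - h2 t) < e / 2"
      by blast
    have d: "(\<lambda>t. f t - h1 t) \<in> Lp p" "(\<lambda>t. g t - h2 t) \<in> Lp p"
      using Lp_diff assms fg trig_Lp[OF h(1), of p] trig_Lp[OF h(3), of p] by auto
    have "Lp_norm p (\<lambda>t. (f t - h1 t) + (g t - h2 t)) \<le> Lp_norm p (\<lambda>t. f t - h1 t) + Lp_norm p (\<lambda>t. g t - h2 t)"
      by (rule Lp_add(2)[OF assms(1) d])
    then show ?thesis using h by (intro bexI[of _ "\<lambda>t. h1 t + h2 t"] trig_plus) (auto simp: algebra_simps)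
  qed
  then show ?thesis using Lp_add assms fg by (auto simp: trig_closure_def)
qed

lemma trig_closure_scale:
  assumes "p \<ge> 1" "f \<in> trig_closure p"
  shows "(\<lambda>t. c * f t) \<in> trig_closure p"
proof -
  have f: "f \<in> Lp p" using assms by (auto simp: trig_closure_def)
  have "\<exists>h\<in>trig. Lp_norm p (\<lambda>t. c * f t - h t) < e" if "e > 0" for e
  proof -
    have "e / (norm c + 1) > 0" using that by (simp add: add_nonneg_pos)
    then obtain h where h: "h \<in> trig" "Lp_norm p (\<lambda>t. f t - h t) < e / (norm c + 1)"
      using assms unfolding trig_closure_def by blast
    have d: "(\<lambda>t. f t - h t) \<in> Lp p"
      using Lp_diff assms f trig_Lp[OF h(1), of p] by auto
    have "Lp_norm p (\<lambda>t. c * f t - c * h t) = norm c * Lp_norm p (\<lambda>t. f t - h t)"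
      using Lp_scale(2)[OF _ d, of c] assms by (simp add: algebra_simps)
    also have "\<dots> \<le> (norm c + 1) * Lp_norm p (\<lambda>t. f t - h t)" by (intro mult_right_mono) auto
    also have "\<dots> < e" using h(2) by (simp add: pos_less_divide_eq add_nonneg_pos mult.commute)
    finally show ?thesis using h by (intro bexI[of _ "\<lambda>t. c * h t"] trig_mult trig_const) auto
  qed
  then show ?thesis using Lp_scale assms f by (auto simp: trig_closure_def)
qed

lemma trig_closure_trig: "f \<in> trig \<Longrightarrow> p \<ge> 1 \<Longrightarrow> f \<in> trig_closure p"
  using trig_Lp[of f p] by (auto simp: trig_closure_def Lp_norm_def intro!: bexI[of _ f])

lemma trig_closure_continuous:
  assumes "p \<ge> 1" "continuous_on (sphere 0 1) (f :: complex \<Rightarrow> real)"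
  shows "(\<lambda>t. of_real (f t)) \<in> trig_closure p"
proof -
  have c: "continuous_on (sphere 0 1) (\<lambda>t. complex_of_real (f t))" using assms by (intro continuous_intros)
  have "\<exists>h\<in>trig. Lp_norm p (\<lambda>t. of_real (f t) - h t) < e" if "e > 0" for e
  proof -
    have e2: "e / 2 > 0" using that by simp
    obtain g where g: "real_polynomial_function g" "\<And>t. t \<in> sphere 0 1 \<Longrightarrow> \<bar>f t - g t\<bar> < e / 2"
      using Stone_Weierstrass_real_polynomial_function[OF compact_sphere assms(2) e2] by metis
    have "(\<lambda>t. complex_of_real (f t) - of_real (g t)) \<in> borel_measurable \<mu>"
      using borel_measurable_circle_continuous[OF c] trig_measurable[OF real_polynomial_function_trig[OF g(1)]]
      by (rule borel_measurable_diff)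
    then have "Lp_norm p (\<lambda>t. of_real (f t) - of_real (g t)) \<le> e / 2"
      using assms(1) that g(2)
      by (intro Lp_bounded(2)) (auto simp flip: of_real_diff intro!: AE_I2 less_imp_le)
    then show ?thesis using that
      by (intro bexI[of _ "\<lambda>t. of_real (g t)"] real_polynomial_function_trig g) auto
  qed
  then show ?thesis using continuous_circle_Lp[OF c, of p] assms by (auto simp: trig_closure_def)
qed

text \<open>Closed sets generate the Borel sets and are stable under intersection, so Dynkin's
  theorem leaves only closed sets to treat. There the truncated multiples of the distance function
  give continuous functions that converge to the indicator under the bound 1.\<close>

lemma trig_closure_indicator:
  assumes "p \<ge> 1" "A \<in> sets borel"
  shows "(\<lambda>t. of_real (indicator A t)) \<in> trig_closure p"
proof -
  have m: "(\<lambda>t. complex_of_real (indicator A t)) \<in> borel_measurable \<mu>" if "A \<in> sets borel" for A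
    by (intro borel_measurable_circleI) (use that in measurable)
  have i: "(\<lambda>t. complex_of_real (indicator A t)) \<in> Lp p" if "A \<in> sets borel" for A
    using m[OF that] assms by (intro Lp_bounded(1)[of p _ 1]) auto
  have one: "(\<lambda>t. 1) \<in> Lp p" using assms by (intro Lp_bounded(1)[of p _ 1]) auto
  have "Int_stable (Collect closed :: complex set set)" by (auto simp: Int_stable_def)
  moreover have "Collect closed \<subseteq> Pow (UNIV :: complex set)" by simp
  moreover have "A \<in> sigma_sets UNIV (Collect closed)"
    using assms by (simp add: borel_eq_closed)
  ultimately show ?thesis
  proof (induction A rule: sigma_sets_induct_disjoint)
    case (basic F)
    then have F: "closed F" by simp
    show ?case
    proof (cases "F = {}")
      case False
      define h where "h n t = max 0 (1 - real n * infdist t F)" for n t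
      have "(\<lambda>t. of_real (h n t)) \<in> trig_closure p" for n
        unfolding h_def using assms by (intro trig_closure_continuous continuous_intros) auto
      moreover have "(\<lambda>n. Lp_norm p (\<lambda>t. of_real (h n t) - of_real (indicator F t))) \<longlonglongrightarrow> 0"
      proof (rule Lp_dominated_convergence(2)[OF assms(1) one])
        show "(\<lambda>t. complex_of_real (h n t)) \<in> borel_measurable \<mu>" for n
          unfolding h_def by (intro borel_measurable_circle_continuous continuous_intros)
        show "AE t in \<mu>. (\<lambda>n. of_real (h n t)) \<longlonglongrightarrow> complex_of_real (indicator F t)"
        proof (intro AE_I2 tendsto_of_real)
          fix t
          show "(\<lambda>n. h n t) \<longlonglongrightarrow> indicator F t"
          proof (cases "t \<in> F")
            case True then show ?thesis using F by (simp add: h_def)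
          next
            case False
            then have "infdist t F > 0" using F \<open>F \<noteq> {}\<close> infdist_pos_not_in_closed by blast
            then obtain N where "real N * infdist t F > 1" using reals_Archimedean3 by blast
            then have "\<forall>n\<ge>N. h n t = 0"
              unfolding h_def using \<open>infdist t F > 0\<close> by (smt (verit) mult_right_mono of_nat_le_iff)
            then have "\<forall>\<^sub>F n in sequentially. h n t = 0" by (auto simp: eventually_sequentially)
            then show ?thesis using False by (simp add: tendsto_eventually)
          qed
        qed
        show "AE t in \<mu>. norm (complex_of_real (h n t)) \<le> norm (1::complex)" for n
          by (intro AE_I2) (auto simp: h_def infdist_nonneg)
      qed (use F m in auto)
      ultimately show ?thesis using trig_closure_limit[OF assms(1) _ i[OF borel_closed[OF F]], of "\<lambda>n t. of_real (h n t)"] by blast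
    qed (use trig_closure_trig[OF trig_const assms(1), of 0] in simp)
  next
    case empty
    show ?case using trig_closure_trig[OF trig_const assms(1), of 0] by simp
  next
    case (compl A)
    have *: "complex_of_real (indicator (UNIV - A) t) = 1 + (-1) * of_real (indicator A t)" for t
      by (auto simp: indicator_def)
    show ?case unfolding * using compl assms trig_closure_trig[OF trig_const assms(1), of 1]
      by (intro trig_closure_add trig_closure_scale) auto
  next
    case (union A)
    have A: "A n \<in> sets borel" for n using union by (auto simp: borel_eq_closed)
    have "(\<lambda>t. \<Sum>k<n. complex_of_real (indicator (A k) t)) \<in> trig_closure p" for n
    proof (induction n)
      case (Suc n)
      show ?case using trig_closure_add[OF assms(1) Suc union(3)[of n]] by simp
    qed (use trig_closure_trig[OF trig_const assms(1), of 0] in simp)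
    moreover have "(\<lambda>n. Lp_norm p (\<lambda>t. (\<Sum>k<n. complex_of_real (indicator (A k) t)) - of_real (indicator (\<Union>(range A)) t))) \<longlonglongrightarrow> 0"
    proof (rule Lp_dominated_convergence(2)[OF assms(1) one])
      have s: "(\<lambda>k. indicator (A k) t :: real) sums indicator (\<Union>(range A)) t" for t
        by (intro indicator_sums) (use union(1) in \<open>auto simp: disjoint_family_on_def\<close>)
      show "AE t in \<mu>. (\<lambda>n. \<Sum>k<n. complex_of_real (indicator (A k) t)) \<longlonglongrightarrow> of_real (indicator (\<Union>(range A)) t)"
        using tendsto_of_real[OF s[unfolded sums_def], where 'a=complex] by (intro AE_I2) simp
      show "AE t in \<mu>. norm (\<Sum>k<n. complex_of_real (indicator (A k) t)) \<le> norm (1::complex)" for n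
      proof (intro AE_I2)
        fix t
        have "(\<Sum>k<n. indicator (A k) t) \<le> (indicator (\<Union>(range A)) t :: real)"
          using sum_le_suminf[OF sums_summable[OF s[of t]], of "{..<n}"] sums_unique[OF s[of t]] by auto
        also have "\<dots> \<le> 1" by (simp add: indicator_def)
        finally show "norm (\<Sum>k<n. complex_of_real (indicator (A k) t)) \<le> norm (1::complex)"
          by (simp flip: of_real_sum add: sum_nonneg)
      qed
    qed (use A m in auto)
    moreover have "\<Union>(range A) \<in> sets borel" using A by auto
    ultimately show ?case
      using i[of "\<Union>(range A)"] trig_closure_limit[OF assms(1), of "\<lambda>n t. \<Sum>k<n. complex_of_real (indicator (A k) t)"] by blast
  qed
qed

lemma Lp_trig_dense:
  assumes "p \<ge> 1" "f \<in> Lp p"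
  shows "f \<in> trig_closure p"
proof -
  have [measurable]: "f \<in> borel_measurable \<mu>" using assms by auto
  obtain s where s: "\<And>i. simple_function \<mu> (s i)" "\<And>x. x \<in> space \<mu> \<Longrightarrow> (\<lambda>i. s i x) \<longlonglongrightarrow> f x"
    "\<And>i x. x \<in> space \<mu> \<Longrightarrow> dist (s i x) 0 \<le> 2 * dist (f x) 0"
    using borel_measurable_implies_sequence_metric[of f \<mu> 0] \<open>f \<in> borel_measurable \<mu>\<close> by metis
  have sm: "s i \<in> borel_measurable \<mu>" for i using s(1) by (rule borel_measurable_simple_function)
  have w: "(\<lambda>t. 2 * f t) \<in> Lp p" using Lp_scale assms by auto
  have lim: "(\<lambda>n. Lp_norm p (\<lambda>t. s n t - f t)) \<longlonglongrightarrow> 0"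
    using s(2,3) sm by (intro Lp_dominated_convergence(2)[OF assms(1) w]) (auto simp: norm_mult)
  have sL: "s n \<in> Lp p" for n
    proof (rule Lp_bound(1)[OF _ w, of 1 "s n"])
    show "AE t in \<mu>. norm (s n t) \<le> 1 * norm (2 * f t)" using s(3)[of _ n] by (intro AE_I2) (simp add: norm_mult)
  qed (use assms(1) sm in auto)
  have "s n \<in> trig_closure p" for n
  proof -
    have fin: "finite (s n ` sphere 0 1)" using simple_functionD(1)[OF s(1)[of n]] by simp
    have "(\<lambda>t. \<Sum>y\<in>B. y * of_real (indicator (s n -` {y} \<inter> sphere 0 1) t)) \<in> trig_closure p"
      if "finite B" "B \<subseteq> s n ` sphere 0 1" for B
      using that
    proof (induction B rule: finite_induct)
      case (insert y B)
      have "s n -` {y} \<inter> sphere 0 1 \<in> sets \<mu>" using simple_functionD(2)[OF s(1)[of n], of "{y}"] by simp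
      then have "s n -` {y} \<inter> sphere 0 1 \<in> sets borel"
        unfolding sets_circle by (subst (asm) sets_restrict_space_iff) auto
      then show ?case
        using insert assms trig_closure_add[OF assms(1) trig_closure_scale[OF assms(1) trig_closure_indicator]] by simp
    qed (use trig_closure_trig[OF trig_const assms(1), of 0] in simp)
    from this[OF fin order_refl] have a: "(\<lambda>t. \<Sum>y\<in>s n ` sphere 0 1. y * of_real (indicator (s n -` {y} \<inter> sphere 0 1) t)) \<in> trig_closure p" .
    have "(\<Sum>y\<in>s n ` sphere 0 1. y * of_real (indicator (s n -` {y} \<inter> sphere 0 1) t)) = s n t" if "norm t = 1" for t
    proof -
      have "(\<Sum>y\<in>s n ` sphere 0 1. y * of_real (indicator (s n -` {y} \<inter> sphere 0 1) t)) = (\<Sum>y\<in>s n ` sphere 0 1. if y = s n t then y else 0)"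
        using that by (intro sum.cong) (auto simp: indicator_def)
      then show ?thesis using fin that by (simp add: sum.delta)
    qed
    then have eq: "(\<integral>t. norm ((\<Sum>y\<in>s n ` sphere 0 1. y * of_real (indicator (s n -` {y} \<inter> sphere 0 1) t)) - s n t) powr p \<partial>\<mu>) = 0"
      by (intro integral_eq_zero_AE AE_I2) simp
    show ?thesis
      by (rule trig_closure_limit[OF assms(1) a sL]) (simp add: Lp_norm_def eq)
  qed
  then show ?thesis using trig_closure_limit[OF assms(1) _ assms(2) lim] by blast
qed

lemma Lp_trig_sequence:
  assumes "p \<ge> 1" "f \<in> Lp p"
  obtains g where "\<And>n. g n \<in> trig" "\<And>n. Lp_norm p (\<lambda>t. f t - g n t) < (1/2)^n"
proof -
  have "\<forall>n. \<exists>g\<in>trig. Lp_norm p (\<lambda>t. f t - g t) < (1/2)^n"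
    using Lp_trig_dense[OF assms] by (simp add: trig_closure_def)
  then show thesis using that by metis
qed

section \<open>Fourier coefficients and Hardy classes\<close>

lemma fourier_integrable:
  assumes "integrable \<mu> f"
  shows "integrable \<mu> (\<lambda>t. f t * t powi n)"
proof (rule Bochner_Integration.integrable_bound[OF assms])
  have "(\<lambda>t. t powi n) \<in> borel_measurable \<mu>"
    by (intro borel_measurable_circle_continuous continuous_intros) auto
  then show "(\<lambda>t. f t * t powi n) \<in> borel_measurable \<mu>" using assms by measurable
qed (auto simp: norm_mult norm_power_int intro!: AE_I2)

lemma fourier_coeff_add:
  "integrable \<mu> f \<Longrightarrow> integrable \<mu> g \<Longrightarrow> fourier_coeff (\<lambda>t. f t + g t) n = fourier_coeff f n + fourier_coeff g n"
  unfolding fourier_coeff_def distrib_right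
  by (intro Bochner_Integration.integral_add fourier_integrable)

lemma fourier_coeff_diff:
  "integrable \<mu> f \<Longrightarrow> integrable \<mu> g \<Longrightarrow> fourier_coeff (\<lambda>t. f t - g t) n = fourier_coeff f n - fourier_coeff g n"
  unfolding fourier_coeff_def left_diff_distrib
  by (intro Bochner_Integration.integral_diff fourier_integrable)

lemma fourier_coeff_scale: "fourier_coeff (\<lambda>t. c * f t) n = c * fourier_coeff f n"
  by (simp add: fourier_coeff_def mult.assoc)

lemma fourier_coeff_cong_AE:
  assumes "AE t in \<mu>. f t = g t" "f \<in> borel_measurable \<mu>" "g \<in> borel_measurable \<mu>"
  shows "fourier_coeff f n = fourier_coeff g n"
proof -
  have [measurable]: "(\<lambda>t. t powi (-n)) \<in> borel_measurable \<mu>"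
    by (intro borel_measurable_circle_continuous continuous_intros) auto
  show ?thesis unfolding fourier_coeff_def
    using assms(2,3) by (intro integral_cong_AE) (use assms(1) in auto)
qed

lemma fourier_coeff_cong:
  assumes "\<And>t. norm t = 1 \<Longrightarrow> f t = g t"
  shows "fourier_coeff f n = fourier_coeff g n"
  unfolding fourier_coeff_def by (intro Bochner_Integration.integral_cong) (use assms in auto)

lemma fourier_coeff_bound:
  "integrable \<mu> f \<Longrightarrow> norm (fourier_coeff f n) \<le> (\<integral>t. norm (f t) \<partial>\<mu>)"
proof -
  have "norm (fourier_coeff f n) \<le> (\<integral>t. norm (f t * t powi (-n)) \<partial>\<mu>)"
    unfolding fourier_coeff_def by (rule integral_norm_bound)
  also have "\<dots> = (\<integral>t. norm (f t) \<partial>\<mu>)"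
    by (intro Bochner_Integration.integral_cong) (auto simp: norm_mult norm_power_int)
  finally show ?thesis .
qed

lemma fourier_coeff_shift:
  "fourier_coeff (\<lambda>t. f t * t powi m) n = fourier_coeff f (n - m)"
  unfolding fourier_coeff_def
proof (intro Bochner_Integration.integral_cong refl)
  fix t assume "t \<in> space \<mu>"
  then have "t \<noteq> 0" by auto
  then show "f t * t powi m * t powi - n = f t * t powi - (n - m)"
    by (simp add: power_int_add[symmetric] mult.assoc)
qed

lemma cnj_circle: "norm t = 1 \<Longrightarrow> cnj t = inverse t"
  by (metis complex_norm_square inverse_unique of_real_1 one_power2)

lemma cnj_powi_circle: "norm t = 1 \<Longrightarrow> cnj (t powi n) = t powi (- n)" "norm t = 1 \<Longrightarrow> cnj t powi n = t powi (- n)"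
  by (auto simp: power_int_def cnj_circle power_inverse)

lemma fourier_coeff_cnj:
  "fourier_coeff (\<lambda>t. cnj (f t)) n = cnj (fourier_coeff f (- n))"
proof -
  have "cnj (fourier_coeff f (- n)) = (\<integral>t. cnj (f t * t powi n) \<partial>\<mu>)"
    unfolding fourier_coeff_def Bochner_Integration.integral_cnj minus_minus ..
  also have "\<dots> = fourier_coeff (\<lambda>t. cnj (f t)) n"
    unfolding fourier_coeff_def
    by (intro Bochner_Integration.integral_cong refl) (simp add: cnj_powi_circle)
  finally show ?thesis ..
qed

lemma fourier_coeff_tendsto:
  assumes "p \<ge> 1" "\<And>n. f n \<in> Lp p" "g \<in> Lp p" "(\<lambda>n. Lp_norm p (\<lambda>t. f n t - g t)) \<longlonglongrightarrow> 0"
  shows "(\<lambda>n. fourier_coeff (f n) k) \<longlonglongrightarrow> fourier_coeff g k"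
proof -
  have "(\<lambda>n. fourier_coeff (f n) k - fourier_coeff g k) \<longlonglongrightarrow> 0"
  proof (rule Lim_null_comparison[OF _ assms(4)], intro always_eventually allI)
    fix n
    have "norm (fourier_coeff (\<lambda>t. f n t - g t) k) \<le> (\<integral>t. norm (f n t - g t) \<partial>\<mu>)"
      by (rule fourier_coeff_bound) (use assms Lp_imp_integrable Lp_diff in blast)
    also have "\<dots> \<le> Lp_norm p (\<lambda>t. f n t - g t)"
      by (rule integral_norm_le_Lp_norm[OF _ assms(1)]) (use assms Lp_diff in blast)
    also have "fourier_coeff (\<lambda>t. f n t - g t) k = fourier_coeff (f n) k - fourier_coeff g k"
      by (rule fourier_coeff_diff) (use assms Lp_imp_integrable in blast)+
    finally show "norm (fourier_coeff (f n) k - fourier_coeff g k) \<le> Lp_norm p (\<lambda>t. f n t - g t)" .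
  qed
  then show ?thesis by (simp add: LIM_zero_iff)
qed

lemma fourier_coeff_powi: "fourier_coeff (\<lambda>t. t powi m) n = (if n = m then 1 else 0)"
  using fourier_coeff_shift[of "\<lambda>t. 1" m n] integral_circle_powi[of "-(n - m)"]
  by (auto simp: fourier_coeff_def)

lemma fourier_coeff_const: "fourier_coeff (\<lambda>t. c) n = (if n = 0 then c else 0)"
  using fourier_coeff_scale[of c "\<lambda>t. t powi 0" n] fourier_coeff_powi[of 0 n] by auto

lemma poly_trig: "poly r \<in> trig"
proof (induction r)
  case 0
  show ?case by (rule trig.monom[of _ 0 0]) simp
next
  case (pCons a r)
  have id: "(\<lambda>t. t) \<in> trig" by (rule trig.monom[of _ 1 1]) simp
  show ?case by (rule trig.add[OF trig_const[of a] trig_mult[OF id pCons.IH(1)]]) simp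
qed

text \<open>The part of negative index is written as the conjugate of \<open>t * s\<close>, so that
  both parts are governed by ordinary polynomials; the factor \<open>t\<close> keeps index 0 out of
  the second part.\<close>

lemma trig_decompose:
  "f \<in> trig \<Longrightarrow> \<exists>r s. \<forall>t. norm t = 1 \<longrightarrow> f t = poly r t + cnj (t * poly s t)"
proof (induction f rule: trig.induct)
  case (monom f c n)
  show ?case
  proof (cases "n \<ge> 0")
    case True
    then show ?thesis using monom
      by (intro exI[of _ "Polynomial.monom c (nat n)"] exI[of _ 0]) (auto simp: poly_monom power_int_def)
  next
    case False
    then obtain m where m: "n = - int (Suc m)" by (metis negD not_le)
    have "f t = poly 0 t + cnj (t * poly (Polynomial.monom (cnj c) m) t)" if "norm t = 1" for t
    proof -
      have "t powi n = inverse t * inverse (t ^ m)"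
        unfolding m power_int_minus power_int_of_nat by simp
      then show ?thesis using monom[OF that] that by (simp add: poly_monom cnj_circle power_inverse)
    qed
    then show ?thesis by blast
  qed
next
  case (add f g h)
  then obtain r s r' s' where "\<forall>t. norm t = 1 \<longrightarrow> f t = poly r t + cnj (t * poly s t)"
    "\<forall>t. norm t = 1 \<longrightarrow> g t = poly r' t + cnj (t * poly s' t)" by blast
  then show ?case using add(3)
    by (intro exI[of _ "r + r'"] exI[of _ "s + s'"]) (auto simp: algebra_simps)
qed

lemma fourier_coeff_poly: "fourier_coeff (poly r) n = (if n \<ge> 0 then coeff r (nat n) else 0)"
proof (induction r arbitrary: n)
  case 0
  have "poly 0 = (\<lambda>t::complex. 0)" by auto
  then show ?case by (simp add: fourier_coeff_def)
next
  case (pCons a r)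
  have "fourier_coeff (poly (pCons a r)) n = fourier_coeff (\<lambda>t. a + poly r t * t powi 1) n"
    by (intro fourier_coeff_cong) (simp add: algebra_simps)
  also have "\<dots> = fourier_coeff (\<lambda>t. a) n + fourier_coeff (\<lambda>t. poly r t * t powi 1) n"
    using Lp_imp_integrable[OF trig_Lp[OF poly_trig, of 1 r]]
    by (intro fourier_coeff_add fourier_integrable) auto
  also have "\<dots> = (if n = 0 then a else 0) + (if n \<ge> 1 then coeff r (nat (n - 1)) else 0)"
    unfolding fourier_coeff_shift pCons.IH fourier_coeff_const by auto
  also have "\<dots> = (if n \<ge> 0 then coeff (pCons a r) (nat n) else 0)"
    by (auto simp: coeff_pCons nat_diff_distrib split: nat.splits)
  finally show ?case .
qed

lemma HardyI: "f \<in> Lp p \<Longrightarrow> (\<And>n. n < 0 \<Longrightarrow> fourier_coeff f n = 0) \<Longrightarrow> f \<in> Hardy p"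
  by (simp add: Hardy_def)

lemma HardyD: "f \<in> Hardy p \<Longrightarrow> f \<in> Lp p" "f \<in> Hardy p \<Longrightarrow> n < 0 \<Longrightarrow> fourier_coeff f n = 0"
  by (simp_all add: Hardy_def)

lemma co_HardyD: "f \<in> co_Hardy p \<Longrightarrow> f \<in> Lp p" "f \<in> co_Hardy p \<Longrightarrow> n > 0 \<Longrightarrow> fourier_coeff f n = 0"
  by (simp_all add: co_Hardy_def)

lemma Lp_cnj: "f \<in> Lp p \<Longrightarrow> (\<lambda>t. cnj (f t)) \<in> Lp p"
  unfolding Lp_def by (simp add: measurable_compose[OF _ borel_measurable_continuous_onI[OF continuous_on_cnj[OF continuous_on_id]]])

lemma Lp_cnj_iff: "(\<lambda>t. cnj (f t)) \<in> Lp p \<longleftrightarrow> f \<in> Lp p"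
  using Lp_cnj[of f p] Lp_cnj[of "\<lambda>t. cnj (f t)" p] by auto

text \<open>On the circle conjugation reverses the sign of the index. Facts about
  \<open>co_Hardy\<close> are obtained from those about \<open>Hardy\<close> through this
  equivalence.\<close>

lemma co_Hardy_iff_cnj: "f \<in> co_Hardy p \<longleftrightarrow> (\<lambda>t. cnj (f t)) \<in> Hardy p"
proof -
  have "(\<forall>n>0. fourier_coeff f n = 0) \<longleftrightarrow> (\<forall>n<0. fourier_coeff f (-n) = 0)"
    by (metis minus_minus neg_0_less_iff_less neg_less_0_iff_less)
  then show ?thesis by (simp add: co_Hardy_def Hardy_def Lp_cnj_iff fourier_coeff_cnj)
qed

lemma poly_Hardy: "p > 0 \<Longrightarrow> poly r \<in> Hardy p"
  by (intro HardyI trig_Lp poly_trig) (auto simp: fourier_coeff_poly)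

lemma Hardy_mono: "0 < a \<Longrightarrow> a \<le> b \<Longrightarrow> f \<in> Hardy b \<Longrightarrow> f \<in> Hardy a"
  using Lp_mono(1)[of a b f] by (simp add: Hardy_def)

lemma Hardy_add: "p \<ge> 1 \<Longrightarrow> f \<in> Hardy p \<Longrightarrow> g \<in> Hardy p \<Longrightarrow> (\<lambda>t. f t + g t) \<in> Hardy p"
  using Lp_imp_integrable[of f p] Lp_imp_integrable[of g p]
  by (auto simp: Hardy_def fourier_coeff_add intro: Lp_add)

lemma Hardy_scale: "p > 0 \<Longrightarrow> f \<in> Hardy p \<Longrightarrow> (\<lambda>t. c * f t) \<in> Hardy p"
  by (auto simp: Hardy_def fourier_coeff_scale intro: Lp_scale)

lemma Hardy_diff: "p \<ge> 1 \<Longrightarrow> f \<in> Hardy p \<Longrightarrow> g \<in> Hardy p \<Longrightarrow> (\<lambda>t. f t - g t) \<in> Hardy p"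
  using Hardy_add[of p f "\<lambda>t. -1 * g t"] Hardy_scale[of p g "-1"] by simp

lemma Hardy_cong_AE:
  assumes "AE t in \<mu>. f t = g t" "f \<in> borel_measurable \<mu>" "g \<in> Hardy p"
  shows "f \<in> Hardy p"
  using Lp_cong_AE[OF assms(1,2)] fourier_coeff_cong_AE[OF assms(1,2)] assms(3)
  by (auto simp: Hardy_def)

lemma Hardy_limit:
  assumes "p \<ge> 1" "\<And>n. f n \<in> Hardy p" "g \<in> Lp p" "(\<lambda>n. Lp_norm p (\<lambda>t. f n t - g t)) \<longlonglongrightarrow> 0"
  shows "g \<in> Hardy p"
proof (rule HardyI[OF assms(3)])
  fix n :: int assume n: "n < 0"
  have "(\<lambda>k. fourier_coeff (f k) n) \<longlonglongrightarrow> fourier_coeff g n"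
    using assms HardyD(1) by (intro fourier_coeff_tendsto) auto
  moreover have "(\<lambda>k. fourier_coeff (f k) n) = (\<lambda>k. 0)" using assms(2) n HardyD(2) by blast
  ultimately show "fourier_coeff g n = 0" using LIMSEQ_unique tendsto_const by metis
qed

section \<open>Cauchy and Poisson integrals\<close>

text \<open>The Abel-regularized projection: the value at the interior point \<open>r * t\<close> of
  the power series formed with the coefficients of \<open>f\<close> of nonnegative index. For
  \<open>r < 1\<close> the kernel is bounded, so the integral exists for every integrable
  \<open>f\<close>.\<close>

definition cauchy_int :: "real \<Rightarrow> (complex \<Rightarrow> complex) \<Rightarrow> complex \<Rightarrow> complex" where
  "cauchy_int r f t = (\<integral>s. f s / (1 - of_real r * t * cnj s) \<partial>\<mu>)"

lemma cauchy_kernel_nz: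
  assumes "norm z < 1" "norm s = 1" shows "1 - z * cnj s \<noteq> 0"
proof
  assume "1 - z * cnj s = 0"
  then have "norm (z * cnj s) = 1" by (metis eq_iff_diff_eq_0 norm_one)
  then show False using assms by (simp add: norm_mult)
qed

lemma cauchy_series:
  assumes f: "integrable \<mu> f" and z: "norm z < 1"
  shows "(\<lambda>n. fourier_coeff f (int n) * z ^ n) sums (\<integral>s. f s / (1 - z * cnj s) \<partial>\<mu>)"
proof -
  have 1: "integrable \<mu> (\<lambda>s. f s * s powi (- int n) * z ^ n)" for n
    using fourier_integrable[OF f] by auto
  have nm: "norm (f s * s powi (- int n) * z ^ n) = norm (f s) * norm z ^ n" if "norm s = 1" for s n
    using that by (simp add: norm_mult norm_power_int norm_power)
  have 2: "AE s in \<mu>. summable (\<lambda>n. norm (f s * s powi (- int n) * z ^ n))"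
    by (intro AE_I2) (use z in \<open>simp add: nm\<close>)
  have eq: "(\<integral>s. norm (f s * s powi (- int n) * z ^ n) \<partial>\<mu>) = (\<integral>s. norm (f s) \<partial>\<mu>) * norm z ^ n" for n
  proof -
    have "(\<integral>s. norm (f s * s powi (- int n) * z ^ n) \<partial>\<mu>) = (\<integral>s. norm (f s) * norm z ^ n \<partial>\<mu>)"
      by (intro Bochner_Integration.integral_cong) (use nm in auto)
    then show ?thesis by simp
  qed
  have 3: "summable (\<lambda>n. \<integral>s. norm (f s * s powi (- int n) * z ^ n) \<partial>\<mu>)"
    unfolding eq using z by (intro summable_mult summable_geometric) auto
  have "(\<lambda>n. \<integral>s. f s * s powi (- int n) * z ^ n \<partial>\<mu>) sums (\<integral>s. (\<Sum>n. f s * s powi (- int n) * z ^ n) \<partial>\<mu>)"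
    using sums_integral[OF 1 2 3] .
  moreover have "(\<lambda>n. \<integral>s. f s * s powi (- int n) * z ^ n \<partial>\<mu>) = (\<lambda>n. fourier_coeff f (int n) * z ^ n)"
    by (simp add: fourier_coeff_def)
  moreover have "(\<integral>s. (\<Sum>n. f s * s powi (- int n) * z ^ n) \<partial>\<mu>) = (\<integral>s. f s / (1 - z * cnj s) \<partial>\<mu>)"
  proof (intro Bochner_Integration.integral_cong refl)
    fix s assume "s \<in> space \<mu>"
    then have s: "norm s = 1" by simp
    have "norm (z * cnj s) < 1" using z s by (simp add: norm_mult)
    then have "(\<lambda>n. f s * (z * cnj s) ^ n) sums (f s * (1 / (1 - z * cnj s)))"
      by (intro sums_mult geometric_sums)
    moreover have "f s * (z * cnj s) ^ n = f s * s powi (- int n) * z ^ n" for n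
      using s by (simp add: cnj_circle power_int_minus power_mult_distrib power_inverse)
    ultimately show "(\<Sum>n. f s * s powi (- int n) * z ^ n) = f s / (1 - z * cnj s)"
      by (simp add: sums_iff)
  qed
  ultimately show ?thesis by metis
qed

lemma cauchy_int_sums:
  assumes "integrable \<mu> f" "0 \<le> r" "r < 1" "norm t = 1"
  shows "(\<lambda>n. fourier_coeff f (int n) * (of_real r * t) ^ n) sums cauchy_int r f t"
  using cauchy_series[OF assms(1), of "of_real r * t"] assms
  by (simp add: cauchy_int_def norm_mult)

text \<open>If \<open>h\<close> is a projection of \<open>D\<close>, its Cauchy integral may be
  computed from \<open>D\<close> itself, whose size and support are known. All kernel estimates for
  projections below rest on this exchange.\<close>

lemma cauchy_int_cong_coeff:
  assumes "integrable \<mu> f" "integrable \<mu> g" "0 \<le> r" "r < 1" "norm t = 1"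
    and "\<And>n. n \<ge> 0 \<Longrightarrow> fourier_coeff f n = fourier_coeff g n"
  shows "cauchy_int r f t = cauchy_int r g t"
  using cauchy_int_sums[OF assms(1,3,4,5)] cauchy_int_sums[OF assms(2,3,4,5)] assms(6)
  by (simp add: sums_iff)

section \<open>The Poisson kernel and Abel summation\<close>

definition poisson_kernel :: "real \<Rightarrow> complex \<Rightarrow> complex \<Rightarrow> real" where
  "poisson_kernel r t s = (1 - r\<^sup>2) / (norm (1 - of_real r * t * cnj s))\<^sup>2"

definition poisson :: "real \<Rightarrow> (complex \<Rightarrow> complex) \<Rightarrow> complex \<Rightarrow> complex" where
  "poisson r f t = (\<integral>s. of_real (poisson_kernel r t s) * f s \<partial>\<mu>)"

lemma poisson_kernel_nonneg: "0 \<le> r \<Longrightarrow> r < 1 \<Longrightarrow> poisson_kernel r t s \<ge> 0"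
  by (auto simp: poisson_kernel_def intro!: divide_nonneg_nonneg power_le_one)

lemma poisson_kernel_sym: "poisson_kernel r t s = poisson_kernel r s t"
proof -
  have "norm (1 - of_real r * t * cnj s) = norm (cnj (1 - of_real r * t * cnj s))" by (rule complex_mod_cnj[symmetric])
  also have "cnj (1 - of_real r * t * cnj s) = 1 - of_real r * s * cnj t" by (simp add: algebra_simps)
  finally show ?thesis by (simp add: poisson_kernel_def)
qed

text \<open>Ties the Poisson integral of \<open>f\<close> to the Cauchy integrals of
  \<open>f\<close> and of its conjugate; the subtracted 1 corrects for the index 0, which both
  Cauchy kernels contain.\<close>

lemma poisson_kernel_eq:
  assumes "0 \<le> r" "r < 1" "norm t = 1" "norm s = 1"
  shows "of_real (poisson_kernel r t s) = 1 / (1 - of_real r * t * cnj s) + cnj (1 / (1 - of_real r * t * cnj s)) - 1"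
    and "poisson_kernel r t s = Re (2 / (1 - of_real r * t * cnj s) - 1)"
proof -
  define z where "z = of_real r * t * cnj s"
  have nz: "norm z = r" using assms by (simp add: z_def norm_mult)
  then have z1: "1 - z \<noteq> 0" using assms by (metis eq_iff_diff_eq_0 less_irrefl norm_one)
  then have z2: "1 - cnj z \<noteq> 0" by (metis complex_cnj_cnj complex_cnj_diff complex_cnj_one complex_cnj_zero_iff)
  have zz: "z * cnj z = of_real (r\<^sup>2)" using nz by (metis complex_norm_square of_real_power)
  have "1 / (1 - z) + cnj (1 / (1 - z)) - 1 = (1 - z * cnj z) / ((1 - z) * (1 - cnj z))"
  proof -
    have "1 / (1 - z) + cnj (1 / (1 - z)) - 1 = ((1 - cnj z) + (1 - z) - (1 - z) * (1 - cnj z)) / ((1 - z) * (1 - cnj z))"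
      using z1 z2 by (simp add: divide_simps)
    also have "(1 - cnj z) + (1 - z) - (1 - z) * (1 - cnj z) = 1 - z * cnj z" by (simp add: algebra_simps)
    finally show ?thesis .
  qed
  also have "(1 - z) * (1 - cnj z) = of_real ((norm (1 - z))\<^sup>2)"
    by (metis complex_cnj_diff complex_cnj_one complex_norm_square of_real_power)
  finally have e: "of_real (poisson_kernel r t s) = 1 / (1 - z) + cnj (1 / (1 - z)) - 1"
    unfolding poisson_kernel_def z_def[symmetric] zz by simp
  then show "of_real (poisson_kernel r t s) = 1 / (1 - of_real r * t * cnj s) + cnj (1 / (1 - of_real r * t * cnj s)) - 1"
    by (simp add: z_def)
  from arg_cong[OF e, of Re] show "poisson_kernel r t s = Re (2 / (1 - of_real r * t * cnj s) - 1)"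
    unfolding z_def[symmetric] by (simp add: Re_divide)
qed

lemma cauchy_kernel_bound:
  assumes "0 \<le> r" "r < 1" "norm t = 1" "norm s = 1"
  shows "norm (1 / (1 - of_real r * t * cnj s)) \<le> 1 / (1 - r)"
proof -
  have "1 - r \<le> norm (1 - of_real r * t * cnj s)"
    using norm_triangle_ineq2[of 1 "of_real r * t * cnj s"] assms by (simp add: norm_mult)
  then show ?thesis using assms by (auto simp: norm_divide intro!: divide_left_mono mult_pos_pos)
qed

lemma measurable_id_circle [measurable]: "(\<lambda>x. x) \<in> borel_measurable \<mu>"
  by (intro borel_measurable_circleI) simp

lemma borel_measurable_cnj [measurable (raw)]: "f \<in> borel_measurable M \<Longrightarrow> (\<lambda>x. cnj (f x)) \<in> borel_measurable M"
  by (rule measurable_compose[OF _ borel_measurable_continuous_onI[OF continuous_on_cnj[OF continuous_on_id]]])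

lemma fst_pair_circle [measurable]: "fst \<in> borel_measurable (\<mu> \<Otimes>\<^sub>M \<mu>)" "snd \<in> borel_measurable (\<mu> \<Otimes>\<^sub>M \<mu>)"
  using measurable_compose[OF measurable_fst measurable_id_circle, of \<mu>] measurable_compose[OF measurable_snd measurable_id_circle, of \<mu>]
  by simp_all

lemma poisson_kernel_measurable2 [measurable]:
  "(\<lambda>x. poisson_kernel r (fst x) (snd x)) \<in> borel_measurable (\<mu> \<Otimes>\<^sub>M \<mu>)"
  unfolding poisson_kernel_def by measurable

lemma poisson_kernel_measurable [measurable]: "poisson_kernel r t \<in> borel_measurable \<mu>"
  unfolding poisson_kernel_def[abs_def] by measurable

lemma poisson_kernel_bound:
  assumes "0 \<le> r" "r < 1" "norm t = 1" "norm s = 1"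
  shows "poisson_kernel r t s \<le> 2 / (1 - r)"
proof -
  have "poisson_kernel r t s = norm (1 / (1 - of_real r * t * cnj s) + cnj (1 / (1 - of_real r * t * cnj s)) - 1)"
    using poisson_kernel_eq(1)[OF assms] poisson_kernel_nonneg[OF assms(1,2), of t s]
    by (metis abs_of_nonneg norm_of_real)
  also have "\<dots> = \<bar>Re (2 / (1 - of_real r * t * cnj s) - 1)\<bar>"
    using poisson_kernel_eq[OF assms] by (metis norm_of_real)
  finally have "poisson_kernel r t s \<le> Re (2 * (1 / (1 - of_real r * t * cnj s)) - 1)"
    using poisson_kernel_eq(2)[OF assms] by simp
  also have "\<dots> = 2 * Re (1 / (1 - of_real r * t * cnj s)) - 1"
    by (subst minus_complex.sel, subst times_complex.sel) simp
  also have "\<dots> \<le> 2 * norm (1 / (1 - of_real r * t * cnj s))"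
    using complex_Re_le_cmod[of "1 / (1 - of_real r * t * cnj s)"] by simp
  also have "\<dots> \<le> 2 * (1 / (1 - r))" using cauchy_kernel_bound[OF assms] by (intro mult_left_mono) auto
  finally show ?thesis by simp
qed

lemma integrable_mult_bounded:
  fixes f g :: "complex \<Rightarrow> complex"
  assumes "integrable \<mu> f" "g \<in> borel_measurable \<mu>" "\<And>s. norm s = 1 \<Longrightarrow> norm (g s) \<le> C"
  shows "integrable \<mu> (\<lambda>s. g s * f s)"
proof (rule Bochner_Integration.integrable_bound)
  show "integrable \<mu> (\<lambda>s. of_real C * f s)" using assms by auto
  show "AE s in \<mu>. norm (g s * f s) \<le> norm (of_real C * f s)"
  proof (intro AE_I2)
    fix s assume "s \<in> space \<mu>"
    then have "norm (g s) \<le> \<bar>C\<bar>" using assms(3)[of s] by auto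
    then show "norm (g s * f s) \<le> norm (of_real C * f s)" by (simp add: norm_mult mult_right_mono)
  qed
qed (use assms in measurable)

lemma cauchy_integrable:
  assumes "integrable \<mu> f" "0 \<le> r" "r < 1" "norm t = 1"
  shows "integrable \<mu> (\<lambda>s. f s / (1 - of_real r * t * cnj s))"
proof -
  have "integrable \<mu> (\<lambda>s. 1 / (1 - of_real r * t * cnj s) * f s)"
    using cauchy_kernel_bound[OF assms(2-4)] by (intro integrable_mult_bounded[OF assms(1), where C="1/(1-r)"]) auto
  then show ?thesis by simp
qed

lemma poisson_eq:
  assumes f: "integrable \<mu> f" and r: "0 \<le> r" "r < 1" "norm t = 1"
  shows "poisson r f t = cauchy_int r f t + cnj (cauchy_int r (\<lambda>s. cnj (f s)) t) - fourier_coeff f 0"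
proof -
  have fc: "integrable \<mu> (\<lambda>s. cnj (f s))" using f by (simp add: integrable_cnj)
  have i2: "integrable \<mu> (\<lambda>s. cnj (cnj (f s) / (1 - of_real r * t * cnj s)))"
    using cauchy_integrable[OF fc r] by (simp add: integrable_cnj del: complex_cnj_divide)
  have "poisson r f t = (\<integral>s. f s / (1 - of_real r * t * cnj s) + cnj (cnj (f s) / (1 - of_real r * t * cnj s)) - f s \<partial>\<mu>)"
    unfolding poisson_def
    by (intro Bochner_Integration.integral_cong refl, subst poisson_kernel_eq[OF r]) (auto simp: algebra_simps)
  also have "\<dots> = (\<integral>s. f s / (1 - of_real r * t * cnj s) \<partial>\<mu>) + (\<integral>s. cnj (cnj (f s) / (1 - of_real r * t * cnj s)) \<partial>\<mu>) - (\<integral>s. f s \<partial>\<mu>)"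
    using f cauchy_integrable[OF f r] i2 by (subst Bochner_Integration.integral_diff; (subst Bochner_Integration.integral_add)?) auto
  also have "(\<integral>s. cnj (cnj (f s) / (1 - of_real r * t * cnj s)) \<partial>\<mu>) = cnj (cauchy_int r (\<lambda>s. cnj (f s)) t)"
    unfolding cauchy_int_def by (rule Bochner_Integration.integral_cnj)
  finally show ?thesis by (simp add: cauchy_int_def fourier_coeff_def)
qed

lemma cauchy_int_const_coeff:
  assumes f: "integrable \<mu> f" and r: "0 \<le> r" "r < 1" "norm t = 1"
    and z: "\<And>n. n > 0 \<Longrightarrow> fourier_coeff f n = 0"
  shows "cauchy_int r f t = fourier_coeff f 0"
proof -
  have "(\<lambda>n. fourier_coeff f (int n) * (of_real r * t) ^ n) = (\<lambda>n. if n = 0 then fourier_coeff f 0 else 0)"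
    using z by auto
  then have "(\<lambda>n. if n = 0 then fourier_coeff f 0 else 0) sums cauchy_int r f t"
    using cauchy_int_sums[OF f r] by simp
  moreover have "(\<lambda>n. if n = (0::nat) then fourier_coeff f 0 else 0) sums fourier_coeff f 0"
    by (rule sums_single)
  ultimately show ?thesis using sums_unique2 by blast
qed

text \<open>Without coefficients of negative index the conjugate term reduces to the mean, which
  cancels against the subtracted one.\<close>

lemma poisson_eq_cauchy_int:
  assumes f: "integrable \<mu> f" and r: "0 \<le> r" "r < 1" "norm t = 1"
    and z: "\<And>n. n < 0 \<Longrightarrow> fourier_coeff f n = 0"
  shows "poisson r f t = cauchy_int r f t"
proof -
  have "cauchy_int r (\<lambda>s. cnj (f s)) t = cnj (fourier_coeff f 0)"
    using z f r by (subst cauchy_int_const_coeff) (auto simp: fourier_coeff_cnj integrable_cnj)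
  then show ?thesis by (simp add: poisson_eq[OF f r])
qed

lemma poisson_one:
  assumes r: "0 \<le> r" "r < 1" "norm t = 1"
  shows "(\<integral>s. poisson_kernel r t s \<partial>\<mu>) = 1"
proof -
  have "poisson r (\<lambda>s. 1) t = 1"
    using r by (subst poisson_eq) (auto simp: cauchy_int_const_coeff fourier_coeff_const)
  then have "of_real (\<integral>s. poisson_kernel r t s \<partial>\<mu>) = (1::complex)"
    by (simp add: poisson_def)
  then show ?thesis using of_real_eq_1_iff by blast
qed

lemma poisson_kernel_integrable:
  assumes r: "0 \<le> r" "r < 1" "norm t = 1"
  shows "integrable \<mu> (poisson_kernel r t)"
  by (rule circle.integrable_const_bound[where B="2/(1-r)"])
     (use poisson_kernel_bound[OF r] poisson_kernel_nonneg[OF r(1,2)] in \<open>auto intro!: AE_I2\<close>)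

lemma nn_integral_poisson_kernel:
  assumes r: "0 \<le> r" "r < 1" "norm t = 1"
  shows "(\<integral>\<^sup>+s. ennreal (poisson_kernel r t s) \<partial>\<mu>) = 1"
    "(\<integral>\<^sup>+s. ennreal (poisson_kernel r s t) \<partial>\<mu>) = 1"
  using nn_integral_eq_integral[OF poisson_kernel_integrable[OF r]] poisson_one[OF r] poisson_kernel_nonneg[OF r(1,2)]
  by (auto simp: poisson_kernel_sym[of r _ t])

interpretation circle2: pair_prob_space \<mu> \<mu> ..

lemma measurable_fst_circle [measurable (raw)]:
  "f \<in> borel_measurable \<mu> \<Longrightarrow> (\<lambda>x. f (fst x)) \<in> borel_measurable (\<mu> \<Otimes>\<^sub>M \<mu>)"
  "f \<in> borel_measurable \<mu> \<Longrightarrow> (\<lambda>x. f (snd x)) \<in> borel_measurable (\<mu> \<Otimes>\<^sub>M \<mu>)"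
  by (rule measurable_compose[OF measurable_fst] measurable_compose[OF measurable_snd]; assumption)+

lemma measurable_fst_snd_circle:
  "(\<lambda>x. k (fst x) (snd x)) \<in> borel_measurable (\<mu> \<Otimes>\<^sub>M \<mu>) \<Longrightarrow> norm t = 1 \<Longrightarrow> k t \<in> borel_measurable \<mu>"
  using measurable_compose[OF measurable_Pair1'[of t \<mu> \<mu>], of "\<lambda>x. k (fst x) (snd x)" borel] by simp

lemma poisson_measurable [measurable]:
  assumes [measurable]: "f \<in> borel_measurable \<mu>"
  shows "poisson r f \<in> borel_measurable \<mu>"
proof -
  have "(\<lambda>x. complex_of_real (poisson_kernel r (fst x) (snd x)) * f (snd x)) \<in> borel_measurable (\<mu> \<Otimes>\<^sub>M \<mu>)"
    by measurable
  then show ?thesis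
    unfolding poisson_def[abs_def]
    by (intro circle.borel_measurable_lebesgue_integral) (simp add: case_prod_unfold)
qed

lemma cauchy_int_measurable [measurable]:
  assumes [measurable]: "f \<in> borel_measurable \<mu>"
  shows "cauchy_int r f \<in> borel_measurable \<mu>"
proof -
  have "(\<lambda>x. f (snd x) / (1 - complex_of_real r * fst x * cnj (snd x))) \<in> borel_measurable (\<mu> \<Otimes>\<^sub>M \<mu>)"
    by measurable
  then show ?thesis
    unfolding cauchy_int_def[abs_def]
    by (intro circle.borel_measurable_lebesgue_integral) (simp add: case_prod_unfold)
qed

lemma norm_poisson_le:
  assumes [measurable]: "f \<in> borel_measurable \<mu>" and r: "0 \<le> r" "r < 1"
  shows "ennreal (norm (poisson r f t)) \<le> (\<integral>\<^sup>+s. ennreal (poisson_kernel r t s * norm (f s)) \<partial>\<mu>)"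
proof (cases "integrable \<mu> (\<lambda>s. of_real (poisson_kernel r t s) * f s)")
  case True
  have "ennreal (norm (poisson r f t)) \<le> (\<integral>\<^sup>+s. ennreal (norm (of_real (poisson_kernel r t s) * f s)) \<partial>\<mu>)"
    unfolding poisson_def using True by (rule integral_norm_bound_ennreal)
  then show ?thesis using poisson_kernel_nonneg[OF r] by (simp add: norm_mult)
qed (simp add: poisson_def not_integrable_integral_eq)

text \<open>Fubini's theorem and the symmetry of the kernel, whose integral over either variable is
  1.\<close>

lemma poisson_L1:
  assumes f: "integrable \<mu> f" and r: "0 \<le> r" "r < 1"
  shows "integrable \<mu> (poisson r f)" "(\<integral>t. norm (poisson r f t) \<partial>\<mu>) \<le> (\<integral>t. norm (f t) \<partial>\<mu>)"
proof -
  have [measurable]: "f \<in> borel_measurable \<mu>" using f by auto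
  have "(\<integral>\<^sup>+t. ennreal (norm (poisson r f t)) \<partial>\<mu>) \<le> (\<integral>\<^sup>+t. \<integral>\<^sup>+s. ennreal (poisson_kernel r t s * norm (f s)) \<partial>\<mu> \<partial>\<mu>)"
    by (intro nn_integral_mono norm_poisson_le r) auto
  also have "\<dots> = (\<integral>\<^sup>+s. \<integral>\<^sup>+t. ennreal (poisson_kernel r t s * norm (f s)) \<partial>\<mu> \<partial>\<mu>)"
    by (rule circle2.Fubini'[symmetric]) (simp add: case_prod_unfold)
  also have "\<dots> = (\<integral>\<^sup>+s. (\<integral>\<^sup>+t. ennreal (poisson_kernel r t s) \<partial>\<mu>) * ennreal (norm (f s)) \<partial>\<mu>)"
  proof (rule nn_integral_cong)
    fix s
    have [measurable]: "(\<lambda>t. poisson_kernel r t s) \<in> borel_measurable \<mu>"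
      unfolding poisson_kernel_sym[of r _ s] by measurable
    show "(\<integral>\<^sup>+t. ennreal (poisson_kernel r t s * norm (f s)) \<partial>\<mu>) = (\<integral>\<^sup>+t. ennreal (poisson_kernel r t s) \<partial>\<mu>) * ennreal (norm (f s))"
      using poisson_kernel_nonneg[OF r] by (subst nn_integral_multc[symmetric]) (auto simp: ennreal_mult)
  qed
  also have "\<dots> = (\<integral>\<^sup>+s. ennreal (norm (f s)) \<partial>\<mu>)"
    by (intro nn_integral_cong) (simp add: nn_integral_poisson_kernel[OF r])
  also have "\<dots> = ennreal (\<integral>t. norm (f t) \<partial>\<mu>)" using f by (intro nn_integral_eq_integral) auto
  finally have le: "(\<integral>\<^sup>+t. ennreal (norm (poisson r f t)) \<partial>\<mu>) \<le> ennreal (\<integral>t. norm (f t) \<partial>\<mu>)" .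
  show i: "integrable \<mu> (poisson r f)"
    using le by (intro integrableI_bounded) (auto simp: le_less_trans)
  show "(\<integral>t. norm (poisson r f t) \<partial>\<mu>) \<le> (\<integral>t. norm (f t) \<partial>\<mu>)"
    using le i by (subst (asm) nn_integral_eq_integral) (auto simp: integral_nonneg_AE)
qed

lemma poisson_powi:
  assumes r: "0 \<le> r" "r < 1" "norm t = 1"
  shows "poisson r (\<lambda>t. c * t powi n) t = c * of_real r ^ (nat \<bar>n\<bar>) * t powi n"
proof -
  have a: "poisson r (\<lambda>t. c * t powi n) t = c * of_real r ^ nat n * t powi n" if "n \<ge> 0" for c n
  proof -
    have i: "integrable \<mu> (\<lambda>t. c * t powi n)" using fourier_integrable[of "\<lambda>t. c"] by simp
    have c: "fourier_coeff (\<lambda>t. c * t powi n) m = (if m = n then c else 0)" for m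
      unfolding fourier_coeff_scale fourier_coeff_powi by auto
    have "poisson r (\<lambda>t. c * t powi n) t = cauchy_int r (\<lambda>t. c * t powi n) t"
      using that c by (intro poisson_eq_cauchy_int i r) auto
    moreover have "(\<lambda>m. fourier_coeff (\<lambda>t. c * t powi n) (int m) * (of_real r * t) ^ m) = (\<lambda>m. if m = nat n then c * (of_real r * t) ^ m else 0)"
      using that unfolding c by (auto simp: fun_eq_iff)
    then have "cauchy_int r (\<lambda>t. c * t powi n) t = c * (of_real r * t) ^ nat n"
      using cauchy_int_sums[OF i r] sums_single[of "nat n" "\<lambda>m. c * (of_real r * t) ^ m"] sums_unique2 by metis
    ultimately show ?thesis using that by (simp add: power_mult_distrib power_int_def)
  qed
  show ?thesis
  proof (cases "n \<ge> 0")
    case False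
    have "cnj (poisson r (\<lambda>t. cnj c * t powi (-n)) t) = poisson r (\<lambda>t. c * t powi n) t"
      unfolding poisson_def Bochner_Integration.integral_cnj[symmetric]
      by (intro Bochner_Integration.integral_cong) (auto simp: cnj_powi_circle)
    then show ?thesis using False a[of "-n" "cnj c"] r(3) by (auto simp: cnj_powi_circle)
  qed (use a in auto)
qed

lemma poisson_add:
  assumes f: "integrable \<mu> f" and g: "integrable \<mu> g" and r: "0 \<le> r" "r < 1" "norm t = 1"
  shows "poisson r (\<lambda>t. f t + g t) t = poisson r f t + poisson r g t"
proof -
  have *: "integrable \<mu> (\<lambda>s. of_real (poisson_kernel r t s) * f s)" if "integrable \<mu> f" for f :: "complex \<Rightarrow> complex"
    using poisson_kernel_bound[OF r] poisson_kernel_nonneg[OF r(1,2)]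
    by (intro integrable_mult_bounded[OF that, where C="2/(1-r)"]) auto
  show ?thesis unfolding poisson_def distrib_left by (intro Bochner_Integration.integral_add * f g)
qed

lemma poisson_cong: "(\<And>t. norm t = 1 \<Longrightarrow> f t = g t) \<Longrightarrow> poisson r f t = poisson r g t"
  unfolding poisson_def by (intro Bochner_Integration.integral_cong) auto

lemma poisson_tendsto_trig:
  assumes r: "\<And>n. 0 \<le> r n" "\<And>n. r n < 1" "r \<longlonglongrightarrow> (1::real)" and f: "f \<in> trig"
  shows "(\<lambda>n. \<integral>t. norm (poisson (r n) f t - f t) \<partial>\<mu>) \<longlonglongrightarrow> 0"
  using f
proof (induction f rule: trig.induct)
  case (monom f c k)
  have "(\<integral>t. norm (poisson (r n) f t - f t) \<partial>\<mu>) = norm c * \<bar>r n ^ (nat \<bar>k\<bar>) - 1\<bar>" for n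
  proof -
    have "(\<integral>t. norm (poisson (r n) f t - f t) \<partial>\<mu>) = (\<integral>t. norm c * \<bar>r n ^ (nat \<bar>k\<bar>) - 1\<bar> \<partial>\<mu>)"
    proof (intro Bochner_Integration.integral_cong refl)
      fix t assume "t \<in> space \<mu>"
      then have t: "norm t = 1" by simp
      have "poisson (r n) f t = poisson (r n) (\<lambda>t. c * t powi k) t" by (rule poisson_cong) (rule monom)
      then have "poisson (r n) f t - f t = c * of_real (r n ^ (nat \<bar>k\<bar>) - 1) * t powi k"
        using poisson_powi[OF r(1,2) t, of n c k] monom[OF t] by (simp add: algebra_simps)
      then show "norm (poisson (r n) f t - f t) = norm c * \<bar>r n ^ (nat \<bar>k\<bar>) - 1\<bar>"
        using t by (simp only: norm_mult norm_power_int norm_of_real) simp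
    qed
    then show ?thesis using circle.prob_space by simp
  qed
  moreover have "(\<lambda>n. norm c * \<bar>r n ^ (nat \<bar>k\<bar>) - 1\<bar>) \<longlonglongrightarrow> norm c * \<bar>1 ^ (nat \<bar>k\<bar>) - 1\<bar>"
    by (intro tendsto_intros r(3))
  ultimately show ?case by simp
next
  case (add f g h)
  have i: "integrable \<mu> f" "integrable \<mu> g" "integrable \<mu> h"
    using Lp_imp_integrable[OF trig_Lp, of _ 1] add.hyps trig.add[OF add.hyps] by auto
  have i2: "integrable \<mu> (\<lambda>t. norm (poisson (r n) f t - f t))" if "integrable \<mu> f" for f n
    using poisson_L1(1)[OF that r(1,2)] that by auto
  show ?case
  proof (rule tendsto_sandwich[OF _ _ tendsto_const])
    show "(\<lambda>n. (\<integral>t. norm (poisson (r n) f t - f t) \<partial>\<mu>) + (\<integral>t. norm (poisson (r n) g t - g t) \<partial>\<mu>)) \<longlonglongrightarrow> 0"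
      using tendsto_add[OF add.IH] by simp
    show "\<forall>\<^sub>F n in sequentially. (\<integral>t. norm (poisson (r n) h t - h t) \<partial>\<mu>) \<le> (\<integral>t. norm (poisson (r n) f t - f t) \<partial>\<mu>) + (\<integral>t. norm (poisson (r n) g t - g t) \<partial>\<mu>)"
    proof (intro always_eventually allI)
      fix n
      have "(\<integral>t. norm (poisson (r n) h t - h t) \<partial>\<mu>) \<le> (\<integral>t. norm (poisson (r n) f t - f t) + norm (poisson (r n) g t - g t) \<partial>\<mu>)"
      proof (intro integral_mono i2 i Bochner_Integration.integrable_add)
        fix t assume "t \<in> space \<mu>"
        then have t: "norm t = 1" by simp
        have "poisson (r n) h t = poisson (r n) (\<lambda>t. f t + g t) t" by (rule poisson_cong) (rule add.hyps(3))
        then have "poisson (r n) h t - h t = (poisson (r n) f t - f t) + (poisson (r n) g t - g t)"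
          using poisson_add[OF i(1,2) r(1,2) t] add.hyps(3)[OF t] by simp
        then show "norm (poisson (r n) h t - h t) \<le> norm (poisson (r n) f t - f t) + norm (poisson (r n) g t - g t)"
          by (simp add: norm_triangle_ineq)
      qed
      then show "(\<integral>t. norm (poisson (r n) h t - h t) \<partial>\<mu>) \<le> (\<integral>t. norm (poisson (r n) f t - f t) \<partial>\<mu>) + (\<integral>t. norm (poisson (r n) g t - g t) \<partial>\<mu>)"
        using i2[OF i(1)] i2[OF i(2)] by simp
    qed
  qed (auto intro!: always_eventually)
qed

text \<open>A three-epsilon argument: convergence is known for trigonometric polynomials, these are
  dense in L^1, and the Poisson integral is a contraction there.\<close>

lemma poisson_tendsto:
  assumes r: "\<And>n. 0 \<le> r n" "\<And>n. r n < 1" "r \<longlonglongrightarrow> (1::real)" and f: "integrable \<mu> f"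
  shows "(\<lambda>n. \<integral>t. norm (poisson (r n) f t - f t) \<partial>\<mu>) \<longlonglongrightarrow> 0"
proof (rule LIMSEQ_I)
  fix e :: real assume e: "e > 0"
  then have e3: "e / 3 > 0" by simp
  have "f \<in> trig_closure 1" using f by (intro Lp_trig_dense) (auto simp: Lp_one_iff)
  then obtain g where g: "g \<in> trig" "Lp_norm 1 (\<lambda>t. f t - g t) < e / 3"
    unfolding trig_closure_def using e3 by blast
  have gi: "integrable \<mu> g" using trig_Lp[OF g(1), of 1] by (simp add: Lp_one_iff)
  have d: "integrable \<mu> (\<lambda>t. f t - g t)" using f gi by auto
  obtain N where N: "\<And>n. n \<ge> N \<Longrightarrow> (\<integral>t. norm (poisson (r n) g t - g t) \<partial>\<mu>) < e / 3"
    using order_tendstoD(2)[OF poisson_tendsto_trig[OF r g(1)] e3] by (auto simp: eventually_sequentially)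
  have "norm ((\<integral>t. norm (poisson (r n) f t - f t) \<partial>\<mu>) - 0) < e" if "n \<ge> N" for n
  proof -
    have i: "integrable \<mu> (\<lambda>t. norm (poisson (r n) (\<lambda>t. f t - g t) t))" "integrable \<mu> (\<lambda>t. norm (poisson (r n) g t - g t))" "integrable \<mu> (\<lambda>t. norm (f t - g t))"
      using poisson_L1(1)[OF d r(1,2)] poisson_L1(1)[OF gi r(1,2)] gi d by auto
    have "(\<integral>t. norm (poisson (r n) f t - f t) \<partial>\<mu>) \<le> (\<integral>t. norm (poisson (r n) (\<lambda>t. f t - g t) t) + norm (poisson (r n) g t - g t) + norm (f t - g t) \<partial>\<mu>)"
    proof (intro integral_mono)
      fix t assume "t \<in> space \<mu>"
      then have t: "norm t = 1" by simp
      have "poisson (r n) f t = poisson (r n) (\<lambda>t. f t - g t) t + poisson (r n) g t"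
        using poisson_add[OF d gi r(1,2) t, of n] by simp
      then have "poisson (r n) f t - f t = poisson (r n) (\<lambda>t. f t - g t) t + (poisson (r n) g t - g t) - (f t - g t)" by simp
      then show "norm (poisson (r n) f t - f t) \<le> norm (poisson (r n) (\<lambda>t. f t - g t) t) + norm (poisson (r n) g t - g t) + norm (f t - g t)"
        by (metis (no_types, lifting) add_right_mono norm_triangle_ineq norm_triangle_ineq4 order_trans)
    qed (use poisson_L1(1)[OF f r(1,2)] f i in auto)
    also have "\<dots> = (\<integral>t. norm (poisson (r n) (\<lambda>t. f t - g t) t) \<partial>\<mu>) + (\<integral>t. norm (poisson (r n) g t - g t) \<partial>\<mu>) + (\<integral>t. norm (f t - g t) \<partial>\<mu>)"
      using i by simp
    also have "\<dots> < e / 3 + e / 3 + e / 3"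
      using poisson_L1(2)[OF d r(1,2), of n] g(2) N[OF that] unfolding Lp_norm_one by simp
    finally show ?thesis by (simp add: integral_nonneg_AE)
  qed
  then show "\<exists>N. \<forall>n\<ge>N. norm ((\<integral>t. norm (poisson (r n) f t - f t) \<partial>\<mu>) - 0) < e" by blast
qed

text \<open>Extracting the subsequence for the sum of the two moduli makes both sequences converge
  along the same indices.\<close>

lemma AE_subseq_two:
  fixes u v :: "nat \<Rightarrow> complex \<Rightarrow> complex"
  assumes "\<And>n. integrable \<mu> (u n)" "\<And>n. integrable \<mu> (v n)"
    "(\<lambda>n. \<integral>t. norm (u n t) \<partial>\<mu>) \<longlonglongrightarrow> 0" "(\<lambda>n. \<integral>t. norm (v n t) \<partial>\<mu>) \<longlonglongrightarrow> 0"
  obtains k :: "nat \<Rightarrow> nat" where "strict_mono k"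
    "AE t in \<mu>. (\<lambda>n. u (k n) t) \<longlonglongrightarrow> 0" "AE t in \<mu>. (\<lambda>n. v (k n) t) \<longlonglongrightarrow> 0"
proof -
  define w where "w n t = norm (u n t) + norm (v n t)" for n t
  have i: "integrable \<mu> (w n)" for n unfolding w_def[abs_def] using assms by auto
  have "(\<integral>t. norm (w n t) \<partial>\<mu>) = (\<integral>t. norm (u n t) \<partial>\<mu>) + (\<integral>t. norm (v n t) \<partial>\<mu>)" for n
    unfolding w_def using assms by simp
  then have "(\<lambda>n. \<integral>t. norm (w n t) \<partial>\<mu>) \<longlonglongrightarrow> 0"
    using tendsto_add[OF assms(3,4)] by simp
  then obtain k :: "nat \<Rightarrow> nat" where k: "strict_mono k" "AE t in \<mu>. (\<lambda>n. w (k n) t) \<longlonglongrightarrow> 0"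
    using tendsto_L1_AE_subseq[of \<mu> w] i by blast
  show thesis
  proof (rule that[OF k(1)])
    show "AE t in \<mu>. (\<lambda>n. u (k n) t) \<longlonglongrightarrow> 0"
      using k(2) by eventually_elim (rule Lim_null_comparison[rotated], assumption, auto simp: w_def)
    show "AE t in \<mu>. (\<lambda>n. v (k n) t) \<longlonglongrightarrow> 0"
      using k(2) by eventually_elim (rule Lim_null_comparison[rotated], assumption, auto simp: w_def)
  qed
qed

text \<open>When all coefficients of the difference vanish, so do its Poisson integrals, and these
  converge to it in L^1.\<close>

lemma fourier_unique:
  assumes f: "integrable \<mu> f" and g: "integrable \<mu> g" and eq: "\<And>n. fourier_coeff f n = fourier_coeff g n"
  shows "AE t in \<mu>. f t = g t"
proof -
  define d where "d t = f t - g t" for t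
  have d: "integrable \<mu> d" unfolding d_def[abs_def] using f g by auto
  have z: "fourier_coeff d n = 0" for n unfolding d_def[abs_def] using fourier_coeff_diff[OF f g] eq by simp
  define r where "r n = 1 - 1 / (real n + 2)" for n
  have r: "0 \<le> r n" "r n < 1" for n by (auto simp: r_def field_simps)
  have "(\<lambda>n. 1 - 1 / (real n + 2)) \<longlonglongrightarrow> 1 - 0"
    by (intro tendsto_intros tendsto_divide_0[OF tendsto_const] filterlim_at_top_imp_at_infinity) real_asymp
  then have r1: "r \<longlonglongrightarrow> 1" unfolding r_def[abs_def] by simp
  have "poisson (r n) d t = 0" if "norm t = 1" for n t
    using that z d r[of n]
    by (subst poisson_eq_cauchy_int) (auto simp: cauchy_int_const_coeff)
  then have "(\<integral>t. norm (poisson (r n) d t - d t) \<partial>\<mu>) = (\<integral>t. norm (d t) \<partial>\<mu>)" for n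
    by (intro Bochner_Integration.integral_cong) auto
  then have "(\<integral>t. norm (d t) \<partial>\<mu>) = 0"
    using poisson_tendsto[OF r r1 d] by (simp add: LIMSEQ_const_iff)
  then have "AE t in \<mu>. norm (d t) = 0"
    using d by (subst (asm) integral_nonneg_eq_0_iff_AE) auto
  then show ?thesis by eventually_elim (simp add: d_def)
qed

text \<open>On H^1 the Cauchy integral coincides with the Poisson integral, so Abel summation
  recovers the boundary function.\<close>

lemma cauchy_int_tendsto:
  assumes f: "f \<in> Hardy 1" and r: "\<And>n. 0 \<le> r n" "\<And>n. r n < 1" "r \<longlonglongrightarrow> (1::real)"
  shows "(\<lambda>n. \<integral>t. norm (cauchy_int (r n) f t - f t) \<partial>\<mu>) \<longlonglongrightarrow> 0" "integrable \<mu> (cauchy_int (r n) f)"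
proof -
  have i: "integrable \<mu> f" using f HardyD(1) Lp_one_iff by blast
  have eq: "cauchy_int (r n) f t = poisson (r n) f t" if "norm t = 1" for n t
    using poisson_eq_cauchy_int[OF i r(1,2) that] HardyD(2)[OF f] by simp
  have "(\<integral>t. norm (cauchy_int (r n) f t - f t) \<partial>\<mu>) = (\<integral>t. norm (poisson (r n) f t - f t) \<partial>\<mu>)" for n
    by (intro Bochner_Integration.integral_cong) (auto simp: eq)
  then show "(\<lambda>n. \<integral>t. norm (cauchy_int (r n) f t - f t) \<partial>\<mu>) \<longlonglongrightarrow> 0"
    using poisson_tendsto[OF r i] by simp
  show "integrable \<mu> (cauchy_int (r n) f)"
    using poisson_L1(1)[OF i r(1,2)] eq by (subst Bochner_Integration.integrable_cong[OF refl]) auto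
qed

section \<open>Multiplication by functions analytic in the disc\<close>

lemma holomorphic_mult_coeff:
  assumes G: "G holomorphic_on ball 0 1" and r: "0 \<le> r" "r < 1" and f: "integrable \<mu> f"
  shows "(\<lambda>n. (deriv ^^ n) G 0 / fact n * of_real r ^ n * fourier_coeff f (k - int n)) sums
           fourier_coeff (\<lambda>t. G (of_real r * t) * f t) k"
proof -
  define a where "a n = (deriv ^^ n) G 0 / fact n" for n
  have ps: "(\<lambda>n. a n * w ^ n) sums G w" if "norm w < 1" for w
    using holomorphic_power_series[OF G, of w] that by (simp add: a_def)
  \<comment> \<open>Convergence of the Taylor series at the larger radius forces absolute
    convergence at \<open>r\<close>, which justifies integrating term by term.\<close>
  define r' where "r' = (r + 1) / 2"
  have "summable (\<lambda>n. a n * complex_of_real r' ^ n)"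
    using ps[of "of_real r'"] r by (auto simp: r'_def sums_iff)
  then have "summable (\<lambda>n. norm (a n * complex_of_real r ^ n))"
    by (rule powser_insidea) (use r in \<open>auto simp: r'_def\<close>)
  then have sm: "summable (\<lambda>n. norm (a n) * r ^ n)" using r by (simp add: norm_mult norm_power)
  have 1: "integrable \<mu> (\<lambda>t. (a n * of_real r ^ n) * (f t * t powi (int n - k)))" for n
    using fourier_integrable[OF f] by auto
  have nm: "norm ((a n * of_real r ^ n) * (f t * t powi (int n - k))) = norm (a n) * r ^ n * norm (f t)" if "norm t = 1" for t n
    using that r by (simp add: norm_mult norm_power_int norm_power)
  have 2: "AE t in \<mu>. summable (\<lambda>n. norm ((a n * of_real r ^ n) * (f t * t powi (int n - k))))"
    by (intro AE_I2) (use sm in \<open>simp add: nm summable_mult2\<close>)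
  have eq: "(\<integral>t. norm ((a n * of_real r ^ n) * (f t * t powi (int n - k))) \<partial>\<mu>) = norm (a n) * r ^ n * (\<integral>t. norm (f t) \<partial>\<mu>)" for n
  proof -
    have "(\<integral>t. norm ((a n * of_real r ^ n) * (f t * t powi (int n - k))) \<partial>\<mu>) = (\<integral>t. norm (a n) * r ^ n * norm (f t) \<partial>\<mu>)"
      by (intro Bochner_Integration.integral_cong) (use nm in auto)
    then show ?thesis by simp
  qed
  have 3: "summable (\<lambda>n. \<integral>t. norm ((a n * of_real r ^ n) * (f t * t powi (int n - k))) \<partial>\<mu>)"
    unfolding eq using sm by (rule summable_mult2)
  have "(\<lambda>n. \<integral>t. (a n * of_real r ^ n) * (f t * t powi (int n - k)) \<partial>\<mu>) sums (\<integral>t. (\<Sum>n. (a n * of_real r ^ n) * (f t * t powi (int n - k))) \<partial>\<mu>)"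
    using sums_integral[OF 1 2 3] .
  moreover have "(\<lambda>n. \<integral>t. (a n * of_real r ^ n) * (f t * t powi (int n - k)) \<partial>\<mu>) = (\<lambda>n. a n * of_real r ^ n * fourier_coeff f (k - int n))"
    unfolding fourier_coeff_def by simp
  moreover have "(\<integral>t. (\<Sum>n. (a n * of_real r ^ n) * (f t * t powi (int n - k))) \<partial>\<mu>) = fourier_coeff (\<lambda>t. G (of_real r * t) * f t) k"
    unfolding fourier_coeff_def
  proof (intro Bochner_Integration.integral_cong refl)
    fix t assume "t \<in> space \<mu>"
    then have t: "norm t = 1" by simp
    have "(\<lambda>n. a n * (of_real r * t) ^ n * (f t * t powi (-k))) sums (G (of_real r * t) * (f t * t powi (-k)))"
      using r t by (intro sums_mult2 ps) (simp add: norm_mult)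
    moreover have "(\<lambda>n. a n * (of_real r * t) ^ n * (f t * t powi (-k))) = (\<lambda>n. (a n * of_real r ^ n) * (f t * t powi (int n - k)))"
    proof
      fix n
      have "t powi (int n - k) = t ^ n * t powi (-k)" using t power_int_add[of t "int n" "-k"] by force
      then show "a n * (of_real r * t) ^ n * (f t * t powi (-k)) = (a n * of_real r ^ n) * (f t * t powi (int n - k))"
        by (simp add: power_mult_distrib)
    qed
    ultimately have "(\<lambda>n. (a n * of_real r ^ n) * (f t * t powi (int n - k))) sums (G (of_real r * t) * (f t * t powi (-k)))"
      by metis
    from sums_unique[OF this] show "(\<Sum>n. (a n * of_real r ^ n) * (f t * t powi (int n - k))) = G (of_real r * t) * f t * t powi - k"
      by (simp add: mult.assoc)
  qed
  ultimately show ?thesis unfolding a_def by metis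
qed

text \<open>In the convolution of Taylor and Fourier coefficients no term survives for negative
  \<open>k\<close>, and only the constant one for \<open>k = 0\<close>.\<close>

lemma holomorphic_mult_Hardy:
  assumes G: "G holomorphic_on ball 0 1" and r: "0 \<le> r" "r < 1" and f: "f \<in> Hardy 1"
  shows "k < 0 \<Longrightarrow> fourier_coeff (\<lambda>t. G (of_real r * t) * f t) k = 0"
    and "fourier_coeff (\<lambda>t. G (of_real r * t) * f t) 0 = G 0 * fourier_coeff f 0"
proof -
  have i: "integrable \<mu> f" using f HardyD(1) Lp_one_iff by blast
  note s = holomorphic_mult_coeff[OF G r i]
  show "fourier_coeff (\<lambda>t. G (of_real r * t) * f t) k = 0" if "k < 0"
  proof -
    have "(\<lambda>n. (deriv ^^ n) G 0 / fact n * of_real r ^ n * fourier_coeff f (k - int n)) = (\<lambda>n. 0)"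
      using HardyD(2)[OF f] that by auto
    then show ?thesis using s[of k] sums_zero sums_unique2 by metis
  qed
  have "(\<lambda>n. (deriv ^^ n) G 0 / fact n * of_real r ^ n * fourier_coeff f (0 - int n)) = (\<lambda>n. if n = 0 then G 0 * fourier_coeff f 0 else 0)"
    using HardyD(2)[OF f] by auto
  then show "fourier_coeff (\<lambda>t. G (of_real r * t) * f t) 0 = G 0 * fourier_coeff f 0"
    using s[of 0] sums_single[of 0 "\<lambda>n. G 0 * fourier_coeff f 0"] sums_unique2 by metis
qed

text \<open>Extension by continuity in which a Lipschitz estimate takes the place of linearity. The
  maps \<open>T\<close> used later involve choice operators, so \<open>T\<close> of a difference and
  the difference of the values need not be the same function.\<close>

lemma trig_extension:
  assumes p: "p \<ge> 1" and K: "K \<ge> 0" and f: "f \<in> Lp p"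
    and T: "\<And>g. g \<in> trig \<Longrightarrow> T g \<in> Lp p" "\<And>g. g \<in> trig \<Longrightarrow> Lp_norm p (T g) \<le> K * Lp_norm p g"
      "\<And>g h. g \<in> trig \<Longrightarrow> h \<in> trig \<Longrightarrow> Lp_norm p (\<lambda>t. T g t - T h t) \<le> K * Lp_norm p (\<lambda>t. g t - h t)"
  obtains g U where "\<And>n. g n \<in> trig" "(\<lambda>n. Lp_norm p (\<lambda>t. g n t - f t)) \<longlonglongrightarrow> 0" "U \<in> Lp p"
    "(\<lambda>n. Lp_norm p (\<lambda>t. T (g n) t - U t)) \<longlonglongrightarrow> 0" "Lp_norm p U \<le> K * Lp_norm p f"
proof -
  have p0: "p > 0" using p by simp
  obtain g where g: "\<And>n. g n \<in> trig" "\<And>n. Lp_norm p (\<lambda>t. f t - g n t) < (1/2)^n"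
    using Lp_trig_sequence[OF p f] by blast
  have gL: "g n \<in> Lp p" for n using trig_Lp[OF g(1)] p by simp
  have dg: "Lp_norm p (\<lambda>t. g n t - f t) = Lp_norm p (\<lambda>t. f t - g n t)" for n
    using Lp_uminus(2)[OF p0 Lp_diff(1)[OF p f gL[of n]]] by simp
  have glim: "(\<lambda>n. Lp_norm p (\<lambda>t. g n t - f t)) \<longlonglongrightarrow> 0"
  proof (rule tendsto_sandwich[OF _ _ tendsto_const])
    show "(\<lambda>n. (1/2::real)^n) \<longlonglongrightarrow> 0" by (intro LIMSEQ_power_zero) simp
  qed (use g(2) in \<open>auto simp: dg intro!: always_eventually less_imp_le\<close>)
  \<comment> \<open>The increments decay geometrically because the approximations \<open>g n\<close>
    do; \<open>U\<close> below is the sum of the telescoping series.\<close>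
  define D where "D n t = T (g (Suc n)) t - T (g n) t" for n t
  have DL: "D n \<in> Lp p" for n unfolding D_def[abs_def] by (intro Lp_diff T g p)
  have Db: "Lp_norm p (D n) \<le> 2 * K * (1/2)^n" for n
  proof -
    have "Lp_norm p (D n) \<le> K * Lp_norm p (\<lambda>t. g (Suc n) t - g n t)"
      unfolding D_def[abs_def] by (intro T g)
    also have "(\<lambda>t. g (Suc n) t - g n t) = (\<lambda>t. (f t - g n t) - (f t - g (Suc n) t))" by auto
    also have "Lp_norm p \<dots> \<le> Lp_norm p (\<lambda>t. f t - g n t) + Lp_norm p (\<lambda>t. f t - g (Suc n) t)"
      by (intro Lp_diff p f gL)
    also have "\<dots> \<le> (1/2)^n + (1/2)^Suc n" using g(2)[of n] g(2)[of "Suc n"] by simp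
    also have "\<dots> \<le> 2 * (1/2)^n" by simp
    finally show ?thesis using K by (simp add: mult_left_mono mult.assoc mult.left_commute)
  qed
  obtain F where F: "F \<in> Lp p" "\<And>n. Lp_norm p (\<lambda>t. F t - (\<Sum>k<n. D k t)) \<le> 2 * (2 * K) * (1/2)^n"
    using Lp_complete[OF p DL Db] by blast
  define U where "U t = T (g 0) t + F t" for t
  have UL: "U \<in> Lp p" unfolding U_def[abs_def] by (intro Lp_add T g p F)
  have tel: "T (g n) t - T (g 0) t = (\<Sum>k<n. D k t)" for n t
    unfolding D_def by (rule sum_lessThan_telescope[symmetric])
  have b: "Lp_norm p (\<lambda>t. T (g n) t - U t) \<le> 2 * (2 * K) * (1/2)^n" for n
  proof -
    have "Lp_norm p (\<lambda>t. F t - (\<Sum>k<n. D k t)) = Lp_norm p (\<lambda>t. - (F t - (\<Sum>k<n. D k t)))"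
      by (rule Lp_uminus(2)[symmetric, OF p0]) (intro Lp_diff p F Lp_sum DL)
    also have "(\<lambda>t. - (F t - (\<Sum>k<n. D k t))) = (\<lambda>t. T (g n) t - U t)"
      unfolding U_def tel[symmetric] by (rule ext) algebra
    finally show ?thesis using F(2)[of n] by simp
  qed
  have Ulim: "(\<lambda>n. Lp_norm p (\<lambda>t. T (g n) t - U t)) \<longlonglongrightarrow> 0"
  proof (rule tendsto_sandwich[OF _ _ tendsto_const])
    have "(\<lambda>n. 2 * (2 * K) * (1/2::real)^n) \<longlonglongrightarrow> 2 * (2 * K) * 0" by (intro tendsto_intros LIMSEQ_power_zero) simp
    then show "(\<lambda>n. 2 * (2 * K) * (1/2::real)^n) \<longlonglongrightarrow> 0" by simp
  qed (use b in \<open>auto intro!: always_eventually\<close>)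
  have "Lp_norm p U \<le> K * Lp_norm p f + (K * Lp_norm p (\<lambda>t. g n t - f t) + Lp_norm p (\<lambda>t. T (g n) t - U t))" for n
  proof -
    have "Lp_norm p (\<lambda>t. T (g n) t - (T (g n) t - U t)) \<le> Lp_norm p (T (g n)) + Lp_norm p (\<lambda>t. T (g n) t - U t)"
      by (intro Lp_diff p T g UL)
    moreover have "Lp_norm p (T (g n)) \<le> K * Lp_norm p (g n)" by (intro T g)
    moreover have "Lp_norm p (\<lambda>t. f t + (g n t - f t)) \<le> Lp_norm p f + Lp_norm p (\<lambda>t. g n t - f t)"
      by (intro Lp_add Lp_diff p f gL)
    then have "K * Lp_norm p (g n) \<le> K * (Lp_norm p f + Lp_norm p (\<lambda>t. g n t - f t))"
      using K by (intro mult_left_mono) auto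
    ultimately show ?thesis by (simp add: algebra_simps)
  qed
  moreover have "(\<lambda>n. K * Lp_norm p f + (K * Lp_norm p (\<lambda>t. g n t - f t) + Lp_norm p (\<lambda>t. T (g n) t - U t))) \<longlonglongrightarrow> K * Lp_norm p f + (K * 0 + 0)"
    by (intro tendsto_intros glim Ulim)
  ultimately have "Lp_norm p U \<le> K * Lp_norm p f"
    by (intro LIMSEQ_le_const) auto
  then show thesis using that g(1) glim UL Ulim by blast
qed

section \<open>The Schur test\<close>

text \<open>Young's inequality with a free parameter at each point plays the role of Hoelder's
  inequality for the kernel. The hypothesis on \<open>v\<close> is a pointwise domination by a
  nonnegative integral, which suits limits of Cauchy integrals as well as Poisson integrals.\<close>

lemma Schur_test:
  fixes K :: "complex \<Rightarrow> complex \<Rightarrow> real" and f v :: "complex \<Rightarrow> complex" and h :: "complex \<Rightarrow> real"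
  assumes pq: "1 < p" "1 < q" "1 / p + 1 / q = 1"
    and K[measurable]: "(\<lambda>x. K (fst x) (snd x)) \<in> borel_measurable (\<mu> \<Otimes>\<^sub>M \<mu>)" and K0: "\<And>t s. K t s \<ge> 0"
    and h[measurable]: "h \<in> borel_measurable \<mu>" and h0: "AE t in \<mu>. h t > 0"
    and C1: "C1 \<ge> 0" "AE t in \<mu>. (\<integral>\<^sup>+s. ennreal (K t s * h s powr q) \<partial>\<mu>) \<le> ennreal (C1 * h t powr q)"
    and C2: "C2 \<ge> 0" "AE s in \<mu>. (\<integral>\<^sup>+t. ennreal (K t s * h t powr p) \<partial>\<mu>) \<le> ennreal (C2 * h s powr p)"
    and f: "f \<in> Lp p" and v[measurable]: "v \<in> borel_measurable \<mu>"
    and le: "AE t in \<mu>. ennreal (norm (v t)) \<le> (\<integral>\<^sup>+s. ennreal (K t s * norm (f s)) \<partial>\<mu>)"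
  shows "v \<in> Lp p" "Lp_norm p v \<le> (C1 + 1) * C2 powr (1 / p) * Lp_norm p f"
proof -
  have [measurable]: "f \<in> borel_measurable \<mu>" using f by auto
  have lin: "ennreal (a * c + b * d) = ennreal a * ennreal c + ennreal b * ennreal d"
    if "a \<ge> 0" "b \<ge> 0" "c \<ge> 0" "d \<ge> 0" for a b c d
    using that by (simp add: ennreal_mult)
  \<comment> \<open>One is added so that \<open>D\<close> is positive and bounds
    \<open>C1 / q + 1 / p\<close>, the constant that Young's inequality produces.\<close>
  define D where "D = C1 + 1"
  have D: "D > 0" using C1 by (simp add: D_def)
  define k where "k s = norm (f s) powr p * h s powr (- p)" for s
  have [measurable]: "k \<in> borel_measurable \<mu>" unfolding k_def[abs_def] by measurable
  have k0: "k s \<ge> 0" for s by (simp add: k_def)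
  have [measurable]: "K t \<in> borel_measurable \<mu>" if "norm t = 1" for t using measurable_fst_snd_circle[OF K that] .
  have "(\<lambda>x. K (snd x) (fst x)) \<in> borel_measurable (\<mu> \<Otimes>\<^sub>M \<mu>)"
    using measurable_compose[OF measurable_pair_swap' K] by (simp add: case_prod_unfold)
  from measurable_fst_snd_circle[OF this]
  have [measurable]: "(\<lambda>t. K t s) \<in> borel_measurable \<mu>" if "norm s = 1" for s using that by simp
  define B where "B t = (\<integral>\<^sup>+s. ennreal (K t s * k s) \<partial>\<mu>)" for t
  have [measurable]: "B \<in> borel_measurable \<mu>"
    unfolding B_def[abs_def] by (rule circle.borel_measurable_nn_integral) (simp add: case_prod_unfold)
  have pw: "AE t in \<mu>. ennreal (norm (v t) powr p) \<le> ennreal (D powr p * h t powr p) * B t"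
    using h0 C1(2) le AE_space
  proof eventually_elim
    case (elim t)
    have t: "norm t = 1" using elim by simp
    have ht: "h t > 0" using elim by simp
    have kt[measurable]: "K t \<in> borel_measurable \<mu>" using measurable_fst_snd_circle[OF K t] .
    show ?case
    proof (cases "B t = \<infinity>")
      case True
      then show ?thesis using D ht by (simp add: ennreal_mult_top)
    next
      case False
      then obtain b where b: "B t = ennreal b" "b \<ge> 0" by (cases "B t") auto
      have main: "norm (v t) powr p \<le> D powr p * (h t powr p * b + \<delta>)" if "\<delta> > 0" for \<delta>
      proof -
        \<comment> \<open>The summand \<delta> keeps \<open>X\<close> positive when \<open>b\<close>
          vanishes; it is removed at the end by letting it tend to zero.\<close>
        define X where "X = h t powr p * b + \<delta>"
        have X: "X > 0" using that b by (simp add: X_def add_nonneg_pos)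
        \<comment> \<open>The parameter that balances the two terms of Young's inequality: both
          become at most a multiple of \<open>X powr (1 / p)\<close>.\<close>
        define l where "l = X powr (1 / (p * q)) / h t"
        have l: "l > 0" using X ht by (simp add: l_def)
        have yg: "AE s in \<mu>. ennreal (K t s * norm (f s)) \<le> ennreal (l powr q / q) * ennreal (K t s * h s powr q) + ennreal (l powr (- p) / p) * ennreal (K t s * k s)"
          using h0
        proof eventually_elim
          case (elim s)
          have "norm (f s) = (norm (f s) / (l * h s)) * (l * h s)" using elim l by simp
          also have "\<dots> \<le> (norm (f s) / (l * h s)) powr p / p + (l * h s) powr q / q"
            using pq elim l by (intro Youngs_inequality) auto
          also have "\<dots> = l powr q / q * h s powr q + l powr (-p) / p * k s"
            using elim l by (simp add: powr_divide powr_mult k_def powr_minus field_simps)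
          finally have "K t s * norm (f s) \<le> K t s * (l powr q / q * h s powr q + l powr (-p) / p * k s)"
            using K0 by (intro mult_left_mono) auto
          also have "\<dots> = l powr q / q * (K t s * h s powr q) + l powr (-p) / p * (K t s * k s)"
            by (simp add: algebra_simps)
          finally have le': "ennreal (K t s * norm (f s)) \<le> ennreal (l powr q / q * (K t s * h s powr q) + l powr (-p) / p * (K t s * k s))"
            by (rule ennreal_leI)
          from lin[of "l powr q / q" "l powr (-p) / p" "K t s * h s powr q" "K t s * k s"] show ?case
            using le' pq K0 k0 by simp
        qed
        have "ennreal (norm (v t)) \<le> (\<integral>\<^sup>+s. ennreal (K t s * norm (f s)) \<partial>\<mu>)" using elim by simp
        also have "\<dots> \<le> (\<integral>\<^sup>+s. ennreal (l powr q / q) * ennreal (K t s * h s powr q) + ennreal (l powr (- p) / p) * ennreal (K t s * k s) \<partial>\<mu>)"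
          by (rule nn_integral_mono_AE[OF yg])
        also have "\<dots> = ennreal (l powr q / q) * (\<integral>\<^sup>+s. ennreal (K t s * h s powr q) \<partial>\<mu>) + ennreal (l powr (- p) / p) * B t"
          unfolding B_def by (simp add: nn_integral_add nn_integral_cmult)
        also have "\<dots> \<le> ennreal (l powr q / q) * ennreal (C1 * h t powr q) + ennreal (l powr (- p) / p) * ennreal b"
          using elim b by (intro add_mono mult_left_mono) auto
        also have "\<dots> = ennreal (l powr q / q * (C1 * h t powr q) + l powr (-p) / p * b)"
          by (rule lin[symmetric]) (use pq C1 b in auto)
        finally have "norm (v t) \<le> l powr q / q * (C1 * h t powr q) + l powr (-p) / p * b"
          using pq C1 b by (subst (asm) ennreal_le_iff) auto
        also have "l powr q / q * (C1 * h t powr q) = C1 / q * X powr (1 / p)"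
          using ht X pq by (simp add: l_def powr_divide powr_powr)
        also have "l powr (-p) / p * b = X powr (- (1 / q)) * (h t powr p * b) / p"
        proof -
          have "1 / (p * q) * (- p) = - (1 / q)" using pq by simp
          then have "l powr (- p) = X powr (- (1 / q)) * h t powr p"
            using ht X unfolding l_def by (simp add: powr_divide powr_powr powr_minus_divide[of "h t"])
          then show ?thesis by simp
        qed
        also have "X powr (- (1 / q)) * (h t powr p * b) / p \<le> X powr (- (1 / q)) * X / p"
          using pq that by (intro divide_right_mono mult_left_mono) (auto simp: X_def)
        also have "X powr (- (1 / q)) * X = X powr (1 / p)"
        proof -
          have "1 / p = - (1 / q) + 1" using pq by simp
          then show ?thesis using X by (metis powr_add powr_one less_imp_le)
        qed
        finally have "norm (v t) \<le> (C1 / q + 1 / p) * X powr (1 / p)" by (simp add: algebra_simps)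
        also have "\<dots> \<le> D * X powr (1 / p)"
        proof (intro mult_right_mono)
          have "C1 / q \<le> C1" "1 / p \<le> 1" using pq C1(1) mult_left_mono[of 1 q C1] by (auto simp: divide_le_eq)
          then show "C1 / q + 1 / p \<le> D" by (simp add: D_def)
        qed auto
        finally have "norm (v t) powr p \<le> (D * X powr (1 / p)) powr p" using pq by (intro powr_mono2) auto
        also have "\<dots> = D powr p * X" using D X pq by (simp add: powr_mult powr_powr)
        finally show ?thesis by (simp add: X_def)
      qed
      have "norm (v t) powr p \<le> D powr p * (h t powr p * b) + e" if "e > 0" for e
        using main[of "e / D powr p"] that D by (simp add: algebra_simps)
      then have "norm (v t) powr p \<le> D powr p * (h t powr p * b)" by (rule field_le_epsilon)
      then have "ennreal (norm (v t) powr p) \<le> ennreal (D powr p * h t powr p * b)"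
        by (intro ennreal_leI) (simp add: mult.assoc)
      then show ?thesis using b by (simp add: ennreal_mult')
    qed
  qed
  have "(\<integral>\<^sup>+t. ennreal (norm (v t) powr p) \<partial>\<mu>) \<le> (\<integral>\<^sup>+t. ennreal (D powr p * h t powr p) * B t \<partial>\<mu>)"
    by (rule nn_integral_mono_AE[OF pw])
  also have "\<dots> = (\<integral>\<^sup>+t. (\<integral>\<^sup>+s. ennreal (D powr p * h t powr p) * ennreal (K t s * k s) \<partial>\<mu>) \<partial>\<mu>)"
    unfolding B_def by (intro nn_integral_cong nn_integral_cmult[symmetric]) auto
  also have "\<dots> = (\<integral>\<^sup>+s. (\<integral>\<^sup>+t. ennreal (D powr p * h t powr p) * ennreal (K t s * k s) \<partial>\<mu>) \<partial>\<mu>)"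
    by (rule circle2.Fubini'[symmetric]) (simp add: case_prod_unfold)
  also have "\<dots> = (\<integral>\<^sup>+s. ennreal (D powr p * k s) * (\<integral>\<^sup>+t. ennreal (K t s * h t powr p) \<partial>\<mu>) \<partial>\<mu>)"
  proof (intro nn_integral_cong)
    fix s assume "s \<in> space \<mu>"
    have "(\<integral>\<^sup>+t. ennreal (D powr p * h t powr p) * ennreal (K t s * k s) \<partial>\<mu>) = (\<integral>\<^sup>+t. ennreal (D powr p * k s) * ennreal (K t s * h t powr p) \<partial>\<mu>)"
      using K0 k0 by (intro nn_integral_cong) (simp add: ennreal_mult'[symmetric] mult_ac)
    also have "\<dots> = ennreal (D powr p * k s) * (\<integral>\<^sup>+t. ennreal (K t s * h t powr p) \<partial>\<mu>)"
      using \<open>s \<in> space \<mu>\<close> by (intro nn_integral_cmult) auto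
    finally show "(\<integral>\<^sup>+t. ennreal (D powr p * h t powr p) * ennreal (K t s * k s) \<partial>\<mu>) = ennreal (D powr p * k s) * (\<integral>\<^sup>+t. ennreal (K t s * h t powr p) \<partial>\<mu>)" .
  qed
  also have "\<dots> \<le> (\<integral>\<^sup>+s. ennreal (D powr p * C2) * ennreal (norm (f s) powr p) \<partial>\<mu>)"
  proof (intro nn_integral_mono_AE)
    show "AE s in \<mu>. ennreal (D powr p * k s) * (\<integral>\<^sup>+t. ennreal (K t s * h t powr p) \<partial>\<mu>) \<le> ennreal (D powr p * C2) * ennreal (norm (f s) powr p)"
      using h0 C2(2)
    proof eventually_elim
      case (elim s)
      have "ennreal (D powr p * k s) * (\<integral>\<^sup>+t. ennreal (K t s * h t powr p) \<partial>\<mu>) \<le> ennreal (D powr p * k s) * ennreal (C2 * h s powr p)"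
        using elim by (intro mult_left_mono) auto
      also have "\<dots> = ennreal (D powr p * C2 * norm (f s) powr p)"
        using elim C2(1) k0[of s] by (subst ennreal_mult'[symmetric]) (auto simp: k_def powr_minus field_simps)
      finally show ?case using C2(1) by (simp add: ennreal_mult')
    qed
  qed
  also have "\<dots> = ennreal (D powr p * C2) * ennreal (Lp_norm p f powr p)"
    using Lp_norm_ennreal[OF f] pq by (simp add: nn_integral_cmult)
  also have "\<dots> = ennreal ((D * C2 powr (1 / p) * Lp_norm p f) powr p)"
    using D C2 pq by (simp add: powr_mult powr_powr ennreal_mult')
  finally have "(\<integral>\<^sup>+t. ennreal (norm (v t) powr p) \<partial>\<mu>) \<le> ennreal ((D * C2 powr (1 / p) * Lp_norm p f) powr p)" .
  from LpI_nn_integral[OF v _ _ this] show "v \<in> Lp p" "Lp_norm p v \<le> (C1 + 1) * C2 powr (1 / p) * Lp_norm p f"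
    using D pq by (auto simp: D_def)
qed

text \<open>The Schur test with weight 1, since the kernel integrates to 1 in both variables; the
  factor 2 is \<open>C1 + 1\<close> with \<open>C1 = 1\<close>.\<close>

lemma poisson_Lp:
  assumes p: "1 < p" and f: "f \<in> Lp p" and r: "0 \<le> r" "r < 1"
  shows "poisson r f \<in> Lp p" "Lp_norm p (poisson r f) \<le> 2 * Lp_norm p f"
proof -
  define q where "q = 1 / (1 - 1 / p)"
  have q: "1 < q" "1 / p + 1 / q = 1" using p by (auto simp: q_def field_simps)
  have [measurable]: "f \<in> borel_measurable \<mu>" using f by auto
  note S = Schur_test[OF p q, of "poisson_kernel r" "\<lambda>t. 1" 1 1 f "poisson r f"]
  have a: "AE t in \<mu>. (\<integral>\<^sup>+s. ennreal (poisson_kernel r t s * 1 powr q) \<partial>\<mu>) \<le> ennreal (1 * 1 powr q)"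
    by (intro AE_I2) (simp add: nn_integral_poisson_kernel[OF r])
  have b: "AE s in \<mu>. (\<integral>\<^sup>+t. ennreal (poisson_kernel r t s * 1 powr p) \<partial>\<mu>) \<le> ennreal (1 * 1 powr p)"
    by (intro AE_I2) (simp add: nn_integral_poisson_kernel[OF r])
  show "poisson r f \<in> Lp p" "Lp_norm p (poisson r f) \<le> 2 * Lp_norm p f"
    using S[OF poisson_kernel_measurable2 poisson_kernel_nonneg[OF r] _ _ _ a _ b f _ AE_I2[OF norm_poisson_le[OF _ r]]] by auto
qed

section \<open>The theorem of M. Riesz\<close>

text \<open>Near the imaginary axis the angle \<open>p * Arg z\<close> exceeds pi/2, so
  \<open>Re (z powr p)\<close> is negative there and controls the modulus. At smaller angles
  \<open>Re z\<close> is itself comparable to the modulus. The bound \<open>p \<le> 2\<close> keeps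
  \<open>p * Arg z\<close> within pi, where the cosine is monotone.\<close>

lemma powr_Re_inequality:
  fixes p :: real
  assumes p: "1 < p" "p \<le> 2"
  obtains A B where "A \<ge> 0" "B \<ge> 0"
    "\<And>z. Re z > 0 \<Longrightarrow> norm z powr p \<le> A * Re z powr p - B * Re (z powr of_real p)"
proof -
  \<comment> \<open>The threshold angle is the midpoint of pi/(2p) and pi/2, so that
    \<open>p * \<psi>\<close> lies strictly above pi/2.\<close>
  define \<psi> where "\<psi> = pi * (1 / p + 1) / 4"
  have p\<psi>: "p * \<psi> = pi * (1 + p) / 4" using p by (simp add: \<psi>_def field_simps)
  have "0 < 1 / p + 1" "1 / p + 1 < 2" using p by (auto simp: field_simps add_pos_pos)
  then have \<psi>: "0 < \<psi>" "\<psi> < pi / 2"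
    by (auto simp: \<psi>_def)
  have p\<psi>': "pi / 2 < p * \<psi>" "p * \<psi> \<le> pi"
    unfolding p\<psi> using p by (auto simp: field_simps)
  define \<delta> where "\<delta> = - cos (p * \<psi>)"
  have "cos (p * \<psi>) < cos (pi / 2)" using p\<psi>' \<psi> p by (intro cos_monotone_0_pi) auto
  then have \<delta>: "\<delta> > 0" by (simp add: \<delta>_def)
  define \<kappa> where "\<kappa> = cos \<psi>"
  have \<kappa>: "\<kappa> > 0" using \<psi> unfolding \<kappa>_def by (intro cos_gt_zero) auto
  define B where "B = 1 / \<delta>"
  define A where "A = (1 + B) / \<kappa> powr p"
  have AB: "A \<ge> 0" "B \<ge> 0" using \<delta> \<kappa> by (auto simp: A_def B_def)
  have ang: "1 \<le> A * cos x powr p - B * cos (p * x)" if x: "0 \<le> x" "x < pi / 2" for x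
  proof (cases "x \<ge> \<psi>")
    case True
    have "cos (p * x) \<le> cos (p * \<psi>)"
    proof (rule cos_monotone_0_pi_le)
      have "p * x \<le> 2 * (pi / 2)" using p x by (intro mult_mono) auto
      then show "p * x \<le> pi" by simp
    qed (use True p \<psi> in auto)
    then have "B * cos (p * x) \<le> B * (- \<delta>)" using AB by (intro mult_left_mono) (auto simp: \<delta>_def)
    also have "\<dots> = - 1" using \<delta> by (simp add: B_def)
    finally show ?thesis using AB(1) by (smt (verit) mult_nonneg_nonneg powr_ge_zero)
  next
    case False
    have "\<kappa> \<le> cos x" using False x \<psi> unfolding \<kappa>_def by (intro cos_monotone_0_pi_le) auto
    then have "\<kappa> powr p \<le> cos x powr p" using \<kappa> p by (intro powr_mono2) auto
    then have "A * \<kappa> powr p \<le> A * cos x powr p" using AB by (intro mult_left_mono)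
    moreover have "A * \<kappa> powr p = 1 + B" using \<kappa> by (simp add: A_def)
    moreover have "B * cos (p * x) \<le> B * 1" using AB by (intro mult_left_mono) auto
    ultimately show ?thesis by linarith
  qed
  have "norm z powr p \<le> A * Re z powr p - B * Re (z powr of_real p)" if z: "Re z > 0" for z
  proof -
    have z0: "z \<noteq> 0" using z by auto
    have x: "\<bar>Arg z\<bar> < pi / 2" using z Arg_Re_pos by blast
    have cz: "Re z = norm z * cos \<bar>Arg z\<bar>"
      using arg_cong[OF Arg_eq[OF z0], of Re] by (simp add: Re_exp)
    have "z powr of_real p = exp (of_real p * Ln z)" using z0 by (simp add: powr_def)
    then have "Re (z powr of_real p) = exp (Re (of_real p * Ln z)) * cos (Im (of_real p * Ln z))"
      by (simp add: Re_exp)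
    also have "\<dots> = norm z powr p * cos (p * \<bar>Arg z\<bar>)"
      using z0 by (simp add: powr_def Arg_eq_Im_Ln cos_abs_real[symmetric, of "p * _"] abs_mult p less_imp_le)
    finally have rz: "Re (z powr of_real p) = norm z powr p * cos (p * \<bar>Arg z\<bar>)" .
    have "cos \<bar>Arg z\<bar> > 0" using x by (intro cos_gt_zero_pi) auto
    then have "Re z powr p = norm z powr p * cos \<bar>Arg z\<bar> powr p"
      unfolding cz by (simp add: powr_mult)
    moreover have "norm z powr p * 1 \<le> norm z powr p * (A * cos \<bar>Arg z\<bar> powr p - B * cos (p * \<bar>Arg z\<bar>))"
      using ang[of "\<bar>Arg z\<bar>"] x by (intro mult_left_mono) auto
    ultimately show ?thesis unfolding rz by (simp add: algebra_simps)
  qed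
  with AB that show thesis by blast
qed

text \<open>The function \<open>F\<close>, twice the Cauchy integral minus the mean, is analytic and
  its real part is the Poisson integral of \<open>f\<close>, which is positive. Its power with
  exponent p is thus analytic, and the mean of that power over a circle is its value at 0, a
  nonnegative number. The negative term of \<open>powr_Re_inequality\<close> can then be dropped
  after integration, leaving the bound for the Poisson integral. The lower bound \<eta> keeps
  \<open>F\<close> in the open half-plane.\<close>

lemma cauchy_bounded_nonneg:
  assumes p: "1 < p" "p \<le> 2"
  obtains C where "C \<ge> 0"
    "\<And>f r \<eta> B. f \<in> borel_measurable \<mu> \<Longrightarrow> (\<eta>::real) > 0 \<Longrightarrow> (\<And>t. norm t = 1 \<Longrightarrow> \<eta> \<le> f t \<and> f t \<le> B) \<Longrightarrow>
       0 \<le> r \<Longrightarrow> r < 1 \<Longrightarrow>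
       Lp_norm p (cauchy_int r (\<lambda>t. complex_of_real (f t))) \<le> C * Lp_norm p (\<lambda>t. of_real (f t))"
proof -
  obtain A B where AB: "A \<ge> 0" "B \<ge> 0"
    "\<And>z. Re z > 0 \<Longrightarrow> norm z powr p \<le> A * Re z powr p - B * Re (z powr of_real p)"
    using powr_Re_inequality[OF p] by metis
  define C where "C = A powr (1 / p) * 2 + 1"
  have "Lp_norm p (cauchy_int r (\<lambda>t. complex_of_real (f t))) \<le> C * Lp_norm p (\<lambda>t. of_real (f t))"
    if f[measurable]: "f \<in> borel_measurable \<mu>" and \<eta>: "\<eta> > 0" and fb: "\<And>t. norm t = 1 \<Longrightarrow> \<eta> \<le> f t \<and> f t \<le> D"
      and r: "0 \<le> r" "r < 1" for f :: "complex \<Rightarrow> real" and r \<eta> D :: real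
  proof -
    define g where "g t = complex_of_real (f t)" for t
    have gm[measurable]: "g \<in> borel_measurable \<mu>" unfolding g_def[abs_def] by measurable
    have gb: "norm (g t) \<le> D" if "norm t = 1" for t using fb[OF that] \<eta> by (auto simp: g_def)
    have "D \<ge> \<eta>" using fb[of 1] by auto
    then have gL: "g \<in> Lp p'" if "p' > 0" for p' using gb \<eta> that by (intro Lp_bounded(1)[of p' g D]) auto
    have gi: "integrable \<mu> g" using Lp_imp_integrable[OF gL, of 1] by simp
    define F where "F z = 2 * (\<integral>s. g s / (1 - z * cnj s) \<partial>\<mu>) - (\<integral>s. g s \<partial>\<mu>)" for z
    have "(\<lambda>z. \<integral>s. g s / (1 - z * cnj s) \<partial>\<mu>) holomorphic_on ball 0 1"
    proof (rule power_series_holomorphic)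
      fix w :: complex assume "w \<in> ball 0 1"
      then show "(\<lambda>n. fourier_coeff g (int n) * (w - 0) ^ n) sums (\<integral>s. g s / (1 - w * cnj s) \<partial>\<mu>)"
        using cauchy_series[OF gi, of w] by simp
    qed
    then have F: "F holomorphic_on ball 0 1" unfolding F_def[abs_def] by (intro holomorphic_intros)
    have ReF: "of_real (Re (F (of_real \<rho> * t))) = poisson \<rho> g t" if \<rho>: "0 \<le> \<rho>" "\<rho> < 1" and t: "norm t = 1" for \<rho> t
    proof -
      have "poisson \<rho> g t = cauchy_int \<rho> g t + cnj (cauchy_int \<rho> (\<lambda>s. cnj (g s)) t) - fourier_coeff g 0"
        by (rule poisson_eq[OF gi \<rho> t])
      also have "(\<lambda>s. cnj (g s)) = g" by (auto simp: g_def)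
      also have "fourier_coeff g 0 = of_real (\<integral>s. f s \<partial>\<mu>)" by (simp add: fourier_coeff_def g_def)
      finally have "poisson \<rho> g t = of_real (2 * Re (cauchy_int \<rho> g t) - (\<integral>s. f s \<partial>\<mu>))"
        by (simp add: complex_eq_iff)
      moreover have "Re (F (of_real \<rho> * t)) = 2 * Re (cauchy_int \<rho> g t) - (\<integral>s. f s \<partial>\<mu>)"
        by (simp add: F_def cauchy_int_def g_def)
      ultimately show ?thesis by simp
    qed
    have fi: "integrable \<mu> f" using gi by (simp add: g_def[abs_def] complex_of_real_integrable_eq)
    have Re_pos: "Re (F z) > 0" if z: "norm z < 1" for z
    proof -
      obtain \<rho> t where zt: "z = of_real \<rho> * t" "0 \<le> \<rho>" "\<rho> < 1" "norm t = 1"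
      proof (cases "z = 0")
        case True then show ?thesis using that[of 0 1] by simp
      next
        case False then show ?thesis using that[of "norm z" "z / of_real (norm z)"] z by (simp add: norm_divide)
      qed
      have "poisson \<rho> g t = of_real (\<integral>s. poisson_kernel \<rho> t s * f s \<partial>\<mu>)"
        unfolding poisson_def g_def by (simp flip: of_real_mult)
      then have "Re (F z) = (\<integral>s. poisson_kernel \<rho> t s * f s \<partial>\<mu>)"
        using ReF[OF zt(2-4)] zt(1) by (metis of_real_eq_iff)
      also have "\<dots> \<ge> (\<integral>s. poisson_kernel \<rho> t s * \<eta> \<partial>\<mu>)"
      proof (rule integral_mono)
        show "integrable \<mu> (\<lambda>s. poisson_kernel \<rho> t s * \<eta>)" using poisson_kernel_integrable[OF zt(2-4)] by simp
        have "integrable \<mu> (\<lambda>s. of_real (poisson_kernel \<rho> t s) * g s)"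
          using poisson_kernel_bound[OF zt(2-4)] poisson_kernel_nonneg[OF zt(2,3)]
          by (intro integrable_mult_bounded[OF gi, where C="2/(1-\<rho>)"]) auto
        then show "integrable \<mu> (\<lambda>s. poisson_kernel \<rho> t s * f s)"
          by (simp add: g_def complex_of_real_integrable_eq flip: of_real_mult)
        show "poisson_kernel \<rho> t s * \<eta> \<le> poisson_kernel \<rho> t s * f s" if "s \<in> space \<mu>" for s
          using fb[of s] that poisson_kernel_nonneg[OF zt(2,3)] by (intro mult_left_mono) auto
      qed
      also have "(\<integral>s. poisson_kernel \<rho> t s * \<eta> \<partial>\<mu>) = \<eta>" using poisson_one[OF zt(2-4)] by simp
      finally show ?thesis using \<eta> by simp
    qed
    have FnR: "F z \<notin> \<real>\<^sub>\<le>\<^sub>0" if "norm z < 1" for z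
      using Re_pos[OF that] complex_nonpos_Reals_iff by force
    have G: "(\<lambda>z. F z powr of_real p) holomorphic_on ball 0 1"
      by (intro holomorphic_intros F) (use FnR in auto)
    have F0: "F 0 = of_real (\<integral>s. f s \<partial>\<mu>)" by (simp add: F_def g_def)
    have nr: "norm (of_real r * t) < 1" if "norm t = 1" for t :: complex using that r by (simp add: norm_mult)
    define \<Phi> where "\<Phi> t = F (of_real r * t)" for t
    have cF: "continuous_on (sphere 0 1) \<Phi>"
      unfolding \<Phi>_def
      by (rule continuous_on_compose2[OF holomorphic_on_imp_continuous_on[OF F]])
         (use nr in \<open>auto intro!: continuous_intros\<close>)
    have cFp: "continuous_on (sphere 0 1) (\<lambda>t. \<Phi> t powr of_real p)"
      unfolding \<Phi>_def
      by (rule continuous_on_compose2[OF holomorphic_on_imp_continuous_on[OF G]])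
         (use nr in \<open>auto intro!: continuous_intros\<close>)
    have i1: "integrable \<mu> (\<lambda>t. \<Phi> t powr of_real p)"
      using Lp_imp_integrable[OF continuous_circle_Lp[OF cFp, of 1]] by simp
    have mean: "(\<integral>t. \<Phi> t powr of_real p \<partial>\<mu>) = of_real ((\<integral>s. f s \<partial>\<mu>) powr p)"
    proof -
      have one: "(\<lambda>t. 1) \<in> Hardy 1" by (auto simp: Hardy_def fourier_coeff_const Lp_one_iff)
      have "(\<integral>t. \<Phi> t powr of_real p \<partial>\<mu>) = F 0 powr of_real p"
        using holomorphic_mult_Hardy(2)[OF G r one] by (simp add: fourier_coeff_const \<Phi>_def fourier_coeff_def)
      moreover have "(\<integral>s. f s \<partial>\<mu>) \<ge> 0" using fb \<eta> by (intro integral_nonneg_AE AE_I2) force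
      ultimately show ?thesis unfolding F0 by (simp add: powr_of_real)
    qed
    have gP: "poisson r g \<in> Lp p" "Lp_norm p (poisson r g) \<le> 2 * Lp_norm p g"
      using poisson_Lp[OF p(1) gL r] p by auto
    have \<Phi>L: "\<Phi> \<in> Lp p" using continuous_circle_Lp[OF cF] p by simp
    have nP: "norm (poisson r g t) = Re (\<Phi> t)" if "norm t = 1" for t
      using ReF[OF r that] Re_pos[OF nr[OF that]] unfolding \<Phi>_def by (metis abs_of_pos norm_of_real)
    have "Lp_norm p \<Phi> powr p = (\<integral>t. norm (\<Phi> t) powr p \<partial>\<mu>)" using p by (simp add: Lp_norm_powr)
    also have "\<dots> \<le> (\<integral>t. A * norm (poisson r g t) powr p - B * Re (\<Phi> t powr of_real p) \<partial>\<mu>)"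
    proof (rule integral_mono)
      show "integrable \<mu> (\<lambda>t. norm (\<Phi> t) powr p)" using Lp_integrable[OF \<Phi>L] .
      show "integrable \<mu> (\<lambda>t. A * norm (poisson r g t) powr p - B * Re (\<Phi> t powr of_real p))"
        using Lp_integrable[OF gP(1)] i1 by (intro Bochner_Integration.integrable_diff integrable_mult_right integrable_Re)
      show "norm (\<Phi> t) powr p \<le> A * norm (poisson r g t) powr p - B * Re (\<Phi> t powr of_real p)" if "t \<in> space \<mu>" for t
        using AB(3)[of "\<Phi> t"] Re_pos[OF nr, of t] nP[of t] that by (simp add: \<Phi>_def)
    qed
    also have "\<dots> = A * (\<integral>t. norm (poisson r g t) powr p \<partial>\<mu>) - B * Re (\<integral>t. \<Phi> t powr of_real p \<partial>\<mu>)"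
      using Lp_integrable[OF gP(1)] i1 by simp
    also have "\<dots> \<le> A * Lp_norm p (poisson r g) powr p"
      using AB p unfolding mean by (simp add: Lp_norm_powr)
    also have "\<dots> \<le> A * (2 * Lp_norm p g) powr p"
      using AB gP p by (intro mult_left_mono powr_mono2) auto
    also have "\<dots> = (A powr (1 / p) * 2 * Lp_norm p g) powr p"
      using AB p by (simp add: powr_mult powr_powr)
    finally have \<Phi>n: "Lp_norm p \<Phi> \<le> A powr (1 / p) * 2 * Lp_norm p g"
      using p by (meson Lp_norm_nonneg mult_nonneg_nonneg not_le powr_ge_zero powr_less_mono2 zero_le_numeral order_less_trans zero_less_one)
    define c where "c = fourier_coeff g 0"
    have cL: "(\<lambda>t. c) \<in> Lp p" "Lp_norm p (\<lambda>t. c) \<le> Lp_norm p g"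
    proof -
      have "norm c \<le> Lp_norm p g"
        using fourier_coeff_bound[OF gi, of 0] integral_norm_le_Lp_norm[OF gL, of p] p unfolding c_def by linarith
      then show "(\<lambda>t. c) \<in> Lp p" "Lp_norm p (\<lambda>t. c) \<le> Lp_norm p g"
        using Lp_bounded[of p "\<lambda>t. c" "norm c"] p by auto
    qed
    have p1: "p \<ge> 1" "p > 0" using p by auto
    have eq: "cauchy_int r g t = (1/2) * (\<Phi> t + c)" for t
      by (simp add: \<Phi>_def F_def c_def fourier_coeff_def cauchy_int_def)
    have "Lp_norm p (cauchy_int r g) = norm (1/2::complex) * Lp_norm p (\<lambda>t. \<Phi> t + c)"
      unfolding eq[abs_def] by (rule Lp_scale(2)[OF p1(2) Lp_add(1)[OF p1(1) \<Phi>L cL(1)]])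
    also have "\<dots> \<le> norm (1/2::complex) * (Lp_norm p \<Phi> + Lp_norm p (\<lambda>t. c))"
      by (intro mult_left_mono Lp_add p1 \<Phi>L cL) auto
    also have "\<dots> \<le> norm (1/2::complex) * (A powr (1 / p) * 2 * Lp_norm p g + Lp_norm p g)"
      by (intro mult_left_mono add_mono \<Phi>n cL) auto
    also have "\<dots> \<le> C * Lp_norm p g" unfolding C_def by (simp add: algebra_simps)
    finally show ?thesis by (simp add: g_def[abs_def])
  qed
  moreover have "C \<ge> 0" by (simp add: C_def)
  ultimately show thesis using that by blast
qed

lemma cauchy_int_add:
  assumes "integrable \<mu> f" "integrable \<mu> g" and r: "0 \<le> r" "r < 1" "norm t = 1"
  shows "cauchy_int r (\<lambda>s. f s + g s) t = cauchy_int r f t + cauchy_int r g t"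
  unfolding cauchy_int_def add_divide_distrib
  by (intro Bochner_Integration.integral_add cauchy_integrable assms)

lemma cauchy_int_scale: "cauchy_int r (\<lambda>s. c * f s) t = c * cauchy_int r f t"
  unfolding cauchy_int_def by (subst integral_mult_right_zero[symmetric]) simp

lemma cauchy_int_bound:
  assumes "f \<in> borel_measurable \<mu>" "\<And>t. norm t = 1 \<Longrightarrow> norm (f t) \<le> B" and r: "0 \<le> r" "r < 1" "norm t = 1"
  shows "norm (cauchy_int r f t) \<le> B / (1 - r)"
proof -
  have B: "B \<ge> 0" using order_trans[OF norm_ge_zero assms(2)[of 1]] by simp
  have "f \<in> Lp 1" using assms B by (intro Lp_bounded(1)[of 1 f B]) auto
  then have fi: "integrable \<mu> f" by (simp add: Lp_one_iff)
  have "norm (cauchy_int r f t) \<le> (\<integral>s. norm (f s / (1 - of_real r * t * cnj s)) \<partial>\<mu>)"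
    unfolding cauchy_int_def by (rule integral_norm_bound)
  also have "\<dots> \<le> (\<integral>s. B / (1 - r) \<partial>\<mu>)"
  proof (rule integral_mono)
    show "integrable \<mu> (\<lambda>s. norm (f s / (1 - of_real r * t * cnj s)))" using cauchy_integrable[OF fi r] by simp
    fix s assume "s \<in> space \<mu>"
    then have "norm (f s) * norm (1 / (1 - of_real r * t * cnj s)) \<le> B * (1 / (1 - r))"
      using B by (intro mult_mono assms(2) cauchy_kernel_bound[OF r]) auto
    then show "norm (f s / (1 - of_real r * t * cnj s)) \<le> B / (1 - r)" by (simp add: norm_divide)
  qed simp
  also have "\<dots> = B / (1 - r)" using circle.prob_space by simp
  finally show ?thesis .
qed

lemma cauchy_bounded_le_2:
  assumes p: "1 < p" "p \<le> 2"
  obtains C where "C \<ge> 0"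
    "\<And>f r B. f \<in> borel_measurable \<mu> \<Longrightarrow> (\<And>t. norm t = 1 \<Longrightarrow> norm (f t) \<le> B) \<Longrightarrow> 0 \<le> r \<Longrightarrow> r < 1 \<Longrightarrow>
       Lp_norm p (cauchy_int r f) \<le> C * Lp_norm p f"
proof -
  obtain C where C: "C \<ge> 0"
    "\<And>f r \<eta> B. f \<in> borel_measurable \<mu> \<Longrightarrow> (\<eta>::real) > 0 \<Longrightarrow> (\<And>t. norm t = 1 \<Longrightarrow> \<eta> \<le> f t \<and> f t \<le> B) \<Longrightarrow>
       0 \<le> r \<Longrightarrow> r < 1 \<Longrightarrow>
       Lp_norm p (cauchy_int r (\<lambda>t. complex_of_real (f t))) \<le> C * Lp_norm p (\<lambda>t. of_real (f t))"
    using cauchy_bounded_nonneg[OF p] by blast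
  have p1: "p \<ge> 1" "p > 0" using p by auto
  have "Lp_norm p (cauchy_int r f) \<le> 4 * C * Lp_norm p f"
    if f[measurable]: "f \<in> borel_measurable \<mu>" and fb: "\<And>t. norm t = 1 \<Longrightarrow> norm (f t) \<le> B" and r: "0 \<le> r" "r < 1"
    for f :: "complex \<Rightarrow> complex" and r B
  proof -
    have B: "B \<ge> 0" using order_trans[OF norm_ge_zero fb[of 1]] by simp
    have fL: "f \<in> Lp p" using fb B p by (intro Lp_bounded(1)[of p f B]) auto
    have "Lp_norm p (cauchy_int r f) \<le> 4 * C * (Lp_norm p f + \<eta>)" if \<eta>: "\<eta> > 0" for \<eta>
    proof -
      \<comment> \<open>The positive parts of the real parts of \<open>u * f\<close>, for the four
        fourth roots of unity \<open>u\<close>, recover \<open>f\<close>. The shift by \<eta> makes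
        them strictly positive and cancels in the combination.\<close>
      define k where "k u t = complex_of_real (max 0 (Re (u * f t)) + \<eta>)" for u t
      have Re_le: "max 0 (Re (u * f t)) \<le> norm (f t)" if "norm u = 1" for u t
        using complex_Re_le_cmod[of "u * f t"] that by (simp add: norm_mult)
      have km[measurable]: "k u \<in> borel_measurable \<mu>" for u unfolding k_def[abs_def] by measurable
      have kb: "norm (k u t) \<le> norm (f t) + \<eta>" if "norm u = 1" for u t
        using Re_le[OF that, of t] \<eta> by (simp add: k_def del: of_real_add)
      have \<eta>L: "(\<lambda>t. complex_of_real \<eta>) \<in> Lp p" "Lp_norm p (\<lambda>t. complex_of_real \<eta>) \<le> \<eta>"
        using \<eta> p by (auto intro!: Lp_bounded[of p _ \<eta>])
      have "(\<lambda>t. complex_of_real (norm (f t)) + of_real \<eta>) \<in> Lp p \<and> Lp_norm p (\<lambda>t. complex_of_real (norm (f t)) + of_real \<eta>) \<le> Lp_norm p f + \<eta>"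
      proof -
        have a: "(\<lambda>t. complex_of_real (norm (f t))) \<in> Lp p" "Lp_norm p (\<lambda>t. complex_of_real (norm (f t))) \<le> 1 * Lp_norm p f"
          using Lp_bound[OF p1(2) fL, of 1 "\<lambda>t. complex_of_real (norm (f t))"] by auto
        show ?thesis using Lp_add[OF p1(1) a(1) \<eta>L(1)] a(2) \<eta>L(2) by simp
      qed
      then have kL: "k u \<in> Lp p" "Lp_norm p (k u) \<le> Lp_norm p f + \<eta>" if "norm u = 1" for u
        using Lp_bound[OF p1(2), of "\<lambda>t. complex_of_real (norm (f t)) + of_real \<eta>" 1 "k u"] kb[OF that] \<eta>
        by (auto simp flip: of_real_add)
      have ki: "integrable \<mu> (k u)" if "norm u = 1" for u using kL(1)[OF that] Lp_imp_integrable p1 by blast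
      have kc: "Lp_norm p (cauchy_int r (k u)) \<le> C * (Lp_norm p f + \<eta>)" if u: "norm u = 1" for u
      proof -
        have "Lp_norm p (cauchy_int r (k u)) \<le> C * Lp_norm p (k u)"
          unfolding k_def[abs_def]
        proof (rule C(2))
          show "\<eta> \<le> max 0 (Re (u * f t)) + \<eta> \<and> max 0 (Re (u * f t)) + \<eta> \<le> B + \<eta>" if "norm t = 1" for t
            using Re_le[OF u, of t] fb[OF that] B by simp
        qed (use \<eta> r in auto)
        also have "\<dots> \<le> C * (Lp_norm p f + \<eta>)" using kL(2)[OF u] C by (intro mult_left_mono)
        finally show ?thesis .
      qed
      have ckm: "cauchy_int r (k u) \<in> borel_measurable \<mu>" for u by (rule cauchy_int_measurable[OF km])
      have ckL: "cauchy_int r (k u) \<in> Lp p" if u: "norm u = 1" for u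
      proof (rule Lp_bounded(1)[OF p1(2) ckm])
        show "AE t in \<mu>. norm (cauchy_int r (k u) t) \<le> (B + \<eta>) / (1 - r)"
        proof (rule AE_I2)
          fix t assume "t \<in> space \<mu>"
          then show "norm (cauchy_int r (k u) t) \<le> (B + \<eta>) / (1 - r)"
            using order_trans[OF kb[OF u] add_right_mono[OF fb]] by (intro cauchy_int_bound[OF km _ r]) auto
        qed
        show "(B + \<eta>) / (1 - r) \<ge> 0" using B \<eta> r by simp
      qed
      define c where "c u = cauchy_int r (k u)" for u
      have dec: "f t = k 1 t + (-1) * k (-1) t + (\<i> * k (-\<i>) t + (-\<i>) * k \<i> t)" for t
        by (auto simp: complex_eq_iff k_def max_def)
      have ks: "integrable \<mu> (\<lambda>t. v * k u t)" if "norm u = 1" for u v using ki[OF that] by simp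
      have "cauchy_int r f t = c 1 t + (-1) * c (-1) t + (\<i> * c (-\<i>) t + (-\<i>) * c \<i> t)" if "norm t = 1" for t
      proof -
        have "cauchy_int r f t = cauchy_int r (\<lambda>t. k 1 t + (-1) * k (-1) t + (\<i> * k (-\<i>) t + (-\<i>) * k \<i> t)) t"
          unfolding dec[abs_def, symmetric] ..
        also have "\<dots> = c 1 t + (-1) * c (-1) t + (\<i> * c (-\<i>) t + (-\<i>) * c \<i> t)"
        proof -
          have i: "integrable \<mu> (k 1)" "integrable \<mu> (\<lambda>t. (-1) * k (-1) t)" "integrable \<mu> (\<lambda>t. \<i> * k (-\<i>) t)" "integrable \<mu> (\<lambda>t. (-\<i>) * k \<i> t)"
            using ki[of 1] ks[of "-1" "-1"] ks[of "-\<i>" \<i>] ks[of \<i> "-\<i>"] by simp_all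
          note j = Bochner_Integration.integrable_add[OF i(1,2)] Bochner_Integration.integrable_add[OF i(3,4)]
          show ?thesis
            unfolding c_def cauchy_int_scale[symmetric] cauchy_int_add[OF i(1,2) r that, symmetric]
              cauchy_int_add[OF i(3,4) r that, symmetric] cauchy_int_add[OF j r that, symmetric] ..
        qed
        finally show ?thesis .
      qed
      then have eqAE: "AE t in \<mu>. cauchy_int r f t = c 1 t + (-1) * c (-1) t + (\<i> * c (-\<i>) t + (-\<i>) * c \<i> t)"
        by (intro AE_I2) simp
      have cL: "c u \<in> Lp p" if "norm u = 1" for u using ckL[OF that] by (simp add: c_def)
      have csL: "(\<lambda>t. v * c u t) \<in> Lp p" "Lp_norm p (\<lambda>t. v * c u t) \<le> C * (Lp_norm p f + \<eta>)" if "norm u = 1" "norm v = 1" for u v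
        using Lp_scale[OF p1(2) cL[OF that(1)], of v] kc[OF that(1)] that(2) by (auto simp: c_def)
      have c1: "Lp_norm p (c 1) \<le> C * (Lp_norm p f + \<eta>)" using kc[of 1] by (simp add: c_def)
      have m: "cauchy_int r f \<in> borel_measurable \<mu>" by (rule cauchy_int_measurable[OF f])
      have l1: "(\<lambda>t. c 1 t + (-1) * c (-1) t) \<in> Lp p" "Lp_norm p (\<lambda>t. c 1 t + (-1) * c (-1) t) \<le> 2 * (C * (Lp_norm p f + \<eta>))"
        using Lp_add[OF p1(1) cL csL(1), of 1 "-1" "-1"] c1 csL(2)[of "-1" "-1"] by auto
      have l2: "(\<lambda>t. \<i> * c (-\<i>) t + (-\<i>) * c \<i> t) \<in> Lp p" "Lp_norm p (\<lambda>t. \<i> * c (-\<i>) t + (-\<i>) * c \<i> t) \<le> 2 * (C * (Lp_norm p f + \<eta>))"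
        using Lp_add[OF p1(1) csL(1) csL(1), of "-\<i>" \<i> \<i> "-\<i>"] csL(2)[of "-\<i>" \<i>] csL(2)[of \<i> "-\<i>"] by auto
      have l3: "Lp_norm p (\<lambda>t. c 1 t + (-1) * c (-1) t + (\<i> * c (-\<i>) t + (-\<i>) * c \<i> t)) \<le> 4 * C * (Lp_norm p f + \<eta>)"
        using Lp_add(2)[OF p1(1) l1(1) l2(1)] l1(2) l2(2) by simp
      have "Lp_norm p (cauchy_int r f) = Lp_norm p (\<lambda>t. c 1 t + (-1) * c (-1) t + (\<i> * c (-\<i>) t + (-\<i>) * c \<i> t))"
        by (rule Lp_norm_cong_AE[OF eqAE m]) (use Lp_add(1)[OF p1(1) l1(1) l2(1)] in auto)
      then show ?thesis using l3 by simp
    qed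
    from eventually_mono[OF eventually_at_right_less[of 0] this]
    have "\<forall>\<^sub>F \<eta> in at_right 0. Lp_norm p (cauchy_int r f) \<le> 4 * C * (Lp_norm p f + \<eta>)" .
    moreover have "((\<lambda>\<eta>. 4 * C * (Lp_norm p f + \<eta>)) \<longlongrightarrow> 4 * C * (Lp_norm p f + 0)) (at_right 0)"
      by (intro tendsto_intros)
    ultimately show ?thesis
      using tendsto_lowerbound[where F="at_right (0::real)"] by (metis add_0_right trivial_limit_at_right_real)
  qed
  moreover have "4 * C \<ge> 0" using C by simp
  ultimately show thesis using that by blast
qed

section \<open>Duality for Cauchy integrals\<close>

lemma cauchy_int_adjoint:
  assumes f[measurable]: "f \<in> borel_measurable \<mu>" and fb: "\<And>t. norm t = 1 \<Longrightarrow> norm (f t) \<le> B"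
    and w[measurable]: "w \<in> borel_measurable \<mu>" and wb: "\<And>t. norm t = 1 \<Longrightarrow> norm (w t) \<le> B'"
    and r: "0 \<le> r" "r < 1"
  shows "(\<integral>t. cauchy_int r f t * w t \<partial>\<mu>) = (\<integral>s. f s * cnj (cauchy_int r (\<lambda>t. cnj (w t)) s) \<partial>\<mu>)"
proof -
  have B: "B \<ge> 0" "B' \<ge> 0" using order_trans[OF norm_ge_zero fb[of 1]] order_trans[OF norm_ge_zero wb[of 1]] by simp_all
  define \<Theta> where "\<Theta> x = f (snd x) / (1 - complex_of_real r * fst x * cnj (snd x)) * w (fst x)" for x
  have [measurable]: "\<Theta> \<in> borel_measurable (\<mu> \<Otimes>\<^sub>M \<mu>)" unfolding \<Theta>_def[abs_def] by measurable
  have i: "integrable (\<mu> \<Otimes>\<^sub>M \<mu>) \<Theta>"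
  proof (rule circle2.P.integrable_const_bound[where B="B * (1 / (1 - r)) * B'"])
    show "AE x in \<mu> \<Otimes>\<^sub>M \<mu>. norm (\<Theta> x) \<le> B * (1 / (1 - r)) * B'"
    proof (rule AE_I2)
      fix x assume "x \<in> space (\<mu> \<Otimes>\<^sub>M \<mu>)"
      then have x: "norm (fst x) = 1" "norm (snd x) = 1" by (auto simp: space_pair_measure)
      have "norm (f (snd x)) * norm (1 / (1 - complex_of_real r * fst x * cnj (snd x))) * norm (w (fst x)) \<le> B * (1 / (1 - r)) * B'"
        using B r by (intro mult_mono fb wb cauchy_kernel_bound x) auto
      then show "norm (\<Theta> x) \<le> B * (1 / (1 - r)) * B'" by (simp add: \<Theta>_def norm_mult norm_divide)
    qed
  qed auto
  have "(\<integral>t. cauchy_int r f t * w t \<partial>\<mu>) = (\<integral>t. (\<integral>s. \<Theta> (t, s) \<partial>\<mu>) \<partial>\<mu>)"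
    unfolding cauchy_int_def \<Theta>_def fst_conv snd_conv by (subst integral_mult_left_zero[symmetric]) (rule refl)
  also have "\<dots> = (\<integral>s. (\<integral>t. \<Theta> (t, s) \<partial>\<mu>) \<partial>\<mu>)"
    using i by (intro circle2.Fubini_integral[symmetric]) (simp add: case_prod_unfold)
  also have "\<dots> = (\<integral>s. f s * cnj (cauchy_int r (\<lambda>t. cnj (w t)) s) \<partial>\<mu>)"
  proof (intro Bochner_Integration.integral_cong refl)
    fix s
    have "f s * cnj (cauchy_int r (\<lambda>t. cnj (w t)) s) = f s * (\<integral>t. cnj (cnj (w t) / (1 - of_real r * s * cnj t)) \<partial>\<mu>)"
      unfolding cauchy_int_def by (subst Bochner_Integration.integral_cnj) (rule refl)
    also have "\<dots> = (\<integral>t. f s * cnj (cnj (w t) / (1 - of_real r * s * cnj t)) \<partial>\<mu>)"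
      by (rule integral_mult_right_zero[symmetric])
    also have "\<dots> = (\<integral>t. \<Theta> (t, s) \<partial>\<mu>)"
      by (intro Bochner_Integration.integral_cong refl) (simp add: \<Theta>_def algebra_simps)
    finally show "(\<integral>t. \<Theta> (t, s) \<partial>\<mu>) = f s * cnj (cauchy_int r (\<lambda>t. cnj (w t)) s)" ..
  qed
  finally show ?thesis .
qed

text \<open>The adjoint of the Cauchy operator is again a Cauchy operator up to conjugation, so a
  bound for the exponent q carries over to p with the same constant. This opens the range of
  exponents above 2.\<close>

lemma cauchy_bounded_dual:
  assumes pq: "1 < p" "1 < q" "1 / p + 1 / q = 1" and C: "C \<ge> 0"
    and H: "\<And>f r B. f \<in> borel_measurable \<mu> \<Longrightarrow> (\<And>t. norm t = 1 \<Longrightarrow> norm (f t) \<le> B) \<Longrightarrow> 0 \<le> r \<Longrightarrow> r < 1 \<Longrightarrow>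
       Lp_norm q (cauchy_int r f) \<le> C * Lp_norm q f"
    and f[measurable]: "f \<in> borel_measurable \<mu>" and fb: "\<And>t. norm t = 1 \<Longrightarrow> norm (f t) \<le> B" and r: "0 \<le> r" "r < 1"
  shows "Lp_norm p (cauchy_int r f) \<le> C * Lp_norm p f"
proof -
  define g where "g = cauchy_int r f"
  have [measurable]: "g \<in> borel_measurable \<mu>" unfolding g_def by measurable
  have B: "B \<ge> 0" using order_trans[OF norm_ge_zero fb[of 1]] by simp
  define B1 where "B1 = B / (1 - r)"
  have B1: "B1 \<ge> 0" using B r by (simp add: B1_def)
  have gb: "norm (g t) \<le> B1" if "norm t = 1" for t
    unfolding g_def B1_def using cauchy_int_bound[OF f fb r that] .
  have gL: "g \<in> Lp p" using gb B1 pq by (intro Lp_bounded(1)[of p g B1]) auto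
  have fL: "f \<in> Lp p" using fb B pq by (intro Lp_bounded(1)[of p f B]) auto
  \<comment> \<open>The extremal function in Hoelder's inequality: \<open>g * w\<close> is the p-th
    power of the modulus of \<open>g\<close>, and so is the q-th power of the modulus of
    \<open>w\<close>.\<close>
  define w where "w t = cnj (g t) * of_real (norm (g t) powr (p - 2))" for t
  have [measurable]: "w \<in> borel_measurable \<mu>" unfolding w_def[abs_def] by measurable
  have nw: "norm (w t) = norm (g t) powr (p - 1)" for t
  proof (cases "g t = 0")
    case False
    have "norm (g t) * norm (g t) powr (p - 2) = norm (g t) powr (1 + (p - 2))"
      using False by (subst powr_add) simp
    then show ?thesis by (simp add: w_def norm_mult)
  qed (simp add: w_def)
  have wb: "norm (w t) \<le> B1 powr (p - 1)" if "norm t = 1" for t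
    unfolding nw using gb[OF that] pq by (intro powr_mono2) auto
  have gw: "g t * w t = of_real (norm (g t) powr p)" for t
  proof (cases "g t = 0")
    case False
    have "g t * w t = of_real ((norm (g t))\<^sup>2 * norm (g t) powr (p - 2))"
      unfolding w_def of_real_mult complex_norm_square by (simp only: mult.assoc)
    also have "(norm (g t))\<^sup>2 * norm (g t) powr (p - 2) = norm (g t) powr (2 + (p - 2))"
      using False by (subst powr_add) (simp flip: powr_numeral)
    finally show ?thesis by simp
  qed (simp add: w_def)
  have wL: "w \<in> Lp q" using wb pq by (intro Lp_bounded(1)[of q w "B1 powr (p - 1)"]) auto
  have pq': "(p - 1) * q = p" using pq by (simp add: field_simps)
  have nwq: "Lp_norm q w powr q = Lp_norm p g powr p"
    using pq by (simp add: Lp_norm_powr nw powr_powr pq')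
  define k where "k s = cnj (cauchy_int r (\<lambda>t. cnj (w t)) s)" for s
  have [measurable]: "k \<in> borel_measurable \<mu>" unfolding k_def[abs_def] by measurable
  have kL: "k \<in> Lp q" and kn: "Lp_norm q k \<le> C * Lp_norm q w"
  proof -
    have "norm (k s) \<le> B1 powr (p - 1) / (1 - r)" if "norm s = 1" for s
      unfolding k_def using wb by (simp, intro cauchy_int_bound r that) auto
    then show "k \<in> Lp q" using r pq by (intro Lp_bounded(1)[of q k "B1 powr (p - 1) / (1 - r)"]) auto
    have "Lp_norm q k = Lp_norm q (cauchy_int r (\<lambda>t. cnj (w t)))" by (simp add: Lp_norm_def k_def)
    also have "\<dots> \<le> C * Lp_norm q (\<lambda>t. cnj (w t))"
      by (rule H[OF _ _ r]) (use wb in auto)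
    also have "Lp_norm q (\<lambda>t. cnj (w t)) = Lp_norm q w" by (simp add: Lp_norm_def)
    finally show "Lp_norm q k \<le> C * Lp_norm q w" .
  qed
  have "of_real (Lp_norm p g powr p) = (\<integral>t. g t * w t \<partial>\<mu>)"
    unfolding gw using pq by (simp add: Lp_norm_powr)
  also have "\<dots> = (\<integral>s. f s * k s \<partial>\<mu>)"
    unfolding g_def k_def by (rule cauchy_int_adjoint[OF f fb _ wb r]) auto
  finally have "Lp_norm p g powr p = norm (\<integral>s. f s * k s \<partial>\<mu>)"
    by (metis abs_of_nonneg norm_of_real powr_ge_zero)
  also have "\<dots> \<le> Lp_norm 1 (\<lambda>s. f s * k s)" unfolding Lp_norm_one by (rule integral_norm_bound)
  also have "\<dots> \<le> Lp_norm p f * Lp_norm q k" by (rule Hoelder_conj[OF pq fL kL])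
  also have "\<dots> \<le> Lp_norm p f * (C * Lp_norm q w)" using kn by (intro mult_left_mono) auto
  finally have main: "Lp_norm p g powr p \<le> C * Lp_norm p f * Lp_norm q w" by (simp add: mult_ac)
  show ?thesis
  proof (cases "Lp_norm p g = 0")
    case True
    then show ?thesis using C by (simp add: g_def)
  next
    case False
    then have pos: "Lp_norm p g > 0" using Lp_norm_nonneg[of p g] by linarith
    have "Lp_norm q w = (Lp_norm q w powr q) powr (1 / q)" using pq by (simp add: powr_powr)
    also have "\<dots> = Lp_norm p g powr (p * (1 / q))" unfolding nwq by (simp add: powr_powr)
    also have "p * (1 / q) = p - 1" using pq by (simp add: field_simps)
    finally have "Lp_norm p g powr p \<le> C * Lp_norm p f * Lp_norm p g powr (p - 1)" using main by simp
    moreover have "Lp_norm p g powr p = Lp_norm p g * Lp_norm p g powr (p - 1)"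
      using pos powr_add[of "Lp_norm p g" 1 "p - 1"] by simp
    ultimately show ?thesis using pos by (simp add: g_def)
  qed
qed

theorem cauchy_bounded:
  assumes p: "1 < p"
  obtains C where "C \<ge> 0"
    "\<And>f r B. f \<in> borel_measurable \<mu> \<Longrightarrow> (\<And>t. norm t = 1 \<Longrightarrow> norm (f t) \<le> B) \<Longrightarrow> 0 \<le> r \<Longrightarrow> r < 1 \<Longrightarrow>
       Lp_norm p (cauchy_int r f) \<le> C * Lp_norm p f"
proof (cases "p \<le> 2")
  case True
  obtain C where "C \<ge> 0" "\<And>f r B. f \<in> borel_measurable \<mu> \<Longrightarrow> (\<And>t. norm t = 1 \<Longrightarrow> norm (f t) \<le> B) \<Longrightarrow> 0 \<le> r \<Longrightarrow> r < 1 \<Longrightarrow>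
       Lp_norm p (cauchy_int r f) \<le> C * Lp_norm p f"
    using cauchy_bounded_le_2[OF p True] by metis
  then show thesis using that by blast
next
  case False
  define q where "q = 1 / (1 - 1 / p)"
  have q: "1 < q" "1 / p + 1 / q = 1" using p by (auto simp: q_def field_simps)
  have q2: "q \<le> 2" using False p by (simp add: q_def field_simps)
  obtain C where C: "C \<ge> 0" "\<And>f r B. f \<in> borel_measurable \<mu> \<Longrightarrow> (\<And>t. norm t = 1 \<Longrightarrow> norm (f t) \<le> B) \<Longrightarrow> 0 \<le> r \<Longrightarrow> r < 1 \<Longrightarrow>
       Lp_norm q (cauchy_int r f) \<le> C * Lp_norm q f"
    using cauchy_bounded_le_2[OF q(1) q2] by metis
  show thesis by (rule that[OF C(1)]) (rule cauchy_bounded_dual[OF p q C])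
qed

section \<open>Riesz projection and products of Hardy functions\<close>

lemma abel_radii:
  obtains r :: "nat \<Rightarrow> real" where "\<And>n. 0 \<le> r n" "\<And>n. r n < 1" "r \<longlonglongrightarrow> 1"
proof -
  define r where "r n = 1 - 1 / (real n + 2)" for n
  have "(\<lambda>n. 1 - 1 / (real n + 2)) \<longlonglongrightarrow> 1" by real_asymp
  then have "r \<longlonglongrightarrow> 1" unfolding r_def[abs_def] by simp
  moreover have "0 \<le> r n" "r n < 1" for n by (auto simp: r_def field_simps)
  ultimately show thesis using that by blast
qed

definition trig_parts :: "(complex \<Rightarrow> complex) \<Rightarrow> complex poly \<Rightarrow> complex poly \<Rightarrow> bool" where
  "trig_parts f u s \<longleftrightarrow> (\<forall>t. norm t = 1 \<longrightarrow> f t = poly u t + cnj (t * poly s t))"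

lemma trig_parts_trig:
  assumes "trig_parts f u s" shows "f \<in> trig"
proof -
  have cn: "(\<lambda>t. cnj (g t)) \<in> trig" if "g \<in> trig" for g
    using that
  proof (induction g rule: trig.induct)
    case (monom f c n)
    show ?case by (rule trig.monom[of _ "cnj c" "-n"]) (simp add: monom cnj_powi_circle)
  next
    case (add f g h)
    show ?case by (rule trig.add[OF add.IH]) (simp add: add.hyps)
  qed
  have "cnj (t * poly s t) = cnj (poly (pCons 0 s) t)" for t by simp
  then show ?thesis
    using assms unfolding trig_parts_def
    by (intro trig.add[OF poly_trig[of u] cn[OF poly_trig[of "pCons 0 s"]]]) auto
qed

lemma trig_parts_coeff:
  assumes "trig_parts f u s" "n \<ge> 0"
  shows "fourier_coeff f n = coeff u (nat n)"
proof -
  have i: "integrable \<mu> (poly v)" for v using Lp_imp_integrable[OF trig_Lp[OF poly_trig, of 1 v]] by simp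
  have "fourier_coeff f n = fourier_coeff (\<lambda>t. poly u t + cnj (poly (pCons 0 s) t)) n"
    using assms(1) by (intro fourier_coeff_cong) (simp add: trig_parts_def)
  also have "\<dots> = fourier_coeff (poly u) n + fourier_coeff (\<lambda>t. cnj (poly (pCons 0 s) t)) n"
    using i by (intro fourier_coeff_add) (auto simp del: poly_pCons)
  also have "fourier_coeff (\<lambda>t. cnj (poly (pCons 0 s) t)) n = 0"
    unfolding fourier_coeff_cnj fourier_coeff_poly using assms(2) by auto
  finally show ?thesis using assms(2) by (simp add: fourier_coeff_poly)
qed

lemma cauchy_int_trig:
  assumes "trig_parts f u s" "0 \<le> r" "r < 1" "norm t = 1"
  shows "cauchy_int r f t = poly u (of_real r * t)"
proof -
  have i: "integrable \<mu> f" using Lp_imp_integrable[OF trig_Lp[OF trig_parts_trig[OF assms(1)], of 1]] by simp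
  have "(\<lambda>n. coeff u n * (of_real r * t) ^ n) sums cauchy_int r f t"
    using cauchy_int_sums[OF i assms(2-4)] by (simp add: trig_parts_coeff[OF assms(1)])
  moreover have "(\<lambda>n. coeff u n * (of_real r * t) ^ n) sums poly u (of_real r * t)"
    unfolding poly_altdef by (rule sums_finite) (auto simp: coeff_eq_0)
  ultimately show ?thesis using sums_unique2 by blast
qed

text \<open>The Cauchy integrals of \<open>f\<close> tend to \<open>poly u\<close> pointwise and are
  bounded in L^p uniformly in the radius, so Fatou's lemma applies.\<close>

lemma trig_projection_bounded:
  assumes p: "1 < p"
  obtains C where "C \<ge> 0" "\<And>f u s. trig_parts f u s \<Longrightarrow> Lp_norm p (poly u) \<le> C * Lp_norm p f"
proof -
  obtain C where C: "C \<ge> 0"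
    "\<And>f r B. f \<in> borel_measurable \<mu> \<Longrightarrow> (\<And>t. norm t = 1 \<Longrightarrow> norm (f t) \<le> B) \<Longrightarrow> 0 \<le> r \<Longrightarrow> r < 1 \<Longrightarrow>
       Lp_norm p (cauchy_int r f) \<le> C * Lp_norm p f"
    using cauchy_bounded[OF p] by metis
  obtain r :: "nat \<Rightarrow> real" where r: "\<And>n. 0 \<le> r n" "\<And>n. r n < 1" "r \<longlonglongrightarrow> 1" by (rule abel_radii) blast
  have "Lp_norm p (poly u) \<le> C * Lp_norm p f" if f: "trig_parts f u s" for f u s
  proof -
    have ft: "f \<in> trig" using trig_parts_trig[OF f] .
    then obtain B where B: "B \<ge> 0" "\<And>t. norm t = 1 \<Longrightarrow> norm (f t) \<le> B"
      using continuous_circle_bounded[OF trig_continuous] by blast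
    have fm[measurable]: "f \<in> borel_measurable \<mu>" using trig_measurable[OF ft] .
    have eq: "AE t in \<mu>. (\<lambda>n. cauchy_int (r n) f t) \<longlonglongrightarrow> poly u t"
    proof (rule AE_I2)
      fix t assume "t \<in> space \<mu>"
      then have t: "norm t = 1" by simp
      have "(\<lambda>n. poly u (of_real (r n) * t)) \<longlonglongrightarrow> poly u (of_real 1 * t)"
        by (intro tendsto_intros r)
      then show "(\<lambda>n. cauchy_int (r n) f t) \<longlonglongrightarrow> poly u t"
        using cauchy_int_trig[OF f r(1,2) t] by simp
    qed
    have L: "cauchy_int (r n) f \<in> Lp p" for n
    proof (rule Lp_bounded(1)[where C="B / (1 - r n)"])
      show "AE t in \<mu>. norm (cauchy_int (r n) f t) \<le> B / (1 - r n)"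
        by (rule AE_I2) (use cauchy_int_bound[OF fm B(2) r(1,2)] in auto)
    qed (use p B r(2)[of n] in auto)
    show ?thesis
      using Lp_Fatou(2)[OF _ L C(2)[OF fm B(2) r(1,2)] trig_measurable[OF poly_trig] eq] p by simp
  qed
  with C(1) that show thesis by blast
qed

text \<open>The choice is harmless: by \<open>trig_parts_coeff\<close> the coefficients of the
  polynomial are the Fourier coefficients of \<open>f\<close>.\<close>

definition trig_proj :: "(complex \<Rightarrow> complex) \<Rightarrow> complex poly" where
  "trig_proj f = (SOME u. \<exists>s. trig_parts f u s)"

lemma trig_proj:
  assumes "f \<in> trig" obtains s where "trig_parts f (trig_proj f) s"
proof -
  have "\<exists>u s. trig_parts f u s" using trig_decompose[OF assms] by (simp add: trig_parts_def)
  then have "\<exists>s. trig_parts f (trig_proj f) s" unfolding trig_proj_def by (rule someI_ex)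
  then show thesis using that by blast
qed

text \<open>The last clause records that the projection is a limit of polynomials; density of
  polynomials in H^p is drawn from it.\<close>

theorem Riesz_projection_bounded:
  assumes p: "1 < p"
  obtains C where "C \<ge> 0"
    "\<And>f. f \<in> Lp p \<Longrightarrow> \<exists>h\<in>Hardy p. (\<forall>n\<ge>0. fourier_coeff h n = fourier_coeff f n) \<and> Lp_norm p h \<le> C * Lp_norm p f \<and>
       (\<exists>u. (\<lambda>n. Lp_norm p (\<lambda>t. poly (u n) t - h t)) \<longlonglongrightarrow> 0)"
proof -
  obtain C where C: "C \<ge> 0" "\<And>f u s. trig_parts f u s \<Longrightarrow> Lp_norm p (poly u) \<le> C * Lp_norm p f"
    using trig_projection_bounded[OF p] by metis
  have p1: "p \<ge> 1" "p > 0" using p by auto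
  have "\<exists>h\<in>Hardy p. (\<forall>n\<ge>0. fourier_coeff h n = fourier_coeff f n) \<and> Lp_norm p h \<le> C * Lp_norm p f \<and>
       (\<exists>u. (\<lambda>n. Lp_norm p (\<lambda>t. poly (u n) t - h t)) \<longlonglongrightarrow> 0)"
    if f: "f \<in> Lp p" for f
  proof -
    define T where "T g = poly (trig_proj g)" for g
    have T1: "T g \<in> Lp p" for g unfolding T_def using trig_Lp[OF poly_trig] p by simp
    have T2: "Lp_norm p (T g) \<le> C * Lp_norm p g" if "g \<in> trig" for g
      using trig_proj[OF that] C(2) unfolding T_def by metis
    have T3: "Lp_norm p (\<lambda>t. T g t - T h t) \<le> C * Lp_norm p (\<lambda>t. g t - h t)" if gh: "g \<in> trig" "h \<in> trig" for g h
    proof -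
      obtain s s' where s: "trig_parts g (trig_proj g) s" "trig_parts h (trig_proj h) s'"
        using trig_proj gh by metis
      then have "trig_parts (\<lambda>t. g t - h t) (trig_proj g - trig_proj h) (s - s')"
        by (auto simp: trig_parts_def algebra_simps)
      from C(2)[OF this] have "Lp_norm p (poly (trig_proj g - trig_proj h)) \<le> C * Lp_norm p (\<lambda>t. g t - h t)" .
      moreover have "poly (trig_proj g - trig_proj h) = (\<lambda>t. poly (trig_proj g) t - poly (trig_proj h) t)"
        by (rule ext) simp
      ultimately show ?thesis by (simp only: T_def)
    qed
    obtain g U where gU: "\<And>n. g n \<in> trig" "(\<lambda>n. Lp_norm p (\<lambda>t. g n t - f t)) \<longlonglongrightarrow> 0" "U \<in> Lp p"
      "(\<lambda>n. Lp_norm p (\<lambda>t. T (g n) t - U t)) \<longlonglongrightarrow> 0" "Lp_norm p U \<le> C * Lp_norm p f"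
      by (rule trig_extension[where T=T, OF p1(1) C(1) f T1 T2 T3]) blast+
    have TH: "T (g n) \<in> Hardy p" for n unfolding T_def using poly_Hardy p by simp
    have "U \<in> Hardy p" by (rule Hardy_limit[OF p1(1) TH gU(3,4)])
    moreover have "fourier_coeff U n = fourier_coeff f n" if n: "n \<ge> 0" for n
    proof (rule LIMSEQ_unique)
      show "(\<lambda>k. fourier_coeff (T (g k)) n) \<longlonglongrightarrow> fourier_coeff U n"
        by (rule fourier_coeff_tendsto[OF p1(1) T1 gU(3,4)])
      have "(\<lambda>k. fourier_coeff (g k) n) \<longlonglongrightarrow> fourier_coeff f n"
        by (rule fourier_coeff_tendsto[OF p1(1) trig_Lp[OF gU(1) p1(2)] f gU(2)])
      moreover have "fourier_coeff (T (g k)) n = fourier_coeff (g k) n" for k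
      proof -
        obtain s where s: "trig_parts (g k) (trig_proj (g k)) s" using trig_proj[OF gU(1)] by metis
        then show ?thesis using trig_parts_coeff[OF s n] n by (simp add: T_def fourier_coeff_poly)
      qed
      ultimately show "(\<lambda>k. fourier_coeff (T (g k)) n) \<longlonglongrightarrow> fourier_coeff f n" by simp
    qed
    moreover have "\<exists>u. (\<lambda>n. Lp_norm p (\<lambda>t. poly (u n) t - U t)) \<longlonglongrightarrow> 0"
      using gU(4) unfolding T_def by (rule exI[where x="\<lambda>n. trig_proj (g n)"])
    ultimately show ?thesis using gU(5) by blast
  qed
  with C(1) that show thesis by blast
qed

lemma Riesz_projection_ex:
  assumes "1 < p" "f \<in> Lp p"
  obtains h where "h \<in> Hardy p" "\<And>n. n \<ge> 0 \<Longrightarrow> fourier_coeff h n = fourier_coeff f n"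
  using Riesz_projection_bounded[OF assms(1)] assms(2) by metis

lemma Hardy_unique:
  assumes "f \<in> Hardy 1" "g \<in> Hardy 1" "\<And>n. n \<ge> 0 \<Longrightarrow> fourier_coeff f n = fourier_coeff g n"
  shows "AE t in \<mu>. f t = g t"
proof (rule fourier_unique)
  show "fourier_coeff f n = fourier_coeff g n" for n
    using assms(3)[of n] HardyD(2)[OF assms(1), of n] HardyD(2)[OF assms(2), of n] by (cases "n \<ge> 0") auto
qed (use assms HardyD(1) Lp_one_iff in auto)

text \<open>A function of H^p is its own projection, and projections are limits of
  polynomials.\<close>

lemma Hardy_poly_dense:
  assumes p: "1 < p" and f: "f \<in> Hardy p"
  obtains u where "(\<lambda>n. Lp_norm p (\<lambda>t. poly (u n) t - f t)) \<longlonglongrightarrow> 0"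
proof -
  obtain h u where h: "h \<in> Hardy p" "\<And>n. n \<ge> 0 \<Longrightarrow> fourier_coeff h n = fourier_coeff f n"
    "(\<lambda>n. Lp_norm p (\<lambda>t. poly (u n) t - h t)) \<longlonglongrightarrow> 0"
    using Riesz_projection_bounded[OF p] HardyD(1)[OF f] by metis
  have H1: "h \<in> Hardy 1" "f \<in> Hardy 1" using Hardy_mono[of 1 p] p h f by auto
  have ae: "AE t in \<mu>. h t = f t" by (rule Hardy_unique[OF H1 h(2)])
  have m[measurable]: "h \<in> borel_measurable \<mu>" "f \<in> borel_measurable \<mu>" using HardyD(1) H1 by auto
  have pm[measurable]: "poly v \<in> borel_measurable \<mu>" for v by (rule trig_measurable[OF poly_trig])
  have "Lp_norm p (\<lambda>t. poly (u n) t - f t) = Lp_norm p (\<lambda>t. poly (u n) t - h t)" for n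
    by (rule Lp_norm_cong_AE) (use ae in auto)
  then show thesis using that[of u] h(3) by simp
qed

section \<open>Products of Hardy functions\<close>

lemma poly_mult_Hardy:
  assumes f: "f \<in> Hardy 1"
  shows "k < 0 \<Longrightarrow> fourier_coeff (\<lambda>t. poly u t * f t) k = 0"
    "fourier_coeff (\<lambda>t. poly u t * f t) 0 = poly u 0 * fourier_coeff f 0"
proof -
  have fi: "integrable \<mu> f" by (rule Lp_one_iff[THEN iffD1, OF HardyD(1)[OF f]])
  have i: "integrable \<mu> (\<lambda>t. poly u t * f t)" for u
  proof -
    obtain C where "\<forall>t. norm t = 1 \<longrightarrow> norm (poly u t) \<le> C"
      using continuous_circle_bounded[OF trig_continuous[OF poly_trig]] by blast
    then show ?thesis by (intro integrable_mult_bounded[OF fi trig_measurable[OF poly_trig], where C=C]) auto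
  qed
  have "(k < 0 \<longrightarrow> fourier_coeff (\<lambda>t. poly u t * f t) k = 0) \<and> (k = 0 \<longrightarrow> fourier_coeff (\<lambda>t. poly u t * f t) k = poly u 0 * fourier_coeff f k)" for k
  proof (induction u arbitrary: k)
    case 0
    then show ?case by (simp add: fourier_coeff_def)
  next
    case (pCons a u)
    have "fourier_coeff (\<lambda>t. poly (pCons a u) t * f t) k = fourier_coeff (\<lambda>t. a * f t + poly u t * f t * t powi 1) k"
      by (rule fourier_coeff_cong) (simp add: algebra_simps)
    also have "\<dots> = a * fourier_coeff f k + fourier_coeff (\<lambda>t. poly u t * f t) (k - 1)"
      using i fi fourier_integrable[OF i, of u 1] by (subst fourier_coeff_add) (auto simp: fourier_coeff_scale fourier_coeff_shift simp del: power_int_1_right)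
    finally show ?case using pCons.IH[of "k - 1"] HardyD(2)[OF f, of k] by auto
  qed
  then show "k < 0 \<Longrightarrow> fourier_coeff (\<lambda>t. poly u t * f t) k = 0"
    "fourier_coeff (\<lambda>t. poly u t * f t) 0 = poly u 0 * fourier_coeff f 0" by auto
qed

text \<open>One factor is replaced by polynomials, which act on coefficients by shifts; Hoelder's
  inequality makes the products converge in L^1 and hence coefficientwise.\<close>

lemma Hardy_mult_conj:
  assumes ab: "1 < a" "1 < b" "1 / a + 1 / b = 1" and f: "f \<in> Hardy a" and g: "g \<in> Hardy b"
  shows "(\<lambda>t. f t * g t) \<in> Hardy 1" "fourier_coeff (\<lambda>t. f t * g t) 0 = fourier_coeff f 0 * fourier_coeff g 0"
proof -
  obtain u where u: "(\<lambda>n. Lp_norm a (\<lambda>t. poly (u n) t - f t)) \<longlonglongrightarrow> 0" using Hardy_poly_dense[OF ab(1) f] by metis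
  have L: "f \<in> Lp a" "g \<in> Lp b" using HardyD(1) f g by auto
  have uL: "poly (u n) \<in> Lp a" for n using trig_Lp[OF poly_trig] ab by simp
  have a1: "a \<ge> 1" using ab by simp
  have fgL: "(\<lambda>t. f t * g t) \<in> Lp 1" by (rule Hoelder_conj(1)[OF ab L])
  have ugL: "(\<lambda>t. poly (u n) t * g t) \<in> Lp 1" for n by (rule Hoelder_conj(1)[OF ab uL L(2)])
  have g1: "g \<in> Hardy 1" using Hardy_mono[of 1 b] ab g by auto
  have lim: "(\<lambda>n. Lp_norm 1 (\<lambda>t. poly (u n) t * g t - f t * g t)) \<longlonglongrightarrow> 0"
  proof (rule tendsto_sandwich[OF _ _ tendsto_const])
    show "(\<lambda>n. Lp_norm a (\<lambda>t. poly (u n) t - f t) * Lp_norm b g) \<longlonglongrightarrow> 0"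
      using tendsto_mult_right[OF u, of "Lp_norm b g"] by simp
    show "\<forall>\<^sub>F n in sequentially. Lp_norm 1 (\<lambda>t. poly (u n) t * g t - f t * g t) \<le> Lp_norm a (\<lambda>t. poly (u n) t - f t) * Lp_norm b g"
      using Hoelder_conj(2)[OF ab Lp_diff(1)[OF a1 uL L(1)] L(2)]
      by (intro always_eventually allI) (simp add: left_diff_distrib)
  qed simp
  show "(\<lambda>t. f t * g t) \<in> Hardy 1"
  proof (rule Hardy_limit[OF _ _ fgL lim])
    show "(\<lambda>t. poly (u n) t * g t) \<in> Hardy 1" for n
      by (rule HardyI[OF ugL]) (rule poly_mult_Hardy(1)[OF g1])
  qed simp
  have "(\<lambda>n. fourier_coeff (\<lambda>t. poly (u n) t * g t) 0) \<longlonglongrightarrow> fourier_coeff (\<lambda>t. f t * g t) 0"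
    by (rule fourier_coeff_tendsto[OF _ ugL fgL lim]) simp
  moreover have "(\<lambda>n. fourier_coeff (\<lambda>t. poly (u n) t * g t) 0) = (\<lambda>n. fourier_coeff (poly (u n)) 0 * fourier_coeff g 0)"
    unfolding poly_mult_Hardy(2)[OF g1] by (simp add: fourier_coeff_poly poly_0_coeff_0)
  moreover have "(\<lambda>n. fourier_coeff (poly (u n)) 0 * fourier_coeff g 0) \<longlonglongrightarrow> fourier_coeff f 0 * fourier_coeff g 0"
    by (intro tendsto_intros fourier_coeff_tendsto[OF a1 uL L(1) u])
  ultimately show "fourier_coeff (\<lambda>t. f t * g t) 0 = fourier_coeff f 0 * fourier_coeff g 0"
    using LIMSEQ_unique by metis
qed

text \<open>The exponent \<open>a\<close> is lowered to the conjugate exponent of \<open>b\<close>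
  to determine the coefficients; Hoelder's inequality with the original exponents then supplies
  membership in L^c.\<close>

lemma Hardy_mult:
  assumes "0 < a" "0 < b" "1 \<le> c" "1 / a + 1 / b = 1 / c" and f: "f \<in> Hardy a" and g: "g \<in> Hardy b"
  shows "(\<lambda>t. f t * g t) \<in> Hardy c" "fourier_coeff (\<lambda>t. f t * g t) 0 = fourier_coeff f 0 * fourier_coeff g 0"
proof -
  have c: "1 / c \<le> 1" using assms by simp
  have "1 / a > 0" "1 / b > 0" using assms by auto
  then have "1 / a < 1" "1 / b < 1" using assms(4) c by linarith+
  then have ab: "1 < a" "1 < b" using assms by (auto simp: field_simps)
  define a' where "a' = 1 / (1 - 1 / b)"
  have a': "1 < a'" "1 / a' + 1 / b = 1" using ab by (auto simp: a'_def field_simps)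
  have "1 / a \<le> 1 / a'" using a'(2) assms(4) c by linarith
  then have "a' \<le> a" using ab a' by (simp add: field_simps)
  then have f': "f \<in> Hardy a'" using Hardy_mono[of a' a f] a' f by auto
  note H = Hardy_mult_conj[OF a'(1) ab(2) a'(2) f' g]
  show "fourier_coeff (\<lambda>t. f t * g t) 0 = fourier_coeff f 0 * fourier_coeff g 0" by (rule H(2))
  have "(\<lambda>t. f t * g t) \<in> Lp c"
    using assms HardyD(1)[OF f] HardyD(1)[OF g] by (intro Hoelder(1)[of a b]) auto
  then show "(\<lambda>t. f t * g t) \<in> Hardy c" using HardyD(2)[OF H(1)] by (rule HardyI)
qed

lemma co_Hardy_mult:
  assumes "0 < a" "0 < b" "1 \<le> c" "1 / a + 1 / b = 1 / c" and f: "f \<in> co_Hardy a" and g: "g \<in> co_Hardy b"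
  shows "(\<lambda>t. f t * g t) \<in> co_Hardy c" "fourier_coeff (\<lambda>t. f t * g t) 0 = fourier_coeff f 0 * fourier_coeff g 0"
proof -
  note H = Hardy_mult[OF assms(1-4) f[unfolded co_Hardy_iff_cnj] g[unfolded co_Hardy_iff_cnj]]
  show "(\<lambda>t. f t * g t) \<in> co_Hardy c" using H(1) by (simp add: co_Hardy_iff_cnj)
  have "fourier_coeff (\<lambda>t. cnj (f t * g t)) 0 = fourier_coeff (\<lambda>t. cnj (f t)) 0 * fourier_coeff (\<lambda>t. cnj (g t)) 0"
    using H(2) by simp
  then have "cnj (fourier_coeff (\<lambda>t. f t * g t) 0) = cnj (fourier_coeff f 0 * fourier_coeff g 0)"
    unfolding fourier_coeff_cnj by simp
  then show "fourier_coeff (\<lambda>t. f t * g t) 0 = fourier_coeff f 0 * fourier_coeff g 0" by (simp only: complex_cnj_cancel_iff)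
qed

text \<open>The analogue of Liouville's theorem: every coefficient of nonzero index vanishes from
  one side or the other.\<close>

lemma Hardy_co_Hardy_const:
  assumes f: "f \<in> Hardy 1" and g: "g \<in> co_Hardy 1" and eq: "AE t in \<mu>. f t = g t"
  shows "AE t in \<mu>. f t = fourier_coeff g 0"
proof (rule fourier_unique)
  have m: "f \<in> borel_measurable \<mu>" "g \<in> borel_measurable \<mu>" using HardyD(1)[OF f] co_HardyD(1)[OF g] by auto
  have e: "fourier_coeff f n = fourier_coeff g n" for n by (rule fourier_coeff_cong_AE[OF eq m])
  show "fourier_coeff f n = fourier_coeff (\<lambda>t. fourier_coeff g 0) n" for n
    unfolding fourier_coeff_const using HardyD(2)[OF f, of n] co_HardyD(2)[OF g, of n] e[of n] by (cases n "0::int" rule: linorder_cases) auto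
  show "integrable \<mu> f" using HardyD(1)[OF f] Lp_one_iff by blast
qed simp

text \<open>Serves to recognize that projecting an antianalytic function times a polynomial gives a
  polynomial again.\<close>

lemma Hardy_degree_poly:
  assumes f: "f \<in> Hardy 1" and z: "\<And>n. n > int d \<Longrightarrow> fourier_coeff f n = 0"
  obtains R where "AE t in \<mu>. f t = poly R t"
proof -
  define R where "R = (\<Sum>i\<le>d. Polynomial.monom (fourier_coeff f (int i)) i)"
  have c: "coeff R n = (if n \<le> d then fourier_coeff f (int n) else 0)" for n
    by (simp add: R_def coeff_sum sum.delta)
  have "AE t in \<mu>. f t = poly R t"
  proof (rule Hardy_unique[OF f poly_Hardy])
    show "fourier_coeff f n = fourier_coeff (poly R) n" if "n \<ge> 0" for n
      using that z[of n] by (auto simp: fourier_coeff_poly c)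
  qed simp
  then show thesis by (rule that)
qed

section \<open>Power functions on the circle\<close>

lemma nn_integral_shift:
  assumes [measurable]: "f \<in> borel_measurable (borel :: real measure)"
  shows "(\<integral>\<^sup>+x. f x * indicator {a<..b} x \<partial>lborel) = (\<integral>\<^sup>+x. f (c + x) * indicator {a-c<..b-c} x \<partial>lborel)"
proof -
  have "(\<integral>\<^sup>+x. f x * indicator {a<..b} x \<partial>lborel) = (\<integral>\<^sup>+x. f (c + x) * indicator {a<..b} (c + x) \<partial>lborel)"
    using nn_integral_real_affine[of "\<lambda>x. f x * indicator {a<..b} x" 1 c] by simp
  also have "\<dots> = (\<integral>\<^sup>+x. f (c + x) * indicator {a-c<..b-c} x \<partial>lborel)"
    by (intro nn_integral_cong) (auto simp: indicator_def)
  finally show ?thesis .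
qed

lemma nn_integral_split:
  assumes [measurable]: "f \<in> borel_measurable (borel :: real measure)" and "a \<le> b" "b \<le> c"
  shows "(\<integral>\<^sup>+x. f x * indicator {a<..c} x \<partial>lborel) = (\<integral>\<^sup>+x. f x * indicator {a<..b} x \<partial>lborel) + (\<integral>\<^sup>+x. f x * indicator {b<..c} x \<partial>lborel)"
  using assms by (subst nn_integral_add[symmetric]) (auto intro!: nn_integral_cong simp: indicator_def)

lemma cis_circle_measurable:
  assumes "f \<in> borel_measurable \<mu>"
  shows "(\<lambda>x. f (cis x)) \<in> borel_measurable borel"
proof -
  have "f \<in> borel_measurable (restrict_space borel (sphere 0 1))"
    using assms by (simp cong: measurable_cong_sets add: sets_circle)
  then show ?thesis by measurable
qed

lemma nn_integral_circle_rotate: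
  assumes f[measurable]: "f \<in> borel_measurable \<mu>" and u: "norm u = 1"
  shows "(\<integral>\<^sup>+t. f (u * t) \<partial>\<mu>) = (\<integral>\<^sup>+t. f t \<partial>\<mu>)"
proof -
  obtain a where a: "u = cis a" "0 \<le> a" "a \<le> 2 * pi"
  proof -
    obtain a where "0 \<le> a" "a < 2 * pi" "u = complex_of_real (norm u) * cis a"
      using complex_unimodular_polar[OF u] by (metis cis.ctr complex_eq_iff complex.sel mult_1 of_real_1 u cis.sel)
    then show thesis using that u by auto
  qed
  define F where "F x = f (cis x)" for x
  have [measurable]: "F \<in> borel_measurable borel" unfolding F_def[abs_def] by (rule cis_circle_measurable[OF f])
  have per: "F (2 * pi + x) = F x" for x by (simp add: F_def cis_conv_exp algebra_simps exp_add)
  have fu: "(\<lambda>t. f (u * t)) \<in> borel_measurable \<mu>"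
  proof (rule measurable_compose[OF _ f])
    have "(\<lambda>t. u * t) \<in> measurable \<mu> (restrict_space borel (sphere 0 1))"
      by (intro measurable_restrict_space2) (auto simp: norm_mult u)
    then show "(\<lambda>t. u * t) \<in> measurable \<mu> \<mu>"
      using measurable_cong_sets[OF refl sets_circle, of \<mu>] by simp
  qed
  have "(\<integral>\<^sup>+x. f (u * cis x) * indicator {-pi<..pi} x \<partial>lborel) = (\<integral>\<^sup>+x. F (a + x) * indicator {-pi+a-a<..pi+a-a} x \<partial>lborel)"
    by (intro nn_integral_cong) (simp add: F_def a cis_mult)
  also have "\<dots> = (\<integral>\<^sup>+x. F x * indicator {-pi+a<..pi+a} x \<partial>lborel)"
    by (rule nn_integral_shift[symmetric]) simp
  \<comment> \<open>The shifted interval is cut at pi, and the overhanging piece is moved back by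
    one period.\<close>
  also have "\<dots> = (\<integral>\<^sup>+x. F x * indicator {-pi+a<..pi} x \<partial>lborel) + (\<integral>\<^sup>+x. F x * indicator {pi<..pi+a} x \<partial>lborel)"
    using a by (intro nn_integral_split) auto
  also have "(\<integral>\<^sup>+x. F x * indicator {pi<..pi+a} x \<partial>lborel) = (\<integral>\<^sup>+x. F (2 * pi + x) * indicator {pi-2*pi<..pi+a-2*pi} x \<partial>lborel)"
    by (rule nn_integral_shift) simp
  also have "\<dots> = (\<integral>\<^sup>+x. F x * indicator {-pi<..-pi+a} x \<partial>lborel)"
    unfolding per by (simp add: algebra_simps)
  also have "(\<integral>\<^sup>+x. F x * indicator {-pi+a<..pi} x \<partial>lborel) + (\<integral>\<^sup>+x. F x * indicator {-pi<..-pi+a} x \<partial>lborel)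
     = (\<integral>\<^sup>+x. F x * indicator {-pi<..pi} x \<partial>lborel)"
    using a by (subst nn_integral_split[of F "-pi" "-pi+a" pi]) (auto simp: add.commute)
  finally show ?thesis
    using nn_integral_circle[OF fu] nn_integral_circle[OF f] by (simp add: F_def)
qed

text \<open>Splitting at \<open>x\<close>: the inner part converges because \<open>e > -1\<close>,
  the outer part because \<open>e < 0\<close>, and both scale like \<open>x powr e\<close>.\<close>

lemma nn_integral_power_max:
  fixes e x :: real
  assumes e: "-1 < e" "e < 0" and x: "x > 0"
  shows "(\<integral>\<^sup>+\<theta>. ennreal (\<bar>\<theta>\<bar> powr e / max x \<bar>\<theta>\<bar>) \<partial>lborel) \<le> ennreal (2 * (1 / (e + 1) + 1 / (-e)) * x powr e)"
proof -
  define k where "k \<theta> = ennreal (\<bar>\<theta>\<bar> powr e / max x \<bar>\<theta>\<bar>)" for \<theta> :: real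
  have [measurable]: "k \<in> borel_measurable borel" unfolding k_def[abs_def] by measurable
  have "(\<integral>\<^sup>+\<theta>. k \<theta> \<partial>lborel) \<le> (\<integral>\<^sup>+\<theta>. k \<theta> * indicator {0..} \<theta> + k \<theta> * indicator {..0} \<theta> \<partial>lborel)"
    by (intro nn_integral_mono) (auto simp: indicator_def)
  also have "\<dots> = (\<integral>\<^sup>+\<theta>. k \<theta> * indicator {0..} \<theta> \<partial>lborel) + (\<integral>\<^sup>+\<theta>. k \<theta> * indicator {..0} \<theta> \<partial>lborel)"
    by (intro nn_integral_add) auto
  also have "(\<integral>\<^sup>+\<theta>. k \<theta> * indicator {..0} \<theta> \<partial>lborel) = (\<integral>\<^sup>+\<theta>. k (- \<theta>) * indicator {..0} (- \<theta>) \<partial>lborel)"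
    using nn_integral_real_affine[of "\<lambda>\<theta>. k \<theta> * indicator {..0} \<theta>" "-1" 0] by simp
  also have "\<dots> = (\<integral>\<^sup>+\<theta>. k \<theta> * indicator {0..} \<theta> \<partial>lborel)"
    by (intro nn_integral_cong) (auto simp: k_def indicator_def)
  finally have 1: "(\<integral>\<^sup>+\<theta>. k \<theta> \<partial>lborel) \<le> (\<integral>\<^sup>+\<theta>. k \<theta> * indicator {0..} \<theta> \<partial>lborel) + (\<integral>\<^sup>+\<theta>. k \<theta> * indicator {0..} \<theta> \<partial>lborel)" .
  have res: "((\<lambda>\<theta>. indicator S \<theta> * u \<theta>) has_integral I) UNIV" if "(u has_integral I) S" for S I and u :: "real \<Rightarrow> real"
  proof -
    have "(\<lambda>\<theta>. indicator S \<theta> * u \<theta>) = (\<lambda>\<theta>. if \<theta> \<in> S then u \<theta> else 0)" by (auto simp: indicator_def)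
    then show ?thesis using that by (simp only: has_integral_restrict_UNIV)
  qed
  have i1: "((\<lambda>\<theta>. \<theta> powr e / x) has_integral (x powr (e + 1) / (e + 1) / x)) {0..x}"
    using has_integral_divide[OF has_integral_powr_from_0[of e x], of x] e x by simp
  have i2: "((\<lambda>\<theta>. \<theta> powr (e - 1)) has_integral (- (x powr (e - 1 + 1) / (e - 1 + 1)))) {x..}"
    using has_integral_powr_to_inf[of "e - 1" x] e x by simp
  have "(\<integral>\<^sup>+\<theta>. k \<theta> * indicator {0..} \<theta> \<partial>lborel) \<le> (\<integral>\<^sup>+\<theta>. ennreal (indicator {0..x} \<theta> * (\<theta> powr e / x)) + ennreal (indicator {x..} \<theta> * (\<theta> powr (e - 1))) \<partial>lborel)"
  proof (intro nn_integral_mono)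
    fix \<theta> :: real
    show "k \<theta> * indicator {0..} \<theta> \<le> ennreal (indicator {0..x} \<theta> * (\<theta> powr e / x)) + ennreal (indicator {x..} \<theta> * (\<theta> powr (e - 1)))"
    proof (cases "0 \<le> \<theta> \<and> \<theta> \<le> x")
      case True
      then show ?thesis by (auto simp: k_def indicator_def max_def)
    next
      case False
      then show ?thesis using x by (auto simp: k_def indicator_def max_def powr_diff)
    qed
  qed
  also have "\<dots> = (\<integral>\<^sup>+\<theta>. ennreal (indicator {0..x} \<theta> * (\<theta> powr e / x)) \<partial>lborel) + (\<integral>\<^sup>+\<theta>. ennreal (indicator {x..} \<theta> * (\<theta> powr (e - 1))) \<partial>lborel)"
    by (intro nn_integral_add) auto
  also have "(\<integral>\<^sup>+\<theta>. ennreal (indicator {0..x} \<theta> * (\<theta> powr e / x)) \<partial>lborel) = ennreal (x powr (e + 1) / (e + 1) / x)"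
    by (rule nn_integral_has_integral_lborel[OF _ _ res[OF i1]]) (use x in auto)
  also have "(\<integral>\<^sup>+\<theta>. ennreal (indicator {x..} \<theta> * (\<theta> powr (e - 1))) \<partial>lborel) = ennreal (- (x powr (e - 1 + 1) / (e - 1 + 1)))"
    by (rule nn_integral_has_integral_lborel[OF _ _ res[OF i2]]) auto
  also have "ennreal (x powr (e + 1) / (e + 1) / x) + ennreal (- (x powr (e - 1 + 1) / (e - 1 + 1))) = ennreal ((1 / (e + 1) + 1 / (-e)) * x powr e)"
  proof -
    have "x powr (e + 1) / (e + 1) / x = x powr e / (e + 1)" using x by (simp add: powr_add)
    moreover have "- (x powr (e - 1 + 1) / (e - 1 + 1)) = x powr e / (- e)" by simp
    moreover have "ennreal (x powr e / (e + 1)) + ennreal (x powr e / (- e)) = ennreal (x powr e / (e + 1) + x powr e / (- e))"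
      by (rule ennreal_plus[symmetric]) (use e in \<open>auto intro!: divide_nonneg_neg\<close>)
    moreover have "x powr e / (e + 1) + x powr e / (- e) = (1 / (e + 1) + 1 / (- e)) * x powr e"
      unfolding distrib_right by simp
    ultimately show ?thesis by metis
  qed
  finally have 2: "(\<integral>\<^sup>+\<theta>. k \<theta> * indicator {0..} \<theta> \<partial>lborel) \<le> ennreal ((1 / (e + 1) + 1 / (-e)) * x powr e)" .
  have "(\<integral>\<^sup>+\<theta>. k \<theta> \<partial>lborel) \<le> ennreal ((1 / (e + 1) + 1 / (-e)) * x powr e) + ennreal ((1 / (e + 1) + 1 / (-e)) * x powr e)"
    using 1 2 by (meson add_mono order_trans)
  also have "\<dots> = ennreal (2 * (1 / (e + 1) + 1 / (-e)) * x powr e)"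
  proof -
    have "0 \<le> 1 / (e + 1)" "0 \<le> 1 / (- e)" using e by auto
    then have "0 \<le> (1 / (e + 1) + 1 / (- e)) * x powr e" by (intro mult_nonneg_nonneg add_nonneg_nonneg) auto
    from ennreal_plus[OF this this] show ?thesis by (simp only: mult.assoc mult_2[symmetric])
  qed
  finally show ?thesis unfolding k_def .
qed

text \<open>The chord has length \<open>2 * |sin (\<theta> / 2)|\<close>, and Jordan's inequality
  follows from the concavity of the sine on [0, pi].\<close>

lemma norm_cis_minus_one_ge:
  assumes "\<bar>\<theta>\<bar> \<le> pi"
  shows "2 / pi * \<bar>\<theta>\<bar> \<le> norm (cis \<theta> - 1)"
proof -
  have 1: "norm (cis \<theta> - 1) = 2 * \<bar>sin (\<theta> / 2)\<bar>"
  proof -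
    have "(norm (cis \<theta> - 1))\<^sup>2 = (cos \<theta> - 1)\<^sup>2 + (sin \<theta>)\<^sup>2" by (simp add: cmod_power2)
    also have "\<dots> = 2 - 2 * cos \<theta>" using sin_cos_squared_add[of \<theta>] by (simp add: power2_eq_square algebra_simps)
    also have "cos \<theta> = 1 - 2 * (sin (\<theta> / 2))\<^sup>2" using cos_double_sin[of "\<theta> / 2"] by simp
    finally have "(norm (cis \<theta> - 1))\<^sup>2 = (2 * \<bar>sin (\<theta> / 2)\<bar>)\<^sup>2" by (simp add: power_mult_distrib)
    then show ?thesis by (rule power2_eq_imp_eq) auto
  qed
  have jordan: "2 / pi * y \<le> sin y" if "0 \<le> y" "y \<le> pi / 2" for y
  proof -
    have "concave_on {0..pi} sin"
    proof (rule f''_le0_imp_concave)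
      show "((\<lambda>x. sin x) has_real_derivative cos x) (at x)" for x by (auto intro!: derivative_eq_intros)
      show "(cos has_real_derivative - sin x) (at x)" for x by (auto intro!: derivative_eq_intros)
      show "- sin x \<le> 0" if "x \<in> {0..pi}" for x using that sin_ge_zero by auto
    qed simp
    from concave_onD[OF this, of "2 / pi * y" 0 "pi / 2"] that
    have "(1 - 2 / pi * y) * sin 0 + (2 / pi * y) * sin (pi / 2) \<le> sin ((1 - 2 / pi * y) *\<^sub>R 0 + (2 / pi * y) *\<^sub>R (pi / 2))"
      by (simp add: field_simps)
    then show ?thesis by simp
  qed
  have "2 / pi * (\<bar>\<theta>\<bar> / 2) \<le> sin (\<bar>\<theta>\<bar> / 2)" using assms by (intro jordan) auto
  also have "\<dots> \<le> \<bar>sin (\<theta> / 2)\<bar>" by (cases "\<theta> \<ge> 0") auto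
  finally show ?thesis unfolding 1 by simp
qed

text \<open>Rotation moves \<tau> to 1, and since chord and arc are comparable the estimate on the
  line applies. The constant is uniform in \<tau> and \<open>x\<close>, as the Schur test
  requires.\<close>

lemma circle_kernel_integral:
  assumes e: "-1 < e" "e < (0::real)"
  obtains C where "C \<ge> 0"
    "\<And>\<tau> x. norm \<tau> = 1 \<Longrightarrow> x > 0 \<Longrightarrow> (\<integral>\<^sup>+s. ennreal (norm (s - \<tau>) powr e / max x (norm (s - \<tau>))) \<partial>\<mu>) \<le> ennreal (C * x powr e)"
proof -
  \<comment> \<open>The first factor pays for replacing the chord by the arc in the numerator,
    \<open>pi / 2\<close> for doing so in the denominator.\<close>
  define C0 where "C0 = (2 / pi) powr e * (pi / 2)"
  define C where "C = C0 * (2 * (1 / (e + 1) + 1 / (-e)))"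
  have C0: "C0 \<ge> 0" by (simp add: C0_def)
  have C: "C \<ge> 0" using C0 e unfolding C_def by (intro mult_nonneg_nonneg add_nonneg_nonneg) auto
  have "(\<integral>\<^sup>+s. ennreal (norm (s - \<tau>) powr e / max x (norm (s - \<tau>))) \<partial>\<mu>) \<le> ennreal (C * x powr e)"
    if \<tau>: "norm \<tau> = 1" and x: "x > 0" for \<tau> x
  proof -
    define F where "F s = ennreal (norm (s - 1) powr e / max x (norm (s - 1)))" for s :: complex
    have [measurable]: "F \<in> borel_measurable \<mu>" unfolding F_def[abs_def] by measurable
    have "(\<integral>\<^sup>+s. ennreal (norm (s - \<tau>) powr e / max x (norm (s - \<tau>))) \<partial>\<mu>) = (\<integral>\<^sup>+s. F (cnj \<tau> * s) \<partial>\<mu>)"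
    proof (intro nn_integral_cong)
      fix s :: complex
      have "norm (s - \<tau>) = norm (cnj \<tau> * (s - \<tau>))" by (simp add: norm_mult \<tau>)
      also have "cnj \<tau> * (s - \<tau>) = cnj \<tau> * s - 1" using \<tau> by (simp add: algebra_simps complex_norm_square[symmetric])
      finally show "ennreal (norm (s - \<tau>) powr e / max x (norm (s - \<tau>))) = F (cnj \<tau> * s)" by (simp add: F_def)
    qed
    also have "\<dots> = (\<integral>\<^sup>+s. F s \<partial>\<mu>)" by (rule nn_integral_circle_rotate) (auto simp: \<tau>)
    also have "\<dots> = (\<integral>\<^sup>+\<theta>. F (cis \<theta>) * indicator {-pi<..pi} \<theta> \<partial>lborel) / ennreal (2*pi)" by (rule nn_integral_circle) simp
    \<comment> \<open>Dropping the normalization only enlarges the value, since 2 pi is at least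
      1.\<close>
    also have "\<dots> \<le> (\<integral>\<^sup>+\<theta>. F (cis \<theta>) * indicator {-pi<..pi} \<theta> \<partial>lborel)"
    proof (rule divide_le_posI_ennreal)
      have "1 \<le> ennreal (2 * pi)" using pi_gt3 by (subst ennreal_1[symmetric], intro ennreal_leI) simp
      then show "(\<integral>\<^sup>+\<theta>. F (cis \<theta>) * indicator {-pi<..pi} \<theta> \<partial>lborel)
          \<le> ennreal (2 * pi) * (\<integral>\<^sup>+\<theta>. F (cis \<theta>) * indicator {-pi<..pi} \<theta> \<partial>lborel)"
        using mult_right_mono[of 1 "ennreal (2 * pi)"] by simp
    qed (simp add: pi_gt_zero)
    also have "\<dots> \<le> (\<integral>\<^sup>+\<theta>. ennreal C0 * ennreal (\<bar>\<theta>\<bar> powr e / max x \<bar>\<theta>\<bar>) \<partial>lborel)"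
    proof (intro nn_integral_mono)
      fix \<theta> :: real
      show "F (cis \<theta>) * indicator {-pi<..pi} \<theta> \<le> ennreal C0 * ennreal (\<bar>\<theta>\<bar> powr e / max x \<bar>\<theta>\<bar>)"
      proof (cases "\<theta> \<in> {-pi<..pi} \<and> \<theta> \<noteq> 0")
        case True
        then have a: "2 / pi * \<bar>\<theta>\<bar> \<le> norm (cis \<theta> - 1)" by (intro norm_cis_minus_one_ge) auto
        have pos: "2 / pi * \<bar>\<theta>\<bar> > 0" using True by simp
        have "norm (cis \<theta> - 1) powr e \<le> (2 / pi * \<bar>\<theta>\<bar>) powr e"
          using a pos e by (intro powr_mono2') auto
        also have "\<dots> = (2 / pi) powr e * \<bar>\<theta>\<bar> powr e" by (rule powr_mult)
        finally have b: "norm (cis \<theta> - 1) powr e \<le> (2 / pi) powr e * \<bar>\<theta>\<bar> powr e" .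
        have "2 / pi * max x \<bar>\<theta>\<bar> \<le> max x (norm (cis \<theta> - 1))"
        proof -
          have "2 / pi * x \<le> 1 * x" using x pi_gt3 by (intro mult_right_mono) auto
          then show ?thesis using a by (auto simp: max_def)
        qed
        then have "norm (cis \<theta> - 1) powr e / max x (norm (cis \<theta> - 1)) \<le> ((2 / pi) powr e * \<bar>\<theta>\<bar> powr e) / (2 / pi * max x \<bar>\<theta>\<bar>)"
          using b x by (intro frac_le) auto
        also have "\<dots> = C0 * (\<bar>\<theta>\<bar> powr e / max x \<bar>\<theta>\<bar>)" by (simp add: C0_def)
        finally have "F (cis \<theta>) \<le> ennreal (C0 * (\<bar>\<theta>\<bar> powr e / max x \<bar>\<theta>\<bar>))" unfolding F_def by (rule ennreal_leI)
        also have "\<dots> = ennreal C0 * ennreal (\<bar>\<theta>\<bar> powr e / max x \<bar>\<theta>\<bar>)" using C0 by (rule ennreal_mult')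
        finally show ?thesis using True by simp
      next
        case False
        then have "\<theta> = 0 \<or> \<theta> \<notin> {-pi<..pi}" by blast
        then show ?thesis
        proof
          assume "\<theta> = 0"
          then have "F (cis \<theta>) = 0" by (simp add: F_def)
          then show ?thesis by simp
        next
          assume "\<theta> \<notin> {-pi<..pi}"
          then have "indicator {-pi<..pi} \<theta> = (0::ennreal)" by (rule indicator_simps(2))
          then show ?thesis by (simp only: mult_zero_right zero_le)
        qed
      qed
    qed
    also have "\<dots> = ennreal C0 * (\<integral>\<^sup>+\<theta>. ennreal (\<bar>\<theta>\<bar> powr e / max x \<bar>\<theta>\<bar>) \<partial>lborel)"
      by (rule nn_integral_cmult) simp
    also have "\<dots> \<le> ennreal C0 * ennreal (2 * (1 / (e + 1) + 1 / (-e)) * x powr e)"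
      by (intro mult_left_mono nn_integral_power_max e x) auto
    also have "\<dots> = ennreal (C * x powr e)"
      using C0 by (subst ennreal_mult'[symmetric]) (auto simp: C_def mult_ac)
    finally show ?thesis .
  qed
  with C that show thesis by blast
qed

lemma AE_circle_neq: "AE t in \<mu>. t \<noteq> \<tau>"
proof -
  have "AE x in lborel. x \<notin> {Arg \<tau>}" by (rule AE_not_in) (rule finite_imp_null_set_lborel, simp)
  then have "AE x in lborel. x \<in> {-pi<..pi} \<longrightarrow> cis x \<noteq> \<tau>"
  proof eventually_elim
    case (elim x)
    then show ?case using Arg_unique[of 1 x \<tau>] by (auto simp: cis_conv_exp)
  qed
  then show ?thesis by (subst AE_circle_iff) auto
qed

lemma dist_power_Lp:
  assumes \<tau>: "norm \<tau> = 1" and p: "p > 0" and e: "e * p > -1"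
  shows "(\<lambda>t. complex_of_real (norm (t - \<tau>) powr e)) \<in> Lp p"
proof (cases "e \<ge> 0")
  case True
  show ?thesis
  proof (rule Lp_bounded(1)[OF p, where C="2 powr e"])
    show "AE t in \<mu>. norm (complex_of_real (norm (t - \<tau>) powr e)) \<le> 2 powr e"
    proof (intro AE_I2)
      fix t assume "t \<in> space \<mu>"
      then have "norm (t - \<tau>) \<le> 2" using norm_triangle_ineq4[of t \<tau>] \<tau> by simp
      then show "norm (complex_of_real (norm (t - \<tau>) powr e)) \<le> 2 powr e" using True by (simp add: powr_mono2)
    qed
  qed auto
next
  case False
  then have ep: "-1 < e * p" "e * p < 0" using e p by (auto simp: mult_neg_pos)
  obtain C where C: "C \<ge> 0" "\<And>\<tau> x. norm \<tau> = 1 \<Longrightarrow> x > 0 \<Longrightarrow> (\<integral>\<^sup>+s. ennreal (norm (s - \<tau>) powr (e*p) / max x (norm (s - \<tau>))) \<partial>\<mu>) \<le> ennreal (C * x powr (e*p))"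
    using circle_kernel_integral[OF ep] by metis
  have m: "(\<lambda>t. complex_of_real (norm (t - \<tau>) powr e)) \<in> borel_measurable \<mu>" by measurable
  \<comment> \<open>Distances on the circle are at most 2, so for \<open>x = 2\<close> the maximum
    in the kernel is constant and the kernel estimate becomes a bound for the plain power.\<close>
  have "(\<integral>\<^sup>+t. ennreal (norm (complex_of_real (norm (t - \<tau>) powr e)) powr p) \<partial>\<mu>) \<le> (\<integral>\<^sup>+s. ennreal 2 * ennreal (norm (s - \<tau>) powr (e*p) / max 2 (norm (s - \<tau>))) \<partial>\<mu>)"
  proof (intro nn_integral_mono)
    fix t assume "t \<in> space \<mu>"
    then have "norm (t - \<tau>) \<le> 2" using norm_triangle_ineq4[of t \<tau>] \<tau> by simp
    then have "max 2 (norm (t - \<tau>)) = 2" by simp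
    then show "ennreal (norm (complex_of_real (norm (t - \<tau>) powr e)) powr p) \<le> ennreal 2 * ennreal (norm (t - \<tau>) powr (e*p) / max 2 (norm (t - \<tau>)))"
      by (subst ennreal_mult'[symmetric]) (auto simp: powr_powr)
  qed
  also have "\<dots> = ennreal 2 * (\<integral>\<^sup>+s. ennreal (norm (s - \<tau>) powr (e*p) / max 2 (norm (s - \<tau>))) \<partial>\<mu>)"
    by (rule nn_integral_cmult) measurable
  also have "\<dots> \<le> ennreal 2 * ennreal (C * 2 powr (e*p))" by (intro mult_left_mono C \<tau>) auto
  also have "\<dots> = ennreal (((2 * (C * 2 powr (e*p))) powr (1/p)) powr p)"
    using C p by (subst ennreal_mult'[symmetric]) (auto simp: powr_powr)
  finally show ?thesis by (rule LpI_nn_integral(1)[OF m p powr_ge_zero])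
qed

section \<open>Complex powers with a singular point on the circle\<close>

definition cpow :: "complex \<Rightarrow> complex \<Rightarrow> complex \<Rightarrow> complex" where
  "cpow \<tau> \<beta> t = exp (\<beta> * Ln (1 - t / \<tau>))"

text \<open>On the circle the conjugate of \<open>1 - t / \<tau>\<close> is
  \<open>1 - \<tau> / t\<close>. Conjugating the exponent as well makes this the power of
  \<open>1 - \<tau> / t\<close> with exponent \<beta>, the counterpart of \<open>cpow\<close> that
  is analytic outside the disc.\<close>

definition ccpow :: "complex \<Rightarrow> complex \<Rightarrow> complex \<Rightarrow> complex" where
  "ccpow \<tau> \<beta> t = cnj (cpow \<tau> (cnj \<beta>) t)"

lemma cpow_nonzero [simp]: "cpow \<tau> \<beta> t \<noteq> 0" "ccpow \<tau> \<beta> t \<noteq> 0"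
  by (auto simp: cpow_def ccpow_def)

lemma cpow_add: "cpow \<tau> (\<alpha> + \<beta>) t = cpow \<tau> \<alpha> t * cpow \<tau> \<beta> t" "ccpow \<tau> (\<alpha> + \<beta>) t = ccpow \<tau> \<alpha> t * ccpow \<tau> \<beta> t"
  by (auto simp: cpow_def ccpow_def algebra_simps exp_add)

lemma cpow_minus: "cpow \<tau> (- \<beta>) t = inverse (cpow \<tau> \<beta> t)" "ccpow \<tau> (- \<beta>) t = inverse (ccpow \<tau> \<beta> t)"
  by (auto simp: cpow_def ccpow_def exp_minus)

lemma cpow_zero [simp]: "cpow \<tau> 0 t = 1" "ccpow \<tau> 0 t = 1"
  by (auto simp: cpow_def ccpow_def)

lemma norm_exp_Ln:
  assumes "w \<noteq> 0"
  shows "norm (exp (\<beta> * Ln w)) = norm w powr Re \<beta> * exp (- (Im \<beta> * Arg w))"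
  using assms by (simp add: Arg_eq_Im_Ln powr_def exp_add[symmetric] algebra_simps exp_diff exp_minus divide_inverse)

text \<open>The imaginary part of the exponent contributes only an exponential of the argument,
  which is bounded in both directions. For questions of size \<open>Re \<beta>\<close> alone
  counts.\<close>

lemma norm_exp_Ln_bounds:
  assumes "w \<noteq> 0"
  shows "norm (exp (\<beta> * Ln w)) \<le> exp (pi * \<bar>Im \<beta>\<bar>) * norm w powr Re \<beta>"
    "norm w powr Re \<beta> \<le> exp (pi * \<bar>Im \<beta>\<bar>) * norm (exp (\<beta> * Ln w))"
proof -
  have "\<bar>Im \<beta> * Arg w\<bar> \<le> \<bar>Im \<beta>\<bar> * pi"
    unfolding abs_mult using mpi_less_Arg[of w] Arg_le_pi[of w] by (intro mult_left_mono) auto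
  then have b: "- (Im \<beta> * Arg w) \<le> pi * \<bar>Im \<beta>\<bar>" "Im \<beta> * Arg w \<le> pi * \<bar>Im \<beta>\<bar>" by (auto simp: mult.commute)
  show "norm (exp (\<beta> * Ln w)) \<le> exp (pi * \<bar>Im \<beta>\<bar>) * norm w powr Re \<beta>"
    unfolding norm_exp_Ln[OF assms] using b(1) by (subst mult.commute, intro mult_right_mono) auto
  have "1 \<le> exp (pi * \<bar>Im \<beta>\<bar>) * exp (- (Im \<beta> * Arg w))" using b(2) by (simp flip: exp_add)
  then have "norm w powr Re \<beta> * 1 \<le> norm w powr Re \<beta> * (exp (pi * \<bar>Im \<beta>\<bar>) * exp (- (Im \<beta> * Arg w)))"
    by (intro mult_left_mono) auto
  then show "norm w powr Re \<beta> \<le> exp (pi * \<bar>Im \<beta>\<bar>) * norm (exp (\<beta> * Ln w))"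
    unfolding norm_exp_Ln[OF assms] by (simp add: mult_ac)
qed

lemma norm_one_minus_div:
  fixes \<tau> t :: complex
  assumes \<tau>: "norm \<tau> = 1"
  shows "norm (1 - t / \<tau>) = norm (t - \<tau>)"
proof -
  from \<tau> have "\<tau> \<noteq> 0" by auto
  then have "1 - t / \<tau> = (\<tau> - t) / \<tau>" by (simp add: diff_divide_distrib)
  then show ?thesis by (simp add: norm_divide \<tau> norm_minus_commute)
qed

lemma norm_cpow_le:
  assumes "norm \<tau> = 1" "t \<noteq> \<tau>"
  shows "norm (cpow \<tau> \<beta> t) \<le> exp (pi * \<bar>Im \<beta>\<bar>) * norm (t - \<tau>) powr Re \<beta>"
    "norm (t - \<tau>) powr Re \<beta> \<le> exp (pi * \<bar>Im \<beta>\<bar>) * norm (cpow \<tau> \<beta> t)"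
    "norm (ccpow \<tau> \<beta> t) \<le> exp (pi * \<bar>Im \<beta>\<bar>) * norm (t - \<tau>) powr Re \<beta>"
    "norm (t - \<tau>) powr Re \<beta> \<le> exp (pi * \<bar>Im \<beta>\<bar>) * norm (ccpow \<tau> \<beta> t)"
proof -
  have w: "1 - t / \<tau> \<noteq> 0" using assms by (auto simp: field_simps)
  show "norm (cpow \<tau> \<beta> t) \<le> exp (pi * \<bar>Im \<beta>\<bar>) * norm (t - \<tau>) powr Re \<beta>"
    "norm (t - \<tau>) powr Re \<beta> \<le> exp (pi * \<bar>Im \<beta>\<bar>) * norm (cpow \<tau> \<beta> t)"
    "norm (ccpow \<tau> \<beta> t) \<le> exp (pi * \<bar>Im \<beta>\<bar>) * norm (t - \<tau>) powr Re \<beta>"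
    "norm (t - \<tau>) powr Re \<beta> \<le> exp (pi * \<bar>Im \<beta>\<bar>) * norm (ccpow \<tau> \<beta> t)"
    using norm_exp_Ln_bounds[OF w, of \<beta>] norm_exp_Ln_bounds[OF w, of "cnj \<beta>"]
    by (auto simp: cpow_def ccpow_def norm_one_minus_div[OF assms(1)])
qed

text \<open>Keeps \<open>1 - z / \<tau>\<close> off the cut of the principal logarithm, for
  analyticity in the disc and for continuity up to the circle away from \<tau>.\<close>

lemma Re_one_minus_div_pos:
  assumes "norm \<tau> = 1" "norm z \<le> 1" "z \<noteq> \<tau>"
  shows "Re (1 - z / \<tau>) > 0"
proof -
  have n: "norm (z / \<tau>) \<le> 1" using assms by (simp add: norm_divide)
  have "Re (z / \<tau>) < 1"
  proof (rule ccontr)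
    assume "\<not> Re (z / \<tau>) < 1"
    then have r: "Re (z / \<tau>) \<ge> 1" by simp
    have "Re (z / \<tau>) = 1" using r n complex_Re_le_cmod[of "z / \<tau>"] by linarith
    moreover have "(norm (z / \<tau>))\<^sup>2 \<le> 1" using n by (intro power_le_one) auto
    then have "(Im (z / \<tau>))\<^sup>2 \<le> 0" using \<open>Re (z / \<tau>) = 1\<close> unfolding cmod_power2 by simp
    then have "Im (z / \<tau>) = 0" by simp
    ultimately have "z / \<tau> = 1" by (simp add: complex_eq_iff)
    then show False using assms by (auto simp: divide_eq_1_iff split: if_splits)
  qed
  then show ?thesis by simp
qed

lemma cpow_holomorphic:
  assumes "norm \<tau> = 1"
  shows "cpow \<tau> \<beta> holomorphic_on ball 0 1"
  unfolding cpow_def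
proof (intro holomorphic_intros)
  fix z :: complex assume "z \<in> ball 0 1"
  then have z: "norm z < 1" by simp
  then have "z \<noteq> \<tau>" using assms by (metis less_irrefl)
  then have "Re (1 - z / \<tau>) > 0" using z assms by (intro Re_one_minus_div_pos) auto
  then show "1 - z / \<tau> \<notin> \<real>\<^sub>\<le>\<^sub>0" by (simp add: complex_nonpos_Reals_iff del: minus_complex.sel)
qed (use assms in auto)

lemma cpow_0: "cpow \<tau> \<beta> 0 = 1"
  by (simp add: cpow_def)

lemma cpow_radial_tendsto:
  assumes \<tau>: "norm \<tau> = 1" and t: "norm t = 1" "t \<noteq> \<tau>" and r: "r \<longlonglongrightarrow> (1::real)"
  shows "(\<lambda>n. cpow \<tau> \<beta> (of_real (r n) * t)) \<longlonglongrightarrow> cpow \<tau> \<beta> t"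
proof -
  have "1 - t / \<tau> \<notin> \<real>\<^sub>\<le>\<^sub>0"
    using Re_one_minus_div_pos[OF \<tau>, of t] t by (auto simp: complex_nonpos_Reals_iff)
  moreover have "\<tau> \<noteq> 0" using \<tau> by auto
  then have "(\<lambda>n. 1 - of_real (r n) * t / \<tau>) \<longlonglongrightarrow> 1 - of_real 1 * t / \<tau>"
    by (intro tendsto_diff tendsto_const tendsto_divide tendsto_mult tendsto_of_real r) 
  then have "(\<lambda>n. 1 - of_real (r n) * t / \<tau>) \<longlonglongrightarrow> 1 - t / \<tau>" by simp
  ultimately show ?thesis unfolding cpow_def by (intro tendsto_exp tendsto_mult tendsto_const tendsto_Ln)
qed

lemma cpow_measurable [measurable]: 
  assumes "norm \<tau> = 1"
  shows "cpow \<tau> \<beta> \<in> borel_measurable \<mu>"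
proof -
  have "cpow \<tau> \<beta> \<in> borel_measurable (restrict_space borel (sphere 0 1))"
  proof (rule measurable_restrict_countable[where X="{\<tau>}"])
    have "continuous_on (sphere 0 1 - {\<tau>}) (cpow \<tau> \<beta>)"
      unfolding cpow_def
    proof (intro continuous_intros)
      fix z :: complex assume "z \<in> sphere 0 1 - {\<tau>}"
      then show "1 - z / \<tau> \<notin> \<real>\<^sub>\<le>\<^sub>0"
        using Re_one_minus_div_pos[OF assms, of z] by (auto simp: complex_nonpos_Reals_iff)
    qed (use assms in auto)
    then have "cpow \<tau> \<beta> \<in> borel_measurable (restrict_space borel (sphere 0 1 - {\<tau>}))"
      by (rule borel_measurable_continuous_on_restrict)
    then show "cpow \<tau> \<beta> \<in> borel_measurable (restrict_space (restrict_space borel (sphere 0 1)) (- {\<tau>}))"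
      by (subst restrict_restrict_space) (auto simp: Diff_eq)
  qed (use assms in \<open>auto simp: sets_restrict_space_iff\<close>)
  then show ?thesis by (simp cong: measurable_cong_sets add: sets_circle)
qed

lemma ccpow_measurable [measurable]:
  assumes "norm \<tau> = 1"
  shows "ccpow \<tau> \<beta> \<in> borel_measurable \<mu>"
  unfolding ccpow_def[abs_def] using cpow_measurable[OF assms] by measurable

lemma cpow_Lp:
  assumes \<tau>: "norm \<tau> = 1" and p: "p > 0" "Re \<beta> * p > -1"
  shows "cpow \<tau> \<beta> \<in> Lp p" "ccpow \<tau> \<beta> \<in> Lp p"
proof -
  note L = dist_power_Lp[OF \<tau> p]
  show "cpow \<tau> \<beta> \<in> Lp p"
  proof (rule Lp_bound(1)[OF p(1) L, of "exp (pi * \<bar>Im \<beta>\<bar>)"])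
    show "AE t in \<mu>. norm (cpow \<tau> \<beta> t) \<le> exp (pi * \<bar>Im \<beta>\<bar>) * norm (complex_of_real (norm (t - \<tau>) powr Re \<beta>))"
      using AE_circle_neq[of \<tau>] by eventually_elim (use norm_cpow_le[OF \<tau>] in simp)
  qed (use cpow_measurable[OF \<tau>] in auto)
  show "ccpow \<tau> \<beta> \<in> Lp p"
  proof (rule Lp_bound(1)[OF p(1) L, of "exp (pi * \<bar>Im \<beta>\<bar>)"])
    show "AE t in \<mu>. norm (ccpow \<tau> \<beta> t) \<le> exp (pi * \<bar>Im \<beta>\<bar>) * norm (complex_of_real (norm (t - \<tau>) powr Re \<beta>))"
      using AE_circle_neq[of \<tau>] by eventually_elim (use norm_cpow_le[OF \<tau>] in simp)
  qed (use ccpow_measurable[OF \<tau>] in auto)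
qed

text \<open>A majorant independent of \<open>r\<close>: the point \<open>r * t\<close> is at least
  half as far from \<tau> as \<open>t\<close> is, which settles negative exponents, while the
  summand 1 takes care of the others.\<close>

lemma norm_cpow_radial_le:
  assumes \<tau>: "norm \<tau> = 1" and t: "norm t = 1" "t \<noteq> \<tau>" and r: "0 \<le> r" "r < 1"
  shows "norm (cpow \<tau> \<beta> (of_real r * t)) \<le> exp (pi * \<bar>Im \<beta>\<bar>) * 2 powr \<bar>Re \<beta>\<bar> * (1 + norm (t - \<tau>) powr Re \<beta>)"
proof -
  define z where "z = of_real r * t"
  have z: "norm z < 1" using t r by (simp add: z_def norm_mult)
  then have z\<tau>: "z \<noteq> \<tau>" using \<tau> by auto
  have up: "norm (z - \<tau>) \<le> 2" using norm_triangle_ineq4[of z \<tau>] \<tau> z by simp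
  have pos: "norm (z - \<tau>) > 0" using z\<tau> by simp
  have "norm (t - \<tau>) \<le> norm (t - z) + norm (z - \<tau>)" by (metis norm_triangle_ineq add_diff_eq diff_add_cancel)
  moreover have "norm (t - z) = 1 - r"
  proof -
    have "t - z = of_real (1 - r) * t" by (simp add: z_def algebra_simps)
    then show ?thesis using t r by (simp add: norm_mult del: of_real_diff)
  qed
  moreover have "1 - r \<le> norm (z - \<tau>)"
    using norm_triangle_ineq2[of \<tau> z] \<tau> t r by (simp add: z_def norm_mult norm_minus_commute)
  ultimately have lo: "norm (t - \<tau>) \<le> 2 * norm (z - \<tau>)" by linarith
  have tpos: "norm (t - \<tau>) > 0" using t by simp
  have "norm (z - \<tau>) powr Re \<beta> \<le> 2 powr \<bar>Re \<beta>\<bar> * (1 + norm (t - \<tau>) powr Re \<beta>)"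
  proof (cases "Re \<beta> \<ge> 0")
    case True
    have "norm (z - \<tau>) powr Re \<beta> \<le> 2 powr Re \<beta>" using up True by (intro powr_mono2) auto
    also have "\<dots> \<le> 2 powr \<bar>Re \<beta>\<bar> * (1 + norm (t - \<tau>) powr Re \<beta>)" using True by (simp add: algebra_simps)
    finally show ?thesis .
  next
    case False
    have "norm (z - \<tau>) powr Re \<beta> \<le> (norm (t - \<tau>) / 2) powr Re \<beta>" using lo False tpos by (intro powr_mono2') auto
    also have "\<dots> = 2 powr \<bar>Re \<beta>\<bar> * norm (t - \<tau>) powr Re \<beta>"
    proof -
      have "2 powr \<bar>Re \<beta>\<bar> = inverse (2 powr Re \<beta>)" using False by (simp add: powr_minus[symmetric])
      moreover have "(norm (t - \<tau>) / 2) powr Re \<beta> = norm (t - \<tau>) powr Re \<beta> / 2 powr Re \<beta>"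
        by (simp add: powr_divide)
      ultimately show ?thesis by (simp only: divide_inverse mult.commute)
    qed
    also have "\<dots> \<le> 2 powr \<bar>Re \<beta>\<bar> * (1 + norm (t - \<tau>) powr Re \<beta>)" by (simp add: algebra_simps)
    finally show ?thesis .
  qed
  then have "exp (pi * \<bar>Im \<beta>\<bar>) * norm (z - \<tau>) powr Re \<beta> \<le> exp (pi * \<bar>Im \<beta>\<bar>) * (2 powr \<bar>Re \<beta>\<bar> * (1 + norm (t - \<tau>) powr Re \<beta>))"
    by (intro mult_left_mono) auto
  from order_trans[OF norm_cpow_le(1)[OF \<tau> z\<tau>, of \<beta>] this] show ?thesis
    unfolding z_def by (simp only: mult.assoc)
qed

text \<open>For the dilated power the claim is the product rule with an analytic function, and
  dominated convergence removes the dilation. The majorant uses integrability of \<open>g\<close>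
  and of the product itself, so no exponent has to be given away. The zeroth coefficient is kept
  because the power equals 1 at the origin.\<close>

lemma cpow_mult_Hardy1:
  assumes \<tau>: "norm \<tau> = 1" and g: "g \<in> Hardy 1" and i: "(\<lambda>t. cpow \<tau> \<beta> t * g t) \<in> Lp 1"
  shows "(\<lambda>t. cpow \<tau> \<beta> t * g t) \<in> Hardy 1" "fourier_coeff (\<lambda>t. cpow \<tau> \<beta> t * g t) 0 = fourier_coeff g 0"
proof -
  have [measurable]: "g \<in> borel_measurable \<mu>" using HardyD(1)[OF g] by auto
  note [measurable] = cpow_measurable[OF \<tau>]
  obtain r :: "nat \<Rightarrow> real" where r: "\<And>n. 0 \<le> r n" "\<And>n. r n < 1" "r \<longlonglongrightarrow> 1" by (rule abel_radii) blast
  note hol = cpow_holomorphic[OF \<tau>, of \<beta>]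
  define f where "f n t = cpow \<tau> \<beta> (of_real (r n) * t) * g t" for n t
  have cm: "continuous_on (sphere 0 1) (\<lambda>t. cpow \<tau> \<beta> (of_real (r n) * t))" for n
    by (rule continuous_on_compose2[OF holomorphic_on_imp_continuous_on[OF hol]])
       (use r in \<open>auto simp: norm_mult intro!: continuous_intros\<close>)
  have fm[measurable]: "f n \<in> borel_measurable \<mu>" for n
    unfolding f_def[abs_def] using borel_measurable_circle_continuous[OF cm[of n]] by measurable
  define A where "A = exp (pi * \<bar>Im \<beta>\<bar>) * 2 powr \<bar>Re \<beta>\<bar>"
  define B where "B = exp (pi * \<bar>Im \<beta>\<bar>)"
  define w where "w t = complex_of_real (A * norm (g t) + A * (B * norm (cpow \<tau> \<beta> t * g t)))" for t
  have AB: "A \<ge> 0" "B \<ge> 0" by (auto simp: A_def B_def)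
  have gi: "integrable \<mu> g" using HardyD(1)[OF g] Lp_one_iff by blast
  have "integrable \<mu> w"
    unfolding w_def[abs_def] using gi i[unfolded Lp_one_iff] by (intro integrable_of_real Bochner_Integration.integrable_add integrable_mult_right integrable_norm)
  then have wL: "w \<in> Lp 1" by (simp add: Lp_one_iff)
  have lim: "AE t in \<mu>. (\<lambda>n. f n t) \<longlonglongrightarrow> cpow \<tau> \<beta> t * g t"
    using AE_circle_neq[of \<tau>] AE_space
  proof eventually_elim
    case (elim t)
    then show ?case unfolding f_def by (intro tendsto_intros cpow_radial_tendsto[OF \<tau>] r) auto
  qed
  have dom: "AE t in \<mu>. norm (f n t) \<le> norm (w t)" for n
    using AE_circle_neq[of \<tau>] AE_space
  proof eventually_elim
    case (elim t)
    have "norm (cpow \<tau> \<beta> (of_real (r n) * t)) \<le> A * (1 + norm (t - \<tau>) powr Re \<beta>)"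
      unfolding A_def using elim by (intro norm_cpow_radial_le[OF \<tau>] r) auto
    also have "\<dots> \<le> A * (1 + B * norm (cpow \<tau> \<beta> t))"
      unfolding B_def using norm_cpow_le(2)[OF \<tau>, of t \<beta>] elim AB by (intro mult_left_mono add_left_mono) auto
    finally have "norm (cpow \<tau> \<beta> (of_real (r n) * t)) * norm (g t) \<le> A * (1 + B * norm (cpow \<tau> \<beta> t)) * norm (g t)"
      by (intro mult_right_mono) auto
    also have "\<dots> = A * norm (g t) + A * (B * norm (cpow \<tau> \<beta> t * g t))" by (simp add: norm_mult algebra_simps)
    also have "\<dots> \<le> norm (w t)" unfolding w_def norm_of_real by simp
    finally show ?case by (simp add: f_def norm_mult)
  qed
  have fL: "f n \<in> Lp 1" for n using Lp_bound(1)[OF _ wL, of 1 "f n"] dom[of n] by simp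
  have conv: "(\<lambda>n. Lp_norm 1 (\<lambda>t. f n t - cpow \<tau> \<beta> t * g t)) \<longlonglongrightarrow> 0"
    by (rule Lp_dominated_convergence(2)[OF _ wL fm _ lim dom]) auto
  show "(\<lambda>t. cpow \<tau> \<beta> t * g t) \<in> Hardy 1"
  proof (rule Hardy_limit[OF _ _ i conv])
    show "f n \<in> Hardy 1" for n
      by (rule HardyI[OF fL]) (unfold f_def, rule holomorphic_mult_Hardy(1)[OF hol r(1,2) g])
  qed simp
  have "(\<lambda>n. fourier_coeff (f n) 0) \<longlonglongrightarrow> fourier_coeff (\<lambda>t. cpow \<tau> \<beta> t * g t) 0"
    by (rule fourier_coeff_tendsto[OF _ fL i conv]) simp
  moreover have "fourier_coeff (f n) 0 = fourier_coeff g 0" for n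
    unfolding f_def using holomorphic_mult_Hardy(2)[OF hol r(1,2) g] by (simp add: cpow_0)
  ultimately show "fourier_coeff (\<lambda>t. cpow \<tau> \<beta> t * g t) 0 = fourier_coeff g 0"
    by (simp add: LIMSEQ_const_iff)
qed

lemma cpow_mult_Hardy:
  assumes \<tau>: "norm \<tau> = 1" and p: "p \<ge> 1" and g: "g \<in> Hardy 1" and i: "(\<lambda>t. cpow \<tau> \<beta> t * g t) \<in> Lp p"
  shows "(\<lambda>t. cpow \<tau> \<beta> t * g t) \<in> Hardy p"
proof (rule HardyI[OF i])
  have "(\<lambda>t. cpow \<tau> \<beta> t * g t) \<in> Lp 1" using Lp_mono(1)[of 1 p] p i by auto
  from HardyD(2)[OF cpow_mult_Hardy1(1)[OF \<tau> g this]]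
  show "n < 0 \<Longrightarrow> fourier_coeff (\<lambda>t. cpow \<tau> \<beta> t * g t) n = 0" for n .
qed

lemma ccpow_mult_co_Hardy:
  assumes \<tau>: "norm \<tau> = 1" and p: "p \<ge> 1" and g: "g \<in> co_Hardy 1" and i: "(\<lambda>t. ccpow \<tau> \<beta> t * g t) \<in> Lp p"
  shows "(\<lambda>t. ccpow \<tau> \<beta> t * g t) \<in> co_Hardy p" "fourier_coeff (\<lambda>t. ccpow \<tau> \<beta> t * g t) 0 = fourier_coeff g 0"
proof -
  have g': "(\<lambda>t. cnj (g t)) \<in> Hardy 1" using g by (simp add: co_Hardy_iff_cnj)
  have i': "(\<lambda>t. cpow \<tau> (cnj \<beta>) t * cnj (g t)) \<in> Lp p"
    using i Lp_cnj_iff[of "\<lambda>t. cpow \<tau> (cnj \<beta>) t * cnj (g t)" p] by (simp add: ccpow_def)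
  have i1: "(\<lambda>t. cpow \<tau> (cnj \<beta>) t * cnj (g t)) \<in> Lp 1" using Lp_mono(1)[of 1 p] p i' by auto
  show "(\<lambda>t. ccpow \<tau> \<beta> t * g t) \<in> co_Hardy p"
    using cpow_mult_Hardy[OF \<tau> p g' i'] by (simp add: co_Hardy_iff_cnj ccpow_def)
  have "cnj (fourier_coeff (\<lambda>t. ccpow \<tau> \<beta> t * g t) 0) = fourier_coeff (\<lambda>t. cpow \<tau> (cnj \<beta>) t * cnj (g t)) 0"
    using fourier_coeff_cnj[of "\<lambda>t. ccpow \<tau> \<beta> t * g t" 0] by (simp add: ccpow_def)
  also have "\<dots> = fourier_coeff (\<lambda>t. cnj (g t)) 0" by (rule cpow_mult_Hardy1(2)[OF \<tau> g' i1])
  also have "\<dots> = cnj (fourier_coeff g 0)" by (simp add: fourier_coeff_cnj)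
  finally show "fourier_coeff (\<lambda>t. ccpow \<tau> \<beta> t * g t) 0 = fourier_coeff g 0" by (simp only: complex_cnj_cancel_iff)
qed

text \<open>With \<open>w = 1 - t / \<tau>\<close> one has \<open>- t / \<tau> = w / cnj w\<close>.
  Since \<open>w\<close> lies in the right half-plane, the argument of the quotient is exactly
  \<open>2 * Arg w\<close>, without a correction by 2 pi.\<close>

lemma jump_fun_eq:
  assumes \<tau>: "norm \<tau> = 1" and t: "norm t = 1" "t \<noteq> \<tau>"
  shows "jump_fun \<beta> \<tau> t = cpow \<tau> \<beta> t * ccpow \<tau> (- \<beta>) t"
proof -
  define w where "w = 1 - t / \<tau>"
  have w0: "Re w > 0" unfolding w_def using Re_one_minus_div_pos[OF \<tau>, of t] t by simp
  then have wn: "w \<noteq> 0" by auto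
  have arg: "\<bar>Arg w\<bar> < pi / 2" using w0 Arg_Re_pos by blast
  define u where "u = t / \<tau>"
  have u: "u * cnj u = 1" using t \<tau> by (simp add: u_def norm_divide complex_norm_square[symmetric])
  have "- u * cnj w = w" using u by (simp add: w_def u_def[symmetric] algebra_simps)
  then have "- u * (cnj w * w) = w * w" by (metis mult.assoc)
  then have wu: "- u * of_real ((norm w)\<^sup>2) = w * w" unfolding complex_norm_square by (simp only: mult.commute)
  have we: "w = of_real (norm w) * exp (\<i> * of_real (Arg w))" by (rule Arg_eq[OF wn])
  have "w * w = of_real (norm w) * exp (\<i> * of_real (Arg w)) * (of_real (norm w) * exp (\<i> * of_real (Arg w)))" using we by metis
  also have "\<dots> = of_real ((norm w)\<^sup>2) * exp (\<i> * of_real (2 * Arg w))"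
    by (simp add: power2_eq_square algebra_simps flip: exp_add)
  finally have "w * w = of_real ((norm w)\<^sup>2) * exp (\<i> * of_real (2 * Arg w))" .
  from trans[OF trans[OF mult.commute wu] this]
  have "of_real ((norm w)\<^sup>2) * (- u) = of_real ((norm w)\<^sup>2) * exp (\<i> * of_real (2 * Arg w))" .
  then have mu: "- u = exp (\<i> * of_real (2 * Arg w))"
    by (subst (asm) mult_left_cancel) (use wn in auto)
  have "Arg (- u) = 2 * Arg w"
  proof (rule Arg_unique[of 1])
    show "of_real 1 * exp (\<i> * of_real (2 * Arg w)) = - u" unfolding mu by simp
    show "- pi < 2 * Arg w" "2 * Arg w \<le> pi" using arg by linarith+
  qed simp
  moreover have "- t / \<tau> = - u" by (simp add: u_def)
  ultimately have J: "jump_fun \<beta> \<tau> t = exp (\<i> * \<beta> * of_real (2 * Arg w))"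
    by (simp only: jump_fun_def)
  have "cpow \<tau> \<beta> t * ccpow \<tau> (- \<beta>) t = exp (\<beta> * Ln w + (- \<beta>) * cnj (Ln w))"
    by (simp add: cpow_def ccpow_def w_def exp_cnj exp_add exp_minus exp_diff divide_inverse)
  also have "\<beta> * Ln w + (- \<beta>) * cnj (Ln w) = \<beta> * (Ln w - cnj (Ln w))" by (simp add: algebra_simps)
  also have "Ln w - cnj (Ln w) = of_real (2 * Im (Ln w)) * \<i>" by (simp add: complex_eq_iff)
  also have "Im (Ln w) = Arg w" using wn by (simp add: Arg_eq_Im_Ln)
  finally show ?thesis unfolding J by (simp add: mult_ac)
qed

section \<open>The boundedness condition of the factorization\<close>

text \<open>
  The boundedness of \<open>g\<^sub>+\<inverse> P g\<^sub>-\<inverse> I\<close> on all of \<open>L\<^sup>p\<close>, phrased through Fourier coefficients because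
  \<open>g\<^sub>-\<inverse> f\<close> is only in \<open>L\<^sup>1\<close>, where the Riesz projection is not available.
\<close>

definition WH_bounded :: "real \<Rightarrow> (complex \<Rightarrow> complex) \<Rightarrow> (complex \<Rightarrow> complex) \<Rightarrow> bool" where
  "WH_bounded p gp gm \<longleftrightarrow> (\<exists>K\<ge>0. \<forall>f\<in>Lp p. \<exists>U\<in>Hardy p. Lp_norm p U \<le> K * Lp_norm p f \<and>
     (\<forall>k\<ge>0. fourier_coeff (\<lambda>t. gp t * U t) k = fourier_coeff (\<lambda>t. inverse (gm t) * f t) k))"

lemma WH_bounded_iff:
  "WH_bounded p gp gm \<longleftrightarrow> (\<exists>K. K \<ge> 0 \<and> (\<forall>f. f \<in> Lp p \<longrightarrow> (\<exists>U. U \<in> Hardy p \<and> Lp_norm p U \<le> K * Lp_norm p f \<and>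
     (\<forall>k\<ge>0. fourier_coeff (\<lambda>t. gp t * U t) k = fourier_coeff (\<lambda>t. inverse (gm t) * f t) k))))"
  unfolding WH_bounded_def Bex_def Ball_def ..

text \<open>No symbol occurs here: the given factors and those of the local model belong to
  different symbols but are treated alike.\<close>

definition WH_pair :: "real \<Rightarrow> real \<Rightarrow> (complex \<Rightarrow> complex) \<Rightarrow> (complex \<Rightarrow> complex) \<Rightarrow> bool" where
  "WH_pair p q gp gm \<longleftrightarrow> (AE t in \<mu>. gp t \<noteq> 0) \<and> gp \<in> Hardy q \<and> (\<lambda>t. inverse (gp t)) \<in> Hardy p \<and>
     (\<lambda>t. inverse (gm t)) \<in> co_Hardy q"

text \<open>The operator estimate on polynomials, with the projection replaced by any
  \<open>h\<close> that has the right coefficients, so that the choice operator stays out of the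
  estimates.\<close>

definition poly_bounded :: "real \<Rightarrow> real \<Rightarrow> (complex \<Rightarrow> complex) \<Rightarrow> (complex \<Rightarrow> complex) \<Rightarrow> bool" where
  "poly_bounded p q gp gm \<longleftrightarrow> (\<exists>K\<ge>0. \<forall>r. \<forall>h\<in>Hardy q.
     (\<forall>k\<ge>0. fourier_coeff h k = fourier_coeff (\<lambda>t. inverse (gm t) * poly r t) k) \<longrightarrow>
     (\<lambda>t. inverse (gp t) * h t) \<in> Lp p \<and> Lp_norm p (\<lambda>t. inverse (gp t) * h t) \<le> K * Lp_norm p (poly r))"

lemma Lp_mult_trig:
  assumes "p > 0" "f \<in> Lp p" "g \<in> trig"
  shows "(\<lambda>t. f t * g t) \<in> Lp p"
proof -
  obtain C where C: "C \<ge> 0" "\<forall>t. norm t = 1 \<longrightarrow> norm (g t) \<le> C"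
    using continuous_circle_bounded[OF trig_continuous[OF assms(3)]] by blast
  have [measurable]: "f \<in> borel_measurable \<mu>" "g \<in> borel_measurable \<mu>" using assms trig_measurable by auto
  show ?thesis
  proof (rule Lp_bound(1)[OF assms(1,2) C(1)])
    show "AE t in \<mu>. norm (f t * g t) \<le> C * norm (f t)"
    proof (intro AE_I2)
      fix t assume "t \<in> space \<mu>"
      then have "norm (f t) * norm (g t) \<le> norm (f t) * C" using C by (intro mult_left_mono) auto
      then show "norm (f t * g t) \<le> C * norm (f t)" by (simp add: norm_mult mult.commute)
    qed
  qed measurable
qed

lemma Riesz_projection_spec:
  assumes "1 < p" "f \<in> Lp p"
  shows "Riesz_projection p f \<in> Hardy p" "\<And>n. n \<ge> 0 \<Longrightarrow> fourier_coeff (Riesz_projection p f) n = fourier_coeff f n"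
proof -
  have "\<exists>h. h \<in> Hardy p \<and> (\<forall>n\<ge>0. fourier_coeff h n = fourier_coeff f n)"
    using Riesz_projection_ex[OF assms] by metis
  from someI_ex[OF this]
  show "Riesz_projection p f \<in> Hardy p" "\<And>n. n \<ge> 0 \<Longrightarrow> fourier_coeff (Riesz_projection p f) n = fourier_coeff f n"
    unfolding Riesz_projection_def by auto
qed

lemma Hoelder_tendsto:
  assumes pq: "1 < q" "1 < p" "1 / q + 1 / p = 1" and f: "f \<in> Lp q" and g: "\<And>n. g n \<in> Lp p" "G \<in> Lp p"
    and lim: "(\<lambda>n. Lp_norm p (\<lambda>t. g n t - G t)) \<longlonglongrightarrow> 0"
  shows "(\<lambda>n. Lp_norm 1 (\<lambda>t. f t * g n t - f t * G t)) \<longlonglongrightarrow> 0"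
proof (rule tendsto_sandwich[OF _ _ tendsto_const])
  show "(\<lambda>n. Lp_norm q f * Lp_norm p (\<lambda>t. g n t - G t)) \<longlonglongrightarrow> 0"
    using tendsto_mult_left[OF lim, of "Lp_norm q f"] by simp
  have "Lp_norm 1 (\<lambda>t. f t * g n t - f t * G t) \<le> Lp_norm q f * Lp_norm p (\<lambda>t. g n t - G t)" for n
  proof -
    have d: "(\<lambda>t. g n t - G t) \<in> Lp p" using Lp_diff(1) g pq by simp
    show ?thesis using Hoelder_conj(2)[OF pq f d] by (simp add: right_diff_distrib)
  qed
  then show "\<forall>\<^sub>F n in sequentially. Lp_norm 1 (\<lambda>t. f t * g n t - f t * G t) \<le> Lp_norm q f * Lp_norm p (\<lambda>t. g n t - G t)"
    by simp
qed simp

text \<open>The antianalytic part of \<open>g\<close> times the antianalytic \<open>m\<close> has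
  negative indices only. Hence data may be projected before multiplication by the minus factor, and
  an estimate on polynomials reaches all trigonometric polynomials.\<close>

lemma co_Hardy_trig_coeff:
  assumes m: "m \<in> co_Hardy 1" and g: "trig_parts g u s" and k: "k \<ge> 0"
  shows "fourier_coeff (\<lambda>t. m t * g t) k = fourier_coeff (\<lambda>t. m t * poly u t) k"
proof -
  have mL: "m \<in> Lp 1" using co_HardyD(1)[OF m] .
  have gt: "g \<in> trig" using trig_parts_trig[OF g] .
  have i: "integrable \<mu> (\<lambda>t. m t * g t)" "integrable \<mu> (\<lambda>t. m t * poly u t)"
    using Lp_mult_trig[OF _ mL gt] Lp_mult_trig[OF _ mL poly_trig] by (auto simp: Lp_one_iff)
  have c: "(\<lambda>t. cnj (m t)) \<in> Hardy 1" using m by (simp add: co_Hardy_iff_cnj)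
  have "fourier_coeff (\<lambda>t. m t * g t) k - fourier_coeff (\<lambda>t. m t * poly u t) k = fourier_coeff (\<lambda>t. m t * g t - m t * poly u t) k"
    by (rule fourier_coeff_diff[OF i, symmetric])
  also have "\<dots> = fourier_coeff (\<lambda>t. cnj (poly s t * cnj (m t) * t powi 1)) k"
    by (rule fourier_coeff_cong) (use g in \<open>auto simp: trig_parts_def algebra_simps\<close>)
  also have "\<dots> = cnj (fourier_coeff (\<lambda>t. poly s t * cnj (m t)) (- k - 1))"
    unfolding fourier_coeff_cnj fourier_coeff_shift ..
  also have "\<dots> = 0" using poly_mult_Hardy(1)[OF c, of "- k - 1"] k by simp
  finally show ?thesis by simp
qed

text \<open>The operator is applied to \<open>trig_proj g\<close>, at the price of the norm of the
  Riesz projection, and extended by continuity. The limit \<open>U\<close> is identified through the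
  coefficients of \<open>gp * U\<close>: Hoelder's inequality turns convergence in L^p into
  convergence of these products in L^1.\<close>

lemma WH_bounded_of_poly:
  assumes pq: "1 < p" "1 < q" "1 / p + 1 / q = 1" and pair: "WH_pair p q gp gm" and pb: "poly_bounded p q gp gm"
  shows "WH_bounded p gp gm"
proof -
  have p1: "p \<ge> 1" "p > 0" "q \<ge> 1" "q > 0" using pq by auto
  have qp: "1 / q + 1 / p = 1" using pq by simp
  have nz: "AE t in \<mu>. gp t \<noteq> 0" and gpH: "gp \<in> Hardy q" and igpH: "(\<lambda>t. inverse (gp t)) \<in> Hardy p"
    and igmH: "(\<lambda>t. inverse (gm t)) \<in> co_Hardy q" using pair by (auto simp: WH_pair_def)
  note gpL = HardyD(1)[OF gpH] and igpL = HardyD(1)[OF igpH] and igmL = co_HardyD(1)[OF igmH]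
  have igm1: "(\<lambda>t. inverse (gm t)) \<in> co_Hardy 1"
    using Hardy_mono[of 1 q] igmH p1 by (auto simp: co_Hardy_iff_cnj)
  obtain K where K: "K \<ge> 0" "\<And>r h. h \<in> Hardy q \<Longrightarrow>
     (\<And>k. k \<ge> 0 \<Longrightarrow> fourier_coeff h k = fourier_coeff (\<lambda>t. inverse (gm t) * poly r t) k) \<Longrightarrow>
     (\<lambda>t. inverse (gp t) * h t) \<in> Lp p \<and> Lp_norm p (\<lambda>t. inverse (gp t) * h t) \<le> K * Lp_norm p (poly r)"
    using pb unfolding poly_bounded_def by blast
  obtain C where C: "C \<ge> 0" "\<And>f u s. trig_parts f u s \<Longrightarrow> Lp_norm p (poly u) \<le> C * Lp_norm p f"
    by (rule trig_projection_bounded[OF pq(1)]) blast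
  define h where "h g = Riesz_projection q (\<lambda>t. inverse (gm t) * poly (trig_proj g) t)" for g
  have arg: "(\<lambda>t. inverse (gm t) * poly r t) \<in> Lp q" for r by (rule Lp_mult_trig[OF p1(4) igmL poly_trig])
  have h: "h g \<in> Hardy q" "k \<ge> 0 \<Longrightarrow> fourier_coeff (h g) k = fourier_coeff (\<lambda>t. inverse (gm t) * poly (trig_proj g) t) k" for g k
    unfolding h_def using Riesz_projection_spec[OF pq(2) arg] by auto
  define T where "T g t = inverse (gp t) * h g t" for g t
  have T1: "T g \<in> Lp p" and T2': "Lp_norm p (T g) \<le> K * Lp_norm p (poly (trig_proj g))" for g
    using K(2)[OF h(1) h(2)] unfolding T_def[abs_def] by auto
  have KC: "K * C \<ge> 0" using K C by simp
  have T2: "Lp_norm p (T g) \<le> K * C * Lp_norm p g" if "g \<in> trig" for g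
  proof -
    obtain s where "trig_parts g (trig_proj g) s" using trig_proj[OF \<open>g \<in> trig\<close>] by metis
    then have "K * Lp_norm p (poly (trig_proj g)) \<le> K * (C * Lp_norm p g)" using C(2) K(1) by (intro mult_left_mono) auto
    then show ?thesis using T2'[of g] by simp
  qed
  have T3: "Lp_norm p (\<lambda>t. T g t - T g' t) \<le> K * C * Lp_norm p (\<lambda>t. g t - g' t)" if gg: "g \<in> trig" "g' \<in> trig" for g g'
  proof -
    obtain s s' where s: "trig_parts g (trig_proj g) s" "trig_parts g' (trig_proj g') s'"
      using trig_proj gg by metis
    then have parts: "trig_parts (\<lambda>t. g t - g' t) (trig_proj g - trig_proj g') (s - s')"
      by (auto simp: trig_parts_def algebra_simps)
    have hd: "(\<lambda>t. h g t - h g' t) \<in> Hardy q" by (rule Hardy_diff[OF p1(3) h(1) h(1)])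
    have "fourier_coeff (\<lambda>t. h g t - h g' t) k = fourier_coeff (\<lambda>t. inverse (gm t) * poly (trig_proj g - trig_proj g') t) k" if "k \<ge> 0" for k
    proof -
      have "fourier_coeff (\<lambda>t. h g t - h g' t) k = fourier_coeff (h g) k - fourier_coeff (h g') k"
        using Lp_imp_integrable[OF HardyD(1)[OF h(1)] p1(3)] by (intro fourier_coeff_diff)
      also have "\<dots> = fourier_coeff (\<lambda>t. inverse (gm t) * poly (trig_proj g) t - inverse (gm t) * poly (trig_proj g') t) k"
        unfolding h(2)[OF that] using Lp_imp_integrable[OF arg p1(3)] by (intro fourier_coeff_diff[symmetric])
      finally show ?thesis by (simp add: right_diff_distrib)
    qed
    from K(2)[OF hd this]
    have "Lp_norm p (\<lambda>t. T g t - T g' t) \<le> K * Lp_norm p (poly (trig_proj g - trig_proj g'))"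
      by (simp add: T_def right_diff_distrib)
    also have "\<dots> \<le> K * (C * Lp_norm p (\<lambda>t. g t - g' t))" using C(2)[OF parts] K(1) by (intro mult_left_mono)
    finally show ?thesis by simp
  qed
  have TH: "T g \<in> Hardy p" for g
  proof (rule HardyI[OF T1])
    have "T g \<in> Hardy 1" unfolding T_def[abs_def] by (rule Hardy_mult_conj(1)[OF pq igpH h(1)])
    then show "n < 0 \<Longrightarrow> fourier_coeff (T g) n = 0" for n by (rule HardyD(2))
  qed
  show ?thesis
    unfolding WH_bounded_def
  proof (intro exI[of _ "K * C"] conjI KC ballI)
    fix f assume f: "f \<in> Lp p"
    obtain g U where gU: "\<And>n. g n \<in> trig" "(\<lambda>n. Lp_norm p (\<lambda>t. g n t - f t)) \<longlonglongrightarrow> 0" "U \<in> Lp p"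
      "(\<lambda>n. Lp_norm p (\<lambda>t. T (g n) t - U t)) \<longlonglongrightarrow> 0" "Lp_norm p U \<le> K * C * Lp_norm p f"
      by (rule trig_extension[where T=T, OF p1(1) KC f T1 T2 T3]) blast+
    have UH: "U \<in> Hardy p" by (rule Hardy_limit[OF p1(1) TH gU(3,4)])
    have gL: "g n \<in> Lp p" for n by (rule trig_Lp[OF gU(1) p1(2)])
    have "fourier_coeff (\<lambda>t. gp t * U t) k = fourier_coeff (\<lambda>t. inverse (gm t) * f t) k" if k: "k \<ge> 0" for k
    proof (rule LIMSEQ_unique)
      show "(\<lambda>n. fourier_coeff (\<lambda>t. gp t * T (g n) t) k) \<longlonglongrightarrow> fourier_coeff (\<lambda>t. gp t * U t) k"
        by (rule fourier_coeff_tendsto[OF order_refl Hoelder_conj(1)[OF pq(2,1) qp gpL T1] Hoelder_conj(1)[OF pq(2,1) qp gpL gU(3)]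
            Hoelder_tendsto[OF pq(2,1) qp gpL T1 gU(3,4)]])
      have "(\<lambda>n. fourier_coeff (\<lambda>t. inverse (gm t) * g n t) k) \<longlonglongrightarrow> fourier_coeff (\<lambda>t. inverse (gm t) * f t) k"
        by (rule fourier_coeff_tendsto[OF order_refl Hoelder_conj(1)[OF pq(2,1) qp igmL gL] Hoelder_conj(1)[OF pq(2,1) qp igmL f]
            Hoelder_tendsto[OF pq(2,1) qp igmL gL f gU(2)]])
      moreover have "fourier_coeff (\<lambda>t. inverse (gm t) * g n t) k = fourier_coeff (\<lambda>t. gp t * T (g n) t) k" for n
      proof -
        obtain s where s: "trig_parts (g n) (trig_proj (g n)) s" using trig_proj[OF gU(1)] by metis
        have "fourier_coeff (\<lambda>t. inverse (gm t) * g n t) k = fourier_coeff (h (g n)) k"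
          unfolding h(2)[OF k] by (rule co_Hardy_trig_coeff[OF igm1 s k])
        also have "\<dots> = fourier_coeff (\<lambda>t. gp t * T (g n) t) k"
        proof (rule fourier_coeff_cong_AE)
          show "AE t in \<mu>. h (g n) t = gp t * T (g n) t"
            using nz by eventually_elim (simp add: T_def)
          show "h (g n) \<in> borel_measurable \<mu>" using HardyD(1)[OF h(1)] by auto
          show "(\<lambda>t. gp t * T (g n) t) \<in> borel_measurable \<mu>" using gpL T1[of "g n"] by auto
        qed
        finally show ?thesis .
      qed
      ultimately show "(\<lambda>n. fourier_coeff (\<lambda>t. gp t * T (g n) t) k) \<longlonglongrightarrow> fourier_coeff (\<lambda>t. inverse (gm t) * f t) k"
        by simp
    qed
    with UH gU(5) show "\<exists>U\<in>Hardy p. Lp_norm p U \<le> K * C * Lp_norm p f \<and>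
       (\<forall>k\<ge>0. fourier_coeff (\<lambda>t. gp t * U t) k = fourier_coeff (\<lambda>t. inverse (gm t) * f t) k)" by blast
  qed
qed

lemma WH_pair_unique:
  assumes pq: "1 < p" "1 < q" "1 / p + 1 / q = 1" and pair: "WH_pair p q gp gm"
    and U: "U \<in> Hardy p" "V \<in> Hardy p"
    and eq: "\<And>k. k \<ge> 0 \<Longrightarrow> fourier_coeff (\<lambda>t. gp t * U t) k = fourier_coeff (\<lambda>t. gp t * V t) k"
  shows "AE t in \<mu>. U t = V t"
proof -
  have nz: "AE t in \<mu>. gp t \<noteq> 0" and gpH: "gp \<in> Hardy q" using pair by (auto simp: WH_pair_def)
  have qp: "1 / q + 1 / p = 1" using pq by simp
  have "AE t in \<mu>. gp t * U t = gp t * V t"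
    by (rule Hardy_unique[OF Hardy_mult_conj(1)[OF pq(2,1) qp gpH U(1)] Hardy_mult_conj(1)[OF pq(2,1) qp gpH U(2)] eq])
  with nz show ?thesis by eventually_elim simp
qed

text \<open>The operator is picked by choice for each function separately. Its linearity and its
  values on polynomials come from \<open>WH_pair_unique\<close>: a function of H^p is determined by
  the coefficients of its product with \<open>gp\<close>.\<close>

lemma WH_bounded_operator:
  assumes pq: "1 < p" "1 < q" "1 / p + 1 / q = 1" and pair: "WH_pair p q gp gm" and wb: "WH_bounded p gp gm"
  shows "\<exists>A. bounded_operator_Hardy p A \<and>
        (\<forall>r :: complex poly.
           ae_eq (A (poly r))
             (\<lambda>t. inverse (gp t) * Riesz_projection q (\<lambda>s. inverse (gm s) * poly r s) t))"
proof -
  have p1: "p \<ge> 1" "p > 0" "q \<ge> 1" "q > 0" using pq by auto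
  have qp: "1 / q + 1 / p = 1" using pq by simp
  have nz: "AE t in \<mu>. gp t \<noteq> 0" and gpH: "gp \<in> Hardy q" and igpH: "(\<lambda>t. inverse (gp t)) \<in> Hardy p"
    and igmH: "(\<lambda>t. inverse (gm t)) \<in> co_Hardy q" using pair by (auto simp: WH_pair_def)
  note gpL = HardyD(1)[OF gpH] and igmL = co_HardyD(1)[OF igmH]
  from wb obtain K where K': "K \<ge> 0 \<and> (\<forall>f. f \<in> Lp p \<longrightarrow> (\<exists>U. U \<in> Hardy p \<and> Lp_norm p U \<le> K * Lp_norm p f \<and>
     (\<forall>k\<ge>0. fourier_coeff (\<lambda>t. gp t * U t) k = fourier_coeff (\<lambda>t. inverse (gm t) * f t) k)))"
    unfolding WH_bounded_iff by (rule exE)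
  note K = conjunct1[OF K'] conjunct2[OF K', rule_format]
  define A where "A f = (SOME U. U \<in> Hardy p \<and> Lp_norm p U \<le> K * Lp_norm p f \<and>
     (\<forall>k\<ge>0. fourier_coeff (\<lambda>t. gp t * U t) k = fourier_coeff (\<lambda>t. inverse (gm t) * f t) k))" for f
  have A: "A f \<in> Hardy p \<and> Lp_norm p (A f) \<le> K * Lp_norm p f \<and>
     (\<forall>k\<ge>0. fourier_coeff (\<lambda>t. gp t * A f t) k = fourier_coeff (\<lambda>t. inverse (gm t) * f t) k)" if "f \<in> Lp p" for f
    unfolding A_def by (rule someI_ex[OF K(2)[OF that]])
  have AH: "A f \<in> Hardy p" if "f \<in> Lp p" for f
    by (rule conjunct1[OF A[OF that]])
  have An: "Lp_norm p (A f) \<le> K * Lp_norm p f" if "f \<in> Lp p" for f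
    by (rule conjunct1[OF conjunct2[OF A[OF that]]])
  have Ac: "fourier_coeff (\<lambda>t. gp t * A f t) k = fourier_coeff (\<lambda>t. inverse (gm t) * f t) k"
    if "f \<in> Lp p" "k \<ge> 0" for f k
    by (rule conjunct2[OF conjunct2[OF A[OF that(1)]], rule_format, OF that(2)])
  have i1: "integrable \<mu> (\<lambda>t. gp t * U t)" if "U \<in> Hardy p" for U
    using Hoelder_conj(1)[OF pq(2,1) qp gpL HardyD(1)[OF that]] by (simp add: Lp_one_iff)
  have i2: "integrable \<mu> (\<lambda>t. inverse (gm t) * f t)" if "f \<in> Lp p" for f
    using Hoelder_conj(1)[OF pq(2,1) qp igmL that] by (simp add: Lp_one_iff)
  have "bounded_operator_Hardy p A"
    unfolding bounded_operator_Hardy_def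
  proof (intro conjI ballI allI)
    fix f assume f: "f \<in> Hardy p"
    then show "A f \<in> Hardy p" by (rule AH[OF HardyD(1)])
    {
      fix g assume g: "g \<in> Hardy p"
      have fg: "f \<in> Lp p" "g \<in> Lp p" "(\<lambda>t. f t + g t) \<in> Lp p"
        using f g Lp_add[OF p1(1)] HardyD(1) by auto
      show "ae_eq (A (\<lambda>t. f t + g t)) (\<lambda>t. A f t + A g t)"
        unfolding ae_eq_def
      proof (rule WH_pair_unique[OF pq pair])
        show "A (\<lambda>t. f t + g t) \<in> Hardy p" by (rule AH[OF fg(3)])
        show "(\<lambda>t. A f t + A g t) \<in> Hardy p" by (intro Hardy_add AH fg p1)
        fix k :: int assume k: "k \<ge> 0"
        have "fourier_coeff (\<lambda>t. gp t * (A f t + A g t)) k = fourier_coeff (\<lambda>t. gp t * A f t) k + fourier_coeff (\<lambda>t. gp t * A g t) k"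
          unfolding distrib_left by (intro fourier_coeff_add i1 AH fg)
        also have "\<dots> = fourier_coeff (\<lambda>t. inverse (gm t) * (f t + g t)) k"
          unfolding Ac[OF fg(1) k] Ac[OF fg(2) k] distrib_left by (intro fourier_coeff_add[symmetric] i2 fg)
        finally show "fourier_coeff (\<lambda>t. gp t * A (\<lambda>t. f t + g t) t) k = fourier_coeff (\<lambda>t. gp t * (A f t + A g t)) k"
          using Ac[OF fg(3) k] by simp
      qed
    }
    fix z :: complex
    have fz: "f \<in> Lp p" "(\<lambda>t. z * f t) \<in> Lp p" using f Lp_scale[OF p1(2)] HardyD(1) by auto
    show "ae_eq (A (\<lambda>t. z * f t)) (\<lambda>t. z * A f t)"
      unfolding ae_eq_def
    proof (rule WH_pair_unique[OF pq pair])
      show "A (\<lambda>t. z * f t) \<in> Hardy p" by (rule AH[OF fz(2)])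
      show "(\<lambda>t. z * A f t) \<in> Hardy p" by (intro Hardy_scale AH fz p1)
      fix k :: int assume k: "k \<ge> 0"
      have "fourier_coeff (\<lambda>t. gp t * (z * A f t)) k = z * fourier_coeff (\<lambda>t. gp t * A f t) k"
        unfolding fourier_coeff_scale[symmetric] by (simp add: mult_ac)
      also have "\<dots> = fourier_coeff (\<lambda>t. inverse (gm t) * (z * f t)) k"
        unfolding Ac[OF fz(1) k] fourier_coeff_scale[symmetric] by (simp add: mult_ac)
      finally show "fourier_coeff (\<lambda>t. gp t * A (\<lambda>t. z * f t) t) k = fourier_coeff (\<lambda>t. gp t * (z * A f t)) k"
        using Ac[OF fz(2) k] by simp
    qed
  next
    show "\<exists>K. \<forall>f\<in>Hardy p. Lp_norm p (A f) \<le> K * Lp_norm p f" using An HardyD(1) by blast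
  qed
  moreover have "ae_eq (A (poly r)) (\<lambda>t. inverse (gp t) * Riesz_projection q (\<lambda>s. inverse (gm s) * poly r s) t)" for r
  proof -
    have rL: "poly r \<in> Lp p" by (rule trig_Lp[OF poly_trig p1(2)])
    have arg: "(\<lambda>t. inverse (gm t) * poly r t) \<in> Lp q" by (rule Lp_mult_trig[OF p1(4) igmL poly_trig])
    have "AE t in \<mu>. gp t * A (poly r) t = Riesz_projection q (\<lambda>s. inverse (gm s) * poly r s) t"
    proof (rule Hardy_unique)
      show "(\<lambda>t. gp t * A (poly r) t) \<in> Hardy 1" by (rule Hardy_mult_conj(1)[OF pq(2,1) qp gpH AH[OF rL]])
      show "Riesz_projection q (\<lambda>s. inverse (gm s) * poly r s) \<in> Hardy 1"
        using Hardy_mono[of 1 q] Riesz_projection_spec(1)[OF pq(2) arg] p1 by auto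
    qed (use Ac[OF rL] Riesz_projection_spec(2)[OF pq(2) arg] in auto)
    with nz show ?thesis unfolding ae_eq_def by eventually_elim (auto simp: field_simps)
  qed
  ultimately show ?thesis by blast
qed

lemma WH_factorization_poly_bounded:
  assumes pq: "1 < p" "1 < q" "1 / p + 1 / q = 1" and wh: "Wiener_Hopf_factorization p q g gm \<nu> gp"
  shows "WH_pair p q gp gm" "poly_bounded p q gp gm"
proof -
  have p1: "p \<ge> 1" "p > 0" "q \<ge> 1" "q > 0" using pq by auto
  show pair: "WH_pair p q gp gm"
    using wh by (simp add: Wiener_Hopf_factorization_def WH_pair_def)
  obtain A where A: "bounded_operator_Hardy p A"
    "\<And>r :: complex poly. ae_eq (A (poly r)) (\<lambda>t. inverse (gp t) * Riesz_projection q (\<lambda>s. inverse (gm s) * poly r s) t)"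
    using wh unfolding Wiener_Hopf_factorization_def by blast
  obtain K where K: "\<And>f. f \<in> Hardy p \<Longrightarrow> Lp_norm p (A f) \<le> K * Lp_norm p f"
    using A(1) unfolding bounded_operator_Hardy_def by blast
  have igpH: "(\<lambda>t. inverse (gp t)) \<in> Hardy p" and igmH: "(\<lambda>t. inverse (gm t)) \<in> co_Hardy q"
    using pair by (auto simp: WH_pair_def)
  show "poly_bounded p q gp gm"
    unfolding poly_bounded_def
  proof (intro exI[of _ "max K 0"] conjI allI ballI impI)
    fix r h assume h: "h \<in> Hardy q" and c: "\<forall>k\<ge>0. fourier_coeff h k = fourier_coeff (\<lambda>t. inverse (gm t) * poly r t) k"
    have rH: "poly r \<in> Hardy p" by (rule poly_Hardy[OF p1(2)])
    have AL: "A (poly r) \<in> Lp p" using A(1) rH HardyD(1) unfolding bounded_operator_Hardy_def by blast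
    have arg: "(\<lambda>t. inverse (gm t) * poly r t) \<in> Lp q" by (rule Lp_mult_trig[OF p1(4) co_HardyD(1)[OF igmH] poly_trig])
    have "AE t in \<mu>. h t = Riesz_projection q (\<lambda>s. inverse (gm s) * poly r s) t"
    proof (rule Hardy_unique)
      show "h \<in> Hardy 1" "Riesz_projection q (\<lambda>s. inverse (gm s) * poly r s) \<in> Hardy 1"
        using Hardy_mono[of 1 q] Riesz_projection_spec(1)[OF pq(2) arg] p1 h by auto
    qed (use c Riesz_projection_spec(2)[OF pq(2) arg] in auto)
    with A(2)[of r] have ae: "AE t in \<mu>. inverse (gp t) * h t = A (poly r) t"
      unfolding ae_eq_def by eventually_elim simp
    have m: "(\<lambda>t. inverse (gp t) * h t) \<in> borel_measurable \<mu>"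
      using HardyD(1)[OF igpH] HardyD(1)[OF h] by auto
    show "(\<lambda>t. inverse (gp t) * h t) \<in> Lp p" by (rule Lp_cong_AE[OF ae m AL])
    have "Lp_norm p (\<lambda>t. inverse (gp t) * h t) = Lp_norm p (A (poly r))"
      by (rule Lp_norm_cong_AE[OF ae m]) (use AL in auto)
    also have "\<dots> \<le> K * Lp_norm p (poly r)" by (rule K[OF rH])
    also have "\<dots> \<le> max K 0 * Lp_norm p (poly r)" by (intro mult_right_mono) auto
    finally show "Lp_norm p (\<lambda>t. inverse (gp t) * h t) \<le> max K 0 * Lp_norm p (poly r)" .
  qed simp
qed

section \<open>Power weights\<close>

text \<open>Outside (1/2, 2) the factor \<open>max 1 z\<close> is at most
  \<open>4 * |z - 1|\<close>, and the triangle inequality suffices. Inside, the logarithm provides a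
  Lipschitz bound.\<close>

lemma powr_difference_bound:
  fixes z \<rho> :: real
  assumes z: "z > 0" and \<rho>: "\<bar>\<rho>\<bar> \<le> 1"
  shows "\<bar>z powr \<rho> - 1\<bar> * max 1 z \<le> 4 * (1 + z powr \<rho>) * \<bar>z - 1\<bar>"
proof (cases "1 / 2 < z \<and> z < 2")
  case False
  then have "max 1 z \<le> 4 * \<bar>z - 1\<bar>" using z by (auto simp: max_def abs_if)
  moreover have "\<bar>z powr \<rho> - 1\<bar> \<le> 1 + z powr \<rho>" using powr_ge_zero[of z \<rho>] by linarith
  ultimately have "\<bar>z powr \<rho> - 1\<bar> * max 1 z \<le> (1 + z powr \<rho>) * (4 * \<bar>z - 1\<bar>)"
    by (intro mult_mono) auto
  then show ?thesis by (simp only: mult_ac)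
next
  case True
  have ln1: "ln z \<le> z - 1" using ln_le_minus_one[OF z] .
  have "ln (1 / z) \<le> 1 / z - 1" using z by (intro ln_le_minus_one) auto
  then have ln2: "- ln z \<le> (1 - z) / z" using z by (simp add: ln_div diff_divide_distrib)
  have lnb: "\<bar>ln z\<bar> \<le> 2 * \<bar>z - 1\<bar>"
  proof (cases "z \<ge> 1")
    case True
    then show ?thesis using ln1 ln_ge_zero[of z] by simp
  next
    case False
    then have "(1 - z) / z \<le> 2 * (1 - z)" using \<open>1 / 2 < z \<and> z < 2\<close> mult_left_mono[of "1 / z" 2 "1 - z"] by (simp add: field_simps)
    then show ?thesis using ln2 False z by (simp add: abs_if)
  qed
  define w where "w = \<rho> * ln z"
  have zw: "z powr \<rho> = exp w" using z by (simp add: powr_def w_def)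
  \<comment> \<open>The factor \<open>1 + exp w\<close> makes one estimate serve both signs of
    \<open>w\<close>.\<close>
  have "\<bar>exp w - 1\<bar> \<le> \<bar>w\<bar> * (1 + exp w)"
  proof (cases "w \<ge> 0")
    case True
    have "1 - w \<le> exp (- w)" using exp_ge_add_one_self[of "- w"] by simp
    then have "(1 - w) * exp w \<le> 1" by (metis exp_minus_inverse exp_ge_zero mult.commute mult_left_mono)
    then have "exp w - 1 \<le> w * exp w" by (simp add: algebra_simps)
    also have "\<dots> \<le> w * (1 + exp w)" using True by (intro mult_left_mono) auto
    finally show ?thesis using True by simp
  next
    case False
    have "1 - exp w \<le> - w" using exp_ge_add_one_self[of w] by linarith
    also have "\<dots> \<le> (- w) * (1 + exp w)" using False mult_left_mono[of 1 "1 + exp w" "- w"] by simp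
    finally show ?thesis using False by simp
  qed
  also have "\<bar>w\<bar> \<le> 1 * (2 * \<bar>z - 1\<bar>)" unfolding w_def abs_mult using lnb \<rho> by (intro mult_mono) auto
  then have "\<bar>w\<bar> * (1 + exp w) \<le> 2 * \<bar>z - 1\<bar> * (1 + exp w)" by (intro mult_right_mono) (auto simp: add_nonneg_nonneg)
  finally have "\<bar>z powr \<rho> - 1\<bar> * max 1 z \<le> (2 * \<bar>z - 1\<bar> * (1 + z powr \<rho>)) * 2"
    unfolding zw using True by (intro mult_mono) (auto simp: add_nonneg_nonneg)
  then show ?thesis by (simp add: mult_ac)
qed

text \<open>By homogeneity everything depends on the ratio \<open>y / x\<close>. The number
  \<open>d\<close> may be any bound for \<open>|x - y|\<close>; it will be twice the modulus of the
  Cauchy denominator.\<close>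

lemma power_kernel_bound:
  fixes x y \<rho> :: real
  assumes x: "x > 0" and y: "y > 0" and \<rho>: "\<bar>\<rho>\<bar> \<le> 1" and d: "\<bar>x - y\<bar> \<le> d" "d > 0"
  shows "\<bar>y powr \<rho> - x powr \<rho>\<bar> / (x powr \<rho> * d) \<le> 4 * (1 + (y / x) powr \<rho>) / max x y"
proof -
  define z where "z = y / x"
  have z: "z > 0" using x y by (simp add: z_def)
  have yx: "y = z * x" using x by (simp add: z_def)
  have xr: "x powr \<rho> > 0" using x by simp
  have "\<bar>y powr \<rho> - x powr \<rho>\<bar> = \<bar>(z powr \<rho> - 1) * x powr \<rho>\<bar>"
    using x z by (simp add: yx powr_mult left_diff_distrib)
  then have e1: "\<bar>y powr \<rho> - x powr \<rho>\<bar> / (x powr \<rho> * d) = \<bar>z powr \<rho> - 1\<bar> / d"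
    using xr by (simp add: abs_mult)
  have mx: "max x y = x * max 1 z" using x by (simp add: yx max_mult_distrib_left mult.commute)
  have mz: "max 1 z > 0" by simp
  have "\<bar>z powr \<rho> - 1\<bar> * (x * max 1 z) \<le> x * (4 * (1 + z powr \<rho>) * \<bar>z - 1\<bar>)"
    using powr_difference_bound[OF z \<rho>] x by (simp add: mult.left_commute)
  also have "\<dots> = 4 * (1 + z powr \<rho>) * (x * \<bar>z - 1\<bar>)" by (simp add: mult_ac)
  also have "x * \<bar>z - 1\<bar> = \<bar>x - y\<bar>"
  proof -
    have "y - x = x * (z - 1)" by (simp add: yx algebra_simps)
    then have "\<bar>y - x\<bar> = x * \<bar>z - 1\<bar>" using x by (simp add: abs_mult)
    then show ?thesis by (simp add: abs_minus_commute)
  qed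
  also have "4 * (1 + z powr \<rho>) * \<bar>x - y\<bar> \<le> 4 * (1 + z powr \<rho>) * d" using d by (intro mult_left_mono) (auto simp: add_nonneg_nonneg)
  finally have "\<bar>z powr \<rho> - 1\<bar> * max x y \<le> 4 * (1 + z powr \<rho>) * d" unfolding mx .
  then have "\<bar>z powr \<rho> - 1\<bar> / d \<le> 4 * (1 + z powr \<rho>) / max x y"
    using d x y by (simp add: field_simps)
  then show ?thesis unfolding e1 z_def .
qed

text \<open>The triangle inequality through \<open>r * t\<close>: the distance from \<open>t\<close>
  to \<open>r * t\<close> is \<open>1 - r\<close>, which is at most the distance from
  \<open>r * t\<close> to \<open>s\<close>. This controls the regularized Cauchy kernel uniformly in
  the radius.\<close>

lemma cauchy_kernel_dist:
  assumes "0 \<le> r" "r < 1" "norm t = 1" "norm s = 1"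
  shows "norm (t - s) \<le> 2 * norm (1 - of_real r * t * cnj s)"
proof -
  have e: "norm (1 - of_real r * t * cnj s) = norm (s - of_real r * t)"
  proof -
    have "s * (1 - of_real r * t * cnj s) = s - of_real r * t"
      using assms(4) by (simp add: algebra_simps) (metis complex_norm_square mult.commute mult.left_commute mult_1 of_real_1 one_power2)
    then have "norm (s - of_real r * t) = norm s * norm (1 - of_real r * t * cnj s)" by (metis norm_mult)
    then show ?thesis using assms by simp
  qed
  have a: "norm (t - of_real r * t) = 1 - r"
  proof -
    have "t - of_real r * t = of_real (1 - r) * t" by (simp add: algebra_simps)
    then show ?thesis using assms by (simp add: norm_mult del: of_real_diff)
  qed
  have b: "1 - r \<le> norm (s - of_real r * t)"
    using norm_triangle_ineq2[of s "of_real r * t"] assms by (simp add: norm_mult)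
  have "norm (t - s) \<le> norm (t - of_real r * t) + norm (of_real r * t - s)"
    by (metis norm_triangle_ineq add_diff_eq diff_add_cancel)
  also have "norm (of_real r * t - s) = norm (s - of_real r * t)" by (rule norm_minus_commute)
  finally show ?thesis unfolding e a using b by simp
qed

text \<open>The factor \<open>a powr (e1 - e2)\<close> gives both summands the same homogeneity, so
  a single power of \<open>a\<close> comes out.\<close>

lemma two_power_integral:
  fixes e1 e2 :: real
  assumes e1: "-1 < e1" "e1 < 0" and e2: "-1 < e2" "e2 < 0"
  obtains C where "C \<ge> 0"
    "\<And>\<tau> a. norm \<tau> = 1 \<Longrightarrow> a > 0 \<Longrightarrow>
      (\<integral>\<^sup>+s. ennreal (8 * (norm (s - \<tau>) powr e1 + a powr (e1 - e2) * norm (s - \<tau>) powr e2) / max a (norm (s - \<tau>))) \<partial>\<mu>)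
        \<le> ennreal (C * a powr e1)"
proof -
  obtain C1 where C1: "C1 \<ge> 0" "\<And>\<tau> x. norm \<tau> = 1 \<Longrightarrow> x > 0 \<Longrightarrow> (\<integral>\<^sup>+s. ennreal (norm (s - \<tau>) powr e1 / max x (norm (s - \<tau>))) \<partial>\<mu>) \<le> ennreal (C1 * x powr e1)"
    using circle_kernel_integral[OF e1] by metis
  obtain C2 where C2: "C2 \<ge> 0" "\<And>\<tau> x. norm \<tau> = 1 \<Longrightarrow> x > 0 \<Longrightarrow> (\<integral>\<^sup>+s. ennreal (norm (s - \<tau>) powr e2 / max x (norm (s - \<tau>))) \<partial>\<mu>) \<le> ennreal (C2 * x powr e2)"
    using circle_kernel_integral[OF e2] by metis
  have lin: "ennreal (a * c + b * d) = ennreal a * ennreal c + ennreal b * ennreal d"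
    if "a \<ge> 0" "b \<ge> 0" "c \<ge> 0" "d \<ge> 0" for a b c d
    using that by (simp add: ennreal_mult)
  show thesis
  proof (rule that[of "8 * (C1 + C2)"])
    fix \<tau> :: complex and a :: real assume \<tau>: "norm \<tau> = 1" and a: "a > 0"
    let ?y = "\<lambda>s. norm (s - \<tau>)"
    have "(\<integral>\<^sup>+s. ennreal (8 * (?y s powr e1 + a powr (e1 - e2) * ?y s powr e2) / max a (?y s)) \<partial>\<mu>)
      = (\<integral>\<^sup>+s. ennreal 8 * ennreal (?y s powr e1 / max a (?y s)) + ennreal (8 * a powr (e1 - e2)) * ennreal (?y s powr e2 / max a (?y s)) \<partial>\<mu>)"
    proof (intro nn_integral_cong)
      fix s
      have m: "max a (?y s) > 0" using a by simp
      have "8 * (?y s powr e1 + a powr (e1 - e2) * ?y s powr e2) / max a (?y s) = 8 * (?y s powr e1 / max a (?y s)) + 8 * a powr (e1 - e2) * (?y s powr e2 / max a (?y s))"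
        by (simp add: add_divide_distrib distrib_left)
      also have "ennreal \<dots> = ennreal 8 * ennreal (?y s powr e1 / max a (?y s)) + ennreal (8 * a powr (e1 - e2)) * ennreal (?y s powr e2 / max a (?y s))"
        by (rule lin) (use m in \<open>auto intro!: divide_nonneg_pos\<close>)
      finally show "ennreal (8 * (?y s powr e1 + a powr (e1 - e2) * ?y s powr e2) / max a (?y s)) = \<dots>" .
    qed
    also have "\<dots> = ennreal 8 * (\<integral>\<^sup>+s. ennreal (?y s powr e1 / max a (?y s)) \<partial>\<mu>) + ennreal (8 * a powr (e1 - e2)) * (\<integral>\<^sup>+s. ennreal (?y s powr e2 / max a (?y s)) \<partial>\<mu>)"
      by (subst nn_integral_add; (subst nn_integral_cmult)?; (subst nn_integral_cmult)?; measurable)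
    also have "\<dots> \<le> ennreal 8 * ennreal (C1 * a powr e1) + ennreal (8 * a powr (e1 - e2)) * ennreal (C2 * a powr e2)"
      by (intro add_mono mult_left_mono C1 C2 \<tau> a) auto
    also have "\<dots> = ennreal (8 * (C1 * a powr e1) + 8 * a powr (e1 - e2) * (C2 * a powr e2))"
      by (rule lin[symmetric]) (use C1(1) C2(1) in auto)
    also have "8 * (C1 * a powr e1) + 8 * a powr (e1 - e2) * (C2 * a powr e2) = 8 * (C1 + C2) * a powr e1"
    proof -
      have "a powr (e1 - e2) * a powr e2 = a powr e1" by (simp add: powr_add[symmetric])
      then have "8 * a powr (e1 - e2) * (C2 * a powr e2) = 8 * C2 * a powr e1" by (metis mult.assoc mult.commute)
      then show ?thesis by (simp add: algebra_simps)
    qed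
    finally show "(\<integral>\<^sup>+s. ennreal (8 * (?y s powr e1 + a powr (e1 - e2) * ?y s powr e2) / max a (?y s)) \<partial>\<mu>) \<le> ennreal (8 * (C1 + C2) * a powr e1)" .
  qed (use C1 C2 in simp)
qed

text \<open>Majorant for the kernel of the difference between the weighted and the unweighted Cauchy
  operator. The number 8 is 2 from \<open>cauchy_kernel_dist\<close> times 4 from
  \<open>power_kernel_bound\<close>.\<close>

definition weight_kernel :: "complex \<Rightarrow> real \<Rightarrow> complex \<Rightarrow> complex \<Rightarrow> real" where
  "weight_kernel \<tau> \<rho> t s = 8 * (1 + (norm (s - \<tau>) / norm (t - \<tau>)) powr \<rho>) / max (norm (t - \<tau>)) (norm (s - \<tau>))"

lemma weight_kernel_nonneg: "weight_kernel \<tau> \<rho> t s \<ge> 0"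
  by (auto simp: weight_kernel_def intro!: divide_nonneg_nonneg add_nonneg_nonneg simp: le_max_iff_disj)

lemma weight_kernel_Schur:
  assumes pq: "1 < p" "1 < q" "1 / p + 1 / q = 1" and \<tau>: "norm \<tau> = 1" and \<rho>: "- (1 / q) < \<rho>" "\<rho> < 1 / p"
  shows "\<exists>C. C \<ge> 0 \<and>
    (\<forall>f v. f \<in> Lp p \<longrightarrow> v \<in> borel_measurable \<mu> \<longrightarrow>
      (AE t in \<mu>. ennreal (norm (v t)) \<le> (\<integral>\<^sup>+s. ennreal (weight_kernel \<tau> \<rho> t s * norm (f s)) \<partial>\<mu>)) \<longrightarrow>
      v \<in> Lp p \<and> Lp_norm p v \<le> C * Lp_norm p f)"
proof -
  have pp: "1 / p < 1" "1 / q < 1" "1 / p > 0" "1 / q > 0" using pq by auto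
  obtain C1 where C1: "C1 \<ge> 0" "\<And>\<tau> a. norm \<tau> = 1 \<Longrightarrow> a > 0 \<Longrightarrow>
      (\<integral>\<^sup>+s. ennreal (8 * (norm (s - \<tau>) powr (- (1/p)) + a powr (- (1/p) - (\<rho> - 1/p)) * norm (s - \<tau>) powr (\<rho> - 1/p)) / max a (norm (s - \<tau>))) \<partial>\<mu>)
        \<le> ennreal (C1 * a powr (- (1/p)))"
    using two_power_integral[of "- (1/p)" "\<rho> - 1/p"] \<rho> pp pq(3) by (smt (verit))
  obtain C2 where C2: "C2 \<ge> 0" "\<And>\<tau> a. norm \<tau> = 1 \<Longrightarrow> a > 0 \<Longrightarrow>
      (\<integral>\<^sup>+s. ennreal (8 * (norm (s - \<tau>) powr (- (1/q)) + a powr (- (1/q) - (- \<rho> - 1/q)) * norm (s - \<tau>) powr (- \<rho> - 1/q)) / max a (norm (s - \<tau>))) \<partial>\<mu>)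
        \<le> ennreal (C2 * a powr (- (1/q)))"
    using two_power_integral[of "- (1/q)" "- \<rho> - 1/q"] \<rho> pp pq(3) by (smt (verit))
  \<comment> \<open>With this weight, \<open>h t powr q\<close> and \<open>h t powr p\<close> are
    the distance to the powers -1/p and -1/q. The exponents -1/p, \<rho> - 1/p, -1/q and -\<rho> -
    1/q in the two Schur conditions all lie in (-1, 0) exactly when \<rho> is in (-1/q,
    1/p).\<close>
  define h where "h t = norm (t - \<tau>) powr (- (1 / (p * q)))" for t
  have [measurable]: "h \<in> borel_measurable \<mu>" unfolding h_def[abs_def] by measurable
  have hq: "h t powr q = norm (t - \<tau>) powr (- (1/p))" and hp: "h t powr p = norm (t - \<tau>) powr (- (1/q))" for t
    using pq(1,2) by (auto simp: h_def powr_powr)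
  have Km: "(\<lambda>x. weight_kernel \<tau> \<rho> (fst x) (snd x)) \<in> borel_measurable (\<mu> \<Otimes>\<^sub>M \<mu>)"
    unfolding weight_kernel_def by measurable
  have pd: "(norm a / norm b) powr \<rho> = norm a powr \<rho> / norm b powr \<rho>" for a b :: complex
    by (simp add: powr_divide)
  have h0: "AE t in \<mu>. h t > 0"
    using AE_circle_neq[of \<tau>] by eventually_elim (simp add: h_def)
  have A: "AE t in \<mu>. (\<integral>\<^sup>+s. ennreal (weight_kernel \<tau> \<rho> t s * h s powr q) \<partial>\<mu>) \<le> ennreal (C1 * h t powr q)"
    using AE_circle_neq[of \<tau>]
  proof eventually_elim
    case (elim t)
    have "weight_kernel \<tau> \<rho> t s * h s powr q = 8 * (norm (s - \<tau>) powr (- (1/p)) + norm (t - \<tau>) powr (- (1/p) - (\<rho> - 1/p)) * norm (s - \<tau>) powr (\<rho> - 1/p)) / max (norm (t - \<tau>)) (norm (s - \<tau>))" for s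
    proof -
      have "(norm (s - \<tau>) / norm (t - \<tau>)) powr \<rho> * norm (s - \<tau>) powr (- (1/p)) = norm (t - \<tau>) powr (- (1/p) - (\<rho> - 1/p)) * norm (s - \<tau>) powr (\<rho> - 1/p)"
      proof -
        have "\<rho> - 1/p = \<rho> + (- (1/p))" "- (1/p) - (\<rho> - 1/p) = - \<rho>" by simp_all
        then show ?thesis by (simp only: powr_add pd) (simp only: powr_minus divide_inverse mult_ac)
      qed
      then show ?thesis unfolding weight_kernel_def hq by (simp add: distrib_right)
    qed
    then show ?case using C1(2)[OF \<tau>, of "norm (t - \<tau>)"] elim by (simp add: hq)
  qed
  have B: "AE s in \<mu>. (\<integral>\<^sup>+t. ennreal (weight_kernel \<tau> \<rho> t s * h t powr p) \<partial>\<mu>) \<le> ennreal (C2 * h s powr p)"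
    using AE_circle_neq[of \<tau>]
  proof eventually_elim
    case (elim s)
    have "weight_kernel \<tau> \<rho> t s * h t powr p = 8 * (norm (t - \<tau>) powr (- (1/q)) + norm (s - \<tau>) powr (- (1/q) - (- \<rho> - 1/q)) * norm (t - \<tau>) powr (- \<rho> - 1/q)) / max (norm (s - \<tau>)) (norm (t - \<tau>))" for t
    proof -
      have "(norm (s - \<tau>) / norm (t - \<tau>)) powr \<rho> * norm (t - \<tau>) powr (- (1/q)) = norm (s - \<tau>) powr (- (1/q) - (- \<rho> - 1/q)) * norm (t - \<tau>) powr (- \<rho> - 1/q)"
      proof -
        have "- \<rho> - 1/q = - \<rho> + (- (1/q))" "- (1/q) - (- \<rho> - 1/q) = \<rho>" by simp_all
        then show ?thesis by (simp only: powr_add pd) (simp only: powr_minus divide_inverse mult_ac)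
      qed
      then show ?thesis unfolding weight_kernel_def hp by (simp add: distrib_right max.commute)
    qed
    then show ?case using C2(2)[OF \<tau>, of "norm (s - \<tau>)"] elim by (simp add: hp)
  qed
  show ?thesis
  proof (intro exI[of _ "(C1 + 1) * C2 powr (1 / p)"] conjI[of "_ \<ge> _"] allI impI)
    show "(C1 + 1) * C2 powr (1 / p) \<ge> 0" using C1 by simp
    fix f v :: "complex \<Rightarrow> complex" assume f: "f \<in> Lp p" and v: "v \<in> borel_measurable \<mu>"
      and le: "AE t in \<mu>. ennreal (norm (v t)) \<le> (\<integral>\<^sup>+s. ennreal (weight_kernel \<tau> \<rho> t s * norm (f s)) \<partial>\<mu>)"
    have hm: "h \<in> borel_measurable \<mu>" by measurable
    show "v \<in> Lp p \<and> Lp_norm p v \<le> (C1 + 1) * C2 powr (1 / p) * Lp_norm p f"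
      by (rule conjI; rule Schur_test[OF pq Km weight_kernel_nonneg hm h0 C1(1) A C2(1) B f v le])
  qed
qed

lemma cpow_mult_Lp:
  assumes \<tau>: "norm \<tau> = 1" and p: "p > 0" and \<beta>: "Re \<beta> > - (1 / p)"
  obtains S where "S \<ge> 1" "\<And>R y. R \<ge> S \<Longrightarrow> y \<in> Lp R \<Longrightarrow> (\<lambda>t. cpow \<tau> \<beta> t * y t) \<in> Lp p \<and> (\<lambda>t. ccpow \<tau> \<beta> t * y t) \<in> Lp p"
proof -
  define m where "m = max 0 (- Re \<beta>)"
  have m: "m < 1 / p" "m \<ge> 0" "- Re \<beta> \<le> m" using \<beta> p by (auto simp: m_def)
  \<comment> \<open>The reciprocal of \<open>e\<close> is the midpoint of \<open>m\<close> and
    \<open>1 / p\<close>: the power is still in L^e although \<open>e > p\<close>, and the slack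
    goes to the exponent \<open>S\<close> of the other factor.\<close>
  define e where "e = 2 / (m + 1 / p)"
  have mp: "m + 1 / p > 0" using m p by (simp add: add_nonneg_pos)
  have e: "e > 0" "1 / e = (m + 1 / p) / 2" using mp by (auto simp: e_def)
  have e2: "- Re \<beta> < 1 / e" "1 / e < 1 / p" using m e(2) by auto
  have "Re \<beta> * e > -1" using e2(1) e(1) by (simp add: field_simps)
  then have L: "cpow \<tau> \<beta> \<in> Lp e" "ccpow \<tau> \<beta> \<in> Lp e" using cpow_Lp[OF \<tau> e(1)] by auto
  define S where "S = 1 / (1 / p - 1 / e)"
  have S: "S > 0" "1 / e + 1 / S = 1 / p" using e2 by (auto simp: S_def)
  show thesis
  proof (rule that[of "max 1 S"])
    fix R y assume R: "R \<ge> max 1 S" and y: "y \<in> Lp R"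
    have yS: "y \<in> Lp S" using Lp_mono(1)[of S R y] S R y by auto
    show "(\<lambda>t. cpow \<tau> \<beta> t * y t) \<in> Lp p \<and> (\<lambda>t. ccpow \<tau> \<beta> t * y t) \<in> Lp p"
      using Hoelder(1)[OF e(1) S(1) p S(2) L(1) yS] Hoelder(1)[OF e(1) S(1) p S(2) L(2) yS] by auto
  qed simp
qed

text \<open>An exponent \<open>s\<close> above 1 makes the Riesz projection available for the
  weighted function.\<close>

lemma dist_power_mult_Lp:
  assumes \<tau>: "norm \<tau> = 1" and pq: "1 < p" "1 < q" "1 / p + 1 / q = 1" and \<rho>: "- (1 / q) < \<rho>"
  obtains s where "1 < s" "\<And>f. f \<in> Lp p \<Longrightarrow> (\<lambda>t. complex_of_real (norm (t - \<tau>) powr \<rho>) * f t) \<in> Lp s"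
proof -
  define m where "m = max 0 (- \<rho>)"
  have m: "m < 1 / q" "m \<ge> 0" "- \<rho> \<le> m" using \<rho> pq by (auto simp: m_def)
  define e where "e = 2 / (m + 1 / q)"
  have mp: "m + 1 / q > 0" using m pq by (simp add: add_nonneg_pos)
  have e: "e > 0" "1 / e = (m + 1 / q) / 2" using mp by (auto simp: e_def)
  have e2: "- \<rho> < 1 / e" "1 / e < 1 / q" using m e(2) by auto
  have "\<rho> * e > -1" using e2(1) e(1) by (simp add: field_simps)
  note L = dist_power_Lp[OF \<tau> e(1) this]
  define s where "s = 1 / (1 / e + 1 / p)"
  have d: "0 < 1 / e + 1 / p" "1 / e + 1 / p < 1" using e2 pq e(1) by (auto simp: add_pos_pos)
  then have s: "s > 1" "1 / e + 1 / p = 1 / s" by (auto simp: s_def)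
  show thesis
  proof (rule that[OF s(1)])
    fix f assume "f \<in> Lp p"
    then show "(\<lambda>t. complex_of_real (norm (t - \<tau>) powr \<rho>) * f t) \<in> Lp s"
      using pq s e(1) by (intro Hoelder(1)[OF _ _ _ s(2) L]) auto
  qed
qed

text \<open>Over a common denominator the two Cauchy integrals leave the numerator
  \<open>\<omega> s - \<omega> t\<close>. It vanishes on the diagonal and cancels the singularity of
  the kernel, so absolute values may be taken.\<close>

lemma cauchy_commutator_bound:
  assumes \<tau>: "norm \<tau> = 1" and \<rho>: "\<bar>\<rho>\<bar> \<le> 1" and t: "norm t = 1" "t \<noteq> \<tau>" and r: "0 \<le> r" "r < 1"
    and f: "integrable \<mu> f" and \<omega>f: "integrable \<mu> (\<lambda>s. complex_of_real (norm (s - \<tau>) powr \<rho>) * f s)"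
  shows "ennreal (norm (cauchy_int r (\<lambda>s. complex_of_real (norm (s - \<tau>) powr \<rho>) * f s) t / of_real (norm (t - \<tau>) powr \<rho>) - cauchy_int r f t))
    \<le> (\<integral>\<^sup>+s. ennreal (weight_kernel \<tau> \<rho> t s * norm (f s)) \<partial>\<mu>)"
proof -
  define \<omega> where "\<omega> s = complex_of_real (norm (s - \<tau>) powr \<rho>)" for s
  define k where "k s = \<omega> s * f s / (1 - of_real r * t * cnj s) / \<omega> t - f s / (1 - of_real r * t * cnj s)" for s
  have i1: "integrable \<mu> (\<lambda>s. \<omega> s * f s / (1 - of_real r * t * cnj s))"
    unfolding \<omega>_def by (rule cauchy_integrable[OF \<omega>f r t(1)])
  have i2: "integrable \<mu> (\<lambda>s. f s / (1 - of_real r * t * cnj s))"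
    by (rule cauchy_integrable[OF f r t(1)])
  have ki: "integrable \<mu> k" unfolding k_def[abs_def] using i1 i2 by (intro Bochner_Integration.integrable_diff integrable_divide_zero)
  have \<omega>t: "norm (t - \<tau>) powr \<rho> > 0" using t by simp
  have "cauchy_int r (\<lambda>s. \<omega> s * f s) t / \<omega> t - cauchy_int r f t = (\<integral>s. k s \<partial>\<mu>)"
    unfolding cauchy_int_def k_def
    by (subst Bochner_Integration.integral_diff[OF integrable_divide_zero[OF i1] i2]) (simp only: integral_divide_zero)
  then have "ennreal (norm (cauchy_int r (\<lambda>s. \<omega> s * f s) t / \<omega> t - cauchy_int r f t)) = ennreal (norm (\<integral>s. k s \<partial>\<mu>))" by simp
  also have "\<dots> \<le> (\<integral>\<^sup>+s. ennreal (norm (k s)) \<partial>\<mu>)" by (rule integral_norm_bound_ennreal[OF ki])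
  also have "\<dots> \<le> (\<integral>\<^sup>+s. ennreal (weight_kernel \<tau> \<rho> t s * norm (f s)) \<partial>\<mu>)"
  proof (rule nn_integral_mono_AE)
    show "AE s in \<mu>. ennreal (norm (k s)) \<le> ennreal (weight_kernel \<tau> \<rho> t s * norm (f s))"
      using AE_circle_neq[of \<tau>] AE_space
    proof eventually_elim
      case (elim s)
      then have s: "norm s = 1" "s \<noteq> \<tau>" by auto
      define d where "d = 2 * norm (1 - of_real r * t * cnj s)"
      have nz: "1 - of_real r * t * cnj s \<noteq> 0" by (rule cauchy_kernel_nz) (use t r s in \<open>auto simp: norm_mult\<close>)
      have d0: "d > 0" using nz by (simp add: d_def)
      have "\<bar>norm (t - \<tau>) - norm (s - \<tau>)\<bar> \<le> norm ((t - \<tau>) - (s - \<tau>))" by (rule norm_triangle_ineq3)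
      also have "\<dots> \<le> d" using cauchy_kernel_dist[OF r t(1) s(1)] by (simp add: d_def)
      finally have dd: "\<bar>norm (t - \<tau>) - norm (s - \<tau>)\<bar> \<le> d" .
      have "k s = (\<omega> s - \<omega> t) / (\<omega> t * (1 - of_real r * t * cnj s)) * f s"
        using nz \<omega>t unfolding k_def \<omega>_def by (simp add: divide_simps) (simp add: algebra_simps)
      then have "norm (k s) = norm (\<omega> s - \<omega> t) / (norm (t - \<tau>) powr \<rho> * norm (1 - of_real r * t * cnj s)) * norm (f s)"
        by (simp add: norm_mult norm_divide \<omega>_def)
      also have "norm (\<omega> s - \<omega> t) = \<bar>norm (s - \<tau>) powr \<rho> - norm (t - \<tau>) powr \<rho>\<bar>"
        unfolding \<omega>_def of_real_diff[symmetric] norm_of_real ..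
      also have "\<bar>norm (s - \<tau>) powr \<rho> - norm (t - \<tau>) powr \<rho>\<bar> / (norm (t - \<tau>) powr \<rho> * norm (1 - of_real r * t * cnj s))
         = 2 * (\<bar>norm (s - \<tau>) powr \<rho> - norm (t - \<tau>) powr \<rho>\<bar> / (norm (t - \<tau>) powr \<rho> * d))"
        by (simp add: d_def)
      also have "\<dots> \<le> 2 * (4 * (1 + (norm (s - \<tau>) / norm (t - \<tau>)) powr \<rho>) / max (norm (t - \<tau>)) (norm (s - \<tau>)))"
        using t s by (intro mult_left_mono power_kernel_bound[OF _ _ \<rho> dd d0]) auto
      also have "\<dots> = weight_kernel \<tau> \<rho> t s" by (simp add: weight_kernel_def)
      finally show ?case by (intro ennreal_leI) (simp add: mult_right_mono)
    qed
  qed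
  finally show ?thesis unfolding \<omega>_def .
qed

lemma Riesz_projection_norm:
  assumes p: "1 < p"
  obtains C where "C \<ge> 0" "\<And>f. f \<in> Lp p \<Longrightarrow> Lp_norm p (Riesz_projection p f) \<le> C * Lp_norm p f"
proof -
  obtain C where C: "C \<ge> 0" "\<And>f. f \<in> Lp p \<Longrightarrow> \<exists>h\<in>Hardy p. (\<forall>n\<ge>0. fourier_coeff h n = fourier_coeff f n) \<and> Lp_norm p h \<le> C * Lp_norm p f"
    using Riesz_projection_bounded[OF p] by metis
  show thesis
  proof (rule that[OF C(1)])
    fix f assume f: "f \<in> Lp p"
    obtain h where h: "h \<in> Hardy p" "\<forall>n\<ge>0. fourier_coeff h n = fourier_coeff f n" "Lp_norm p h \<le> C * Lp_norm p f"
      using C(2)[OF f] by blast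
    note P = Riesz_projection_spec[OF p f]
    have "AE t in \<mu>. Riesz_projection p f t = h t"
      by (rule Hardy_unique) (use Hardy_mono[of 1 p] p P h in auto)
    then have "Lp_norm p (Riesz_projection p f) = Lp_norm p h"
      by (rule Lp_norm_cong_AE) (use HardyD(1)[OF P(1)] HardyD(1)[OF h(1)] in auto)
    then show "Lp_norm p (Riesz_projection p f) \<le> C * Lp_norm p f" using h(3) by simp
  qed
qed

text \<open>Up to bounded factors the operator is the Riesz projection conjugated by the positive
  weight \<omega>. Its difference from the projection itself is dominated by
  \<open>weight_kernel\<close> and falls to the Schur test; the projection is bounded by the theorem
  of M. Riesz.\<close>

lemma power_WH_bounded:
  assumes pq: "1 < p" "1 < q" "1 / p + 1 / q = 1" and \<tau>: "norm \<tau> = 1" and \<beta>: "- (1 / q) < Re \<beta>" "Re \<beta> < 1 / p"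
  shows "WH_bounded p (cpow \<tau> \<beta>) (ccpow \<tau> (- \<beta>))"
proof -
  have p1: "p \<ge> 1" "p > 0" using pq by auto
  define \<rho> where "\<rho> = Re \<beta>"
  have "1 / p < 1" "1 / q < 1" using pq by auto
  then have \<rho>: "\<bar>\<rho>\<bar> \<le> 1" using \<beta> by (auto simp: \<rho>_def)
  define B where "B = exp (pi * \<bar>Im \<beta>\<bar>)"
  have B: "B \<ge> 0" by (simp add: B_def)
  define \<omega> where "\<omega> t = complex_of_real (norm (t - \<tau>) powr \<rho>)" for t
  have [measurable]: "\<omega> \<in> borel_measurable \<mu>" unfolding \<omega>_def[abs_def] by measurable
  note [measurable] = cpow_measurable[OF \<tau>] ccpow_measurable[OF \<tau>]
  from weight_kernel_Schur[OF pq \<tau> \<beta>[folded \<rho>_def]]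
  obtain C1 where C1': "C1 \<ge> 0 \<and>
    (\<forall>f v. f \<in> Lp p \<longrightarrow> v \<in> borel_measurable \<mu> \<longrightarrow>
      (AE t in \<mu>. ennreal (norm (v t)) \<le> (\<integral>\<^sup>+s. ennreal (weight_kernel \<tau> \<rho> t s * norm (f s)) \<partial>\<mu>)) \<longrightarrow>
      v \<in> Lp p \<and> Lp_norm p v \<le> C1 * Lp_norm p f)" by (rule exE)
  note C1 = conjunct1[OF C1']
  obtain C2 where C2: "C2 \<ge> 0" "\<And>f. f \<in> Lp p \<Longrightarrow> Lp_norm p (Riesz_projection p f) \<le> C2 * Lp_norm p f"
    using Riesz_projection_norm[OF pq(1)] by metis
  obtain s where s: "1 < s" "\<And>f. f \<in> Lp p \<Longrightarrow> (\<lambda>t. \<omega> t * f t) \<in> Lp s"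
    using dist_power_mult_Lp[OF \<tau> pq \<beta>(1)] unfolding \<omega>_def \<rho>_def by metis
  obtain r :: "nat \<Rightarrow> real" where r: "\<And>n. 0 \<le> r n" "\<And>n. r n < 1" "r \<longlonglongrightarrow> 1" by (rule abel_radii) blast
  define K where "K = B * (C1 + C2) * B"
  have K0: "K \<ge> 0" using B C1 C2 by (simp add: K_def)
  show ?thesis
    unfolding WH_bounded_def
  proof (intro exI[of _ K] conjI K0 ballI)
    fix f assume f: "f \<in> Lp p"
    have [measurable]: "f \<in> borel_measurable \<mu>" using f by auto
    \<comment> \<open>The bounded quotient of the complex power by the positive weight is absorbed
      into the data, so that only \<omega> has to be commuted with the projection.\<close>
    define f' where "f' t = ccpow \<tau> \<beta> t / \<omega> t * f t" for t
    have [measurable]: "f' \<in> borel_measurable \<mu>" unfolding f'_def[abs_def] by measurable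
    have f'b: "AE t in \<mu>. norm (f' t) \<le> B * norm (f t)"
      using AE_circle_neq[of \<tau>]
    proof eventually_elim
      case (elim t)
      have "norm (ccpow \<tau> \<beta> t) \<le> B * norm (t - \<tau>) powr \<rho>" using norm_cpow_le(3)[OF \<tau> elim] by (simp add: B_def \<rho>_def)
      then have "norm (ccpow \<tau> \<beta> t / \<omega> t) \<le> B" using elim by (simp add: \<omega>_def norm_divide divide_le_eq)
      then show ?case unfolding f'_def norm_mult by (rule mult_right_mono) simp
    qed
    have f'L: "f' \<in> Lp p" "Lp_norm p f' \<le> B * Lp_norm p f"
      using Lp_bound[OF p1(2) f B _ f'b] by auto
    have \<omega>f': "AE t in \<mu>. \<omega> t * f' t = ccpow \<tau> \<beta> t * f t"
      using AE_circle_neq[of \<tau>] by eventually_elim (simp add: f'_def \<omega>_def)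
    define g where "g = Riesz_projection p f'"
    have g: "g \<in> Hardy p" "\<And>n. n \<ge> 0 \<Longrightarrow> fourier_coeff g n = fourier_coeff f' n" "Lp_norm p g \<le> C2 * Lp_norm p f'"
      unfolding g_def using Riesz_projection_spec[OF pq(1) f'L(1)] C2(2)[OF f'L(1)] by auto
    define h where "h = Riesz_projection s (\<lambda>t. \<omega> t * f' t)"
    have h: "h \<in> Hardy s" "\<And>n. n \<ge> 0 \<Longrightarrow> fourier_coeff h n = fourier_coeff (\<lambda>t. \<omega> t * f' t) n"
      unfolding h_def using Riesz_projection_spec[OF s(1) s(2)[OF f'L(1)]] by auto
    have g1: "g \<in> Hardy 1" and h1: "h \<in> Hardy 1" using Hardy_mono[of 1 p g] Hardy_mono[of 1 s h] g h pq s by auto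
    have gi: "integrable \<mu> g" and hi: "integrable \<mu> h" using g1 h1 HardyD(1) Lp_one_iff by auto
    have f'i: "integrable \<mu> f'" using Lp_imp_integrable[OF f'L(1) p1(1)] .
    have \<omega>f'i: "integrable \<mu> (\<lambda>t. \<omega> t * f' t)" using Lp_imp_integrable[OF s(2)[OF f'L(1)]] s(1) by simp
    have [measurable]: "g \<in> borel_measurable \<mu>" "h \<in> borel_measurable \<mu>" using gi hi by auto
    define v where "v t = h t / \<omega> t - g t" for t
    have vm[measurable]: "v \<in> borel_measurable \<mu>" unfolding v_def[abs_def] by measurable
    note cg = cauchy_int_tendsto[OF g1 r] and ch = cauchy_int_tendsto[OF h1 r]
    \<comment> \<open>The commutator bound couples the Cauchy integrals of \<open>g\<close> and
      \<open>h\<close> at the same radius, so both need limits along a common sequence of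
      radii.\<close>
    obtain k :: "nat \<Rightarrow> nat" where k: "strict_mono k"
      "AE t in \<mu>. (\<lambda>n. cauchy_int (r (k n)) g t - g t) \<longlonglongrightarrow> 0" "AE t in \<mu>. (\<lambda>n. cauchy_int (r (k n)) h t - h t) \<longlonglongrightarrow> 0"
      by (rule AE_subseq_two[of "\<lambda>n t. cauchy_int (r n) g t - g t" "\<lambda>n t. cauchy_int (r n) h t - h t"])
         (use cg ch gi hi in auto)
    have "AE t in \<mu>. ennreal (norm (v t)) \<le> (\<integral>\<^sup>+s. ennreal (weight_kernel \<tau> \<rho> t s * norm (f' s)) \<partial>\<mu>)"
      using k(2,3) AE_circle_neq[of \<tau>] AE_space
    proof eventually_elim
      case (elim t)
      have t: "norm t = 1" "t \<noteq> \<tau>" using elim by auto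
      have \<omega>t: "\<omega> t \<noteq> 0" using t by (simp add: \<omega>_def)
      have lim: "(\<lambda>n. cauchy_int (r (k n)) h t / \<omega> t - cauchy_int (r (k n)) g t) \<longlonglongrightarrow> v t"
        unfolding v_def using elim(1,2) \<omega>t by (intro tendsto_intros) (auto simp: LIM_zero_iff)
      have "ennreal (norm (cauchy_int (r (k n)) h t / \<omega> t - cauchy_int (r (k n)) g t)) \<le> (\<integral>\<^sup>+s. ennreal (weight_kernel \<tau> \<rho> t s * norm (f' s)) \<partial>\<mu>)" for n
      proof -
        have "cauchy_int (r (k n)) h t = cauchy_int (r (k n)) (\<lambda>t. \<omega> t * f' t) t"
          by (rule cauchy_int_cong_coeff[OF hi \<omega>f'i r(1,2) t(1) h(2)])
        moreover have "cauchy_int (r (k n)) g t = cauchy_int (r (k n)) f' t"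
          by (rule cauchy_int_cong_coeff[OF gi f'i r(1,2) t(1) g(2)])
        ultimately show ?thesis
          using cauchy_commutator_bound[OF \<tau> \<rho> t r(1,2) f'i \<omega>f'i[unfolded \<omega>_def], of "k n"] unfolding \<omega>_def by simp
      qed
      then show ?case by (intro LIMSEQ_le_const2[OF tendsto_ennrealI[OF tendsto_norm[OF lim]]]) blast
    qed
    then have vL: "v \<in> Lp p" "Lp_norm p v \<le> C1 * Lp_norm p f'" using conjunct2[OF C1', THEN spec, THEN spec, THEN mp, OF f'L(1), THEN mp, OF vm] by auto
    define U where "U t = cpow \<tau> (- \<beta>) t * h t" for t
    have [measurable]: "U \<in> borel_measurable \<mu>" unfolding U_def[abs_def] by measurable
    have vg: "(\<lambda>t. v t + g t) \<in> Lp p" "Lp_norm p (\<lambda>t. v t + g t) \<le> (C1 + C2) * Lp_norm p f'"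
      using Lp_add[OF p1(1) vL(1) HardyD(1)[OF g(1)]] vL(2) g(3) by (auto simp: distrib_right)
    have Ub: "AE t in \<mu>. norm (U t) \<le> B * norm (v t + g t)"
      using AE_circle_neq[of \<tau>]
    proof eventually_elim
      case (elim t)
      have "norm (cpow \<tau> (- \<beta>) t) \<le> B * norm (t - \<tau>) powr (- \<rho>)" using norm_cpow_le(1)[OF \<tau> elim, of "- \<beta>"] by (simp add: B_def \<rho>_def)
      then have "norm (U t) \<le> B * norm (t - \<tau>) powr (- \<rho>) * norm (h t)" unfolding U_def norm_mult by (rule mult_right_mono) simp
      also have "\<dots> = B * norm (h t / \<omega> t)" by (simp add: \<omega>_def norm_divide powr_minus_divide)
      finally show ?case by (simp add: v_def)
    qed
    have UL: "U \<in> Lp p" "Lp_norm p U \<le> B * Lp_norm p (\<lambda>t. v t + g t)"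
      using Lp_bound[OF p1(2) vg(1) B _ Ub] by auto
    \<comment> \<open>Analyticity is inherited from \<open>h\<close> in H^1; the estimate above has
      only to place the product in L^p.\<close>
    have UH: "U \<in> Hardy p" unfolding U_def[abs_def] by (rule cpow_mult_Hardy[OF \<tau> p1(1) h1 UL(1)[unfolded U_def[abs_def]]])
    have "Lp_norm p U \<le> B * ((C1 + C2) * (B * Lp_norm p f))"
    proof -
      have "(C1 + C2) * Lp_norm p f' \<le> (C1 + C2) * (B * Lp_norm p f)" using C1 C2(1) f'L(2) by (intro mult_left_mono) auto
      then have "Lp_norm p (\<lambda>t. v t + g t) \<le> (C1 + C2) * (B * Lp_norm p f)" using vg(2) by linarith
      then have "B * Lp_norm p (\<lambda>t. v t + g t) \<le> B * ((C1 + C2) * (B * Lp_norm p f))" using B by (intro mult_left_mono)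
      then show ?thesis using UL(2) by linarith
    qed
    then have Un: "Lp_norm p U \<le> K * Lp_norm p f" by (simp add: K_def mult.assoc)
    have "fourier_coeff (\<lambda>t. cpow \<tau> \<beta> t * U t) n = fourier_coeff (\<lambda>t. inverse (ccpow \<tau> (- \<beta>) t) * f t) n" if "n \<ge> 0" for n
    proof -
      have "(\<lambda>t. cpow \<tau> \<beta> t * U t) = h" by (auto simp: U_def cpow_minus fun_eq_iff)
      moreover have "fourier_coeff h n = fourier_coeff (\<lambda>t. ccpow \<tau> \<beta> t * f t) n"
        unfolding h(2)[OF that] by (rule fourier_coeff_cong_AE[OF \<omega>f']) measurable
      ultimately show ?thesis by (simp add: cpow_minus)
    qed
    with UH Un show "\<exists>U\<in>Hardy p. Lp_norm p U \<le> K * Lp_norm p f \<and>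
      (\<forall>k\<ge>0. fourier_coeff (\<lambda>t. cpow \<tau> \<beta> t * U t) k = fourier_coeff (\<lambda>t. inverse (ccpow \<tau> (- \<beta>) t) * f t) k)"
      by (intro bexI[of _ U]) auto
  qed
qed

section \<open>Symbols close to one\<close>

text \<open>The equation \<open>y + P (m y) = 1\<close> is solved by iteration. It says that
  \<open>(1 + m) y\<close> has mean 1 and no coefficients of positive index, that is,
  \<open>1 + m\<close> is turned into an antianalytic function by an analytic multiplier.\<close>

lemma Neumann:
  assumes R: "1 < R"
  obtains \<epsilon> where "\<epsilon> > 0"
    "\<And>m :: complex \<Rightarrow> complex. m \<in> borel_measurable \<mu> \<Longrightarrow> (AE t in \<mu>. norm (m t) \<le> \<epsilon>) \<Longrightarrow>
      \<exists>y. y \<in> Hardy R \<and> (\<lambda>t. (1 + m t) * y t) \<in> co_Hardy R \<and> fourier_coeff (\<lambda>t. (1 + m t) * y t) 0 = 1"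
proof -
  have R1: "R \<ge> 1" "R > 0" using R by auto
  obtain C where C: "C \<ge> 0" "\<And>f. f \<in> Lp R \<Longrightarrow> Lp_norm R (Riesz_projection R f) \<le> C * Lp_norm R f"
    using Riesz_projection_norm[OF R] by metis
  \<comment> \<open>Chosen so that multiplication by \<open>m\<close> followed by the projection has
    norm at most 1/2; the added 1 only avoids a zero denominator.\<close>
  define \<epsilon> where "\<epsilon> = 1 / (2 * (C + 1))"
  have \<epsilon>: "\<epsilon> > 0" "C * \<epsilon> \<le> 1/2" using C(1) by (auto simp: \<epsilon>_def field_simps)
  show thesis
  proof (rule that[OF \<epsilon>(1)])
    fix m :: "complex \<Rightarrow> complex" assume m[measurable]: "m \<in> borel_measurable \<mu>" and mb: "AE t in \<mu>. norm (m t) \<le> \<epsilon>"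
    have mf: "(\<lambda>t. m t * f t) \<in> Lp R" "Lp_norm R (\<lambda>t. m t * f t) \<le> \<epsilon> * Lp_norm R f" if f: "f \<in> Lp R" for f
    proof -
      have [measurable]: "f \<in> borel_measurable \<mu>" using f by auto
      have "AE t in \<mu>. norm (m t * f t) \<le> \<epsilon> * norm (f t)"
        using mb by eventually_elim (simp add: norm_mult mult_right_mono)
      then show "(\<lambda>t. m t * f t) \<in> Lp R" "Lp_norm R (\<lambda>t. m t * f t) \<le> \<epsilon> * Lp_norm R f"
        using Lp_bound[OF R1(2) f, of \<epsilon> "\<lambda>t. m t * f t"] \<epsilon> by auto
    qed
    define T where "T f = Riesz_projection R (\<lambda>t. - (m t * f t))" for f
    define z where "z n = (T ^^ n) (\<lambda>t. 1)" for n
    have z0: "z 0 = (\<lambda>t. 1)" and zS: "z (Suc n) = T (z n)" for n by (simp_all add: z_def)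
    have zL: "z n \<in> Hardy R" for n
    proof (induction n)
      case 0
      show ?case unfolding z0 using R1 by (intro HardyI Lp_bounded(1)[where C=1]) (auto simp: fourier_coeff_const)
    next
      case (Suc n)
      show ?case unfolding zS T_def
        by (rule Riesz_projection_spec(1)[OF R Lp_uminus(1)[OF R1(2) mf(1)[OF HardyD(1)[OF Suc]]]])
    qed
    note zLp = HardyD(1)[OF zL]
    have zc: "fourier_coeff (z (Suc n)) k = - fourier_coeff (\<lambda>t. m t * z n t) k" if "k \<ge> 0" for n k
    proof -
      have "fourier_coeff (z (Suc n)) k = fourier_coeff (\<lambda>t. - (m t * z n t)) k"
        unfolding zS T_def by (rule Riesz_projection_spec(2)[OF R Lp_uminus(1)[OF R1(2) mf(1)[OF zLp]] that])
      then show ?thesis using fourier_coeff_scale[of "-1" "\<lambda>t. m t * z n t" k] by simp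
    qed
    have zn: "Lp_norm R (z n) \<le> 1 * (1/2)^n" for n
    proof (induction n)
      case 0
      show ?case unfolding z0 using Lp_bounded(2)[of R "\<lambda>t. 1" 1] R1 by simp
    next
      case (Suc n)
      have "Lp_norm R (z (Suc n)) \<le> C * Lp_norm R (\<lambda>t. - (m t * z n t))"
        unfolding zS T_def by (rule C(2)[OF Lp_uminus(1)[OF R1(2) mf(1)[OF zLp]]])
      also have "Lp_norm R (\<lambda>t. - (m t * z n t)) = Lp_norm R (\<lambda>t. m t * z n t)" by (rule Lp_uminus(2)[OF R1(2) mf(1)[OF zLp]])
      also have "C * Lp_norm R (\<lambda>t. m t * z n t) \<le> C * (\<epsilon> * Lp_norm R (z n))" using C(1) mf(2)[OF zLp] by (intro mult_left_mono)
      also have "\<dots> = (C * \<epsilon>) * Lp_norm R (z n)" by simp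
      also have "\<dots> \<le> 1/2 * (1 * (1/2)^n)" using \<epsilon> Suc C(1) by (intro mult_mono) auto
      finally show ?case by simp
    qed
    obtain F where F: "F \<in> Lp R" "\<And>n. Lp_norm R (\<lambda>t. F t - (\<Sum>k<n. z k t)) \<le> 2 * 1 * (1/2)^n"
      using Lp_complete[OF R1(1) zLp zn] by metis
    define Y where "Y n t = (\<Sum>k<n. z k t)" for n t
    have YH: "Y n \<in> Hardy R" for n
    proof (induction n)
      case 0
      have "Y 0 = (\<lambda>t. 0)" by (auto simp: Y_def)
      then show ?case by (auto intro!: HardyI simp: fourier_coeff_const)
    next
      case (Suc n)
      have "Y (Suc n) = (\<lambda>t. Y n t + z n t)" by (auto simp: Y_def)
      then show ?case using Hardy_add[OF R1(1) Suc zL] by simp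
    qed
    note YL = HardyD(1)[OF YH]
    have Ylim: "(\<lambda>n. Lp_norm R (\<lambda>t. Y n t - F t)) \<longlonglongrightarrow> 0"
    proof (rule tendsto_sandwich[OF _ _ tendsto_const])
      have "(\<lambda>n. 2 * 1 * (1/2::real)^n) \<longlonglongrightarrow> 2 * 1 * 0" by (intro tendsto_intros LIMSEQ_power_zero) simp
      then show "(\<lambda>n. 2 * 1 * (1/2::real)^n) \<longlonglongrightarrow> 0" by simp
      have "Lp_norm R (\<lambda>t. Y n t - F t) = Lp_norm R (\<lambda>t. F t - Y n t)" for n
        using Lp_uminus(2)[OF R1(2) Lp_diff(1)[OF R1(1) F(1) YL[of n]]] by simp
      then show "\<forall>\<^sub>F n in sequentially. Lp_norm R (\<lambda>t. Y n t - F t) \<le> 2 * 1 * (1/2)^n"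
        using F(2) by (auto simp: Y_def)
    qed simp
    have mYlim: "(\<lambda>n. Lp_norm R (\<lambda>t. m t * Y n t - m t * F t)) \<longlonglongrightarrow> 0"
    proof (rule tendsto_sandwich[OF _ _ tendsto_const])
      show "(\<lambda>n. \<epsilon> * Lp_norm R (\<lambda>t. Y n t - F t)) \<longlonglongrightarrow> 0" using tendsto_mult_left[OF Ylim, of \<epsilon>] by simp
      show "\<forall>\<^sub>F n in sequentially. Lp_norm R (\<lambda>t. m t * Y n t - m t * F t) \<le> \<epsilon> * Lp_norm R (\<lambda>t. Y n t - F t)"
        using mf(2)[OF Lp_diff(1)[OF R1(1) YL F(1)]] by (simp add: right_diff_distrib)
    qed simp
    have Yc: "fourier_coeff (Y (Suc n)) k = (if k = 0 then 1 else 0) - fourier_coeff (\<lambda>t. m t * Y n t) k" if k: "k \<ge> 0" for n k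
    proof (induction n)
      case 0
      have "Y (Suc 0) = (\<lambda>t. 1)" "(\<lambda>t. m t * Y 0 t) = (\<lambda>t. 0)" by (auto simp: Y_def z0)
      then show ?case by (simp add: fourier_coeff_const)
    next
      case (Suc n)
      have i: "integrable \<mu> (Y (Suc n))" "integrable \<mu> (z (Suc n))" "integrable \<mu> (\<lambda>t. m t * Y n t)" "integrable \<mu> (\<lambda>t. m t * z n t)"
        using Lp_imp_integrable[OF YL R1(1)] Lp_imp_integrable[OF zLp R1(1)] Lp_imp_integrable[OF mf(1)[OF YL] R1(1)] Lp_imp_integrable[OF mf(1)[OF zLp] R1(1)] by auto
      have e1: "Y (Suc (Suc n)) = (\<lambda>t. Y (Suc n) t + z (Suc n) t)" by (auto simp: Y_def)
      have e2: "(\<lambda>t. m t * Y (Suc n) t) = (\<lambda>t. m t * Y n t + m t * z n t)" by (auto simp: Y_def algebra_simps)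
      show ?case
        unfolding e1 e2 fourier_coeff_add[OF i(1,2)] fourier_coeff_add[OF i(3,4)] Suc zc[OF k] by simp
    qed
    have Fc: "fourier_coeff F k = (if k = 0 then 1 else 0) - fourier_coeff (\<lambda>t. m t * F t) k" if k: "k \<ge> 0" for k
    proof (rule LIMSEQ_unique)
      show "(\<lambda>n. fourier_coeff (Y (Suc n)) k) \<longlonglongrightarrow> fourier_coeff F k"
        by (rule LIMSEQ_Suc[OF fourier_coeff_tendsto[OF R1(1) YL F(1) Ylim]])
      show "(\<lambda>n. fourier_coeff (Y (Suc n)) k) \<longlonglongrightarrow> (if k = 0 then 1 else 0) - fourier_coeff (\<lambda>t. m t * F t) k"
        unfolding Yc[OF k]
        by (intro tendsto_intros fourier_coeff_tendsto[OF R1(1) mf(1)[OF YL] mf(1)[OF F(1)] mYlim])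
    qed
    have FH: "F \<in> Hardy R" by (rule Hardy_limit[OF R1(1) YH F(1) Ylim])
    have eq: "(\<lambda>t. (1 + m t) * F t) = (\<lambda>t. F t + m t * F t)" by (auto simp: algebra_simps)
    have c: "fourier_coeff (\<lambda>t. (1 + m t) * F t) k = (if k = 0 then 1 else 0)" if "k \<ge> 0" for k
      unfolding eq using Fc[OF that] Lp_imp_integrable[OF F(1) R1(1)] Lp_imp_integrable[OF mf(1)[OF F(1)] R1(1)]
      by (subst fourier_coeff_add) auto
    have "(\<lambda>t. (1 + m t) * F t) \<in> Lp R" unfolding eq by (rule Lp_add(1)[OF R1(1) F(1) mf(1)[OF F(1)]])
    then have "(\<lambda>t. (1 + m t) * F t) \<in> co_Hardy R" using c by (auto simp: co_Hardy_def)
    then show "\<exists>y. y \<in> Hardy R \<and> (\<lambda>t. (1 + m t) * y t) \<in> co_Hardy R \<and> fourier_coeff (\<lambda>t. (1 + m t) * y t) 0 = 1"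
      using FH c[of 0] by (intro exI[of _ F]) auto
  qed
qed

section \<open>Local bounds\<close>

text \<open>At distance \<open>d\<close> from the support of \<open>D\<close> the Cauchy kernel is
  bounded by \<open>2 / d\<close> uniformly in the radius, so the L^1 norm of \<open>D\<close> alone
  bounds its projection pointwise.\<close>

lemma cauchy_off_support:
  assumes D: "integrable \<mu> D" and h: "h \<in> Hardy 1" and c: "\<And>n. n \<ge> 0 \<Longrightarrow> fourier_coeff h n = fourier_coeff D n"
    and d: "d > 0" and sep: "\<And>t. norm t = 1 \<Longrightarrow> t \<in> A \<Longrightarrow> AE s in \<mu>. D s \<noteq> 0 \<longrightarrow> d \<le> norm (t - s)"
  shows "AE t in \<mu>. t \<in> A \<longrightarrow> norm (h t) \<le> 2 / d * (\<integral>s. norm (D s) \<partial>\<mu>)"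
proof -
  obtain r :: "nat \<Rightarrow> real" where r: "\<And>n. 0 \<le> r n" "\<And>n. r n < 1" "r \<longlonglongrightarrow> 1" by (rule abel_radii) blast
  note ch = cauchy_int_tendsto[OF h r]
  have hi: "integrable \<mu> h" using HardyD(1)[OF h] Lp_one_iff by blast
  have di: "integrable \<mu> (\<lambda>t. cauchy_int (r n) h t - h t)" for n using ch(2) hi by auto
  obtain k :: "nat \<Rightarrow> nat" where k: "AE t in \<mu>. (\<lambda>n. cauchy_int (r (k n)) h t - h t) \<longlonglongrightarrow> 0"
    using tendsto_L1_AE_subseq[OF di ch(1)] by blast
  from k AE_space show ?thesis
  proof eventually_elim
    case (elim t)
    have t: "norm t = 1" using elim by simp
    show ?case
    proof
      assume tA: "t \<in> A"
      have b: "norm (cauchy_int (r n) h t) \<le> 2 / d * (\<integral>s. norm (D s) \<partial>\<mu>)" for n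
      proof -
        have "cauchy_int (r n) h t = cauchy_int (r n) D t"
          by (rule cauchy_int_cong_coeff[OF hi D r(1,2) t c])
        also have "norm \<dots> \<le> (\<integral>s. norm (D s / (1 - of_real (r n) * t * cnj s)) \<partial>\<mu>)"
          unfolding cauchy_int_def by (rule integral_norm_bound)
        also have "\<dots> \<le> (\<integral>s. 2 / d * norm (D s) \<partial>\<mu>)"
        proof (rule integral_mono_AE)
          show "integrable \<mu> (\<lambda>s. norm (D s / (1 - of_real (r n) * t * cnj s)))" using cauchy_integrable[OF D r(1,2) t] by simp
          show "integrable \<mu> (\<lambda>s. 2 / d * norm (D s))" using D by simp
          show "AE s in \<mu>. norm (D s / (1 - of_real (r n) * t * cnj s)) \<le> 2 / d * norm (D s)"
            using sep[OF t tA] AE_space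
          proof eventually_elim
            case (elim s)
            show ?case
            proof (cases "D s = 0")
              case False
              have "d \<le> 2 * norm (1 - of_real (r n) * t * cnj s)"
                using elim False cauchy_kernel_dist[OF r(1,2) t, of s n] by auto
              then have "norm (D s) / norm (1 - of_real (r n) * t * cnj s) \<le> norm (D s) / (d / 2)"
                using d by (intro divide_left_mono mult_pos_pos) auto
              then show ?thesis by (simp add: norm_divide mult.commute)
            qed simp
          qed
        qed
        finally show ?thesis by simp
      qed
      have "(\<lambda>n. norm (cauchy_int (r (k n)) h t)) \<longlonglongrightarrow> norm (h t)"
        using elim(1) by (intro tendsto_norm) (simp add: LIM_zero_iff)
      then show "norm (h t) \<le> 2 / d * (\<integral>s. norm (D s) \<partial>\<mu>)" using b by (intro LIMSEQ_le_const2) auto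
    qed
  qed
qed

text \<open>The reflection argument in terms of coefficients. \<open>Y t * t powi n\<close>
  continues \<open>X\<close> across the arc from outside, so the difference \<open>D\<close>
  vanishes on the arc. Up to a polynomial, \<open>X\<close> is the projection of \<open>D\<close>
  and is therefore bounded at a positive distance from the support of \<open>D\<close>.\<close>

lemma gluing_bounded:
  assumes X: "X \<in> Hardy 1" and Y: "Y \<in> co_Hardy 1"
    and eq: "AE t in \<mu>. norm (t - \<tau>) < \<eta> \<longrightarrow> X t = Y t * t powi n" and \<eta>: "0 < \<eta>'" "\<eta>' < \<eta>"
  obtains C where "C \<ge> 0" "AE t in \<mu>. norm (t - \<tau>) < \<eta>' \<longrightarrow> norm (X t) \<le> C"
proof -
  have Xi: "integrable \<mu> X" and Yi: "integrable \<mu> Y" using HardyD(1)[OF X] co_HardyD(1)[OF Y] Lp_one_iff by auto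
  define G where "G t = Y t * t powi n" for t
  have Gi: "integrable \<mu> G" unfolding G_def[abs_def] by (rule fourier_integrable[OF Yi])
  have Gc: "fourier_coeff G k = fourier_coeff Y (k - n)" for k unfolding G_def[abs_def] by (rule fourier_coeff_shift)
  define D where "D t = X t - G t" for t
  have Di: "integrable \<mu> D" unfolding D_def[abs_def] using Xi Gi by auto
  \<comment> \<open>Coefficients of \<open>G\<close> with index above \<open>n\<close> vanish, so
    those of nonnegative index fit into a polynomial of degree \<open>d\<close>.\<close>
  define d where "d = nat (max 0 n)"
  define R where "R = (\<Sum>i\<le>d. Polynomial.monom (fourier_coeff G (int i)) i)"
  have Rc: "coeff R j = (if j \<le> d then fourier_coeff G (int j) else 0)" for j
    by (simp add: R_def coeff_sum sum.delta)
  define H where "H t = X t - poly R t" for t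
  have HH: "H \<in> Hardy 1" unfolding H_def[abs_def] by (intro Hardy_diff X poly_Hardy) auto
  have Ri: "integrable \<mu> (poly R)" using Lp_imp_integrable[OF trig_Lp[OF poly_trig, of 1 R]] by simp
  have Hc: "fourier_coeff H k = fourier_coeff D k" if k: "k \<ge> 0" for k
  proof -
    have "fourier_coeff (poly R) k = fourier_coeff G k"
    proof (cases "nat k \<le> d")
      case False
      then have "k > n" using k by (auto simp: d_def)
      then have "fourier_coeff G k = 0" unfolding Gc using co_HardyD(2)[OF Y] by simp
      then show ?thesis using False k by (simp add: fourier_coeff_poly Rc)
    qed (use k in \<open>simp add: fourier_coeff_poly Rc\<close>)
    then show ?thesis unfolding H_def[abs_def] D_def[abs_def] fourier_coeff_diff[OF Xi Ri] fourier_coeff_diff[OF Xi Gi] by simp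
  qed
  have sep: "AE s in \<mu>. D s \<noteq> 0 \<longrightarrow> \<eta> - \<eta>' \<le> norm (t - s)" if "t \<in> ball \<tau> \<eta>'" for t
    using eq
  proof eventually_elim
    case (elim s)
    show ?case
    proof
      assume "D s \<noteq> 0"
      then have "norm (s - \<tau>) \<ge> \<eta>" using elim by (auto simp: D_def G_def)
      moreover have "norm (s - \<tau>) \<le> norm (t - \<tau>) + norm (t - s)"
        using norm_triangle_ineq4[of "t - \<tau>" "t - s"] by simp
      moreover have "norm (t - \<tau>) < \<eta>'" using that by (simp add: dist_norm norm_minus_commute)
      ultimately show "\<eta> - \<eta>' \<le> norm (t - s)" by linarith
    qed
  qed
  have ae: "AE t in \<mu>. t \<in> ball \<tau> \<eta>' \<longrightarrow> norm (H t) \<le> 2 / (\<eta> - \<eta>') * (\<integral>s. norm (D s) \<partial>\<mu>)"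
    by (rule cauchy_off_support[OF Di HH Hc]) (use \<eta> sep in auto)
  obtain C where C: "C \<ge> 0" "\<forall>t. norm t = 1 \<longrightarrow> norm (poly R t) \<le> C"
    using continuous_circle_bounded[OF trig_continuous[OF poly_trig]] by blast
  have i0: "(\<integral>s. norm (D s) \<partial>\<mu>) \<ge> 0" by (intro integral_nonneg_AE) auto
  show thesis
  proof (rule that[of "2 / (\<eta> - \<eta>') * (\<integral>s. norm (D s) \<partial>\<mu>) + C"])
    show "2 / (\<eta> - \<eta>') * (\<integral>s. norm (D s) \<partial>\<mu>) + C \<ge> 0" using i0 C(1) \<eta> by simp
    show "AE t in \<mu>. norm (t - \<tau>) < \<eta>' \<longrightarrow> norm (X t) \<le> 2 / (\<eta> - \<eta>') * (\<integral>s. norm (D s) \<partial>\<mu>) + C"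
      using ae AE_space
    proof eventually_elim
      case (elim t)
      have "norm (X t) \<le> norm (H t) + norm (poly R t)" unfolding H_def using norm_triangle_ineq[of "X t - poly R t" "poly R t"] by simp
      moreover have "norm (poly R t) \<le> C" using C(2) elim by simp
      ultimately show ?case using elim by (auto simp: dist_norm norm_minus_commute)
    qed
  qed
qed

section \<open>Localization\<close>

lemma Lp_restrict:
  assumes "p > 0" "f \<in> Lp p" and [measurable]: "Measurable.pred \<mu> P"
  shows "(\<lambda>t. if P t then f t else 0) \<in> Lp p" "Lp_norm p (\<lambda>t. if P t then f t else 0) \<le> Lp_norm p f"
proof -
  have [measurable]: "f \<in> borel_measurable \<mu>" using assms by auto
  have m: "(\<lambda>t. if P t then f t else 0) \<in> borel_measurable \<mu>" by measurable
  show "(\<lambda>t. if P t then f t else 0) \<in> Lp p" "Lp_norm p (\<lambda>t. if P t then f t else 0) \<le> Lp_norm p f"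
    using Lp_bound[OF assms(1,2) zero_le_one m] by auto
qed

lemma Lp_split:
  assumes p: "p \<ge> 1" and P[measurable]: "Measurable.pred \<mu> P" and f[measurable]: "f \<in> borel_measurable \<mu>"
    and l1: "(\<lambda>t. if P t then f t else 0) \<in> Lp p" and l2: "(\<lambda>t. if \<not> P t then f t else 0) \<in> Lp p"
  shows "f \<in> Lp p" "Lp_norm p f \<le> Lp_norm p (\<lambda>t. if P t then f t else 0) + Lp_norm p (\<lambda>t. if \<not> P t then f t else 0)"
proof -
  have eq: "f = (\<lambda>t. (if P t then f t else 0) + (if \<not> P t then f t else 0))" by auto
  from Lp_add[OF p l1 l2, folded eq]
  show "f \<in> Lp p" "Lp_norm p f \<le> Lp_norm p (\<lambda>t. if P t then f t else 0) + Lp_norm p (\<lambda>t. if \<not> P t then f t else 0)" .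
qed

lemma Lp_patch:
  assumes p: "p \<ge> 1" and P[measurable]: "Measurable.pred \<mu> P" and f[measurable]: "f \<in> borel_measurable \<mu>"
    and u: "u \<in> Lp p" "C \<ge> 0" "AE t in \<mu>. P t \<longrightarrow> norm (f t) \<le> C * norm (u t)"
    and v: "v \<in> Lp p" "D \<ge> 0" "AE t in \<mu>. \<not> P t \<longrightarrow> norm (f t) \<le> D * norm (v t)"
  shows "f \<in> Lp p"
proof (rule Lp_split(1)[OF p P f])
  have p0: "p > 0" using p by simp
  have m: "(\<lambda>t. if P t then f t else 0) \<in> borel_measurable \<mu>" "(\<lambda>t. if \<not> P t then f t else 0) \<in> borel_measurable \<mu>"
    by measurable
  show "(\<lambda>t. if P t then f t else 0) \<in> Lp p"
    by (rule Lp_bound(1)[OF p0 u(1,2) m(1)]) (use u(2,3) in auto)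
  show "(\<lambda>t. if \<not> P t then f t else 0) \<in> Lp p"
    by (rule Lp_bound(1)[OF p0 v(1,2) m(2)]) (use v(2,3) in auto)
qed

text \<open>Carries the estimate for \<open>gp\<close>, \<open>gm\<close> over to other factors on
  the region \<open>A\<close>. Data on \<open>B\<close> pass through the known operator, because the
  ratios of the factors are bounded where they occur. Data outside \<open>B\<close> are separated
  from \<open>A\<close>, so their projection is bounded on \<open>A\<close> and contributes at most
  a multiple of \<open>inverse (g'p t)\<close>, which is in L^p.\<close>

lemma patch_bounded:
  assumes pq: "1 < p" "1 < q" "1 / p + 1 / q = 1" and pair: "WH_pair p q gp gm" and gm0: "AE t in \<mu>. gm t \<noteq> 0"
    and wb: "WH_bounded p gp gm" and g'm: "(\<lambda>t. inverse (g'm t)) \<in> Lp q" and g'p: "(\<lambda>t. inverse (g'p t)) \<in> Lp p"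
    and A[measurable]: "Measurable.pred \<mu> A" and B[measurable]: "Measurable.pred \<mu> B"
    and d: "d > 0" and sep: "\<And>t s. A t \<Longrightarrow> \<not> B s \<Longrightarrow> d \<le> norm (t - s)" and M: "M \<ge> 0"
    and b1: "AE t in \<mu>. B t \<longrightarrow> norm (gm t * inverse (g'm t)) \<le> M" and b2: "AE t in \<mu>. A t \<longrightarrow> norm (inverse (g'p t) * gp t) \<le> M"
  shows "\<exists>K. K \<ge> 0 \<and> (\<forall>r h. h \<in> Hardy q \<longrightarrow>
     (\<forall>k\<ge>0. fourier_coeff h k = fourier_coeff (\<lambda>t. inverse (g'm t) * poly r t) k) \<longrightarrow>
     (\<lambda>t. if A t then inverse (g'p t) * h t else 0) \<in> Lp p \<and>
     Lp_norm p (\<lambda>t. if A t then inverse (g'p t) * h t else 0) \<le> K * Lp_norm p (poly r))"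
proof -
  have p1: "p \<ge> 1" "p > 0" "q \<ge> 1" "q > 0" using pq by auto
  have qp: "1 / q + 1 / p = 1" using pq by simp
  have gpH: "gp \<in> Hardy q" and igmH: "(\<lambda>t. inverse (gm t)) \<in> co_Hardy q" using pair by (auto simp: WH_pair_def)
  have gm_m: "(\<lambda>t. inverse (gm t)) \<in> borel_measurable \<mu>" using co_HardyD(1)[OF igmH] by auto
  have [measurable]: "gm \<in> borel_measurable \<mu>" using borel_measurable_inverse[OF gm_m] by simp
  have [measurable]: "gp \<in> borel_measurable \<mu>" using HardyD(1)[OF gpH] by auto
  have [measurable]: "(\<lambda>t. inverse (g'm t)) \<in> borel_measurable \<mu>" "(\<lambda>t. inverse (g'p t)) \<in> borel_measurable \<mu>" using g'm g'p by auto
  have [measurable]: "poly r \<in> borel_measurable \<mu>" for r :: "complex poly" by (rule trig_measurable[OF poly_trig])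
  from wb obtain K0 where K0': "K0 \<ge> 0 \<and> (\<forall>f. f \<in> Lp p \<longrightarrow> (\<exists>U. U \<in> Hardy p \<and> Lp_norm p U \<le> K0 * Lp_norm p f \<and>
     (\<forall>k\<ge>0. fourier_coeff (\<lambda>t. gp t * U t) k = fourier_coeff (\<lambda>t. inverse (gm t) * f t) k)))"
    unfolding WH_bounded_iff by (rule exE)
  define Q where "Q = Lp_norm q (\<lambda>t. inverse (g'm t))"
  define Q' where "Q' = Lp_norm p (\<lambda>t. inverse (g'p t))"
  \<comment> \<open>The first summand accounts for the data on \<open>B\<close>, the second for the
    remaining data through the off-diagonal kernel and Hoelder's inequality.\<close>
  define K where "K = M * (K0 * M) + 2 / d * Q * Q'"
  have K: "K \<ge> 0" using K0' M d by (simp add: K_def Q_def Q'_def)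
  show ?thesis
  proof (intro exI[of _ K] conjI[of "_ \<ge> _"] K allI impI)
    fix r h assume h: "h \<in> Hardy q" and c: "\<forall>k\<ge>0. fourier_coeff h k = fourier_coeff (\<lambda>t. inverse (g'm t) * poly r t) k"
    have rL: "poly r \<in> Lp p" by (rule trig_Lp[OF poly_trig p1(2)])
    have [measurable]: "h \<in> borel_measurable \<mu>" using HardyD(1)[OF h] by auto
    \<comment> \<open>Chosen so that \<open>inverse (gm t) * f t\<close> is the restriction of
      \<open>inverse (g'm t) * poly r t\<close> to \<open>B\<close>.\<close>
    define f where "f t = (if B t then gm t * inverse (g'm t) * poly r t else 0)" for t
    have fm[measurable]: "f \<in> borel_measurable \<mu>" unfolding f_def[abs_def] by measurable
    have "AE t in \<mu>. norm (f t) \<le> M * norm (poly r t)"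
      using b1 by eventually_elim (use M in \<open>auto simp: f_def norm_mult intro!: mult_right_mono\<close>)
    from Lp_bound[OF p1(2) rL M fm this] have fL: "f \<in> Lp p" "Lp_norm p f \<le> M * Lp_norm p (poly r)" .
    from conjunct2[OF K0', rule_format, OF fL(1)] obtain U where U: "U \<in> Hardy p" "Lp_norm p U \<le> K0 * Lp_norm p f"
      "\<forall>k\<ge>0. fourier_coeff (\<lambda>t. gp t * U t) k = fourier_coeff (\<lambda>t. inverse (gm t) * f t) k" by (elim exE conjE)
    have [measurable]: "U \<in> borel_measurable \<mu>" using HardyD(1)[OF U(1)] by auto
    define D1 where "D1 t = (if B t then inverse (g'm t) * poly r t else 0)" for t
    define D where "D t = (if \<not> B t then inverse (g'm t) * poly r t else 0)" for t
    have irL: "(\<lambda>t. inverse (g'm t) * poly r t) \<in> Lp q" by (rule Lp_mult_trig[OF p1(4) g'm poly_trig])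
    have DL: "D1 \<in> Lp q" "D \<in> Lp q" unfolding D1_def[abs_def] D_def[abs_def]
      by (rule Lp_restrict(1)[OF p1(4) irL], measurable)+
    have Di: "integrable \<mu> D1" "integrable \<mu> D" using Lp_imp_integrable[OF DL(1) p1(3)] Lp_imp_integrable[OF DL(2) p1(3)] by auto
    define h2 where "h2 = Riesz_projection q D"
    note h2 = Riesz_projection_spec[OF pq(2) DL(2), folded h2_def]
    have h21: "h2 \<in> Hardy 1" using Hardy_mono[of 1 q] h2(1) p1 by auto
    have gU: "(\<lambda>t. gp t * U t) \<in> Hardy 1" by (rule Hardy_mult_conj(1)[OF pq(2,1) qp gpH U(1)])
    have [measurable]: "h2 \<in> borel_measurable \<mu>" using HardyD(1)[OF h2(1)] by auto
    have ae: "AE t in \<mu>. h t = gp t * U t + h2 t"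
    proof (rule Hardy_unique)
      show "h \<in> Hardy 1" using Hardy_mono[of 1 q] h p1 by auto
      show "(\<lambda>t. gp t * U t + h2 t) \<in> Hardy 1" by (rule Hardy_add[OF _ gU h21]) simp
      fix k :: int assume k: "k \<ge> 0"
      have e: "AE t in \<mu>. inverse (gm t) * f t = D1 t" using gm0 by eventually_elim (simp add: f_def D1_def)
      have "fourier_coeff h k = fourier_coeff (\<lambda>t. D1 t + D t) k"
        using c k by (simp add: D1_def D_def if_distrib cong: if_cong) (auto intro!: fourier_coeff_cong)
      also have "\<dots> = fourier_coeff D1 k + fourier_coeff D k" by (rule fourier_coeff_add[OF Di])
      also have "fourier_coeff D1 k = fourier_coeff (\<lambda>t. inverse (gm t) * f t) k"
        by (rule fourier_coeff_cong_AE[OF e, symmetric]) (use DL(1) in measurable)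
      also have "\<dots> = fourier_coeff (\<lambda>t. gp t * U t) k" using U(3) k by simp
      also have "fourier_coeff D k = fourier_coeff h2 k" using h2(2)[OF k] by simp
      also have "fourier_coeff (\<lambda>t. gp t * U t) k + fourier_coeff h2 k = fourier_coeff (\<lambda>t. gp t * U t + h2 t) k"
        using gU h21 HardyD(1) Lp_one_iff by (intro fourier_coeff_add[symmetric]) auto
      finally show "fourier_coeff h k = fourier_coeff (\<lambda>t. gp t * U t + h2 t) k" .
    qed
    define N where "N = 2 / d * (\<integral>s. norm (D s) \<partial>\<mu>)"
    have off: "AE t in \<mu>. t \<in> {t. A t} \<longrightarrow> norm (h2 t) \<le> N"
      unfolding N_def
      by (rule cauchy_off_support[OF Di(2) h21 h2(2) d]) (use sep in \<open>auto simp: D_def\<close>)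
    have "(\<integral>s. norm (D s) \<partial>\<mu>) = Lp_norm 1 D" by (simp add: Lp_norm_one)
    also have "\<dots> \<le> Lp_norm 1 (\<lambda>t. inverse (g'm t) * poly r t)"
      unfolding D_def[abs_def] by (rule Lp_restrict(2)) (use Hoelder_conj(1)[OF pq(2,1) qp g'm rL] in auto)
    also have "\<dots> \<le> Q * Lp_norm p (poly r)" unfolding Q_def by (rule Hoelder_conj(2)[OF pq(2,1) qp g'm rL])
    finally have N: "N \<le> 2 / d * Q * Lp_norm p (poly r)" "0 \<le> N"
      using d by (auto simp: N_def mult.assoc field_simps intro!: integral_nonneg_AE)
    define v1 where "v1 t = (if A t then inverse (g'p t) * gp t * U t else 0)" for t
    define v2 where "v2 t = (if A t then inverse (g'p t) * h2 t else 0)" for t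
    have [measurable]: "v1 \<in> borel_measurable \<mu>" "v2 \<in> borel_measurable \<mu>" unfolding v1_def[abs_def] v2_def[abs_def] by measurable
    have "AE t in \<mu>. norm (v1 t) \<le> M * norm (U t)"
      using b2 by eventually_elim (use M in \<open>auto simp: v1_def norm_mult intro!: mult_right_mono\<close>)
    note v1 = Lp_bound[OF p1(2) HardyD(1)[OF U(1)] M _ this]
    have "AE t in \<mu>. norm (v2 t) \<le> N * norm (inverse (g'p t))"
      using off by eventually_elim (use N in \<open>auto simp: v2_def norm_mult norm_inverse mult.commute intro!: mult_right_mono\<close>)
    note v2 = Lp_bound[OF p1(2) g'p N(2) _ this]
    have v1L: "v1 \<in> Lp p" "Lp_norm p v1 \<le> M * Lp_norm p U" by (rule v1, measurable)+
    have v2L: "v2 \<in> Lp p" "Lp_norm p v2 \<le> N * Q'" unfolding Q'_def by (rule v2, measurable)+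
    have eq: "AE t in \<mu>. (if A t then inverse (g'p t) * h t else 0) = v1 t + v2 t"
      using ae by eventually_elim (simp add: v1_def v2_def algebra_simps)
    have m: "(\<lambda>t. if A t then inverse (g'p t) * h t else 0) \<in> borel_measurable \<mu>" by measurable
    note v12 = Lp_add[OF p1(1) v1L(1) v2L(1)]
    have L: "(\<lambda>t. if A t then inverse (g'p t) * h t else 0) \<in> Lp p" by (rule Lp_cong_AE[OF eq m v12(1)])
    have "Lp_norm p (\<lambda>t. if A t then inverse (g'p t) * h t else 0) = Lp_norm p (\<lambda>t. v1 t + v2 t)"
      by (rule Lp_norm_cong_AE[OF eq m]) measurable
    also have "\<dots> \<le> M * Lp_norm p U + N * Q'" using v12(2) v1L(2) v2L(2) by linarith
    also have "\<dots> \<le> M * (K0 * (M * Lp_norm p (poly r))) + 2 / d * Q * Lp_norm p (poly r) * Q'"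
    proof (rule add_mono)
      have "K0 * Lp_norm p f \<le> K0 * (M * Lp_norm p (poly r))" using fL(2) K0' by (intro mult_left_mono) auto
      then show "M * Lp_norm p U \<le> M * (K0 * (M * Lp_norm p (poly r)))" using U(2) M by (intro mult_left_mono) auto
      show "N * Q' \<le> 2 / d * Q * Lp_norm p (poly r) * Q'" using N(1) by (rule mult_right_mono) (simp add: Q'_def)
    qed
    also have "\<dots> = K * Lp_norm p (poly r)" by (simp add: K_def algebra_simps)
    finally have "Lp_norm p (\<lambda>t. if A t then inverse (g'p t) * h t else 0) \<le> K * Lp_norm p (poly r)".
    with L show "(\<lambda>t. if A t then inverse (g'p t) * h t else 0) \<in> Lp p \<and>
      Lp_norm p (\<lambda>t. if A t then inverse (g'p t) * h t else 0) \<le> K * Lp_norm p (poly r)" ..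
  qed
qed

text \<open>A factorization of \<open>1 + m\<close> of index zero with all functions in L^R: the
  minus factor is \<open>(1 + m) y\<close>, the plus factor is \<open>k\<close>, and
  \<open>k / (1 + m)\<close> and \<open>y\<close> are their reciprocals.\<close>

definition near_pair :: "real \<Rightarrow> (complex \<Rightarrow> complex) \<Rightarrow> (complex \<Rightarrow> complex) \<Rightarrow> (complex \<Rightarrow> complex) \<Rightarrow> bool" where
  "near_pair R m y k \<longleftrightarrow> y \<in> Hardy R \<and> (\<lambda>t. (1 + m t) * y t) \<in> co_Hardy R \<and>
     k \<in> Hardy R \<and> (\<lambda>t. k t / (1 + m t)) \<in> co_Hardy R \<and> (AE t in \<mu>. y t * k t = 1)"

text \<open>The Neumann series is used for \<open>1 + m\<close> and for its reciprocal
  \<open>1 + m'\<close>. The product \<open>y k\<close> is analytic and equals a product of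
  antianalytic functions of mean 1, so it is the constant 1. The condition \<open>R \<ge> 2\<close>
  makes these products integrable.\<close>

lemma near_pair_exists:
  assumes R: "R \<ge> 2"
  obtains \<epsilon> where "\<epsilon> > 0"
    "\<And>m :: complex \<Rightarrow> complex. m \<in> borel_measurable \<mu> \<Longrightarrow> (AE t in \<mu>. norm (m t) \<le> \<epsilon>) \<Longrightarrow> \<exists>y k. near_pair R m y k"
proof -
  obtain e where e: "e > 0"
    "\<And>m :: complex \<Rightarrow> complex. m \<in> borel_measurable \<mu> \<Longrightarrow> (AE t in \<mu>. norm (m t) \<le> e) \<Longrightarrow>
      \<exists>y. y \<in> Hardy R \<and> (\<lambda>t. (1 + m t) * y t) \<in> co_Hardy R \<and> fourier_coeff (\<lambda>t. (1 + m t) * y t) 0 = 1"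
    by (rule Neumann[of R]) (use R in auto)
  \<comment> \<open>For \<open>norm (m t)\<close> at most 1/2 the perturbation of the reciprocal is
    at most twice as large, whence \<open>e / 2\<close>.\<close>
  show thesis
  proof (rule that[of "min (1/2) (e / 2)"])
    fix m :: "complex \<Rightarrow> complex" assume [measurable]: "m \<in> borel_measurable \<mu>" and m: "AE t in \<mu>. norm (m t) \<le> min (1/2) (e / 2)"
    define m' where "m' t = 1 / (1 + m t) - 1" for t
    have [measurable]: "m' \<in> borel_measurable \<mu>" unfolding m'_def[abs_def] by measurable
    have nz: "AE t in \<mu>. 1 + m t \<noteq> 0"
      using m
    proof eventually_elim
      case (elim t)
      then have "norm (m t) < 1" by simp
      then show ?case by (metis add_eq_0_iff norm_minus_cancel norm_one order_less_irrefl)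
    qed
    have m'e: "AE t in \<mu>. norm (m' t) \<le> e"
      using m nz
    proof eventually_elim
      case (elim t)
      have "1 - norm (m t) \<le> norm (1 + m t)" using norm_diff_ineq[of 1 "m t"] by simp
      then have "1 / 2 \<le> norm (1 + m t)" using elim(1) by simp
      moreover have "m' t = - m t / (1 + m t)" using elim(2) by (simp add: m'_def field_simps)
      ultimately have "norm (m' t) \<le> norm (m t) / (1 / 2)"
        by (simp only: norm_divide norm_minus_cancel) (intro divide_left_mono mult_pos_pos, auto)
      then show ?case using elim(1) by simp
    qed
    have "AE t in \<mu>. norm (m t) \<le> e" using m by eventually_elim (use e(1) in auto)
    then obtain y where y: "y \<in> Hardy R" "(\<lambda>t. (1 + m t) * y t) \<in> co_Hardy R" "fourier_coeff (\<lambda>t. (1 + m t) * y t) 0 = 1"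
      using e(2)[of m] by auto
    obtain k where k: "k \<in> Hardy R" "(\<lambda>t. (1 + m' t) * k t) \<in> co_Hardy R" "fourier_coeff (\<lambda>t. (1 + m' t) * k t) 0 = 1"
      using e(2)[of m'] m'e by auto
    have [simp]: "(1 + m' t) * k t = k t / (1 + m t)" for t by (simp add: m'_def)
    have two: "0 < (2::real)" "1 \<le> (1::real)" "1 / 2 + 1 / 2 = 1 / (1::real)" by simp_all
    have y2: "y \<in> Hardy 2" "k \<in> Hardy 2" using Hardy_mono[of 2 R] R y(1) k(1) by auto
    have c2: "(\<lambda>t. (1 + m t) * y t) \<in> co_Hardy 2" "(\<lambda>t. k t / (1 + m t)) \<in> co_Hardy 2"
      using Hardy_mono[of 2 R] R y(2) k(2) by (auto simp: co_Hardy_iff_cnj)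
    have H: "(\<lambda>t. y t * k t) \<in> Hardy 1" by (rule Hardy_mult(1)[OF two(1,1,2,3) y2])
    note C = co_Hardy_mult[OF two(1,1,2,3) c2]
    have ae: "AE t in \<mu>. y t * k t = (1 + m t) * y t * (k t / (1 + m t))"
      using nz by eventually_elim simp
    have "AE t in \<mu>. y t * k t = fourier_coeff (\<lambda>t. (1 + m t) * y t * (k t / (1 + m t))) 0"
      by (rule Hardy_co_Hardy_const[OF H C(1) ae])
    then have "AE t in \<mu>. y t * k t = 1" unfolding C(2) y(3) using k(3) by simp
    then have "near_pair R m y k" using y k by (simp add: near_pair_def)
    then show "\<exists>y k. near_pair R m y k" by blast
  qed (use e(1) in auto)
qed

text \<open>The real parts of the two exponents cancel, so the jump function is bounded by the
  contributions of \<open>Im \<beta>\<close> alone. With -\<beta> in place of \<beta> the same bound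
  holds for its reciprocal.\<close>

lemma norm_cpow_ccpow_le:
  assumes \<tau>: "norm \<tau> = 1" and t: "t \<noteq> \<tau>"
  shows "norm (cpow \<tau> \<beta> t * ccpow \<tau> (- \<beta>) t) \<le> exp (pi * \<bar>Im \<beta>\<bar>) * exp (pi * \<bar>Im \<beta>\<bar>)"
proof -
  have "norm (cpow \<tau> \<beta> t) * norm (ccpow \<tau> (- \<beta>) t) \<le> (exp (pi * \<bar>Im \<beta>\<bar>) * norm (t - \<tau>) powr Re \<beta>) * (exp (pi * \<bar>Im (- \<beta>)\<bar>) * norm (t - \<tau>) powr Re (- \<beta>))"
    by (intro mult_mono norm_cpow_le \<tau> t) auto
  also have "\<dots> = exp (pi * \<bar>Im \<beta>\<bar>) * exp (pi * \<bar>Im \<beta>\<bar>) * (norm (t - \<tau>) powr Re \<beta> * norm (t - \<tau>) powr (- Re \<beta>))" by (simp add: mult_ac)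
  also have "norm (t - \<tau>) powr Re \<beta> * norm (t - \<tau>) powr (- Re \<beta>) = 1" using t by (simp add: powr_add[symmetric])
  finally show ?thesis by (simp add: norm_mult)
qed

definition power_multiplier :: "complex \<Rightarrow> complex \<Rightarrow> real \<Rightarrow> real \<Rightarrow> bool" where
  "power_multiplier \<tau> \<beta> R p \<longleftrightarrow> (\<forall>y\<in>Lp R. (\<lambda>t. cpow \<tau> \<beta> t * y t) \<in> Lp p \<and> (\<lambda>t. ccpow \<tau> \<beta> t * y t) \<in> Lp p)"

lemma power_multiplier_Hardy:
  assumes \<tau>: "norm \<tau> = 1" and p: "p \<ge> 1" and R: "R \<ge> 1" and pm: "power_multiplier \<tau> \<beta> R p"
  shows "y \<in> Hardy R \<Longrightarrow> (\<lambda>t. cpow \<tau> \<beta> t * y t) \<in> Hardy p" "y \<in> co_Hardy R \<Longrightarrow> (\<lambda>t. ccpow \<tau> \<beta> t * y t) \<in> co_Hardy p"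
proof -
  show "(\<lambda>t. cpow \<tau> \<beta> t * y t) \<in> Hardy p" if y: "y \<in> Hardy R"
  proof (rule cpow_mult_Hardy[OF \<tau> p])
    show "y \<in> Hardy 1" using Hardy_mono[of 1 R] y R by simp
    show "(\<lambda>t. cpow \<tau> \<beta> t * y t) \<in> Lp p" using pm HardyD(1)[OF y] by (simp add: power_multiplier_def)
  qed
  show "(\<lambda>t. ccpow \<tau> \<beta> t * y t) \<in> co_Hardy p" if y: "y \<in> co_Hardy R"
  proof (rule ccpow_mult_co_Hardy(1)[OF \<tau> p])
    show "y \<in> co_Hardy 1" using Hardy_mono[of 1 R] y R by (simp add: co_Hardy_iff_cnj)
    show "(\<lambda>t. ccpow \<tau> \<beta> t * y t) \<in> Lp p" using pm co_HardyD(1)[OF y] by (simp add: power_multiplier_def)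
  qed
qed

lemma near_WH_pair:
  assumes pq: "1 < p" "1 < q" "1 / p + 1 / q = 1" and \<tau>: "norm \<tau> = 1" and R: "R \<ge> 1"
    and pm: "power_multiplier \<tau> \<beta> R q" "power_multiplier \<tau> (- \<beta>) R p"
    and m[measurable]: "m \<in> borel_measurable \<mu>" and nz: "AE t in \<mu>. 1 + m t \<noteq> 0" and np: "near_pair R m y k"
  shows "WH_pair p q (\<lambda>t. cpow \<tau> \<beta> t * k t) (\<lambda>t. ccpow \<tau> (- \<beta>) t * ((1 + m t) * y t))"
proof -
  have p1: "p \<ge> 1" "q \<ge> 1" using pq by auto
  note [measurable] = cpow_measurable[OF \<tau>] ccpow_measurable[OF \<tau>]
  have y: "y \<in> Hardy R" and k: "k \<in> Hardy R" and km: "(\<lambda>t. k t / (1 + m t)) \<in> co_Hardy R" and yk: "AE t in \<mu>. y t * k t = 1"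
    using np by (auto simp: near_pair_def)
  have [measurable]: "y \<in> borel_measurable \<mu>" "k \<in> borel_measurable \<mu>" using HardyD(1)[OF y] HardyD(1)[OF k] by auto
  note H = power_multiplier_Hardy[OF \<tau> p1(2) R pm(1)] power_multiplier_Hardy[OF \<tau> p1(1) R pm(2)]
  have e1: "AE t in \<mu>. inverse (cpow \<tau> \<beta> t * k t) = cpow \<tau> (- \<beta>) t * y t"
    using yk
  proof eventually_elim
    case (elim t)
    then have "inverse (k t) = y t" by (metis inverse_unique mult.commute)
    then show ?case by (simp add: cpow_minus)
  qed
  have e2: "AE t in \<mu>. inverse (ccpow \<tau> (- \<beta>) t * ((1 + m t) * y t)) = ccpow \<tau> \<beta> t * (k t / (1 + m t))"
    using yk
  proof eventually_elim
    case (elim t)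
    then have "inverse (y t) = k t" by (rule inverse_unique)
    then show ?case by (simp add: cpow_minus divide_inverse mult.commute)
  qed
  have m1: "(\<lambda>t. inverse (cpow \<tau> \<beta> t * k t)) \<in> borel_measurable \<mu>" "(\<lambda>t. inverse (ccpow \<tau> (- \<beta>) t * ((1 + m t) * y t))) \<in> borel_measurable \<mu>"
    by measurable
  have a: "AE t in \<mu>. cpow \<tau> \<beta> t * k t \<noteq> 0" using yk by eventually_elim auto
  have b: "(\<lambda>t. inverse (cpow \<tau> \<beta> t * k t)) \<in> Hardy p" by (rule Hardy_cong_AE[OF e1 m1(1) H(3)[OF y]])
  have c: "(\<lambda>t. inverse (ccpow \<tau> (- \<beta>) t * ((1 + m t) * y t))) \<in> co_Hardy q"
    unfolding co_Hardy_iff_cnj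
  proof (rule Hardy_cong_AE)
    show "AE t in \<mu>. cnj (inverse (ccpow \<tau> (- \<beta>) t * ((1 + m t) * y t))) = cnj (ccpow \<tau> \<beta> t * (k t / (1 + m t)))"
      using e2 by eventually_elim simp
    show "(\<lambda>t. cnj (ccpow \<tau> \<beta> t * (k t / (1 + m t)))) \<in> Hardy q" using H(2)[OF km] unfolding co_Hardy_iff_cnj .
  qed (rule borel_measurable_cnj[OF m1(2)])
  show ?thesis unfolding WH_pair_def using a b c H(1)[OF k] by simp
qed

text \<open>Multiplication by a polynomial raises the top index of an antianalytic function by no
  more than the degree.\<close>

lemma co_Hardy_mult_poly_coeff:
  assumes g: "g \<in> co_Hardy 1" and n: "n > int (degree r)"
  shows "fourier_coeff (\<lambda>t. g t * poly r t) n = 0"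
proof -
  have gi: "integrable \<mu> (\<lambda>t. g t * (c * t powi j))" for c j
    using fourier_integrable[of g j] co_HardyD(1)[OF g] by (simp add: Lp_one_iff mult.left_commute)
  have "fourier_coeff (\<lambda>t. g t * poly r t) n = fourier_coeff (\<lambda>t. \<Sum>i\<le>degree r. g t * (coeff r i * t powi int i)) n"
    by (simp add: poly_altdef sum_distrib_left)
  also have "\<dots> = (\<Sum>i\<le>degree r. fourier_coeff (\<lambda>t. g t * (coeff r i * t powi int i)) n)"
    unfolding fourier_coeff_def sum_distrib_right by (intro Bochner_Integration.integral_sum fourier_integrable gi)
  also have "\<dots> = (\<Sum>i\<le>degree r. coeff r i * fourier_coeff (\<lambda>t. g t * t powi int i) n)"
    by (simp only: mult.left_commute[of "g _" "coeff r _"] fourier_coeff_scale)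
  also have "\<dots> = 0"
    unfolding fourier_coeff_shift using co_HardyD(2)[OF g] n by (intro sum.neutral) auto
  finally show ?thesis .
qed

text \<open>The local model is a perturbation of the pure power model, whose operator has norm
  \<open>K0\<close>. The model's result \<open>u\<close> for the data \<open>poly r\<close> is the
  power model's result for \<open>poly r - W\<close>, where \<open>W\<close> is bounded by a small
  multiple of \<open>u\<close>. The smallness of \<delta> makes that term at most half of the
  left-hand side, whence the constant \<open>2 * K0\<close>.\<close>

lemma near_poly_bounded:
  assumes pq: "1 < p" "1 < q" "1 / p + 1 / q = 1" and \<tau>: "norm \<tau> = 1" and R: "R \<ge> 1" "R \<ge> p"
    and pm: "power_multiplier \<tau> \<beta> R q" "power_multiplier \<tau> (- \<beta>) R p"
    and m[measurable]: "m \<in> borel_measurable \<mu>" and nz: "AE t in \<mu>. 1 + m t \<noteq> 0" and np: "near_pair R m y k"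
    and K0: "K0 \<ge> 0" and wb: "\<And>f. f \<in> Lp p \<Longrightarrow> \<exists>U. U \<in> Hardy p \<and> Lp_norm p U \<le> K0 * Lp_norm p f \<and>
     (\<forall>j\<ge>0. fourier_coeff (\<lambda>t. cpow \<tau> \<beta> t * U t) j = fourier_coeff (\<lambda>t. inverse (ccpow \<tau> (- \<beta>) t) * f t) j)"
    and \<delta>: "\<delta> \<ge> 0" "K0 * (exp (pi * \<bar>Im \<beta>\<bar>) * exp (pi * \<bar>Im \<beta>\<bar>) * \<delta>) \<le> 1/2" and mb: "AE t in \<mu>. norm (m t) \<le> \<delta>"
  shows "poly_bounded p q (\<lambda>t. cpow \<tau> \<beta> t * k t) (\<lambda>t. ccpow \<tau> (- \<beta>) t * ((1 + m t) * y t))"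
proof -
  have p1: "p \<ge> 1" "p > 0" "q \<ge> 1" "q > 0" using pq by auto
  have qp: "1 / q + 1 / p = 1" using pq by simp
  note [measurable] = cpow_measurable[OF \<tau>] ccpow_measurable[OF \<tau>]
  have [measurable]: "poly r \<in> borel_measurable \<mu>" for r :: "complex poly" by (rule trig_measurable[OF poly_trig])
  have y: "y \<in> Hardy R" and ym: "(\<lambda>t. (1 + m t) * y t) \<in> co_Hardy R" and k: "k \<in> Hardy R"
    and km: "(\<lambda>t. k t / (1 + m t)) \<in> co_Hardy R" and yk: "AE t in \<mu>. y t * k t = 1"
    using np by (auto simp: near_pair_def)
  have [measurable]: "y \<in> borel_measurable \<mu>" "k \<in> borel_measurable \<mu>" using HardyD(1)[OF y] HardyD(1)[OF k] by auto
  have ymp: "(\<lambda>t. (1 + m t) * y t) \<in> co_Hardy p" using Hardy_mono[of p R] ym R(2) p1 by (simp add: co_Hardy_iff_cnj)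
  define hp where "hp t = cpow \<tau> \<beta> t * k t" for t
  define hm where "hm t = ccpow \<tau> (- \<beta>) t * ((1 + m t) * y t)" for t
  define E where "E = exp (pi * \<bar>Im \<beta>\<bar>) * exp (pi * \<bar>Im \<beta>\<bar>)"
  have E: "E \<ge> 0" by (simp add: E_def)
  have pair: "WH_pair p q hp hm" unfolding hp_def[abs_def] hm_def[abs_def] by (rule near_WH_pair[OF pq \<tau> R(1) pm m nz np])
  have ihpH: "(\<lambda>t. inverse (hp t)) \<in> Hardy p" and ihmH: "(\<lambda>t. inverse (hm t)) \<in> co_Hardy q" using pair by (auto simp: WH_pair_def)
  have [measurable]: "(\<lambda>t. inverse (hp t)) \<in> borel_measurable \<mu>" "(\<lambda>t. inverse (hm t)) \<in> borel_measurable \<mu>"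
    using HardyD(1)[OF ihpH] co_HardyD(1)[OF ihmH] by auto
  have one: "(\<lambda>t. 1) \<in> Hardy R'" "(\<lambda>t. 1) \<in> co_Hardy R'" "(\<lambda>t. 1) \<in> Lp R'" if "R' \<ge> 1" for R'
    using that Lp_bounded(1)[of R' "\<lambda>t. 1" 1] by (auto simp: Hardy_def co_Hardy_def fourier_coeff_const)
  note H = power_multiplier_Hardy[OF \<tau> p1(3) R(1) pm(1)] power_multiplier_Hardy[OF \<tau> p1(1) R(1) pm(2)]
  have pair0: "WH_pair p q (cpow \<tau> \<beta>) (ccpow \<tau> (- \<beta>))"
    using H(1)[OF one(1)[OF R(1)]] H(2)[OF one(2)[OF R(1)]] H(3)[OF one(1)[OF R(1)]]
    by (simp add: WH_pair_def cpow_minus)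
  show ?thesis
    unfolding poly_bounded_def hp_def[symmetric] hm_def[symmetric]
  proof (intro exI[of _ "2 * K0"] conjI[of "0 \<le> _"] allI ballI impI)
    show "0 \<le> 2 * K0" using K0 by simp
    fix r h assume h: "h \<in> Hardy q" and c: "\<forall>j\<ge>0. fourier_coeff h j = fourier_coeff (\<lambda>t. inverse (hm t) * poly r t) j"
    have hL: "h \<in> Lp q" by (rule HardyD(1)[OF h])
    have [measurable]: "h \<in> borel_measurable \<mu>" using hL by auto
    have h1: "h \<in> Hardy 1" using Hardy_mono[of 1 q] h p1 by simp
    have ihm1: "(\<lambda>t. inverse (hm t)) \<in> co_Hardy 1" using Hardy_mono[of 1 q] ihmH p1 by (simp add: co_Hardy_iff_cnj)
    \<comment> \<open>The projected data of a polynomial form a polynomial again. This puts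
      \<open>u\<close> in L^p beforehand; otherwise the term containing the norm of \<open>u\<close>
      could not be absorbed.\<close>
    have "fourier_coeff h n = 0" if "n > int (degree r)" for n
      using c that co_Hardy_mult_poly_coeff[OF ihm1 that] by simp
    then obtain S where S: "AE t in \<mu>. h t = poly S t" by (rule Hardy_degree_poly[OF h1])
    define u where "u t = inverse (hp t) * h t" for t
    have [measurable]: "u \<in> borel_measurable \<mu>" unfolding u_def[abs_def] by measurable
    have uS: "AE t in \<mu>. u t = inverse (hp t) * poly S t" using S by eventually_elim (simp add: u_def)
    have uL: "u \<in> Lp p" by (rule Lp_cong_AE[OF uS _ Lp_mult_trig[OF p1(2) HardyD(1)[OF ihpH] poly_trig]]) measurable
    have u1: "u \<in> Hardy 1" unfolding u_def[abs_def] by (rule Hardy_mult_conj(1)[OF pq ihpH h])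
    have uH: "u \<in> Hardy p" by (rule HardyI[OF uL HardyD(2)[OF u1]])
    \<comment> \<open>\<open>N\<close> is the part of the data removed by the projection. Multiplied
      by the antianalytic \<open>(1 + m) y\<close> it still has only negative indices, so
      \<open>G\<close> is invisible to the coefficients that count.\<close>
    define N where "N t = inverse (hm t) * poly r t - h t" for t
    have irL: "(\<lambda>t. inverse (hm t) * poly r t) \<in> Lp q" by (rule Lp_mult_trig[OF p1(4) co_HardyD(1)[OF ihmH] poly_trig])
    have NL: "N \<in> Lp q" unfolding N_def[abs_def] by (rule Lp_diff(1)[OF p1(3) irL hL])
    have Nc: "fourier_coeff N j = 0" if "j \<ge> 0" for j
      unfolding N_def[abs_def] fourier_coeff_diff[OF Lp_imp_integrable[OF irL p1(3)] Lp_imp_integrable[OF hL p1(3)]]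
      using c that by simp
    define G where "G t = (1 + m t) * y t * N t" for t
    have G1: "G \<in> Lp 1" unfolding G_def[abs_def] by (rule Hoelder_conj(1)[OF pq co_HardyD(1)[OF ymp] NL])
    have Gc: "fourier_coeff G j = 0" if "j \<ge> 0" for j
    proof -
      \<comment> \<open>\<open>co_Hardy\<close> admits index 0, whereas strictly negative indices
        are to be preserved; the factor \<open>t\<close> bridges the shift by one.\<close>
      have "(\<lambda>t. N t * t powi 1) \<in> co_Hardy q"
      proof -
        have "(\<lambda>t. N t * t powi 1) \<in> Lp q"
          by (rule Lp_mult_trig[OF p1(4) NL]) (rule trig.monom[of _ 1 1], simp)
        then show ?thesis unfolding co_Hardy_def mem_Collect_eq fourier_coeff_shift using Nc by auto
      qed
      then have *: "(\<lambda>t. (1 + m t) * y t * (N t * t powi 1)) \<in> co_Hardy 1"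
        by (intro co_Hardy_mult(1)[OF p1(2,4) _ _ ymp]) (use pq in auto)
      have "fourier_coeff (\<lambda>t. G t * t powi 1) (j + 1) = 0"
        using co_HardyD(2)[OF *, of "j + 1"] that by (simp add: G_def mult.assoc)
      then show ?thesis unfolding fourier_coeff_shift by simp
    qed
    define W where "W t = m t * (cpow \<tau> \<beta> t * ccpow \<tau> (- \<beta>) t) * u t" for t
    have [measurable]: "W \<in> borel_measurable \<mu>" unfolding W_def[abs_def] by measurable
    have "AE t in \<mu>. norm (W t) \<le> (\<delta> * E) * norm (u t)"
      using mb AE_circle_neq[of \<tau>]
    proof eventually_elim
      case (elim t)
      show ?case unfolding W_def norm_mult
        using elim(1) norm_cpow_ccpow_le[OF \<tau> elim(2), of \<beta>] \<delta>(1)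
        by (intro mult_right_mono mult_mono) (auto simp: E_def norm_mult)
    qed
    note W' = Lp_bound[OF p1(2) uL _ _ this]
    have W: "W \<in> Lp p" "Lp_norm p W \<le> (\<delta> * E) * Lp_norm p u" by (rule W'; use \<delta> E in simp)+
    have rL: "poly r \<in> Lp p" by (rule trig_Lp[OF poly_trig p1(2)])
    define f where "f t = poly r t - W t" for t
    have f: "f \<in> Lp p" "Lp_norm p f \<le> Lp_norm p (poly r) + Lp_norm p W"
      unfolding f_def[abs_def] using Lp_diff[OF p1(1) rL W(1)] by auto
    have [measurable]: "f \<in> borel_measurable \<mu>" using f(1) by auto
    from wb[OF f(1)] obtain U where U: "U \<in> Hardy p" "Lp_norm p U \<le> K0 * Lp_norm p f"
      "\<forall>j\<ge>0. fourier_coeff (\<lambda>t. cpow \<tau> \<beta> t * U t) j = fourier_coeff (\<lambda>t. inverse (ccpow \<tau> (- \<beta>) t) * f t) j" by (elim exE conjE)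
    \<comment> \<open>The equation of the power model for \<open>u\<close> with data
      \<open>f\<close>, up to \<open>G\<close>, which has no coefficients of nonnegative
      index.\<close>
    have key: "AE t in \<mu>. inverse (ccpow \<tau> (- \<beta>) t) * f t = cpow \<tau> \<beta> t * u t + G t"
      using yk nz
    proof eventually_elim
      case (elim t)
      have iy: "y t \<noteq> 0" "k t = inverse (y t)" using elim(1) inverse_unique[of "y t" "k t"] by auto
      have u: "cpow \<tau> \<beta> t * u t = y t * h t" using iy by (simp add: u_def hp_def)
      have e: "inverse (hm t) = ccpow \<tau> \<beta> t * inverse ((1 + m t) * y t)" by (simp add: hm_def cpow_minus)
      have "inverse (ccpow \<tau> (- \<beta>) t) * W t = m t * (cpow \<tau> \<beta> t * u t)" by (simp add: W_def field_simps)
      then have f_eq: "inverse (ccpow \<tau> (- \<beta>) t) * f t = ccpow \<tau> \<beta> t * poly r t - m t * (y t * h t)"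
        unfolding f_def right_diff_distrib u by (simp add: cpow_minus)
      have G_eq: "G t = ccpow \<tau> \<beta> t * poly r t - (1 + m t) * y t * h t"
        
      proof -
        define n where "n = (1 + m t) * y t"
        have "n \<noteq> 0" using elim(2) iy by (simp add: n_def)
        then show ?thesis unfolding G_def N_def right_diff_distrib e n_def[symmetric] by simp
      qed
      show ?case unfolding u f_eq G_eq by (simp add: algebra_simps)
    qed
    have cuL: "(\<lambda>t. cpow \<tau> \<beta> t * u t) \<in> Lp 1"
      using Hoelder_conj(1)[OF pq(2,1) qp HardyD(1) uL] pair0 by (simp add: WH_pair_def)
    have UuAE: "AE t in \<mu>. U t = u t"
    proof (rule WH_pair_unique[OF pq pair0 U(1) uH])
      fix j :: int assume j: "j \<ge> 0"
      have [measurable]: "G \<in> borel_measurable \<mu>" using G1 by auto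
      have "fourier_coeff (\<lambda>t. cpow \<tau> \<beta> t * U t) j = fourier_coeff (\<lambda>t. inverse (ccpow \<tau> (- \<beta>) t) * f t) j" using U(3) j by simp
      also have "\<dots> = fourier_coeff (\<lambda>t. cpow \<tau> \<beta> t * u t + G t) j" by (rule fourier_coeff_cong_AE[OF key]) measurable
      also have "\<dots> = fourier_coeff (\<lambda>t. cpow \<tau> \<beta> t * u t) j + fourier_coeff G j"
        using cuL G1 by (intro fourier_coeff_add) (auto simp: Lp_one_iff)
      finally show "fourier_coeff (\<lambda>t. cpow \<tau> \<beta> t * U t) j = fourier_coeff (\<lambda>t. cpow \<tau> \<beta> t * u t) j" using Gc[OF j] by simp
    qed
    have "Lp_norm p u = Lp_norm p U"
      using UuAE HardyD(1)[OF U(1)] uL by (intro Lp_norm_cong_AE) auto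
    also have "\<dots> \<le> K0 * (Lp_norm p (poly r) + \<delta> * E * Lp_norm p u)"
    proof -
      have "K0 * Lp_norm p f \<le> K0 * (Lp_norm p (poly r) + \<delta> * E * Lp_norm p u)" using f(2) W(2) K0 by (intro mult_left_mono) auto
      then show ?thesis using U(2) by linarith
    qed
    also have "\<dots> = K0 * Lp_norm p (poly r) + K0 * (E * \<delta>) * Lp_norm p u" by (simp add: algebra_simps)
    also have "\<dots> \<le> K0 * Lp_norm p (poly r) + 1/2 * Lp_norm p u"
      using \<delta>(2) unfolding E_def[symmetric] by (intro add_left_mono mult_right_mono) auto
    finally have "Lp_norm p u \<le> 2 * K0 * Lp_norm p (poly r)" by simp
    with uL show "(\<lambda>t. inverse (hp t) * h t) \<in> Lp p \<and> Lp_norm p (\<lambda>t. inverse (hp t) * h t) \<le> 2 * K0 * Lp_norm p (poly r)"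
      unfolding u_def[abs_def] by simp
  qed
qed

text \<open>The order of quantifiers matters: \<epsilon> depends on the exponent and on the power
  model but not on \<open>m\<close>, so it can be fixed before the arc on which the symbol is nearly
  constant is chosen.\<close>

lemma near_WH_bounded:
  assumes pq: "1 < p" "1 < q" "1 / p + 1 / q = 1" and \<tau>: "norm \<tau> = 1" and \<beta>: "- (1 / q) < Re \<beta>" "Re \<beta> < 1 / p"
    and R: "R \<ge> 1" "R \<ge> p" and pm: "power_multiplier \<tau> \<beta> R q" "power_multiplier \<tau> (- \<beta>) R p"
  shows "\<exists>\<epsilon>>0. \<forall>m y k. m \<in> borel_measurable \<mu> \<longrightarrow> (AE t in \<mu>. norm (m t) \<le> \<epsilon>) \<longrightarrow> (AE t in \<mu>. 1 + m t \<noteq> 0) \<longrightarrow> near_pair R m y k \<longrightarrow>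
    WH_bounded p (\<lambda>t. cpow \<tau> \<beta> t * k t) (\<lambda>t. ccpow \<tau> (- \<beta>) t * ((1 + m t) * y t))"
proof -
  from power_WH_bounded[OF pq \<tau> \<beta>] obtain K0 where K0: "K0 \<ge> 0 \<and> (\<forall>f. f \<in> Lp p \<longrightarrow> (\<exists>U. U \<in> Hardy p \<and> Lp_norm p U \<le> K0 * Lp_norm p f \<and>
     (\<forall>j\<ge>0. fourier_coeff (\<lambda>t. cpow \<tau> \<beta> t * U t) j = fourier_coeff (\<lambda>t. inverse (ccpow \<tau> (- \<beta>) t) * f t) j)))"
    unfolding WH_bounded_iff by (rule exE)
  define E where "E = exp (pi * \<bar>Im \<beta>\<bar>) * exp (pi * \<bar>Im \<beta>\<bar>)"
  have E: "E > 0" by (simp add: E_def)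
  define \<epsilon> where "\<epsilon> = 1 / (2 * E * (K0 + 1))"
  have \<epsilon>: "\<epsilon> > 0" using E K0 by (simp add: \<epsilon>_def)
  have "K0 * (E * \<epsilon>) = (K0 / (K0 + 1)) / 2" using E K0 by (simp add: \<epsilon>_def)
  also have "\<dots> \<le> 1 / 2" using K0 by (simp add: divide_le_eq)
  finally have \<epsilon>2: "K0 * (E * \<epsilon>) \<le> 1 / 2" .
  show ?thesis
  proof (intro exI[of _ \<epsilon>] conjI \<epsilon> allI impI)
    fix m y k
    assume m: "m \<in> borel_measurable \<mu>" and mb: "AE t in \<mu>. norm (m t) \<le> \<epsilon>" and nz: "AE t in \<mu>. 1 + m t \<noteq> 0" and np: "near_pair R m y k"
    have "poly_bounded p q (\<lambda>t. cpow \<tau> \<beta> t * k t) (\<lambda>t. ccpow \<tau> (- \<beta>) t * ((1 + m t) * y t))"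
      by (rule near_poly_bounded[OF pq \<tau> R pm m nz np conjunct1[OF K0] conjunct2[OF K0, rule_format] less_imp_le[OF \<epsilon>] \<epsilon>2[unfolded E_def] mb])
    then show "WH_bounded p (\<lambda>t. cpow \<tau> \<beta> t * k t) (\<lambda>t. ccpow \<tau> (- \<beta>) t * ((1 + m t) * y t))"
      by (rule WH_bounded_of_poly[OF pq near_WH_pair[OF pq \<tau> R(1) pm m nz np]])
  qed
qed

section \<open>Change of the power factor\<close>

lemma power_multiplier_ex:
  assumes "norm \<tau> = 1" "p > 0" "Re \<beta> > - (1 / p)"
  obtains S where "\<And>R. R \<ge> S \<Longrightarrow> power_multiplier \<tau> \<beta> R p"
  by (rule cpow_mult_Lp[OF assms]) (auto simp: power_multiplier_def)

lemma cpow_bounded_off: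
  assumes \<tau>: "norm \<tau> = 1" and d: "d > 0"
  obtains D where "D \<ge> 0" "\<And>t. norm t = 1 \<Longrightarrow> d \<le> norm (t - \<tau>) \<Longrightarrow> norm (cpow \<tau> \<gamma> t) \<le> D \<and> norm (ccpow \<tau> \<gamma> t) \<le> D"
proof (rule that[of "exp (pi * \<bar>Im \<gamma>\<bar>) * (2 powr Re \<gamma> + d powr Re \<gamma>)"])
  fix t :: complex assume t: "norm t = 1" and td: "d \<le> norm (t - \<tau>)"
  have n: "t \<noteq> \<tau>" using d td by auto
  have "norm (t - \<tau>) \<le> 2" using norm_triangle_ineq4[of t \<tau>] t \<tau> by simp
  then have "norm (t - \<tau>) powr Re \<gamma> \<le> 2 powr Re \<gamma> + d powr Re \<gamma>"
  proof (cases "Re \<gamma> \<ge> 0")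
    case True
    then have "norm (t - \<tau>) powr Re \<gamma> \<le> 2 powr Re \<gamma>" using \<open>norm (t - \<tau>) \<le> 2\<close> by (intro powr_mono2) auto
    then show ?thesis by (rule order_trans) simp
  next
    case False
    then have "norm (t - \<tau>) powr Re \<gamma> \<le> d powr Re \<gamma>" using d td by (intro powr_mono2') auto
    then show ?thesis by (rule order_trans) simp
  qed
  then have "exp (pi * \<bar>Im \<gamma>\<bar>) * norm (t - \<tau>) powr Re \<gamma> \<le> exp (pi * \<bar>Im \<gamma>\<bar>) * (2 powr Re \<gamma> + d powr Re \<gamma>)"
    by (intro mult_left_mono) auto
  then show "norm (cpow \<tau> \<gamma> t) \<le> exp (pi * \<bar>Im \<gamma>\<bar>) * (2 powr Re \<gamma> + d powr Re \<gamma>) \<and>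
    norm (ccpow \<tau> \<gamma> t) \<le> exp (pi * \<bar>Im \<gamma>\<bar>) * (2 powr Re \<gamma> + d powr Re \<gamma>)"
    using norm_cpow_le(1,3)[OF \<tau> n, of \<gamma>] by linarith
qed simp

text \<open>Pointwise algebra for the comparison near \<tau>: \<open>c\<close> and \<open>c'\<close>
  stand for the two powers, \<open>n\<close> for \<open>1 + m\<close>, \<open>g\<close> and
  \<open>gp\<close> for the given factors, and \<open>T\<close> for the power of \<open>t\<close>.
  The hypothesis \<open>e\<close> equates the two ways of writing the symbol.\<close>

lemma gluing_identities:
  fixes c c' s n g T gp y k :: complex
  assumes "c \<noteq> 0" "c' \<noteq> 0" "s \<noteq> 0" "n \<noteq> 0" "g \<noteq> 0" "T \<noteq> 0" and e: "c * c' * (s * n) = g * T * gp"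
  shows "inverse c * y * gp = s * (c' * (n * y) * inverse g) * inverse T"
    "c * k * inverse gp = inverse s * (inverse c' * (k / n) * g) * T"
proof -
  have gp: "gp = c * c' * s * n / (g * T)" using assms by (simp add: field_simps)
  show "inverse c * y * gp = s * (c' * (n * y) * inverse g) * inverse T"
    "c * k * inverse gp = inverse s * (inverse c' * (k / n) * g) * T"
    using assms(1-6) by (simp_all add: gp field_simps)
qed

text \<open>Two free exponents make one result serve both directions. Old and new factors differ by
  powers with exponents \<open>\<beta> - \<alpha>\<close> and \<open>\<alpha> - \<beta>\<close>,
  which are singular at \<tau> only; there the comparison with the local model takes over. The local
  model itself is used with exponent \<alpha> to analyse the old factors and with \<beta> to
  estimate the new ones.\<close>

lemma WH_transfer:
  assumes pq: "1 < p" "1 < q" "1 / p + 1 / q = 1" and \<tau>: "norm \<tau> = 1"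
    and \<alpha>: "- (1 / q) < Re \<alpha>" "Re \<alpha> < 1 / p" and \<beta>: "- (1 / q) < Re \<beta>" "Re \<beta> < 1 / p"
    and wh: "Wiener_Hopf_factorization p q a gm \<nu> gp"
    and a: "AE t in \<mu>. a t = cpow \<tau> \<alpha> t * ccpow \<tau> (- \<alpha>) t * a0 t"
    and b: "AE t in \<mu>. b t = cpow \<tau> \<beta> t * ccpow \<tau> (- \<beta>) t * a0 t"
    and a0[measurable]: "a0 \<in> borel_measurable \<mu>" and L: "L > 0" "AE t in \<mu>. norm (a0 t) \<le> L" "AE t in \<mu>. 1 / L \<le> norm (a0 t)"
    and s: "s \<noteq> 0" and lim: "\<And>\<epsilon>. \<epsilon> > 0 \<Longrightarrow> \<exists>\<eta>>0. AE t in \<mu>. norm (t - \<tau>) < \<eta> \<longrightarrow> norm (a0 t - s) \<le> \<epsilon>"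
  shows "Wiener_Hopf_factorization p q b (\<lambda>t. ccpow \<tau> (\<alpha> - \<beta>) t * gm t) \<nu> (\<lambda>t. cpow \<tau> (\<beta> - \<alpha>) t * gp t)"
    "fourier_coeff (\<lambda>t. cpow \<tau> (\<beta> - \<alpha>) t * gp t) 0 = fourier_coeff gp 0"
proof -
  have p1: "p \<ge> 1" "p > 0" "q \<ge> 1" "q > 0" using pq by auto
  have qp: "1 / q + 1 / p = 1" using pq by simp
  note [measurable] = cpow_measurable[OF \<tau>] ccpow_measurable[OF \<tau>]
  have gp0: "AE t in \<mu>. gp t \<noteq> 0" and gm0: "AE t in \<mu>. gm t \<noteq> 0" and gpH: "gp \<in> Hardy q" and igpH: "(\<lambda>t. inverse (gp t)) \<in> Hardy p"
    and gmH: "gm \<in> co_Hardy p" and igmH: "(\<lambda>t. inverse (gm t)) \<in> co_Hardy q" and gm1: "fourier_coeff gm 0 = 1"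
    and fac: "AE t in \<mu>. a t = gm t * t powi \<nu> * gp t"
    using wh by (auto simp: Wiener_Hopf_factorization_def ae_eq_def)
  have [measurable]: "gp \<in> borel_measurable \<mu>" "gm \<in> borel_measurable \<mu>" using HardyD(1)[OF gpH] co_HardyD(1)[OF gmH] by auto
  note pair = WH_factorization_poly_bounded(1)[OF pq wh]
  have wb: "WH_bounded p gp gm" by (rule WH_bounded_of_poly[OF pq pair WH_factorization_poly_bounded(2)[OF pq wh]])
  obtain S1 where S1: "\<And>R. R \<ge> S1 \<Longrightarrow> power_multiplier \<tau> \<beta> R q" using power_multiplier_ex[OF \<tau> p1(4) \<beta>(1)] by blast
  obtain S2 where S2: "\<And>R. R \<ge> S2 \<Longrightarrow> power_multiplier \<tau> (- \<beta>) R p" using power_multiplier_ex[OF \<tau> p1(2), of "- \<beta>"] \<beta>(2) by auto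
  obtain S3 where S3: "\<And>R. R \<ge> S3 \<Longrightarrow> power_multiplier \<tau> \<alpha> R q" using power_multiplier_ex[OF \<tau> p1(4) \<alpha>(1)] by blast
  obtain S4 where S4: "\<And>R. R \<ge> S4 \<Longrightarrow> power_multiplier \<tau> (- \<alpha>) R p" using power_multiplier_ex[OF \<tau> p1(2), of "- \<alpha>"] \<alpha>(2) by auto
  \<comment> \<open>Large enough for all four powers to map L^R into the space required of them, at
    least 2 for the local factorization and at least \<open>p\<close> for its operator
    bound.\<close>
  define R where "R = Max {2, p, S1, S2, S3, S4}"
  have R: "R \<ge> 2" "R \<ge> p" "R \<ge> S1" "R \<ge> S2" "R \<ge> S3" "R \<ge> S4" unfolding R_def by (rule Max_ge; simp)+
  then have R1: "R \<ge> 1" by simp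
  note pm = S1[OF R(3)] S2[OF R(4)] S3[OF R(5)] S4[OF R(6)]
  note H\<beta> = power_multiplier_Hardy[OF \<tau> p1(3) R1 pm(1)] power_multiplier_Hardy[OF \<tau> p1(1) R1 pm(2)]
  note H\<alpha> = power_multiplier_Hardy[OF \<tau> p1(3) R1 pm(3)] power_multiplier_Hardy[OF \<tau> p1(1) R1 pm(4)]
  obtain e1 where e1: "e1 > 0"
    "\<And>m :: complex \<Rightarrow> complex. m \<in> borel_measurable \<mu> \<Longrightarrow> (AE t in \<mu>. norm (m t) \<le> e1) \<Longrightarrow> \<exists>y k. near_pair R m y k"
    by (rule near_pair_exists[OF R(1)]) blast
  from near_WH_bounded[OF pq \<tau> \<beta> R1 R(2) pm(1,2)] obtain e2 where e2: "e2 > 0 \<and> (\<forall>m y k. m \<in> borel_measurable \<mu> \<longrightarrow> (AE t in \<mu>. norm (m t) \<le> e2) \<longrightarrow> (AE t in \<mu>. 1 + m t \<noteq> 0) \<longrightarrow> near_pair R m y k \<longrightarrow>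
    WH_bounded p (\<lambda>t. cpow \<tau> \<beta> t * k t) (\<lambda>t. ccpow \<tau> (- \<beta>) t * ((1 + m t) * y t)))" by (rule exE)
  define \<epsilon> where "\<epsilon> = min (min e1 e2) (1 / 2)"
  have \<epsilon>: "\<epsilon> > 0" "\<epsilon> \<le> e1" "\<epsilon> \<le> e2" "\<epsilon> \<le> 1 / 2" using e1(1) e2 by (auto simp: \<epsilon>_def)
  obtain \<eta> where \<eta>: "\<eta> > 0" "AE t in \<mu>. norm (t - \<tau>) < \<eta> \<longrightarrow> norm (a0 t - s) \<le> \<epsilon> * norm s"
    using lim[of "\<epsilon> * norm s"] \<epsilon>(1) s by auto
  \<comment> \<open>The symbol is frozen: \<open>1 + m\<close> is \<open>a0 / s\<close> on the arc,
    where it is nearly 1, and exactly 1 elsewhere. So the perturbation is small on the whole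
    circle.\<close>
  define m where "m t = (if norm (t - \<tau>) < \<eta> then a0 t / s - 1 else 0)" for t
  have mm[measurable]: "m \<in> borel_measurable \<mu>" unfolding m_def[abs_def] by measurable
  have mb: "AE t in \<mu>. norm (m t) \<le> \<epsilon>"
    using \<eta>(2)
  proof eventually_elim
    case (elim t)
    have "a0 t / s - 1 = (a0 t - s) / s" using s by (simp add: field_simps)
    then show ?case using elim \<epsilon>(1) s by (simp add: m_def norm_divide divide_le_eq)
  qed
  have m0: "AE t in \<mu>. 1 + m t \<noteq> 0"
    using mb
  proof eventually_elim
    case (elim t)
    then have "norm (m t) < 1" using \<epsilon>(4) by simp
    then show ?case by (metis add_eq_0_iff norm_minus_cancel norm_one order_less_irrefl)
  qed
  have "AE t in \<mu>. norm (m t) \<le> e1" using mb by eventually_elim (use \<epsilon>(2) in simp)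
  from e1(2)[OF mm this] obtain y k where np: "near_pair R m y k" by (elim exE)
  have mb2: "AE t in \<mu>. norm (m t) \<le> e2" using mb by eventually_elim (use \<epsilon>(3) in simp)
  have y: "y \<in> Hardy R" and ym: "(\<lambda>t. (1 + m t) * y t) \<in> co_Hardy R" and k: "k \<in> Hardy R"
    and km: "(\<lambda>t. k t / (1 + m t)) \<in> co_Hardy R" and yk: "AE t in \<mu>. y t * k t = 1"
    using np by (auto simp: near_pair_def)
  have [measurable]: "y \<in> borel_measurable \<mu>" "k \<in> borel_measurable \<mu>" using HardyD(1)[OF y] HardyD(1)[OF k] by auto
  define hp where "hp t = cpow \<tau> \<beta> t * k t" for t
  define hm where "hm t = ccpow \<tau> (- \<beta>) t * ((1 + m t) * y t)" for t
  have hpair: "WH_pair p q hp hm" unfolding hp_def[abs_def] hm_def[abs_def] by (rule near_WH_pair[OF pq \<tau> R1 pm(1,2) mm m0 np])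
  have hwb: "WH_bounded p hp hm" unfolding hp_def[abs_def] hm_def[abs_def] using conjunct2[OF e2] mm mb2 m0 np by blast
  have hm0: "AE t in \<mu>. hm t \<noteq> 0" using yk m0 by eventually_elim (auto simp: hm_def)

  \<comment> \<open>\<open>F\<close> is \<open>gp\<close> divided by the model's plus factor for the
    exponent \<alpha>, and \<open>X\<close> is the reciprocal of \<open>F\<close>.\<close>
  define F where "F t = (cpow \<tau> (- \<alpha>) t * y t) * gp t" for t
  define X where "X t = (cpow \<tau> \<alpha> t * k t) * inverse (gp t)" for t
  have FH: "F \<in> Hardy 1" unfolding F_def[abs_def] by (rule Hardy_mult_conj(1)[OF pq H\<alpha>(3)[OF y] gpH])
  have XH: "X \<in> Hardy 1" unfolding X_def[abs_def] by (rule Hardy_mult_conj(1)[OF pq(2,1) qp H\<alpha>(1)[OF k] igpH])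
  have co_scale: "(\<lambda>t. z * (f t * g t)) \<in> co_Hardy 1" if "f \<in> co_Hardy p" "g \<in> co_Hardy q" for z f g
  proof -
    have "(\<lambda>t. f t * g t) \<in> co_Hardy 1" by (rule co_Hardy_mult(1)[OF p1(2,4) _ _ that]) (use pq in auto)
    then have "(\<lambda>t. cnj z * cnj (f t * g t)) \<in> Hardy 1" unfolding co_Hardy_iff_cnj by (rule Hardy_scale[rotated]) simp
    then show ?thesis by (simp add: co_Hardy_iff_cnj)
  qed
  define Y where "Y t = s * (ccpow \<tau> (- \<alpha>) t * ((1 + m t) * y t) * inverse (gm t))" for t
  define Z where "Z t = inverse s * (gm t * (ccpow \<tau> \<alpha> t * (k t / (1 + m t))))" for t
  have YH: "Y \<in> co_Hardy 1" unfolding Y_def[abs_def] by (rule co_scale[OF H\<alpha>(4)[OF ym] igmH])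
  have ZH: "Z \<in> co_Hardy 1" unfolding Z_def[abs_def] by (rule co_scale[OF gmH H\<alpha>(2)[OF km]])
  \<comment> \<open>On the arc \<open>s * (1 + m)\<close> is the true \<open>a0\<close>, so the
    quotients of plus factors are also quotients of minus factors, up to a constant and a power of
    \<open>t\<close>.\<close>
  have near: "AE t in \<mu>. norm (t - \<tau>) < \<eta> \<longrightarrow> F t = Y t * t powi (- \<nu>) \<and> X t = Z t * t powi \<nu>"
    using fac a m0 gm0 AE_space
  proof eventually_elim
    case (elim t)
    show ?case
    proof
      assume n: "norm (t - \<tau>) < \<eta>"
      have T: "t powi \<nu> \<noteq> 0" using elim(5) by auto
      have "cpow \<tau> \<alpha> t * ccpow \<tau> (- \<alpha>) t * (s * (1 + m t)) = gm t * t powi \<nu> * gp t"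
        using n s elim(1,2) by (simp add: m_def)
      note gi = gluing_identities[OF cpow_nonzero(1) cpow_nonzero(2) s elim(3,4) T this]
      show "F t = Y t * t powi (- \<nu>) \<and> X t = Z t * t powi \<nu>"
        using gi(1)[of "y t"] gi(2)[of "k t"] unfolding F_def X_def Y_def Z_def
        by (simp add: cpow_minus power_int_minus mult_ac)
    qed
  qed
  \<comment> \<open>Four nested radii with gaps of \<open>\<eta> / 4\<close>: identities hold within
    \<open>\<eta>\<close>, bounds within \<open>3 * \<eta> / 4\<close>, the final estimate is split
    at \<open>\<eta> / 2\<close>, and its far part discards data only within
    \<open>\<eta> / 4\<close>.\<close>
  have \<eta>': "0 < 3 * \<eta> / 4" "3 * \<eta> / 4 < \<eta>" using \<eta>(1) by auto
  obtain C1 where C1: "C1 \<ge> 0" "AE t in \<mu>. norm (t - \<tau>) < 3 * \<eta> / 4 \<longrightarrow> norm (F t) \<le> C1"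
    by (rule gluing_bounded[OF FH YH _ \<eta>', where n="- \<nu>"]) (use near in auto)
  obtain C2 where C2: "C2 \<ge> 0" "AE t in \<mu>. norm (t - \<tau>) < 3 * \<eta> / 4 \<longrightarrow> norm (X t) \<le> C2"
    by (rule gluing_bounded[OF XH ZH _ \<eta>', where n=\<nu>]) (use near in auto)

  define g'p where "g'p t = cpow \<tau> (\<beta> - \<alpha>) t * gp t" for t
  define g'm where "g'm t = ccpow \<tau> (\<alpha> - \<beta>) t * gm t" for t
  have [measurable]: "g'p \<in> borel_measurable \<mu>" "g'm \<in> borel_measurable \<mu>" unfolding g'p_def[abs_def] g'm_def[abs_def] by measurable
  have diff: "cpow \<tau> (x - z) t = cpow \<tau> x t / cpow \<tau> z t" "ccpow \<tau> (x - z) t = ccpow \<tau> x t / ccpow \<tau> z t" for x z t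
    using cpow_add[of \<tau> x "- z" t] by (auto simp: cpow_minus divide_inverse)
  \<comment> \<open>Here the exponent \<alpha> disappears: the new plus factor is \<open>F\<close>,
    bounded near \<tau>, times the model's plus factor for \<beta>, which is in H^q by the choice of
    \<open>R\<close>.\<close>
  have g'p_eq: "AE t in \<mu>. g'p t = F t * (cpow \<tau> \<beta> t * k t)"
    using yk
  proof eventually_elim
    case (elim t)
    have "F t * (cpow \<tau> \<beta> t * k t) = cpow \<tau> (- \<alpha>) t * cpow \<tau> \<beta> t * gp t * (y t * k t)" by (simp add: F_def)
    then have "F t * (cpow \<tau> \<beta> t * k t) = cpow \<tau> (- \<alpha>) t * cpow \<tau> \<beta> t * gp t" unfolding elim by simp
    then show ?case by (simp add: g'p_def diff cpow_minus divide_inverse mult_ac)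
  qed
  have ig'p: "inverse (g'p t) = cpow \<tau> \<alpha> t * cpow \<tau> (- \<beta>) t * inverse (gp t)" for t
    by (simp add: g'p_def diff cpow_minus field_simps)
  have ig'p_eq: "AE t in \<mu>. inverse (g'p t) = X t * (cpow \<tau> (- \<beta>) t * y t)"
    using yk
  proof eventually_elim
    case (elim t)
    have "X t * (cpow \<tau> (- \<beta>) t * y t) = cpow \<tau> \<alpha> t * cpow \<tau> (- \<beta>) t * inverse (gp t) * (y t * k t)" by (simp add: X_def)
    then show ?case unfolding elim ig'p by simp
  qed
  have hp_eq: "inverse (g'p t) * hp t = X t" for t
    by (simp add: ig'p hp_def X_def cpow_minus)
  obtain D1 where D1: "D1 \<ge> 0" "\<And>t. norm t = 1 \<Longrightarrow> \<eta> / 4 \<le> norm (t - \<tau>) \<Longrightarrow> norm (cpow \<tau> (\<beta> - \<alpha>) t) \<le> D1 \<and> norm (ccpow \<tau> (\<beta> - \<alpha>) t) \<le> D1"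
    using cpow_bounded_off[OF \<tau>, of "\<eta> / 4" "\<beta> - \<alpha>"] \<eta>(1) by auto
  obtain D2 where D2: "D2 \<ge> 0" "\<And>t. norm t = 1 \<Longrightarrow> \<eta> / 4 \<le> norm (t - \<tau>) \<Longrightarrow> norm (cpow \<tau> (\<alpha> - \<beta>) t) \<le> D2 \<and> norm (ccpow \<tau> (\<alpha> - \<beta>) t) \<le> D2"
    using cpow_bounded_off[OF \<tau>, of "\<eta> / 4" "\<alpha> - \<beta>"] \<eta>(1) by auto
  have Pm: "Measurable.pred \<mu> (\<lambda>t. norm (t - \<tau>) < d)" for d by measurable
  have g'pL: "g'p \<in> Lp q"
  proof (rule Lp_patch[OF p1(3) Pm[of "3 * \<eta> / 4"] _ HardyD(1)[OF H\<beta>(1)[OF k]] C1(1) _ HardyD(1)[OF gpH] D1(1)])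
    show "AE t in \<mu>. norm (t - \<tau>) < 3 * \<eta> / 4 \<longrightarrow> norm (g'p t) \<le> C1 * norm (cpow \<tau> \<beta> t * k t)"
      using g'p_eq C1(2) by eventually_elim (auto simp: norm_mult intro!: mult_right_mono)
    show "AE t in \<mu>. \<not> norm (t - \<tau>) < 3 * \<eta> / 4 \<longrightarrow> norm (g'p t) \<le> D1 * norm (gp t)"
      using AE_space by eventually_elim (use D1(2) \<eta>(1) in \<open>auto simp: g'p_def norm_mult intro!: mult_right_mono\<close>)
  qed measurable
  have ig'pL: "(\<lambda>t. inverse (g'p t)) \<in> Lp p"
  proof (rule Lp_patch[OF p1(1) Pm[of "3 * \<eta> / 4"] _ HardyD(1)[OF H\<beta>(3)[OF y]] C2(1) _ HardyD(1)[OF igpH] D2(1)])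
    show "AE t in \<mu>. norm (t - \<tau>) < 3 * \<eta> / 4 \<longrightarrow> norm (inverse (g'p t)) \<le> C2 * norm (cpow \<tau> (- \<beta>) t * y t)"
      using ig'p_eq C2(2)
    proof eventually_elim
      case (elim t)
      show ?case unfolding elim(1) norm_mult[of "X t"] using elim(2) by (auto intro!: mult_right_mono)
    qed
    show "AE t in \<mu>. \<not> norm (t - \<tau>) < 3 * \<eta> / 4 \<longrightarrow> norm (inverse (g'p t)) \<le> D2 * norm (inverse (gp t))"
      using AE_space
    proof eventually_elim
      case (elim t)
      have "inverse (g'p t) = cpow \<tau> (\<alpha> - \<beta>) t * inverse (gp t)" by (simp add: g'p_def diff field_simps)
      then show ?case using D2(2)[of t] \<eta>(1) elim by (auto simp only: norm_mult intro!: mult_right_mono) auto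
    qed
  qed measurable
  define E where "E = exp (pi * \<bar>Im \<beta>\<bar>) * exp (pi * \<bar>Im \<beta>\<bar>)"
  have E: "E > 0" by (simp add: E_def)
  have b_fac: "AE t in \<mu>. b t = g'm t * t powi \<nu> * g'p t"
    using fac a b
  proof eventually_elim
    case (elim t)
    have "a0 t = gm t * t powi \<nu> * gp t * inverse (cpow \<tau> \<alpha> t) * inverse (ccpow \<tau> (- \<alpha>) t)"
      using elim(2) unfolding elim(1) by (simp add: field_simps)
    then show ?case unfolding elim(3) g'm_def g'p_def by (simp add: diff cpow_minus divide_inverse mult_ac)
  qed
  \<comment> \<open>As \<open>b\<close> is bounded above and below, the minus factor is comparable
    to the reciprocal of the plus factor, and its integrability is inherited in both
    directions.\<close>
  have g'b: "AE t in \<mu>. norm (g'm t) \<le> (E * L) * norm (inverse (g'p t)) \<and> norm (inverse (g'm t)) \<le> (E * L) * norm (g'p t)"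
    using b_fac b L(2,3) gp0 gm0 AE_circle_neq[of \<tau>] AE_space
  proof eventually_elim
    case (elim t)
    have t1: "norm (t powi \<nu>) = 1" using elim(8) by (simp add: norm_power_int)
    have nz: "g'p t \<noteq> 0" "g'm t \<noteq> 0" using elim(5,6) by (auto simp: g'p_def g'm_def)
    define w where "w = norm (cpow \<tau> \<beta> t * ccpow \<tau> (- \<beta>) t)"
    have w: "w \<le> E" "w > 0" using norm_cpow_ccpow_le[OF \<tau> elim(7), of \<beta>] by (auto simp: w_def E_def)
    have "1 / w = norm (inverse (cpow \<tau> \<beta> t * ccpow \<tau> (- \<beta>) t))"
      unfolding w_def norm_inverse by (simp only: divide_inverse mult_1)
    also have "inverse (cpow \<tau> \<beta> t * ccpow \<tau> (- \<beta>) t) = cpow \<tau> (- \<beta>) t * ccpow \<tau> (- (- \<beta>)) t"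
      by (simp only: cpow_minus inverse_mult_distrib)
    also have "norm \<dots> \<le> E" using norm_cpow_ccpow_le[OF \<tau> elim(7), of "- \<beta>"] by (simp add: E_def)
    finally have w2: "1 / w \<le> E" .
    have nb: "norm (b t) = w * norm (a0 t)" using elim(2) by (simp add: w_def norm_mult)
    have nb': "norm (b t) = norm (g'm t) * norm (g'p t)" using elim(1) t1 by (simp add: norm_mult)
    have a00: "norm (a0 t) > 0" using elim(4) L(1) by (meson less_le_trans zero_less_divide_1_iff)
    have e1: "norm (g'm t) = norm (b t) * norm (inverse (g'p t))" unfolding nb' norm_inverse using nz by (simp add: field_simps)
    have l1: "norm (b t) \<le> E * L" unfolding nb using w elim(3) by (intro mult_mono) auto
    have e2: "norm (inverse (g'm t)) = (1 / norm (b t)) * norm (g'p t)" unfolding nb' norm_inverse using nz by (simp add: field_simps)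
    have l2: "1 / norm (b t) \<le> E * L"
    proof -
      have "1 / norm (a0 t) \<le> L" using elim(4) L(1) a00 by (simp add: field_simps)
      then have "(1 / w) * (1 / norm (a0 t)) \<le> E * L" using w w2 a00 E by (intro mult_mono) auto
      then show ?thesis by (simp add: nb)
    qed
    show ?case unfolding e1 e2 by (intro conjI mult_right_mono l1 l2) auto
  qed
  have EL: "E * L \<ge> 0" using E L(1) by simp
  have g'mL: "g'm \<in> Lp p" by (rule Lp_bound(1)[OF p1(2) ig'pL EL]) (use g'b in \<open>measurable, auto\<close>)
  have ig'mL: "(\<lambda>t. inverse (g'm t)) \<in> Lp q" by (rule Lp_bound(1)[OF p1(4) g'pL EL]) (use g'b in \<open>measurable, auto\<close>)
  have down: "f \<in> Hardy 1" if "f \<in> Hardy u" "u \<ge> 1" for f u using Hardy_mono[of 1 u f] that by simp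
  have codown: "f \<in> co_Hardy 1" if "f \<in> co_Hardy u" "u \<ge> 1" for f u using Hardy_mono[of 1 u] that by (simp add: co_Hardy_iff_cnj)
  have i1: "(\<lambda>t. inverse (g'p t)) = (\<lambda>t. cpow \<tau> (\<alpha> - \<beta>) t * inverse (gp t))" by (simp add: g'p_def diff field_simps)
  have i2: "(\<lambda>t. inverse (g'm t)) = (\<lambda>t. ccpow \<tau> (\<beta> - \<alpha>) t * inverse (gm t))" by (simp add: g'm_def diff field_simps)
  have g'pH: "g'p \<in> Hardy q" unfolding g'p_def[abs_def] by (rule cpow_mult_Hardy[OF \<tau> p1(3) down[OF gpH p1(3)] g'pL[unfolded g'p_def[abs_def]]])
  have ig'pH: "(\<lambda>t. inverse (g'p t)) \<in> Hardy p" unfolding i1 by (rule cpow_mult_Hardy[OF \<tau> p1(1) down[OF igpH p1(1)] ig'pL[unfolded i1]])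
  note cg = ccpow_mult_co_Hardy[OF \<tau> p1(1) codown[OF gmH p1(1)] g'mL[unfolded g'm_def[abs_def]], folded g'm_def[abs_def]]
  have ig'mH: "(\<lambda>t. inverse (g'm t)) \<in> co_Hardy q" unfolding i2 by (rule ccpow_mult_co_Hardy(1)[OF \<tau> p1(3) codown[OF igmH p1(3)] ig'mL[unfolded i2]])
  have g'p0: "AE t in \<mu>. g'p t \<noteq> 0" using gp0 by eventually_elim (simp add: g'p_def)
  have g'm0: "AE t in \<mu>. g'm t \<noteq> 0" using gm0 by eventually_elim (simp add: g'm_def)
  have pair': "WH_pair p q g'p g'm" using g'p0 g'pH ig'pH ig'mH by (simp add: WH_pair_def)

  have sep1: "\<eta> / 4 \<le> norm (t - u)" if "norm (t - \<tau>) < \<eta> / 2" "\<not> norm (u - \<tau>) < 3 * \<eta> / 4" for t u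
    using that norm_triangle_ineq4[of "t - \<tau>" "t - u"] by simp
  have sep2: "\<eta> / 4 \<le> norm (t - u)" if "\<not> norm (t - \<tau>) < \<eta> / 2" "\<not> \<not> norm (u - \<tau>) < \<eta> / 4" for t u
    using that norm_triangle_ineq[of "t - u" "u - \<tau>"] by simp
  \<comment> \<open>Near \<tau> the ratio of the minus factors has modulus
    \<open>norm (F t) / norm s\<close>, and the ratio of the plus factors is
    \<open>X\<close>.\<close>
  define M where "M = max (C1 / norm s) C2"
  have near1: "AE t in \<mu>. norm (t - \<tau>) < 3 * \<eta> / 4 \<longrightarrow> norm (hm t * inverse (g'm t)) \<le> M"
    using near C1(2) AE_space
  proof eventually_elim
    case (elim t)
    show ?case
    proof
      assume n: "norm (t - \<tau>) < 3 * \<eta> / 4"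
      then have F: "F t = Y t * t powi (- \<nu>)" "norm (F t) \<le> C1" using elim(1,2) \<eta>(1) by auto
      have t1: "norm (t powi (- \<nu>)) = 1" using elim(3) by (simp add: norm_power_int)
      have "hm t * inverse (g'm t) = inverse s * Y t"
      proof -
        define n where "n = (1 + m t) * y t"
        show ?thesis using s unfolding hm_def g'm_def Y_def n_def[symmetric] by (simp add: diff cpow_minus field_simps)
      qed
      then have "norm (hm t * inverse (g'm t)) = norm (inverse s * Y t)" by (rule arg_cong)
      also have "\<dots> = norm (F t) / norm s"
        unfolding F(1) norm_mult t1 norm_inverse by (simp add: field_simps)
      also have "\<dots> \<le> C1 / norm s" using F(2) by (rule divide_right_mono) simp
      finally show "norm (hm t * inverse (g'm t)) \<le> M" by (simp add: M_def)
    qed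
  qed
  have near2: "AE t in \<mu>. norm (t - \<tau>) < \<eta> / 2 \<longrightarrow> norm (inverse (g'p t) * hp t) \<le> M"
    using C2(2) by eventually_elim (use \<eta>(1) in \<open>auto simp: M_def hp_eq\<close>)
  have far1: "AE t in \<mu>. \<not> norm (t - \<tau>) < \<eta> / 4 \<longrightarrow> norm (gm t * inverse (g'm t)) \<le> max D1 D2"
    using gm0 AE_space
  proof eventually_elim
    case (elim t)
    have "gm t * inverse (g'm t) = ccpow \<tau> (\<beta> - \<alpha>) t" using elim(1) by (simp add: g'm_def diff field_simps)
    then show ?case using D1(2)[of t] elim(2) by auto
  qed
  have far2: "AE t in \<mu>. \<not> norm (t - \<tau>) < \<eta> / 2 \<longrightarrow> norm (inverse (g'p t) * gp t) \<le> max D1 D2"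
    using gp0 AE_space
  proof eventually_elim
    case (elim t)
    have "inverse (g'p t) * gp t = cpow \<tau> (\<alpha> - \<beta>) t" using elim(1) by (simp add: g'p_def diff field_simps)
    then show ?case using D2(2)[of t] elim(2) \<eta>(1) by auto
  qed
  have d4: "\<eta> / 4 > 0" "max D1 D2 \<ge> 0" "M \<ge> 0" using \<eta>(1) D1(1) C2(1) by (auto simp: M_def)
  have nPm: "Measurable.pred \<mu> (\<lambda>t. \<not> norm (t - \<tau>) < d)" for d by measurable
  \<comment> \<open>Near \<tau> the operator of the local model is used, away from \<tau> the
    operator of the given factorization.\<close>
  from patch_bounded[OF pq hpair hm0 hwb ig'mL ig'pL Pm Pm d4(1) sep1 d4(3) near1 near2]
  obtain K1 where K1: "K1 \<ge> 0 \<and> (\<forall>r h. h \<in> Hardy q \<longrightarrow>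
     (\<forall>j\<ge>0. fourier_coeff h j = fourier_coeff (\<lambda>t. inverse (g'm t) * poly r t) j) \<longrightarrow>
     (\<lambda>t. if norm (t - \<tau>) < \<eta> / 2 then inverse (g'p t) * h t else 0) \<in> Lp p \<and>
     Lp_norm p (\<lambda>t. if norm (t - \<tau>) < \<eta> / 2 then inverse (g'p t) * h t else 0) \<le> K1 * Lp_norm p (poly r))" by (rule exE)
  from patch_bounded[OF pq pair gm0 wb ig'mL ig'pL nPm nPm d4(1) sep2 d4(2) far1 far2]
  obtain K2 where K2: "K2 \<ge> 0 \<and> (\<forall>r h. h \<in> Hardy q \<longrightarrow>
     (\<forall>j\<ge>0. fourier_coeff h j = fourier_coeff (\<lambda>t. inverse (g'm t) * poly r t) j) \<longrightarrow>
     (\<lambda>t. if \<not> norm (t - \<tau>) < \<eta> / 2 then inverse (g'p t) * h t else 0) \<in> Lp p \<and>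
     Lp_norm p (\<lambda>t. if \<not> norm (t - \<tau>) < \<eta> / 2 then inverse (g'p t) * h t else 0) \<le> K2 * Lp_norm p (poly r))" by (rule exE)
  have pb: "poly_bounded p q g'p g'm"
    unfolding poly_bounded_def
  proof (intro exI[of _ "K1 + K2"] conjI[of "0 \<le> _"] allI ballI impI)
    show "0 \<le> K1 + K2" using K1 K2 by simp
    fix r h assume h: "h \<in> Hardy q" and c: "\<forall>j\<ge>0. fourier_coeff h j = fourier_coeff (\<lambda>t. inverse (g'm t) * poly r t) j"
    have "h \<in> borel_measurable \<mu>" using HardyD(1)[OF h] by auto
    then have mu: "(\<lambda>t. inverse (g'p t) * h t) \<in> borel_measurable \<mu>" by measurable
    note k1 = conjunct2[OF K1, THEN spec, THEN spec, THEN mp, OF h, THEN mp, OF c]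
    note k2 = conjunct2[OF K2, THEN spec, THEN spec, THEN mp, OF h, THEN mp, OF c]
    note sp = Lp_split[OF p1(1) Pm mu conjunct1[OF k1] conjunct1[OF k2]]
    have "Lp_norm p (\<lambda>t. inverse (g'p t) * h t) \<le> (K1 + K2) * Lp_norm p (poly r)"
      using sp(2) conjunct2[OF k1] conjunct2[OF k2] by (simp only: distrib_right)
    with sp(1) show "(\<lambda>t. inverse (g'p t) * h t) \<in> Lp p \<and> Lp_norm p (\<lambda>t. inverse (g'p t) * h t) \<le> (K1 + K2) * Lp_norm p (poly r)" ..
  qed
  note op = WH_bounded_operator[OF pq pair' WH_bounded_of_poly[OF pq pair' pb]]
  have "Wiener_Hopf_factorization p q b g'm \<nu> g'p"
    unfolding Wiener_Hopf_factorization_def ae_eq_def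
    using b_fac g'p0 g'm0 g'pH ig'pH cg(1) ig'mH cg(2) gm1 op[unfolded ae_eq_def] by simp
  then show "Wiener_Hopf_factorization p q b (\<lambda>t. ccpow \<tau> (\<alpha> - \<beta>) t * gm t) \<nu> (\<lambda>t. cpow \<tau> (\<beta> - \<alpha>) t * gp t)"
    unfolding g'm_def[abs_def] g'p_def[abs_def] .
  show "fourier_coeff (\<lambda>t. cpow \<tau> (\<beta> - \<alpha>) t * gp t) 0 = fourier_coeff gp 0"
    by (rule cpow_mult_Hardy1(2)[OF \<tau> down[OF gpH p1(3)]]) (use Lp_mono(1)[of 1 q] g'pL p1 in \<open>simp add: g'p_def[abs_def]\<close>)
qed

section \<open>The signature\<close>

lemma circle_inverse_measurable: "(\<lambda>t. 1 / t) \<in> measurable \<mu> \<mu>"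
proof -
  have "(\<lambda>t::complex. 1 / t) \<in> borel_measurable \<mu>" by measurable
  then have "(\<lambda>t. 1 / t) \<in> measurable \<mu> (restrict_space borel (sphere 0 1))"
    by (intro measurable_restrict_space2) (auto simp: norm_divide)
  then show ?thesis by (simp cong: measurable_cong_sets add: sets_circle)
qed

text \<open>In terms of the angle, inversion on the circle is the reflection of \<open>x\<close> to
  \<open>- x\<close>, which preserves null sets.\<close>

lemma AE_circle_inverse:
  assumes P: "Measurable.pred \<mu> P" and ae: "AE t in \<mu>. P t"
  shows "AE t in \<mu>. P (1 / t)"
proof -
  have P': "Measurable.pred \<mu> (\<lambda>t. P (1 / t))" by (rule measurable_compose[OF circle_inverse_measurable P])
  have [measurable]: "Measurable.pred (restrict_space borel (sphere 0 1)) P"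
    using P by (simp cong: measurable_cong_sets add: sets_circle)
  have [measurable]: "Measurable.pred borel (\<lambda>x. P (cis x))" by measurable
  have "AE x in lborel. x \<in> {-pi<..pi} \<longrightarrow> P (cis x)" using ae AE_circle_iff[OF P] by simp
  then have "AE x in lborel. 0 + (-1) * x \<in> {-pi<..pi} \<longrightarrow> P (cis (0 + (-1) * x))"
    by (intro AE_borel_affine) (auto, measurable)
  \<comment> \<open>Reflection turns (-pi, pi] into [-pi, pi), so the endpoint is discarded.\<close>
  moreover have "AE x in lborel. x \<noteq> pi" by (rule AE_lborel_singleton)
  ultimately have "AE x in lborel. x \<in> {-pi<..pi} \<longrightarrow> P (1 / cis x)"
    by eventually_elim (auto simp: cis_inverse divide_inverse)
  then show ?thesis using AE_circle_iff[OF P'] by simp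
qed

text \<open>Arcs have positive measure; this turns a statement holding almost everywhere into one at
  an actual point close to \<tau>.\<close>

lemma AE_circle_exists_near:
  assumes \<tau>: "norm \<tau> = 1" and \<eta>: "\<eta> > 0" and ae: "AE t in \<mu>. P t"
  obtains t where "norm t = 1" "norm (t - \<tau>) < \<eta>" "P t"
proof -
  have "\<exists>t\<in>sphere 0 1. norm (t - \<tau>) < \<eta> \<and> P t"
  proof (rule ccontr)
    assume none: "\<not> ?thesis"
    have "AE t in \<mu>. \<not> norm (t - \<tau>) < \<eta>"
      using ae AE_space by eventually_elim (use none in auto)
    moreover have "Measurable.pred \<mu> (\<lambda>t. \<not> norm (t - \<tau>) < \<eta>)" by measurable
    ultimately have *: "AE x in lborel. x \<in> {-pi<..pi} \<longrightarrow> \<not> norm (cis x - \<tau>) < \<eta>"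
      by (simp only: AE_circle_iff)
    define x0 where "x0 = Arg \<tau>"
    have "\<tau> \<noteq> 0" using \<tau> by auto
    then have x0: "cis x0 = \<tau>" "- pi < x0" "x0 \<le> pi"
      using \<tau> Arg_bounded[of \<tau>] cis_Arg[of \<tau>] by (auto simp: x0_def sgn_div_norm)
    have "continuous_on UNIV cis" by (intro continuous_intros)
    then have "isCont cis x0" by (simp add: continuous_on_eq_continuous_at)
    then obtain d where d: "d > 0" "\<And>x. dist x x0 < d \<Longrightarrow> dist (cis x) (cis x0) < \<eta>"
      unfolding continuous_at_eps_delta using \<eta> by blast
    \<comment> \<open>An interval to the left of \<open>x0\<close> stays inside (-pi, pi] even when
      \<open>x0\<close> is pi.\<close>
    define l where "l = max (- pi) (x0 - d)"
    have l: "l < x0" using x0 d by (simp add: l_def)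
    from * have "AE x in lborel. x \<notin> {l<..<x0}"
    proof eventually_elim
      case (elim x)
      show ?case
      proof
        assume x: "x \<in> {l<..<x0}"
        then have "dist x x0 < d" "x \<in> {-pi<..pi}" using x0 by (auto simp: l_def dist_real_def)
        then show False using elim d(2)[of x] x0(1) by (simp add: dist_norm)
      qed
    qed
    then have "{l<..<x0} \<in> null_sets lborel" by (subst AE_iff_null_sets) auto
    then show False using l by (auto simp: null_sets_def)
  qed
  then show thesis using that by auto
qed

lemma PC_D:
  assumes "c \<in> PC"
  shows "c \<in> borel_measurable \<mu>" "\<exists>K\<ge>1. AE t in \<mu>. norm (c t) \<le> K"
proof -
  obtain K where K: "AE t in \<mu>. norm (c t) \<le> K" using assms by (auto simp: PC_def Linfty_def)
  then have "AE t in \<mu>. norm (c t) \<le> max 1 K" by eventually_elim simp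
  then show "\<exists>K\<ge>1. AE t in \<mu>. norm (c t) \<le> K" by (intro exI[of _ "max 1 K"]) simp
qed (use assms in \<open>auto simp: PC_def Linfty_def\<close>)

text \<open>The moduli at \<open>t\<close> and \<open>1 / t\<close> are reciprocal, so the upper
  bound at one point is a lower bound at the other.\<close>

lemma matching_bounded_below:
  assumes c: "c \<in> borel_measurable \<mu>" and m: "matching c" and K: "K \<ge> 1" "AE t in \<mu>. norm (c t) \<le> K"
  shows "AE t in \<mu>. 1 / K \<le> norm (c t)"
proof -
  have P: "Measurable.pred \<mu> (\<lambda>t. norm (c t) \<le> K)" using c by measurable
  from m AE_circle_inverse[OF P K(2)] show ?thesis
    unfolding matching_def ae_eq_def
  proof eventually_elim
    case (elim t)
    have "norm (c t) * norm (c (1 / t)) = 1" using elim(1) by (metis norm_mult norm_one)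
    moreover have "norm (c t) * norm (c (1 / t)) \<le> norm (c t) * K" using elim(2) by (intro mult_left_mono) auto
    ultimately show ?case using K(1) by (simp add: field_simps)
  qed
qed

text \<open>Both \<open>c\<close> and \<open>c1\<close> are jump functions at \<tau> times
  \<open>c1\<close>, with exponents \<gamma> and 0. Transfer in either direction shows that the same
  values occur as zeroth coefficients of plus factors, hence the definite descriptions
  coincide.\<close>

lemma factorization_signature_eq:
  assumes pq: "1 < p" "1 < q" "1 / p + 1 / q = 1" and \<tau>: "norm \<tau> = 1" and \<gamma>: "- (1 / q) < Re \<gamma>" "Re \<gamma> < 1 / p"
    and K: "K \<ge> 1" "AE t in \<mu>. norm (c t) \<le> K" "AE t in \<mu>. 1 / K \<le> norm (c t)"
    and c1[measurable]: "c1 \<in> borel_measurable \<mu>" and cont: "continuous (at \<tau> within sphere 0 1) c1"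
    and eq: "ae_eq c (\<lambda>t. jump_fun \<gamma> \<tau> t * c1 t)"
  shows "factorization_signature p q c = factorization_signature p q c1"
proof -
  have eq': "AE t in \<mu>. c t = cpow \<tau> \<gamma> t * ccpow \<tau> (- \<gamma>) t * c1 t"
    using eq AE_circle_neq[of \<tau>] AE_space unfolding ae_eq_def
    by eventually_elim (simp add: jump_fun_eq[OF \<tau>])
  have eq0: "AE t in \<mu>. c1 t = cpow \<tau> 0 t * ccpow \<tau> (- 0) t * c1 t" by simp
  define E where "E = exp (pi * \<bar>Im \<gamma>\<bar>) * exp (pi * \<bar>Im \<gamma>\<bar>)"
  have E: "E > 0" by (simp add: E_def)
  have L: "AE t in \<mu>. norm (c1 t) \<le> K * E \<and> 1 / (K * E) \<le> norm (c1 t)"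
    using eq' K(2,3) AE_circle_neq[of \<tau>]
  proof eventually_elim
    case (elim t)
    define w where "w = norm (cpow \<tau> \<gamma> t * ccpow \<tau> (- \<gamma>) t)"
    have w: "w \<le> E" "w > 0" using norm_cpow_ccpow_le[OF \<tau> elim(4), of \<gamma>] by (auto simp: w_def E_def)
    have "1 / w = norm (inverse (cpow \<tau> \<gamma> t * ccpow \<tau> (- \<gamma>) t))"
      unfolding w_def norm_inverse by (simp only: divide_inverse mult_1)
    also have "inverse (cpow \<tau> \<gamma> t * ccpow \<tau> (- \<gamma>) t) = cpow \<tau> (- \<gamma>) t * ccpow \<tau> (- (- \<gamma>)) t"
      by (simp only: cpow_minus inverse_mult_distrib)
    also have "norm \<dots> \<le> E" using norm_cpow_ccpow_le[OF \<tau> elim(4), of "- \<gamma>"] by (simp add: E_def)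
    finally have w2: "1 / w \<le> E" .
    have n: "norm (c t) = w * norm (c1 t)" using elim(1) by (simp add: w_def norm_mult)
    have "norm (c1 t) = norm (c t) * (1 / w)" using w n by simp
    also have "\<dots> \<le> K * E" using elim(2) w w2 K(1) by (intro mult_mono) auto
    finally have 1: "norm (c1 t) \<le> K * E" .
    have "1 / K \<le> E * norm (c1 t)" using elim(3) mult_right_mono[OF w(1), of "norm (c1 t)"] n by simp
    then have "1 / (K * E) \<le> norm (c1 t)" using K(1) E by (simp add: field_simps)
    with 1 show ?case ..
  qed
  have KE: "K * E > 0" using K(1) E by simp
  have L1: "AE t in \<mu>. norm (c1 t) \<le> K * E" and L2: "AE t in \<mu>. 1 / (K * E) \<le> norm (c1 t)"
    using L by (auto elim: eventually_mono)
  have lim: "\<exists>\<eta>>0. AE t in \<mu>. norm (t - \<tau>) < \<eta> \<longrightarrow> norm (c1 t - c1 \<tau>) \<le> e" if e: "e > 0" for e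
  proof -
    from cont e obtain d where d: "d > 0" "\<forall>t\<in>sphere 0 1. dist t \<tau> < d \<longrightarrow> dist (c1 t) (c1 \<tau>) < e"
      unfolding continuous_within_eps_delta by blast
    have "AE t in \<mu>. norm (t - \<tau>) < d \<longrightarrow> norm (c1 t - c1 \<tau>) \<le> e"
      using AE_space by eventually_elim (use d(2) in \<open>auto simp: dist_norm less_imp_le\<close>)
    with d(1) show ?thesis by blast
  qed
  \<comment> \<open>A zero would make \<open>c1\<close> small on a whole arc, against the lower
    bound that holds almost everywhere on it.\<close>
  have s: "c1 \<tau> \<noteq> 0"
  proof
    assume z: "c1 \<tau> = 0"
    obtain d where d: "d > 0" "AE t in \<mu>. norm (t - \<tau>) < d \<longrightarrow> norm (c1 t - c1 \<tau>) \<le> 1 / (2 * (K * E))"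
      using lim[of "1 / (2 * (K * E))"] KE by auto
    have "AE t in \<mu>. norm (t - \<tau>) < d \<longrightarrow> False"
      using d(2) L2
    proof eventually_elim
      case (elim t)
      have "1 / (2 * x) < 1 / x" if "x > 0" for x :: real using that by (simp add: field_simps)
      from this[OF KE]
      show ?case using elim z by auto
    qed
    then show False by (rule AE_circle_exists_near[OF \<tau> d(1)]) simp
  qed
  have r0: "- (1 / q) < Re 0" "Re 0 < 1 / p" using pq by auto
  have "(\<exists>gm \<nu> gp. Wiener_Hopf_factorization p q c gm \<nu> gp \<and> \<sigma> = fourier_coeff gp 0) \<longleftrightarrow>
    (\<exists>gm \<nu> gp. Wiener_Hopf_factorization p q c1 gm \<nu> gp \<and> \<sigma> = fourier_coeff gp 0)" for \<sigma>
  proof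
    assume "\<exists>gm \<nu> gp. Wiener_Hopf_factorization p q c gm \<nu> gp \<and> \<sigma> = fourier_coeff gp 0"
    then obtain gm \<nu> gp where wh: "Wiener_Hopf_factorization p q c gm \<nu> gp" "\<sigma> = fourier_coeff gp 0" by blast
    note tr = WH_transfer[OF pq \<tau> \<gamma> r0 wh(1) eq' eq0 c1 KE L1 L2 s lim]
    show "\<exists>gm \<nu> gp. Wiener_Hopf_factorization p q c1 gm \<nu> gp \<and> \<sigma> = fourier_coeff gp 0"
      using tr(1) tr(2)[symmetric] unfolding wh(2) by blast
  next
    assume "\<exists>gm \<nu> gp. Wiener_Hopf_factorization p q c1 gm \<nu> gp \<and> \<sigma> = fourier_coeff gp 0"
    then obtain gm \<nu> gp where wh: "Wiener_Hopf_factorization p q c1 gm \<nu> gp" "\<sigma> = fourier_coeff gp 0" by blast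
    note tr = WH_transfer[OF pq \<tau> r0 \<gamma> wh(1) eq0 eq' c1 KE L1 L2 s lim]
    show "\<exists>gm \<nu> gp. Wiener_Hopf_factorization p q c gm \<nu> gp \<and> \<sigma> = fourier_coeff gp 0"
      using tr(1) tr(2)[symmetric] unfolding wh(2) by blast
  qed
  then show ?thesis unfolding factorization_signature_def by simp
qed

theorem theorem8p1:
  fixes p q :: real and c c1 c2 :: "complex \<Rightarrow> complex" and \<gamma>p \<gamma>m :: complex
  assumes "1 < p" and "1 / p + 1 / q = 1"
    and "c \<in> PC" and "matching c"
    and "Fredholm_Hardy p (Toeplitz p c)"
    and "c1 \<in> PC" and "continuous (at 1 within sphere 0 1) c1"
    and "c2 \<in> PC" and "continuous (at (- 1) within sphere 0 1) c2"
    and "Re \<gamma>p \<in> {- 1 / q <..< 1 / p}" and "Re \<gamma>m \<in> {- 1 / q <..< 1 / p}"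
    and "ae_eq c (\<lambda>t. jump_fun \<gamma>p 1 t * c1 t)"
    and "ae_eq c (\<lambda>t. jump_fun \<gamma>m (- 1) t * c2 t)"
  shows "factorization_signature p q c = factorization_signature p q c1 \<and>
         factorization_signature p q c1 = factorization_signature p q c2"
proof -
  have q: "1 < q"
  proof -
    have "0 < 1 / p" "1 / p < 1" using assms(1) by auto
    then have "0 < 1 / q" "1 / q < 1" using assms(2) by linarith+
    then show ?thesis by (simp add: zero_less_divide_iff)
  qed
  obtain K where K: "K \<ge> 1" "AE t in circle_measure. norm (c t) \<le> K" using PC_D(2)[OF assms(3)] by blast
  note below = matching_bounded_below[OF PC_D(1)[OF assms(3)] assms(4) K]
  have "factorization_signature p q c = factorization_signature p q c1"
    by (rule factorization_signature_eq[OF assms(1) q assms(2) _ _ _ K below PC_D(1)[OF assms(6)] assms(7) assms(12)])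
       (use assms(10) in auto)
  moreover have "factorization_signature p q c = factorization_signature p q c2"
    by (rule factorization_signature_eq[OF assms(1) q assms(2) _ _ _ K below PC_D(1)[OF assms(8)] assms(9) assms(13)])
       (use assms(11) in auto)
  ultimately show ?thesis by simp
qed

end
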